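(* Let $(X,d_X,\mathfrak m)$ be a complete separable metric space with a non-negative, non-zero Radon measure finite on bounded sets, let $(Y,d_Y)$ be a complete metric space, let $u\in S^2(X,Y)$, and put $\mu:=u_*(|Du|^2\mathfrak m)$. Then the differential $\mathrm du$ is well defined: for every $v\in L^0(TX)$ there is a unique element $\mathrm du(v)\in \mathrm{Ext}\big((u^*L^0_\mu(T^*Y))^*\big)$ such that for every $f\in S^2(Y,d_Y,\mu)$ and every $g\in S^2(X)$ associated to $f$ (in the sense of the context) one has $$\mathrm{ext}\big([u^*\mathrm d_\mu f]\big)\big(\mathrm du(v)\big)=\mathrm dg(v)\qquad \mathfrak m\text{-a.e.}$$ Moreover the map $\mathrm du: L^0(TX)\to \mathrm{Ext}\big((u^*L^0_\mu(T^*Y))^*\big)$ is $L^0(\mathfrak m)$-linear and continuous, and $$|\mathrm du|=|Du|\qquad\mathfrak m\text{-a.e.}$$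
   Context: Sobolev functions. On a metric space $Z$ with a non-negative Radon measure $\mathfrak n$ finite on bounded sets, $\mathrm{LIP}(Z)$ is the set of real-valued Lipschitz functions, $\mathrm{LIP}_{bd}(Z)$ the set of functions Lipschitz on bounded sets, $\mathrm{Lip}(f)$ the global Lipschitz constant, and $\mathrm{lip}_a(f)(x):=\limsup_{y,z\to x}|f(y)-f(z)|/d_Z(y,z)$ ($0$ at isolated points). $L^0(\mathfrak n)$ is the space of real Borel functions modulo $\mathfrak n$-a.e. equality, with the topology of convergence in measure on sets of finite measure. $f\in S^2(Z,d_Z,\mathfrak n)$ means: there are $G\in L^2(\mathfrak n)$ and $(f_n)\subset\mathrm{LIP}_{bd}(Z)$ with $f_n\to f$ in $L^0(\mathfrak n)$ and $\mathrm{lip}_a(f_n)\rightharpoonup G$ weakly in $L^2(\mathfrak n)$; the $\mathfrak n$-a.e. minimal such $G\ge0$ is denoted $|Df|$. $S^2(X):=S^2(X,d_X,\mathfrak m)$. Metric-valued Sobolev maps. $S^2(X,Y)$ is the set of Borel maps $u:X\to Y$ with $u(X\setminus N)$ separable for some $\mathfrak m$-null $N$, for which there is $G\in L^2(\mathfrak m)$, $G\ge 0$, such that for every $f\in\mathrm{LIP}(Y)$ one has $f\circ u\in S^2(X)$ and $|D(f\circ u)|\le \mathrm{Lip}(f)\,G$ $\mathfrak m$-a.e. The $\mathfrak m$-a.e. least such $G$ is denoted $|Du|$. The measure $\mu=u_*(|Du|^2\mathfrak m)$ on $Y$ is finite. For $h\in L^0(\mu)$ the function $h\circ u\,|Du|\in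 L^0(\mathfrak m)$ is well defined (it is $0$ on $\{|Du|=0\}$). Modules. An $L^0(\mathfrak n)$-normed module is a module $\mathscr M$ over $L^0(\mathfrak n)$ with a pointwise norm $|\cdot|:\mathscr M\to L^0(\mathfrak n)$, $|v|\ge 0$ with equality iff $v=0$, $|v+w|\le|v|+|w|$, $|hv|=|h||v|$ $\mathfrak n$-a.e., complete for the distance $\int \min\{1,|v-w|\}\,\mathrm d\mathfrak n'$, $\mathfrak n'$ a finite measure equivalent to $\mathfrak n$. A subset generates $\mathscr M$ if its $L^0(\mathfrak n)$-linear combinations are dense. The dual $\mathscr M^*$ is the set of $L^0(\mathfrak n)$-linear continuous maps $L:\mathscr M\to L^0(\mathfrak n)$, with $|L|:=\operatorname{ess\,sup}\{|L(v)|:|v|\le1\}$; elements of $\mathscr M$ and $\mathscr M^*$ are paired as $\omega(L)=L(\omega)$. For an $L^0(\mathfrak n)$-linear continuous map $T$ between normed modules, $|T|:=\operatorname{ess\,sup}\{|T(v)|:|v|\le 1\}$. Cotangent module. $(L^0_{\mathfrak n}(T^*Z),\mathrm d_{\mathfrak n})$ is the unique (up to unique isomorphism) pair of an $L^0(\mathfrak n)$-normed module and a linear map $\mathrm d_{\mathfrak n}:S^2(Z,d_Z,\mathfrak n)\to L^0_{\mathfrak n}(T^*Z)$ such that $|\mathrm d_{\mathfrak n}f|=|Df|$ $\mathfrak n$-a.e. and $\{\mathrm d_{\mathfrak n}f\}$ generates. On $X$ write $L^0(T^*X)$, $\mathrm d$ for $\mathfrak n=\mathfrak m$; $L^0(TX):=L^0(T^*X)^*$.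 Pullback. If $\nu$ is a measure on $X$ with $u_*\nu\ll\mu$ and $\mathscr M$ is an $L^0(\mu)$-normed module, $(u^*\mathscr M,[u^*])$ is the unique (up to unique isomorphism) pair of an $L^0(\nu)$-normed module and a linear continuous map $[u^*]:\mathscr M\to u^*\mathscr M$ with $|[u^*v]|=|v|\circ u$ $\nu$-a.e. whose image generates. Here $\nu:=\mathfrak m|_{\{|Du|>0\}}$, for which $u_*\nu\ll\mu$. Extension. If $\nu=\mathfrak m|_E$ with $E$ Borel and $\mathscr M$ is an $L^0(\nu)$-normed module, $\mathrm{Ext}(\mathscr M)$ is the $L^0(\mathfrak m)$-normed module equal to $\mathscr M$ as a set, with multiplication by $h\in L^0(\mathfrak m)$ given by multiplication by the class of $h$ in $L^0(\nu)$ and pointwise norm equal to $|v|$ on $E$ and $0$ on $X\setminus E$; $\mathrm{ext}:\mathscr M\to\mathrm{Ext}(\mathscr M)$ is the identity map (for functions, $\mathrm{ext}$ is extension by $0$ outside $E$). One identifies $\mathrm{Ext}(\mathscr M^* )\sim\mathrm{Ext}(\mathscr M)^*$ via $\mathrm{ext}(L)(\mathrm{ext}(v))=\mathrm{ext}(L(v))$. Associated functions. Given $f\in S^2(Y,d_Y,\mu)$, a function $g\in S^2(X)$ is called associated to $f$ if $g=f\circ u$ $\mathfrak m$-a.e. on $\{|Du|>0\}$ and $|\mathrm dg|\le|\mathrm d_\mu f|\circ u\,|Du|$ $\mathfrak m$-a.e. on $X$ (such $g$ exists for every $f$). *)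

theory Defs
  imports "HOL-Analysis.Analysis" "HOL-Algebra.Module"
begin

section \<open>The ring $L^0$\<close>

text \<open>An element of \<open>L\<^sup>0(n)\<close> is an a.e.-equality class, represented as the set of its Borel
  representatives. Measures are always on the Borel sets of the whole type.\<close>

type_synonym 'z L0_elt = "('z \<Rightarrow> real) set"

definition L0_cls :: "'z measure \<Rightarrow> ('z \<Rightarrow> real) \<Rightarrow> 'z L0_elt" where
  "L0_cls n f = {g \<in> borel_measurable n. AE x in n. g x = f x}"

definition L0_rep :: "'z L0_elt \<Rightarrow> 'z \<Rightarrow> real" where
  "L0_rep F = (SOME f. f \<in> F)"

record ('s, 'v) normed_module = "('s, 'v) module" +
  pnorm :: "'v \<Rightarrow> 's"

text \<open>\<open>L0 n\<close> serves both as the ring of scalars and as a normed module over itself.\<close>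

definition L0 :: "'z measure \<Rightarrow> ('z L0_elt, 'z L0_elt) normed_module" where
  "L0 n = \<lparr>carrier = L0_cls n ` borel_measurable n,
           mult = (\<lambda>F G. L0_cls n (\<lambda>x. L0_rep F x * L0_rep G x)),
           one = L0_cls n (\<lambda>_. 1),
           zero = L0_cls n (\<lambda>_. 0),
           add = (\<lambda>F G. L0_cls n (\<lambda>x. L0_rep F x + L0_rep G x)),
           smult = (\<lambda>F G. L0_cls n (\<lambda>x. L0_rep F x * L0_rep G x)),
           pnorm = (\<lambda>F. L0_cls n (\<lambda>x. \<bar>L0_rep F x\<bar>))\<rparr>"

definition L0_le :: "'z measure \<Rightarrow> 'z L0_elt \<Rightarrow> 'z L0_elt \<Rightarrow> bool" where
  "L0_le n F G \<longleftrightarrow> (AE x in n. L0_rep F x \<le> L0_rep G x)"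

definition L0_least :: "'z measure \<Rightarrow> 'z L0_elt set \<Rightarrow> 'z L0_elt" where
  "L0_least n S = (THE G. G \<in> S \<and> (\<forall>H\<in>S. L0_le n G H))"

definition L0_esssup :: "'z measure \<Rightarrow> 'z L0_elt set \<Rightarrow> 'z L0_elt" where
  "L0_esssup n S = L0_least n {G \<in> carrier (L0 n). \<forall>F\<in>S. L0_le n F G}"

definition L0_tendsto_in_measure :: "'z measure \<Rightarrow> (nat \<Rightarrow> 'z L0_elt) \<Rightarrow> 'z L0_elt \<Rightarrow> bool" where
  "L0_tendsto_in_measure n Fs F \<longleftrightarrow>
     (\<forall>A\<in>sets n. emeasure n A < \<infinity> \<longrightarrow> (\<forall>\<epsilon>>0.
        (\<lambda>k. emeasure n {x \<in> A. \<bar>L0_rep (Fs k) x - L0_rep F x\<bar> > \<epsilon>}) \<longlonglongrightarrow> 0))"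

section \<open>Normed modules over $L^0$\<close>

text \<open>Every $\sigma$-finite measure has an equivalent finite one; the topology and the notion of
  completeness obtained from \<open>L0_dist\<close> do not depend on which one is chosen. On \<open>L0 n\<close>
  the topology is that of convergence in measure on sets of finite measure.\<close>

definition finite_equiv :: "'z measure \<Rightarrow> 'z measure" where
  "finite_equiv n = (SOME n'. finite_measure n' \<and> sets n' = sets n \<and>
     absolutely_continuous n n' \<and> absolutely_continuous n' n)"

definition L0_dist ::
  "'z measure \<Rightarrow> ('z L0_elt, 'v, 'm) normed_module_scheme \<Rightarrow> 'v \<Rightarrow> 'v \<Rightarrow> real" where
  "L0_dist n M v w =
     (if v \<in> carrier M \<and> w \<in> carrier M
      then (\<integral>x. min 1 (L0_rep (pnorm M (v \<ominus>\<^bsub>M\<^esub> w)) x) \<partial>finite_equiv n) else 0)"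

definition L0_topology ::
  "'z measure \<Rightarrow> ('z L0_elt, 'v, 'm) normed_module_scheme \<Rightarrow> 'v topology" where
  "L0_topology n M = Metric_space.mtopology (carrier M) (L0_dist n M)"

definition L0_normed_module ::
  "'z measure \<Rightarrow> ('z L0_elt, 'v, 'm) normed_module_scheme \<Rightarrow> bool" where
  "L0_normed_module n M \<longleftrightarrow>
     Module.module (L0 n) M \<and>
     pnorm M \<in> carrier M \<rightarrow> carrier (L0 n) \<and>
     (\<forall>v\<in>carrier M. L0_le n \<zero>\<^bsub>L0 n\<^esub> (pnorm M v)) \<and>
     (\<forall>v\<in>carrier M. pnorm M v = \<zero>\<^bsub>L0 n\<^esub> \<longleftrightarrow> v = \<zero>\<^bsub>M\<^esub>) \<and>
     (\<forall>v\<in>carrier M. \<forall>w\<in>carrier M. L0_le n (pnorm M (v \<oplus>\<^bsub>M\<^esub> w)) (pnorm M v \<oplus>\<^bsub>L0 n\<^esub> pnorm M w)) \<and>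
     (\<forall>h\<in>carrier (L0 n). \<forall>v\<in>carrier M.
        pnorm M (h \<odot>\<^bsub>M\<^esub> v) = pnorm (L0 n) h \<otimes>\<^bsub>L0 n\<^esub> pnorm M v) \<and>
     Metric_space.mcomplete (carrier M) (L0_dist n M)"

definition L0_span ::
  "'z measure \<Rightarrow> ('z L0_elt, 'v, 'm) normed_module_scheme \<Rightarrow> 'v set \<Rightarrow> 'v set" where
  "L0_span n M S = {(\<Oplus>\<^bsub>M\<^esub>v\<in>A. a v \<odot>\<^bsub>M\<^esub> v) | a A.
     finite A \<and> A \<subseteq> S \<and> a \<in> A \<rightarrow> carrier (L0 n)}"

definition L0_generates ::
  "'z measure \<Rightarrow> ('z L0_elt, 'v, 'm) normed_module_scheme \<Rightarrow> 'v set \<Rightarrow> bool" where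
  "L0_generates n M S \<longleftrightarrow>
     S \<subseteq> carrier M \<and> L0_topology n M closure_of L0_span n M S = carrier M"

definition L0_linear ::
  "'z measure \<Rightarrow> ('z L0_elt, 'v, 'm) normed_module_scheme \<Rightarrow>
   ('z L0_elt, 'w, 'k) normed_module_scheme \<Rightarrow> ('v \<Rightarrow> 'w) \<Rightarrow> bool" where
  "L0_linear n M N T \<longleftrightarrow>
     T \<in> carrier M \<rightarrow> carrier N \<and>
     (\<forall>v\<in>carrier M. \<forall>w\<in>carrier M. T (v \<oplus>\<^bsub>M\<^esub> w) = T v \<oplus>\<^bsub>N\<^esub> T w) \<and>
     (\<forall>h\<in>carrier (L0 n). \<forall>v\<in>carrier M. T (h \<odot>\<^bsub>M\<^esub> v) = h \<odot>\<^bsub>N\<^esub> T v)"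

definition L0_continuous ::
  "'z measure \<Rightarrow> ('z L0_elt, 'v, 'm) normed_module_scheme \<Rightarrow>
   ('z L0_elt, 'w, 'k) normed_module_scheme \<Rightarrow> ('v \<Rightarrow> 'w) \<Rightarrow> bool" where
  "L0_continuous n M N T \<longleftrightarrow> continuous_map (L0_topology n M) (L0_topology n N) T"

definition L0_opnorm ::
  "'z measure \<Rightarrow> ('z L0_elt, 'v, 'm) normed_module_scheme \<Rightarrow>
   ('z L0_elt, 'w, 'k) normed_module_scheme \<Rightarrow> ('v \<Rightarrow> 'w) \<Rightarrow> 'z L0_elt" where
  "L0_opnorm n M N T =
     L0_esssup n {pnorm N (T v) | v. v \<in> carrier M \<and> L0_le n (pnorm M v) \<one>\<^bsub>L0 n\<^esub>}"

text \<open>Functionals are made extensional, so that equality in the dual is equality of functions.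
  The ring fields \<open>mult\<close> and \<open>one\<close> play no role in a module.\<close>

definition L0_dual ::
  "'z measure \<Rightarrow> ('z L0_elt, 'v) normed_module \<Rightarrow> ('z L0_elt, 'v \<Rightarrow> 'z L0_elt) normed_module" where
  "L0_dual n M =
     \<lparr>carrier = {L \<in> extensional (carrier M). L0_linear n M (L0 n) L \<and> L0_continuous n M (L0 n) L},
      mult = undefined,
      one = undefined,
      zero = (\<lambda>v\<in>carrier M. \<zero>\<^bsub>L0 n\<^esub>),
      add = (\<lambda>K L. \<lambda>v\<in>carrier M. K v \<oplus>\<^bsub>L0 n\<^esub> L v),
      smult = (\<lambda>h L. \<lambda>v\<in>carrier M. h \<otimes>\<^bsub>L0 n\<^esub> L v),
      pnorm = (\<lambda>L. L0_opnorm n M (L0 n) L)\<rparr>"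

text \<open>\<open>\<real>\<close>-linearity of a map defined on a subset \<open>S\<close> of the carrier of an \<open>L\<^sup>0(n)\<close>-module \<open>V\<close>
  with values in an \<open>L\<^sup>0(n')\<close>-module \<open>W\<close>; the two base measures may live on different spaces.\<close>

definition real_linear_map ::
  "'z measure \<Rightarrow> 'v set \<Rightarrow> ('z L0_elt, 'v, 'm) normed_module_scheme \<Rightarrow>
   'y measure \<Rightarrow> ('y L0_elt, 'w, 'k) normed_module_scheme \<Rightarrow> ('v \<Rightarrow> 'w) \<Rightarrow> bool" where
  "real_linear_map n S V n' W T \<longleftrightarrow>
     T \<in> S \<rightarrow> carrier W \<and>
     (\<forall>v\<in>S. \<forall>w\<in>S. T (v \<oplus>\<^bsub>V\<^esub> w) = T v \<oplus>\<^bsub>W\<^esub> T w) \<and>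
     (\<forall>c. \<forall>v\<in>S. T (L0_cls n (\<lambda>_. c) \<odot>\<^bsub>V\<^esub> v) = L0_cls n' (\<lambda>_. c) \<odot>\<^bsub>W\<^esub> T v)"

section \<open>Sobolev functions and the cotangent module\<close>

definition radon_measure :: "'z::metric_space measure \<Rightarrow> bool" where
  "radon_measure n \<longleftrightarrow>
     sets n = sets borel \<and>
     (\<forall>K. compact K \<longrightarrow> emeasure n K < \<infinity>) \<and>
     (\<forall>B\<in>sets borel. emeasure n B = (SUP K\<in>{K. compact K \<and> K \<subseteq> B}. emeasure n K))"

definition LIP :: "('z::metric_space \<Rightarrow> real) set" where
  "LIP = {f. \<exists>L. L-lipschitz_on UNIV f}"

definition LIP_bd :: "('z::metric_space \<Rightarrow> real) set" where
  "LIP_bd = {f. \<forall>B. bounded B \<longrightarrow> (\<exists>L. L-lipschitz_on B f)}"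

definition Lip :: "('z::metric_space \<Rightarrow> real) \<Rightarrow> real" where
  "Lip f = Inf {L. L-lipschitz_on UNIV f}"

text \<open>The limsup is taken over pairs of distinct points.\<close>

definition lip_a :: "('z::metric_space \<Rightarrow> real) \<Rightarrow> 'z \<Rightarrow> real" where
  "lip_a f x =
     (if x islimpt UNIV
      then enn2real (Limsup (inf (nhds x \<times>\<^sub>F nhds x) (principal {(y, z). y \<noteq> z}))
                            (\<lambda>(y, z). ennreal (\<bar>f y - f z\<bar> / dist y z)))
      else 0)"

definition L2 :: "'z measure \<Rightarrow> 'z L0_elt set" where
  "L2 n = {G \<in> carrier (L0 n). integrable n (\<lambda>x. (L0_rep G x)\<^sup>2)}"

definition L2_weakly_tendsto :: "'z measure \<Rightarrow> (nat \<Rightarrow> 'z L0_elt) \<Rightarrow> 'z L0_elt \<Rightarrow> bool" where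
  "L2_weakly_tendsto n Gs G \<longleftrightarrow>
     range Gs \<subseteq> L2 n \<and> G \<in> L2 n \<and>
     (\<forall>H\<in>L2 n. (\<lambda>k. \<integral>x. L0_rep (Gs k) x * L0_rep H x \<partial>n)
                  \<longlonglongrightarrow> (\<integral>x. L0_rep G x * L0_rep H x \<partial>n))"

definition relaxed_slopes :: "'z::metric_space measure \<Rightarrow> 'z L0_elt \<Rightarrow> 'z L0_elt set" where
  "relaxed_slopes n F = {G \<in> L2 n. \<exists>fs. range fs \<subseteq> LIP_bd \<and>
     L0_tendsto_in_measure n (\<lambda>k. L0_cls n (fs k)) F \<and>
     L2_weakly_tendsto n (\<lambda>k. L0_cls n (lip_a (fs k))) G}"

definition S2 :: "'z::metric_space measure \<Rightarrow> 'z L0_elt set" where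
  "S2 n = {F \<in> carrier (L0 n). relaxed_slopes n F \<noteq> {}}"

definition min_slope :: "'z::metric_space measure \<Rightarrow> 'z L0_elt \<Rightarrow> 'z L0_elt" where
  "min_slope n F = L0_least n (relaxed_slopes n F)"

definition cotangent_module ::
  "'z::metric_space measure \<Rightarrow> ('z L0_elt, 'v) normed_module \<Rightarrow> ('z L0_elt \<Rightarrow> 'v) \<Rightarrow> bool" where
  "cotangent_module n M d \<longleftrightarrow>
     L0_normed_module n M \<and>
     real_linear_map n (S2 n) (L0 n) n M d \<and>
     (\<forall>F\<in>S2 n. pnorm M (d F) = min_slope n F) \<and>
     L0_generates n M (d ` S2 n)"

section \<open>Metric-valued Sobolev maps\<close>

definition map_slopes :: "'x::metric_space measure \<Rightarrow> ('x \<Rightarrow> 'y::metric_space) \<Rightarrow> 'x L0_elt set" where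
  "map_slopes m u = {G \<in> L2 m. L0_le m \<zero>\<^bsub>L0 m\<^esub> G \<and>
     (\<forall>f\<in>LIP. L0_cls m (f \<circ> u) \<in> S2 m \<and>
        L0_le m (min_slope m (L0_cls m (f \<circ> u))) (L0_cls m (\<lambda>_. Lip f) \<otimes>\<^bsub>L0 m\<^esub> G))}"

definition S2_map :: "'x::metric_space measure \<Rightarrow> ('x \<Rightarrow> 'y::metric_space) set" where
  "S2_map m = {u \<in> borel_measurable m.
     (\<exists>N\<in>null_sets m. separable_space (top_of_set (u ` (UNIV - N)))) \<and>
     map_slopes m u \<noteq> {}}"

definition map_slope :: "'x::metric_space measure \<Rightarrow> ('x \<Rightarrow> 'y::metric_space) \<Rightarrow> 'x L0_elt" where
  "map_slope m u = L0_least m (map_slopes m u)"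

definition map_meas :: "'x::metric_space measure \<Rightarrow> ('x \<Rightarrow> 'y::metric_space) \<Rightarrow> 'y measure" where
  "map_meas m u = distr (density m (\<lambda>x. ennreal ((L0_rep (map_slope m u) x)\<^sup>2))) borel u"

definition pos_slope_set :: "'x::metric_space measure \<Rightarrow> ('x \<Rightarrow> 'y::metric_space) \<Rightarrow> 'x set" where
  "pos_slope_set m u = {x. L0_rep (map_slope m u) x > 0}"

text \<open>The restriction of \<open>n\<close> to \<open>E\<close>, still regarded as a measure on the whole space.\<close>

definition restr_meas :: "'x measure \<Rightarrow> 'x set \<Rightarrow> 'x measure" where
  "restr_meas n E = density n (indicator E)"

text \<open>The class of \<open>h \<circ> u |Du|\<close>; the choice of representative of \<open>h\<close> in \<open>L\<^sup>0(\<mu>)\<close> is immaterial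
  because of the factor \<open>|Du|\<close>.\<close>

definition comp_mult_slope ::
  "'x::metric_space measure \<Rightarrow> ('x \<Rightarrow> 'y::metric_space) \<Rightarrow> 'y L0_elt \<Rightarrow> 'x L0_elt" where
  "comp_mult_slope m u h = L0_cls m (\<lambda>x. L0_rep h (u x) * L0_rep (map_slope m u) x)"

section \<open>Pullback and extension\<close>

definition pullback_module ::
  "('x \<Rightarrow> 'y) \<Rightarrow> 'x measure \<Rightarrow> 'y measure \<Rightarrow> ('y L0_elt, 'v) normed_module \<Rightarrow>
   ('x L0_elt, 'w) normed_module \<Rightarrow> ('v \<Rightarrow> 'w) \<Rightarrow> bool" where
  "pullback_module u \<nu> \<mu> M P pb \<longleftrightarrow>
     L0_normed_module \<nu> P \<and>
     real_linear_map \<mu> (carrier M) M \<nu> P pb \<and>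
     continuous_map (L0_topology \<mu> M) (L0_topology \<nu> P) pb \<and>
     (\<forall>v\<in>carrier M. pnorm P (pb v) = L0_cls \<nu> (L0_rep (pnorm M v) \<circ> u)) \<and>
     L0_generates \<nu> P (pb ` carrier M)"

definition L0_ext :: "'x measure \<Rightarrow> 'x set \<Rightarrow> 'x L0_elt \<Rightarrow> 'x L0_elt" where
  "L0_ext m E F = L0_cls m (\<lambda>x. indicator E x * L0_rep F x)"

definition Ext ::
  "'x measure \<Rightarrow> 'x set \<Rightarrow> ('x L0_elt, 'v) normed_module \<Rightarrow> ('x L0_elt, 'v) normed_module" where
  "Ext m E M = M\<lparr>smult := (\<lambda>h v. L0_cls (restr_meas m E) (L0_rep h) \<odot>\<^bsub>M\<^esub> v),
                 pnorm := (\<lambda>v. L0_ext m E (pnorm M v))\<rparr>"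

text \<open>The pairing of \<open>ext(v) \<in> Ext(M)\<close> with an element \<open>ext(L)\<close> of \<open>Ext(M\<^sup>*) \<sim> Ext(M)\<^sup>*\<close>; on elements
  \<open>ext\<close> is the identity.\<close>

definition ext_pairing ::
  "'x measure \<Rightarrow> 'x set \<Rightarrow> 'v \<Rightarrow> ('v \<Rightarrow> 'x L0_elt) \<Rightarrow> 'x L0_elt" where
  "ext_pairing m E v L = L0_ext m E (L v)"

section \<open>The differential\<close>

text \<open>Below, \<open>(TX, dX)\<close> and \<open>(TY, dY)\<close> are the cotangent modules of \<open>(X, m)\<close> and \<open>(Y, \<mu>)\<close>, and
  \<open>(P, pb)\<close> is the pullback of \<open>TY\<close>.\<close>

definition associated ::
  "'x::metric_space measure \<Rightarrow> ('x \<Rightarrow> 'y::metric_space) \<Rightarrow>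
   ('x L0_elt, 'a) normed_module \<Rightarrow> ('x L0_elt \<Rightarrow> 'a) \<Rightarrow>
   ('y L0_elt, 'b) normed_module \<Rightarrow> ('y L0_elt \<Rightarrow> 'b) \<Rightarrow>
   'y L0_elt \<Rightarrow> 'x L0_elt \<Rightarrow> bool" where
  "associated m u TX dX TY dY F G \<longleftrightarrow>
     F \<in> S2 (map_meas m u) \<and> G \<in> S2 m \<and>
     (AE x in m. x \<in> pos_slope_set m u \<longrightarrow> L0_rep G x = L0_rep F (u x)) \<and>
     L0_le m (pnorm TX (dX G)) (comp_mult_slope m u (pnorm TY (dY F)))"

definition tangent_module ::
  "'x measure \<Rightarrow> ('x L0_elt, 'a) normed_module \<Rightarrow> ('x L0_elt, 'a \<Rightarrow> 'x L0_elt) normed_module" where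
  "tangent_module m TX = L0_dual m TX"

definition target_module ::
  "'x::metric_space measure \<Rightarrow> ('x \<Rightarrow> 'y::metric_space) \<Rightarrow> ('x L0_elt, 'c) normed_module \<Rightarrow>
   ('x L0_elt, 'c \<Rightarrow> 'x L0_elt) normed_module" where
  "target_module m u P =
     Ext m (pos_slope_set m u) (L0_dual (restr_meas m (pos_slope_set m u)) P)"

definition is_differential_at ::
  "'x::metric_space measure \<Rightarrow> ('x \<Rightarrow> 'y::metric_space) \<Rightarrow>
   ('x L0_elt, 'a) normed_module \<Rightarrow> ('x L0_elt \<Rightarrow> 'a) \<Rightarrow>
   ('y L0_elt, 'b) normed_module \<Rightarrow> ('y L0_elt \<Rightarrow> 'b) \<Rightarrow>
   ('x L0_elt, 'c) normed_module \<Rightarrow> ('b \<Rightarrow> 'c) \<Rightarrow>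
   ('a \<Rightarrow> 'x L0_elt) \<Rightarrow> ('c \<Rightarrow> 'x L0_elt) \<Rightarrow> bool" where
  "is_differential_at m u TX dX TY dY P pb v w \<longleftrightarrow>
     w \<in> carrier (target_module m u P) \<and>
     (\<forall>F\<in>S2 (map_meas m u). \<forall>G\<in>S2 m. associated m u TX dX TY dY F G \<longrightarrow>
        ext_pairing m (pos_slope_set m u) (pb (dY F)) w = v (dX G))"

definition differential ::
  "'x::metric_space measure \<Rightarrow> ('x \<Rightarrow> 'y::metric_space) \<Rightarrow>
   ('x L0_elt, 'a) normed_module \<Rightarrow> ('x L0_elt \<Rightarrow> 'a) \<Rightarrow>
   ('y L0_elt, 'b) normed_module \<Rightarrow> ('y L0_elt \<Rightarrow> 'b) \<Rightarrow>
   ('x L0_elt, 'c) normed_module \<Rightarrow> ('b \<Rightarrow> 'c) \<Rightarrow>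
   ('a \<Rightarrow> 'x L0_elt) \<Rightarrow> ('c \<Rightarrow> 'x L0_elt)" where
  "differential m u TX dX TY dY P pb v = (THE w. is_differential_at m u TX dX TY dY P pb v w)"

end

(* Call G an upper slope of F if some Lipschitz functions converge to F while functions dominating
   their asymptotic Lipschitz constants converge strongly to G. By Mazur's lemma these are the
   relaxed slopes up to enlargement, and they are local and obey a chain rule. Given F on Y with
   approximations f_k, the functions arctan o f_k o u are bounded with controlled slopes; a weak limit,
   composed with tan, is a function associated to F. Locality makes the relation between u^* d_mu F and
   v(dg) (g associated to F) well defined, linear and bounded by |v| |Du|. Its domain generates the
   pullback, so it extends uniquely to an L0-linear functional, which is du(v); this gives |du| <= |Du|.
   Conversely, for Lipschitz f the function f o u is associated to f, and by Hahn-Banach some v with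
   |v| <= 1 satisfies v(d(f o u)) = |d(f o u)|. Hence |d(f o u)| <= Lip(f) |du|, and minimality of
   |Du| gives |Du| <= |du|. *)
theory Submission
  imports Defs
begin

section \<open>Square integrable functions\<close>

text \<open>Domination is built into upper slopes because truncation, gluing and composition control
  asymptotic Lipschitz constants only from above. Relaxed slopes ask for these constants themselves;
  they are recovered for the least upper slope, whose minimal norm forces the dominating functions
  to approach \<open>lip_a\<close>. Weak compactness is replaced by the parallelogram law:
  near-minimisers of the norm in decreasing midpoint convex sets converge strongly. The
  approximations of F on Y converge only mu-a.e., hence say nothing on {|Du| = 0}; this is the
  obstacle behind arctan. Bounded functions have convergent convex combinations even there, and the
  factor 1/(1 + t^2) that arctan puts on the slope is cancelled by tan' = 1 + tan^2, so the final
  bound loses nothing. Functionals are built over the reals with values in L0. Its order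
  completeness, in the form of essential infima, plays the part of the completeness of the reals in
  the theorems of Hahn-Banach and McShane; homogeneity over L0 then follows from a pointwise
  bound.\<close>

definition sqi :: "'z measure \<Rightarrow> ('z \<Rightarrow> real) \<Rightarrow> bool" where
  "sqi n f \<longleftrightarrow> f \<in> borel_measurable n \<and> integrable n (\<lambda>x. (f x)\<^sup>2)"

abbreviation nsq :: "'z measure \<Rightarrow> ('z \<Rightarrow> real) \<Rightarrow> real" where
  "nsq n f \<equiv> (\<integral>x. (f x)\<^sup>2 \<partial>n)"

lemma sqi_measurable [measurable_dest]: "sqi n f \<Longrightarrow> f \<in> borel_measurable n"
  by (simp add: sqi_def)

lemma sqi_integrable: "sqi n f \<Longrightarrow> integrable n (\<lambda>x. (f x)\<^sup>2)"
  by (simp add: sqi_def)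

lemma sqi_bound:
  assumes "sqi n g" "f \<in> borel_measurable n" "AE x in n. \<bar>f x\<bar> \<le> \<bar>g x\<bar>"
  shows "sqi n f"
  unfolding sqi_def
proof
  show "integrable n (\<lambda>x. (f x)\<^sup>2)"
  proof (rule Bochner_Integration.integrable_bound)
    show "integrable n (\<lambda>x. (g x)\<^sup>2)" using assms(1) by (rule sqi_integrable)
    show "AE x in n. norm ((f x)\<^sup>2) \<le> norm ((g x)\<^sup>2)"
      using assms(3) by eventually_elim (simp add: abs_le_square_iff)
  qed (use assms(2) in measurable)
qed (fact assms(2))

lemma sqi_cmult: "sqi n f \<Longrightarrow> sqi n (\<lambda>x. c * f x)"
  by (auto simp: sqi_def power_mult_distrib)

lemma sqi_zero: "sqi n (\<lambda>x. 0)"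
  by (simp add: sqi_def)

lemma sqi_abs: "sqi n f \<Longrightarrow> sqi n (\<lambda>x. \<bar>f x\<bar>)"
  by (auto simp: sqi_def)

lemma integrable_sqi_mult:
  assumes "sqi n f" "sqi n g"
  shows "integrable n (\<lambda>x. f x * g x)"
proof (rule Bochner_Integration.integrable_bound)
  show "integrable n (\<lambda>x. (f x)\<^sup>2 + (g x)\<^sup>2)"
    using assms by (auto simp: sqi_def)
  show "(\<lambda>x. f x * g x) \<in> borel_measurable n" using assms by (auto simp: sqi_def)
  have "\<bar>a * b\<bar> \<le> a\<^sup>2 + b\<^sup>2" for a b :: real
  proof -
    have "0 \<le> (\<bar>a\<bar> - \<bar>b\<bar>)\<^sup>2" "0 \<le> \<bar>a\<bar> * \<bar>b\<bar>" by simp_all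
    then show ?thesis unfolding abs_mult power2_diff power2_abs by linarith
  qed
  then show "AE x in n. norm (f x * g x) \<le> norm ((f x)\<^sup>2 + (g x)\<^sup>2)"
    by (intro always_eventually allI) simp
qed

lemma sqi_add:
  assumes "sqi n f" "sqi n g"
  shows "sqi n (\<lambda>x. f x + g x)"
proof -
  have "integrable n (\<lambda>x. (f x)\<^sup>2 + (g x)\<^sup>2 + 2 * (f x * g x))"
    using assms integrable_sqi_mult[OF assms] by (auto simp: sqi_def)
  moreover have "(\<lambda>x. (f x + g x)\<^sup>2) = (\<lambda>x. (f x)\<^sup>2 + (g x)\<^sup>2 + 2 * (f x * g x))"
    by (simp add: power2_sum algebra_simps)
  ultimately show ?thesis using assms by (auto simp: sqi_def)
qed

lemma sqi_diff: "sqi n f \<Longrightarrow> sqi n g \<Longrightarrow> sqi n (\<lambda>x. f x - g x)"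
  using sqi_add[of n f "\<lambda>x. (-1) * g x"] sqi_cmult[of n g "-1"] by simp

lemma nsq_mono:
  assumes "sqi n g" "f \<in> borel_measurable n" "AE x in n. \<bar>f x\<bar> \<le> \<bar>g x\<bar>"
  shows "nsq n f \<le> nsq n g"
proof (rule integral_mono_AE)
  show "AE x in n. (f x)\<^sup>2 \<le> (g x)\<^sup>2"
    using assms(3) by eventually_elim (simp add: abs_le_square_iff)
qed (use assms sqi_bound[OF assms] in \<open>auto simp: sqi_def\<close>)

lemma nsq_cmult: "nsq n (\<lambda>x. c * f x) = c\<^sup>2 * nsq n f"
  by (simp add: power_mult_distrib)

lemma nsq_minus_commute: "nsq n (\<lambda>x. f x - g x) = nsq n (\<lambda>x. g x - f x)"
  by (simp add: power2_commute)

lemma nsq_eq_0_iff: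
  assumes "sqi n f"
  shows "nsq n f = 0 \<longleftrightarrow> (AE x in n. f x = 0)"
  using integral_nonneg_eq_0_iff_AE[OF sqi_integrable[OF assms]] by simp

text \<open>Stated with the midpoint because it will be applied to two near-minimisers in a midpoint
  convex set, where the midpoint term is bounded below by the infimum of the norms.\<close>

lemma nsq_parallelogram:
  assumes "sqi n f" "sqi n g"
  shows "nsq n (\<lambda>x. f x - g x) = 2 * nsq n f + 2 * nsq n g - 4 * nsq n (\<lambda>x. (f x + g x) / 2)"
proof -
  have "integrable n (\<lambda>x. ((f x + g x) / 2)\<^sup>2)"
    using sqi_integrable[OF sqi_cmult[OF sqi_add[OF assms], of "1/2"]] by simp
  then have "2 * nsq n f + 2 * nsq n g - 4 * nsq n (\<lambda>x. (f x + g x) / 2) =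
    (\<integral>x. 2 * (f x)\<^sup>2 + 2 * (g x)\<^sup>2 - 4 * ((f x + g x) / 2)\<^sup>2 \<partial>n)"
    using sqi_integrable[OF assms(1)] sqi_integrable[OF assms(2)] by simp
  also have "(\<lambda>x. 2 * (f x)\<^sup>2 + 2 * (g x)\<^sup>2 - 4 * ((f x + g x) / 2)\<^sup>2) = (\<lambda>x. (f x - g x)\<^sup>2)"
    by (auto simp: power2_eq_square field_simps)
  finally show ?thesis by simp
qed

lemma nsq_add_le:
  assumes "sqi n f" "sqi n g"
  shows "nsq n (\<lambda>x. f x + g x) \<le> 2 * nsq n f + 2 * nsq n g"
  using nsq_parallelogram[OF assms(1) sqi_cmult[OF assms(2), of "-1"]]
    Bochner_Integration.integral_nonneg[of n "\<lambda>x. ((f x - g x) / 2)\<^sup>2"] by simp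

text \<open>Expand the square of \<open>b * f + s * a * g\<close>, where \<open>a\<close> and
  \<open>b\<close> are the two norms and \<open>s\<close> is a sign. Division by
  \<open>a * b\<close> is possible unless one of the functions vanishes a.e.\<close>

lemma Cauchy_Schwarz_sqi:
  assumes "sqi n f" "sqi n g"
  shows "\<bar>\<integral>x. f x * g x \<partial>n\<bar> \<le> sqrt (nsq n f) * sqrt (nsq n g)"
proof -
  define a b where "a = sqrt (nsq n f)" and "b = sqrt (nsq n g)"
  have nn: "0 \<le> a" "0 \<le> b" "a\<^sup>2 = nsq n f" "b\<^sup>2 = nsq n g" by (auto simp: a_def b_def)
  note I = sqi_integrable[OF assms(1)] sqi_integrable[OF assms(2)] integrable_sqi_mult[OF assms]
  have *: "0 \<le> 2 * (a * b) * (a * b + s * (\<integral>x. f x * g x \<partial>n))" if "s\<^sup>2 = 1" for s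
  proof -
    have "0 \<le> (\<integral>x. (b * f x + s * a * g x)\<^sup>2 \<partial>n)" by simp
    also have "(\<lambda>x. (b * f x + s * a * g x)\<^sup>2) =
      (\<lambda>x. b\<^sup>2 * (f x)\<^sup>2 + a\<^sup>2 * (g x)\<^sup>2 + 2 * s * a * b * (f x * g x))"
      using that by (auto simp: power2_sum power_mult_distrib algebra_simps)
    also have "(\<integral>x. b\<^sup>2 * (f x)\<^sup>2 + a\<^sup>2 * (g x)\<^sup>2 + 2 * s * a * b * (f x * g x) \<partial>n) =
      b\<^sup>2 * a\<^sup>2 + a\<^sup>2 * b\<^sup>2 + 2 * s * a * b * (\<integral>x. f x * g x \<partial>n)"
      using I nn by simp
    finally show ?thesis by (simp add: power2_eq_square algebra_simps)
  qed
  consider "a = 0" | "b = 0" | "a * b > 0" using nn by force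
  then have "\<bar>\<integral>x. f x * g x \<partial>n\<bar> \<le> a * b"
  proof cases
    case 1
    then have "AE x in n. f x = 0" using nn nsq_eq_0_iff[OF assms(1)] by simp
    then have "AE x in n. f x * g x = 0" by eventually_elim simp
    then show ?thesis using 1 by (simp add: integral_eq_zero_AE)
  next
    case 2
    then have "AE x in n. g x = 0" using nn nsq_eq_0_iff[OF assms(2)] by simp
    then have "AE x in n. f x * g x = 0" by eventually_elim simp
    then show ?thesis using 2 by (simp add: integral_eq_zero_AE)
  next
    case 3
    then show ?thesis using *[of 1] *[of "-1"]
      by (simp add: zero_le_mult_iff abs_le_iff)
  qed
  then show ?thesis by (simp add: a_def b_def)
qed

lemma sqi_tendsto_integral:
  assumes "\<And>k. sqi n (f k)" "sqi n g" "sqi n h" "(\<lambda>k. nsq n (\<lambda>x. f k x - g x)) \<longlonglongrightarrow> 0"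
  shows "(\<lambda>k. \<integral>x. f k x * h x \<partial>n) \<longlonglongrightarrow> (\<integral>x. g x * h x \<partial>n)"
proof -
  have "(\<lambda>k. sqrt (nsq n (\<lambda>x. f k x - g x)) * sqrt (nsq n h)) \<longlonglongrightarrow> sqrt 0 * sqrt (nsq n h)"
    by (intro tendsto_intros assms)
  then have *: "(\<lambda>k. sqrt (nsq n (\<lambda>x. f k x - g x)) * sqrt (nsq n h)) \<longlonglongrightarrow> 0" by simp
  have "(\<lambda>k. (\<integral>x. (f k x - g x) * h x \<partial>n)) \<longlonglongrightarrow> 0"
  proof (rule Lim_null_comparison[OF _ *])
    show "\<forall>\<^sub>F k in sequentially. norm (\<integral>x. (f k x - g x) * h x \<partial>n) \<le>
      sqrt (nsq n (\<lambda>x. f k x - g x)) * sqrt (nsq n h)"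
      using Cauchy_Schwarz_sqi[OF sqi_diff[OF assms(1) assms(2)] assms(3)] by simp
  qed
  moreover have "(\<integral>x. (f k x - g x) * h x \<partial>n) = (\<integral>x. f k x * h x \<partial>n) - (\<integral>x. g x * h x \<partial>n)" for k
    using assms by (simp add: left_diff_distrib integrable_sqi_mult)
  ultimately show ?thesis by (simp add: LIM_zero_iff)
qed

text \<open>The squared norm is expressed by the squared distance to the limit and a pairing with
  the fixed function \<open>g\<close>; both converge.\<close>

lemma sqi_tendsto_nsq:
  assumes "\<And>k. sqi n (f k)" "sqi n g" "(\<lambda>k. nsq n (\<lambda>x. f k x - g x)) \<longlonglongrightarrow> 0"
  shows "(\<lambda>k. nsq n (f k)) \<longlonglongrightarrow> nsq n g"
proof -
  have eq: "nsq n (f k) = nsq n (\<lambda>x. f k x - g x) + 2 * (\<integral>x. f k x * g x \<partial>n) - nsq n g" for k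
  proof -
    have "(\<lambda>x. (f k x - g x)\<^sup>2) = (\<lambda>x. (f k x)\<^sup>2 - 2 * (f k x * g x) + (g x)\<^sup>2)"
      by (auto simp: power2_diff algebra_simps)
    then show ?thesis
      using assms by (simp add: sqi_integrable integrable_sqi_mult)
  qed
  have "(\<lambda>k. nsq n (\<lambda>x. f k x - g x) + 2 * (\<integral>x. f k x * g x \<partial>n) - nsq n g)
    \<longlonglongrightarrow> 0 + 2 * (\<integral>x. g x * g x \<partial>n) - nsq n g"
    by (intro tendsto_intros assms sqi_tendsto_integral)
  moreover have "0 + 2 * (\<integral>x. g x * g x \<partial>n) - nsq n g = nsq n g" by (simp add: power2_eq_square)
  ultimately show ?thesis unfolding eq by (simp only:)
qed

lemma summable_bounded_terms:
  fixes h :: "nat \<Rightarrow> ennreal"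
  assumes "(\<Sum>i. h i) \<noteq> \<infinity>"
  shows "\<exists>C::real. \<forall>i. h i \<le> ennreal C"
proof -
  obtain C where "(\<Sum>i. h i) = ennreal C" using assms by (cases "\<Sum>i. h i") auto
  then have "\<And>i. h i \<le> ennreal C"
    using sum_le_suminf[of h "{_}"] by (simp add: summableI)
  then show ?thesis by blast
qed

text \<open>The weight 4^k lies between 1 and the decay 8^k: the sum of 4^k |f_(k+1) - f_k|^2 still
  has finite integral, and boundedness of its terms at a point makes the increments there O(2^-k),
  hence summable.\<close>

lemma geometric_AE_Cauchy:
  fixes f :: "nat \<Rightarrow> 'z \<Rightarrow> real"
  assumes f: "\<And>k. sqi n (f k)" and le: "\<And>k. nsq n (\<lambda>x. f (Suc k) x - f k x) \<le> (1/8) ^ k"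
  shows "AE x in n. convergent (\<lambda>k. f k x)"
proof -
  have fm [measurable]: "\<And>k. f k \<in> borel_measurable n" using f by (auto simp: sqi_def)
  define h where "h k x = ennreal (4 ^ k * (f (Suc k) x - f k x)\<^sup>2)" for k x
  have h_m [measurable]: "\<And>k. h k \<in> borel_measurable n" unfolding h_def by measurable
  have "(\<integral>\<^sup>+x. h k x \<partial>n) \<le> ennreal ((1/2)^k)" for k
  proof -
    have "(\<integral>\<^sup>+x. h k x \<partial>n) = ennreal (\<integral>x. 4 ^ k * (f (Suc k) x - f k x)\<^sup>2 \<partial>n)"
      unfolding h_def using sqi_integrable[OF sqi_diff[OF f f]]
      by (intro nn_integral_eq_integral) auto
    also have "\<dots> \<le> ennreal (4 ^ k * (1/8) ^ k)"
      using le[of k] by (intro ennreal_leI) simp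
    also have "(4::real) ^ k * (1/8) ^ k = (1/2)^k" by (simp flip: power_mult_distrib)
    finally show ?thesis .
  qed
  then have "(\<Sum>k. \<integral>\<^sup>+x. h k x \<partial>n) \<le> (\<Sum>k. ennreal ((1/2)^k))" by (intro suminf_le) auto
  also have "\<dots> = ennreal (\<Sum>k. (1/2)^k)" by (intro suminf_ennreal2) (auto simp: summable_geometric)
  finally have "(\<integral>\<^sup>+x. (\<Sum>k. h k x) \<partial>n) \<noteq> \<infinity>"
    by (subst nn_integral_suminf) (auto simp: top_unique)
  then have "AE x in n. (\<Sum>k. h k x) \<noteq> \<infinity>" by (intro nn_integral_PInf_AE) auto
  then show ?thesis
  proof eventually_elim
    case (elim x)
    then obtain C where C: "\<And>k. h k x \<le> ennreal C" using summable_bounded_terms by blast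
    define D where "D = max C 0"
    have "4 ^ k * (f (Suc k) x - f k x)\<^sup>2 \<le> D" for k
      using C[of k] unfolding h_def D_def
      by (auto simp: ennreal_le_iff2)
    moreover have "((2::real) ^ k)\<^sup>2 = 4 ^ k" for k
      by (simp add: power2_eq_square flip: power_mult_distrib)
    ultimately have D: "(2 ^ k * \<bar>f (Suc k) x - f k x\<bar>)\<^sup>2 \<le> D" for k
      by (simp add: power_mult_distrib)
    have "summable (\<lambda>k. f (Suc k) x - f k x)"
    proof (rule summable_comparison_test)
      show "summable (\<lambda>k. sqrt D * (1/2)^k)" by (intro summable_mult summable_geometric) simp
      have "norm (f (Suc k) x - f k x) \<le> sqrt D * (1/2)^k" for k
        using real_le_rsqrt[OF D[of k]] by (simp add: field_simps)
      then show "\<exists>N. \<forall>k\<ge>N. norm (f (Suc k) x - f k x) \<le> sqrt D * (1/2)^k" by blast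
    qed
    then have "convergent (\<lambda>k. \<Sum>i<k. f (Suc i) x - f i x)" by (simp add: summable_iff_convergent)
    then have "convergent (\<lambda>k. f k x - f 0 x)" using sum_lessThan_telescope[of "\<lambda>i. f i x"] by simp
    then have "convergent (\<lambda>k. (f k x - f 0 x) + f 0 x)" by (intro convergent_add convergent_const)
    then show ?case by simp
  qed
qed

lemma nsq_Fatou:
  assumes f: "\<And>k. sqi n (f k)" and g: "g \<in> borel_measurable n"
    and lim: "AE x in n. (\<lambda>k. f k x) \<longlonglongrightarrow> g x" and le: "\<And>k. nsq n (f k) \<le> C"
  shows "sqi n g \<and> nsq n g \<le> C"
proof -
  note fm [measurable] = sqi_measurable[OF f]
  note g [measurable]
  have "0 \<le> nsq n (f 0)" by (rule Bochner_Integration.integral_nonneg) simp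
  with le[of 0] have C0: "0 \<le> C" by linarith
  have "(\<integral>\<^sup>+x. ennreal ((g x)\<^sup>2) \<partial>n) = (\<integral>\<^sup>+x. liminf (\<lambda>k. ennreal ((f k x)\<^sup>2)) \<partial>n)"
  proof (rule nn_integral_cong_AE)
    show "AE x in n. ennreal ((g x)\<^sup>2) = liminf (\<lambda>k. ennreal ((f k x)\<^sup>2))"
      using lim
    proof eventually_elim
      case (elim x)
      have "(\<lambda>k. ennreal ((f k x)\<^sup>2)) \<longlonglongrightarrow> ennreal ((g x)\<^sup>2)"
        by (intro tendsto_ennrealI tendsto_intros elim)
      then show ?case by (metis lim_imp_Liminf sequentially_bot)
    qed
  qed
  also have "\<dots> \<le> liminf (\<lambda>k. \<integral>\<^sup>+x. ennreal ((f k x)\<^sup>2) \<partial>n)"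
    by (intro nn_integral_liminf) measurable
  also have "\<dots> \<le> ennreal C"
  proof -
    have "(\<integral>\<^sup>+x. ennreal ((f k x)\<^sup>2) \<partial>n) \<le> ennreal C" for k
      using le[of k] by (subst nn_integral_eq_integral) (auto intro: ennreal_leI sqi_integrable f)
    then have "liminf (\<lambda>k. \<integral>\<^sup>+x. ennreal ((f k x)\<^sup>2) \<partial>n) \<le> liminf (\<lambda>_. ennreal C)"
      by (intro Liminf_mono always_eventually allI)
    then show ?thesis by (simp add: Liminf_const)
  qed
  finally have *: "(\<integral>\<^sup>+x. ennreal ((g x)\<^sup>2) \<partial>n) \<le> ennreal C" .
  then have "integrable n (\<lambda>x. (g x)\<^sup>2)"
    by (intro integrableI_bounded) (auto simp: top_unique less_top intro: le_less_trans)
  moreover from this have "nsq n g \<le> C"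
    using * C0 by (subst (asm) nn_integral_eq_integral) (auto simp: ennreal_le_iff)
  ultimately show ?thesis using g by (simp add: sqi_def)
qed

text \<open>Riesz-Fischer. A subsequence with geometrically small increments converges a.e.; Fatou's
  lemma, with the other index kept fixed, turns this a.e. limit into a limit in norm of the whole
  sequence.\<close>

lemma sqi_complete:
  fixes f :: "nat \<Rightarrow> 'z \<Rightarrow> real"
  assumes f: "\<And>k. sqi n (f k)"
    and C: "\<And>e. e > 0 \<Longrightarrow> \<exists>N. \<forall>j\<ge>N. \<forall>k\<ge>N. nsq n (\<lambda>x. f j x - f k x) < e"
  obtains g where "sqi n g" "(\<lambda>k. nsq n (\<lambda>x. f k x - g x)) \<longlonglongrightarrow> 0"
proof -
  have "\<exists>r::nat \<Rightarrow> nat. \<forall>i. (\<forall>j\<ge>r i. \<forall>k\<ge>r i. nsq n (\<lambda>x. f j x - f k x) < (1/8)^i) \<and> r i < r (Suc i)"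
  proof (rule dependent_nat_choice)
    show "\<exists>x. \<forall>j\<ge>x. \<forall>k\<ge>x. nsq n (\<lambda>x. f j x - f k x) < (1/8)^0" using C[of 1] by simp
  next
    fix x i
    obtain N where "\<forall>j\<ge>N. \<forall>k\<ge>N. nsq n (\<lambda>x. f j x - f k x) < (1/8)^(Suc i)"
      using C[of "(1/8)^(Suc i)"] by auto
    then show "\<exists>y. (\<forall>j\<ge>y. \<forall>k\<ge>y. nsq n (\<lambda>x. f j x - f k x) < (1/8)^(Suc i)) \<and> x < y"
      by (intro exI[of _ "max N (Suc x)"]) auto
  qed
  then obtain r :: "nat \<Rightarrow> nat"
    where r: "\<And>i j k. j \<ge> r i \<Longrightarrow> k \<ge> r i \<Longrightarrow> nsq n (\<lambda>x. f j x - f k x) < (1/8)^i"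
    and mono: "\<And>i. r i < r (Suc i)" by metis
  have sm: "strict_mono r" using mono by (simp add: strict_mono_Suc_iff)
  have conv: "AE x in n. convergent (\<lambda>k. f (r k) x)"
    by (rule geometric_AE_Cauchy) (auto intro!: f less_imp_le[OF r] less_imp_le[OF mono])
  define g where "g x = lim (\<lambda>k. f (r k) x)" for x
  note fm [measurable] = sqi_measurable[OF f]
  have gm [measurable]: "g \<in> borel_measurable n" unfolding g_def by measurable
  have lim: "AE x in n. (\<lambda>k. f (r k) x) \<longlonglongrightarrow> g x"
    using conv by eventually_elim (simp add: g_def convergent_LIMSEQ_iff)
  have ev: "\<exists>N. \<forall>k\<ge>N. sqi n (\<lambda>x. g x - f k x) \<and> nsq n (\<lambda>x. g x - f k x) \<le> e" if e: "e > 0" for e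
  proof -
    obtain N where N: "\<And>j k. j \<ge> N \<Longrightarrow> k \<ge> N \<Longrightarrow> nsq n (\<lambda>x. f j x - f k x) < e"
      using C[OF e] by blast
    have "sqi n (\<lambda>x. g x - f k x) \<and> nsq n (\<lambda>x. g x - f k x) \<le> e" if "k \<ge> N" for k
    proof (rule nsq_Fatou)
      show "sqi n (\<lambda>x. f (r (i + N)) x - f k x)" for i by (intro sqi_diff f)
      \<comment> \<open>The shift by \<open>N\<close> puts all indices \<open>r (i + N)\<close> in
        the range where the Cauchy bound holds.\<close>
      have "N \<le> r (i + N)" for i using seq_suble[OF sm, of "i + N"] by simp
      then show "nsq n (\<lambda>x. f (r (i + N)) x - f k x) \<le> e" for i
        using N[of "r (i + N)" k] that by (simp add: less_imp_le)
      show "AE x in n. (\<lambda>i. f (r (i + N)) x - f k x) \<longlonglongrightarrow> g x - f k x"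
        using lim
      proof eventually_elim
        case (elim x)
        then show ?case by (intro tendsto_diff tendsto_const LIMSEQ_ignore_initial_segment[of "\<lambda>i. f (r i) x"])
      qed
    qed measurable
    then show ?thesis by blast
  qed
  show thesis
  proof
    obtain N where "sqi n (\<lambda>x. g x - f N x)" using ev[of 1] by auto
    from sqi_add[OF this f[of N]] show "sqi n g" by simp
    show "(\<lambda>k. nsq n (\<lambda>x. f k x - g x)) \<longlonglongrightarrow> 0"
    proof (rule LIMSEQ_I)
      fix e :: real assume "e > 0"
      then obtain N where "\<forall>k\<ge>N. nsq n (\<lambda>x. g x - f k x) \<le> e / 2" using ev[of "e / 2"] by auto
      then have "\<forall>k\<ge>N. norm (nsq n (\<lambda>x. f k x - g x) - 0) < e"
        using \<open>e > 0\<close> nsq_minus_commute[of n g] by fastforce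
      then show "\<exists>N. \<forall>k\<ge>N. norm (nsq n (\<lambda>x. f k x - g x) - 0) < e" by blast
    qed
  qed
qed

text \<open>The substitute for weak compactness: near-minimisers of the norm on a decreasing sequence of
  midpoint convex sets form a Cauchy sequence, by the parallelogram law.\<close>

lemma midpoint_convex_minimising:
  fixes C :: "nat \<Rightarrow> ('z \<Rightarrow> real) set"
  assumes sq: "\<And>N f. f \<in> C N \<Longrightarrow> sqi n f" and dec: "\<And>N. C (Suc N) \<subseteq> C N"
    and mid: "\<And>N f g. f \<in> C N \<Longrightarrow> g \<in> C N \<Longrightarrow> (\<lambda>x. (f x + g x) / 2) \<in> C N"
    and bd: "\<And>N. \<exists>f\<in>C N. nsq n f \<le> B"
  obtains f g where "\<And>N. f N \<in> C N" "sqi n g" "(\<lambda>N. nsq n (\<lambda>x. f N x - g x)) \<longlonglongrightarrow> 0"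
    "\<And>B'. (\<And>N. \<exists>f\<in>C N. nsq n f \<le> B') \<Longrightarrow> nsq n g \<le> B'"
proof -
  define d where "d N = (INF f\<in>C N. nsq n f)" for N
  have ne: "C N \<noteq> {}" for N using bd[of N] by auto
  have bb: "bdd_below ((\<lambda>f. nsq n f) ` C N)" for N by (rule bdd_belowI[of _ 0]) auto
  have dle: "d N \<le> nsq n f" if "f \<in> C N" for f N unfolding d_def by (rule cINF_lower[OF bb that])
  have dB: "d N \<le> B'" if "\<And>N. \<exists>f\<in>C N. nsq n f \<le> B'" for N B' using that[of N] dle order_trans by blast
  have dmono: "d N \<le> d (Suc N)" for N
    unfolding d_def by (rule cINF_superset_mono[OF ne bb dec]) simp
  then have inc: "incseq d" by (rule incseq_SucI)
  obtain D where D: "d \<longlonglongrightarrow> D" and leD: "\<And>N. d N \<le> D"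
    using incseq_convergent[OF inc, of B] dB[OF bd] by auto
  have "\<exists>f\<in>C N. nsq n f < d N + 1 / real (Suc N)" for N
    using cINF_less_iff[OF ne bb, of N "d N + 1 / real (Suc N)"] by (simp add: d_def)
  then obtain f where f: "\<And>N. f N \<in> C N" and fl: "\<And>N. nsq n (f N) < d N + 1 / real (Suc N)" by metis
  have fs: "sqi n (f N)" for N using sq f by blast
  have decs: "C k \<subseteq> C j" if "j \<le> k" for j k using dec that by (metis lift_Suc_antimono_le)
  \<comment> \<open>The midpoint of \<open>f j\<close> and \<open>f k\<close> lies in the larger set
    \<open>C j\<close>, so its squared norm is at least \<open>d j\<close>; the parallelogram law
    then bounds the distance by the gap between \<open>D\<close> and \<open>d j\<close> plus the
    tolerances.\<close>
  have *: "nsq n (\<lambda>x. f j x - f k x) \<le> 2 * (D - d j) + 4 * (1 / real (Suc j))" if "j \<le> k" for j k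
  proof -
    have "(\<lambda>x. (f j x + f k x) / 2) \<in> C j" using mid f decs[OF that] by blast
    then have "d j \<le> nsq n (\<lambda>x. (f j x + f k x) / 2)" by (rule dle)
    moreover have "1 / real (Suc k) \<le> 1 / real (Suc j)" using that by (simp add: frac_le)
    moreover have "S \<le> 2 * (D - dj) + 4 * e"
      if "dj \<le> M" "e' \<le> e" "S = 2 * a + 2 * b - 4 * M" "a < dj + e" "b < dk + e'" "dk \<le> D"
      for S dj e M e' a b dk :: real using that by argo
    ultimately show ?thesis
      using nsq_parallelogram[OF fs fs, of j k] fl[of j] fl[of k] leD[of k] by blast
  qed
  have lim: "(\<lambda>j. 2 * (D - d j) + 4 * (1 / real (Suc j))) \<longlonglongrightarrow> 2 * (D - D) + 4 * 0"
    by (intro tendsto_intros D LIMSEQ_Suc[OF lim_1_over_n])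
  obtain g where g: "sqi n g" "(\<lambda>k. nsq n (\<lambda>x. f k x - g x)) \<longlonglongrightarrow> 0"
  proof (rule sqi_complete[OF fs])
    fix e :: real assume "e > 0"
    then obtain N where N: "\<And>j. j \<ge> N \<Longrightarrow> 2 * (D - d j) + 4 * (1 / real (Suc j)) < e"
      using order_tendstoD(2)[OF lim, of e] by (auto simp: eventually_sequentially)
    have "nsq n (\<lambda>x. f j x - f k x) < e" if "j \<ge> N" "k \<ge> N" for j k
    proof (cases "j \<le> k")
      case True then show ?thesis using * N that by (meson le_less_trans)
    next
      case False then show ?thesis using *[of k j] N[of k] that nsq_minus_commute[of n "f j" "f k"] by linarith
    qed
    then show "\<exists>N. \<forall>j\<ge>N. \<forall>k\<ge>N. nsq n (\<lambda>x. f j x - f k x) < e" by blast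
  qed
  \<comment> \<open>Each infimum \<open>d k\<close> is at most \<open>B'\<close>, and
    \<open>f k\<close> exceeds it by less than \<open>1 / real (Suc k)\<close>. Leaving
    \<open>B'\<close> free allows the bound to be improved after the limit has been fixed.\<close>
  have "nsq n g \<le> B'" if B': "\<And>N. \<exists>f\<in>C N. nsq n f \<le> B'" for B'
  proof (rule LIMSEQ_le)
    show "(\<lambda>k. nsq n (f k)) \<longlonglongrightarrow> nsq n g" by (rule sqi_tendsto_nsq[OF fs g])
    show "(\<lambda>k. B' + 1 / real (Suc k)) \<longlonglongrightarrow> B'"
      using tendsto_add[OF tendsto_const LIMSEQ_Suc[OF lim_1_over_n], of B'] by simp
    show "\<exists>N. \<forall>k\<ge>N. nsq n (f k) \<le> B' + 1 / real (Suc k)"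
      using fl dB[OF B'] by (meson add_right_mono less_imp_le order_trans)
  qed
  then show thesis using that f g by blast
qed

section \<open>Classes of measurable functions\<close>

lemma L0_cls_eq_iff:
  assumes "f \<in> borel_measurable n" "g \<in> borel_measurable n"
  shows "L0_cls n f = L0_cls n g \<longleftrightarrow> (AE x in n. f x = g x)"
proof
  assume "L0_cls n f = L0_cls n g"
  moreover have "f \<in> L0_cls n f" using assms by (simp add: L0_cls_def)
  ultimately show "AE x in n. f x = g x" by (auto simp: L0_cls_def)
next
  assume *: "AE x in n. f x = g x"
  have "(AE x in n. h x = f x) = (AE x in n. h x = g x)" for h
  proof
    assume "AE x in n. h x = f x" with * show "AE x in n. h x = g x" by eventually_elim simp
  next
    assume "AE x in n. h x = g x" with * show "AE x in n. h x = f x" by eventually_elim simp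
  qed
  then show "L0_cls n f = L0_cls n g" by (auto simp: L0_cls_def)
qed

lemma L0_rep_cls_in: "f \<in> borel_measurable n \<Longrightarrow> L0_rep (L0_cls n f) \<in> L0_cls n f"
  unfolding L0_rep_def by (rule someI[of _ f]) (simp add: L0_cls_def)

lemma L0_rep_cls: "f \<in> borel_measurable n \<Longrightarrow> AE x in n. L0_rep (L0_cls n f) x = f x"
  by (drule L0_rep_cls_in) (unfold L0_cls_def, blast)

lemma L0_cls_carrier [simp, intro]: "f \<in> borel_measurable n \<Longrightarrow> L0_cls n f \<in> carrier (L0 n)"
  by (simp add: L0_def)

lemma L0_rep_measurable [measurable_dest]:
  "F \<in> carrier (L0 n) \<Longrightarrow> L0_rep F \<in> borel_measurable n"
proof -
  assume "F \<in> carrier (L0 n)"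
  then obtain f where "f \<in> borel_measurable n" "F = L0_cls n f" by (auto simp: L0_def)
  with L0_rep_cls_in[of f n] show ?thesis unfolding L0_cls_def by blast
qed

lemma L0_cls_rep:
  assumes "F \<in> carrier (L0 n)" shows "L0_cls n (L0_rep F) = F"
proof -
  obtain f where f: "f \<in> borel_measurable n" "F = L0_cls n f" using assms by (auto simp: L0_def)
  show ?thesis
    using L0_rep_cls[OF f(1)] L0_cls_eq_iff[OF L0_rep_measurable[OF assms] f(1)] f(2) by simp
qed

lemma L0_eqI:
  assumes "F \<in> carrier (L0 n)" "G \<in> carrier (L0 n)" "AE x in n. L0_rep F x = L0_rep G x"
  shows "F = G"
proof -
  have "L0_cls n (L0_rep F) = L0_cls n (L0_rep G)"
    using assms by (subst L0_cls_eq_iff) (auto intro: L0_rep_measurable)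
  then show ?thesis by (simp add: L0_cls_rep assms)
qed

lemma L0_add_carrier: "F \<in> carrier (L0 n) \<Longrightarrow> G \<in> carrier (L0 n) \<Longrightarrow> F \<oplus>\<^bsub>L0 n\<^esub> G \<in> carrier (L0 n)"
  and L0_mult_carrier: "F \<in> carrier (L0 n) \<Longrightarrow> G \<in> carrier (L0 n) \<Longrightarrow> F \<otimes>\<^bsub>L0 n\<^esub> G \<in> carrier (L0 n)"
  and L0_smult_eq: "F \<odot>\<^bsub>L0 n\<^esub> G = F \<otimes>\<^bsub>L0 n\<^esub> G"
  and L0_pnorm_carrier: "F \<in> carrier (L0 n) \<Longrightarrow> pnorm (L0 n) F \<in> carrier (L0 n)"
  and L0_zero_carrier: "\<zero>\<^bsub>L0 n\<^esub> \<in> carrier (L0 n)"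
  and L0_one_carrier: "\<one>\<^bsub>L0 n\<^esub> \<in> carrier (L0 n)"
  by (auto simp: L0_def dest!: L0_rep_measurable[unfolded L0_def, simplified])

lemmas L0_carriers = L0_add_carrier L0_mult_carrier L0_pnorm_carrier L0_zero_carrier L0_one_carrier

lemma L0_rep_add: "F \<in> carrier (L0 n) \<Longrightarrow> G \<in> carrier (L0 n) \<Longrightarrow>
    AE x in n. L0_rep (F \<oplus>\<^bsub>L0 n\<^esub> G) x = L0_rep F x + L0_rep G x"
  and L0_rep_mult: "F \<in> carrier (L0 n) \<Longrightarrow> G \<in> carrier (L0 n) \<Longrightarrow>
    AE x in n. L0_rep (F \<otimes>\<^bsub>L0 n\<^esub> G) x = L0_rep F x * L0_rep G x"
  and L0_rep_pnorm: "F \<in> carrier (L0 n) \<Longrightarrow> AE x in n. L0_rep (pnorm (L0 n) F) x = \<bar>L0_rep F x\<bar>"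
  and L0_rep_zero: "AE x in n. L0_rep \<zero>\<^bsub>L0 n\<^esub> x = 0"
  and L0_rep_one: "AE x in n. L0_rep \<one>\<^bsub>L0 n\<^esub> x = 1"
  by (auto simp: L0_def intro!: L0_rep_cls dest!: L0_rep_measurable[unfolded L0_def, simplified])

lemma L0_cring: "cring (L0 n)"
proof (rule cringI)
  show "abelian_group (L0 n)"
  proof (rule abelian_groupI)
    fix F G H assume c: "F \<in> carrier (L0 n)" "G \<in> carrier (L0 n)" "H \<in> carrier (L0 n)"
    note c' = L0_add_carrier[OF c(1,2)] L0_add_carrier[OF c(2,3)]
    show "F \<oplus>\<^bsub>L0 n\<^esub> G \<oplus>\<^bsub>L0 n\<^esub> H = F \<oplus>\<^bsub>L0 n\<^esub> (G \<oplus>\<^bsub>L0 n\<^esub> H)"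
      by (intro L0_eqI[of _ n] L0_carriers c c')
        (use L0_rep_add[OF c'(1) c(3)] L0_rep_add[OF c(1) c'(2)] L0_rep_add[OF c(1,2)] L0_rep_add[OF c(2,3)] in \<open>eventually_elim, simp\<close>)
  next
    fix F G assume c: "F \<in> carrier (L0 n)" "G \<in> carrier (L0 n)"
    show "F \<oplus>\<^bsub>L0 n\<^esub> G = G \<oplus>\<^bsub>L0 n\<^esub> F"
      by (intro L0_eqI[of _ n] L0_carriers c)
        (use L0_rep_add[OF c] L0_rep_add[OF c(2,1)] in \<open>eventually_elim, simp\<close>)
  next
    fix F assume c: "F \<in> carrier (L0 n)"
    show "\<zero>\<^bsub>L0 n\<^esub> \<oplus>\<^bsub>L0 n\<^esub> F = F"
      by (intro L0_eqI[of _ n] L0_carriers c)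
        (use L0_rep_add[OF L0_zero_carrier c] L0_rep_zero[of n] in \<open>eventually_elim, simp\<close>)
    have m: "(\<lambda>x. - L0_rep F x) \<in> borel_measurable n" using c by measurable
    show "\<exists>G\<in>carrier (L0 n). G \<oplus>\<^bsub>L0 n\<^esub> F = \<zero>\<^bsub>L0 n\<^esub>"
    proof
      show "L0_cls n (\<lambda>x. - L0_rep F x) \<oplus>\<^bsub>L0 n\<^esub> F = \<zero>\<^bsub>L0 n\<^esub>"
        by (intro L0_eqI[of _ n] L0_carriers c L0_cls_carrier m)
          (use L0_rep_add[OF L0_cls_carrier[OF m] c] L0_rep_cls[OF m] L0_rep_zero[of n] in \<open>eventually_elim, simp\<close>)
    qed (rule L0_cls_carrier[OF m])
  qed (auto intro: L0_carriers)
  show "comm_monoid (L0 n)"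
  proof (rule comm_monoidI)
    fix F G H assume c: "F \<in> carrier (L0 n)" "G \<in> carrier (L0 n)" "H \<in> carrier (L0 n)"
    note c' = L0_mult_carrier[OF c(1,2)] L0_mult_carrier[OF c(2,3)]
    show "F \<otimes>\<^bsub>L0 n\<^esub> G \<otimes>\<^bsub>L0 n\<^esub> H = F \<otimes>\<^bsub>L0 n\<^esub> (G \<otimes>\<^bsub>L0 n\<^esub> H)"
      by (intro L0_eqI[of _ n] L0_carriers c c')
        (use L0_rep_mult[OF c'(1) c(3)] L0_rep_mult[OF c(1) c'(2)] L0_rep_mult[OF c(1,2)] L0_rep_mult[OF c(2,3)] in \<open>eventually_elim, simp\<close>)
  next
    fix F G assume c: "F \<in> carrier (L0 n)" "G \<in> carrier (L0 n)"
    show "F \<otimes>\<^bsub>L0 n\<^esub> G = G \<otimes>\<^bsub>L0 n\<^esub> F"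
      by (intro L0_eqI[of _ n] L0_carriers c)
        (use L0_rep_mult[OF c] L0_rep_mult[OF c(2,1)] in \<open>eventually_elim, simp\<close>)
  next
    fix F assume c: "F \<in> carrier (L0 n)"
    show "\<one>\<^bsub>L0 n\<^esub> \<otimes>\<^bsub>L0 n\<^esub> F = F"
      by (intro L0_eqI[of _ n] L0_carriers c)
        (use L0_rep_mult[OF L0_one_carrier c] L0_rep_one[of n] in \<open>eventually_elim, simp\<close>)
  qed (auto intro: L0_carriers)
  fix F G H assume c: "F \<in> carrier (L0 n)" "G \<in> carrier (L0 n)" "H \<in> carrier (L0 n)"
  note c' = L0_add_carrier[OF c(1,2)] L0_mult_carrier[OF c(1,3)] L0_mult_carrier[OF c(2,3)]
  show "(F \<oplus>\<^bsub>L0 n\<^esub> G) \<otimes>\<^bsub>L0 n\<^esub> H = F \<otimes>\<^bsub>L0 n\<^esub> H \<oplus>\<^bsub>L0 n\<^esub> G \<otimes>\<^bsub>L0 n\<^esub> H"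
    by (intro L0_eqI[of _ n] L0_carriers c c')
      (use L0_rep_mult[OF c'(1) c(3)] L0_rep_add[OF c'(2,3)] L0_rep_add[OF c(1,2)] L0_rep_mult[OF c(1,3)]
      L0_rep_mult[OF c(2,3)] in \<open>eventually_elim, simp add: algebra_simps\<close>)
qed

text \<open>Subtraction in the ring is derived from the group structure and has no representative by
  definition; the formula is read off from \<open>(F - G) + G = F\<close>.\<close>

lemma L0_rep_minus:
  assumes c: "F \<in> carrier (L0 n)" "G \<in> carrier (L0 n)"
  shows "F \<ominus>\<^bsub>L0 n\<^esub> G \<in> carrier (L0 n)" "AE x in n. L0_rep (F \<ominus>\<^bsub>L0 n\<^esub> G) x = L0_rep F x - L0_rep G x"
proof -
  interpret cring "L0 n" by (rule L0_cring)
  show c': "F \<ominus>\<^bsub>L0 n\<^esub> G \<in> carrier (L0 n)" using c by simp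
  have "(F \<ominus>\<^bsub>L0 n\<^esub> G) \<oplus>\<^bsub>L0 n\<^esub> G = F" using c by algebra
  with L0_rep_add[OF c' c(2)] have "AE x in n. L0_rep F x = L0_rep (F \<ominus>\<^bsub>L0 n\<^esub> G) x + L0_rep G x" by simp
  then show "AE x in n. L0_rep (F \<ominus>\<^bsub>L0 n\<^esub> G) x = L0_rep F x - L0_rep G x"
    by eventually_elim simp
qed

lemma L0_le_antisym:
  "F \<in> carrier (L0 n) \<Longrightarrow> G \<in> carrier (L0 n) \<Longrightarrow> L0_le n F G \<Longrightarrow> L0_le n G F \<Longrightarrow> F = G"
  unfolding L0_le_def by (erule (1) L0_eqI, erule (1) AE_mp[OF AE_conjI]) simp

text \<open>Antisymmetry of \<open>L0_le\<close> on classes makes the definite description in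
  \<open>L0_least\<close> unique, so that exhibiting a least element computes it.\<close>

lemma L0_least_eqI:
  assumes "S \<subseteq> carrier (L0 n)" "G \<in> S" "\<And>H. H \<in> S \<Longrightarrow> L0_le n G H"
  shows "L0_least n S = G"
  unfolding L0_least_def
proof (rule the_equality)
  fix H assume "H \<in> S \<and> (\<forall>K\<in>S. L0_le n H K)"
  then show "H = G" using assms by (intro L0_le_antisym[of H n G]) auto
qed (use assms in blast)

lemma L0_cls_cmult:
  assumes "F \<in> carrier (L0 n)"
  shows "AE x in n. L0_rep (L0_cls n (\<lambda>_. c) \<otimes>\<^bsub>L0 n\<^esub> F) x = c * L0_rep F x"
proof -
  have m: "(\<lambda>_. c) \<in> borel_measurable n" by simp
  show ?thesis
    using L0_rep_mult[OF L0_cls_carrier[OF m] assms] L0_rep_cls[OF m] by eventually_elim simp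
qed

section \<open>Equivalent finite measures and essential infima\<close>

text \<open>A sigma-finite measure has a strictly positive function with finite integral. The
  density built from it witnesses the choice in \<open>finite_equiv\<close>, whose defining
  properties therefore hold for the chosen measure.\<close>

lemma finite_equiv:
  assumes "sigma_finite_measure n"
  shows finite_measure_finite_equiv: "finite_measure (finite_equiv n)"
    and sets_finite_equiv [measurable_cong]: "sets (finite_equiv n) = sets n"
    and null_sets_finite_equiv: "null_sets (finite_equiv n) = null_sets n"
proof -
  interpret sigma_finite_measure n by (rule assms)
  obtain h where h [measurable]: "h \<in> borel_measurable n" and i: "integral\<^sup>N n h \<noteq> \<infinity>"
    and pos: "\<And>x. x \<in> space n \<Longrightarrow> 0 < h x" using Ex_finite_integrable_function by blast
  have *: "null_sets (density n h) = null_sets n"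
  proof (rule Set.set_eqI, rule iffI)
    fix A assume "A \<in> null_sets (density n h)"
    then have A: "A \<in> sets n" and "AE x in n. x \<in> A \<longrightarrow> h x = 0" by (auto simp: null_sets_density_iff)
    from this(2) have "AE x in n. x \<notin> A"
      using AE_space[of n] by eventually_elim (use pos in force)
    then show "A \<in> null_sets n" using A AE_iff_null_sets by blast
  next
    fix A assume A: "A \<in> null_sets n"
    from AE_not_in[OF A] have "AE x in n. x \<in> A \<longrightarrow> h x = 0" by eventually_elim simp
    then show "A \<in> null_sets (density n h)" using A by (auto simp: null_sets_density_iff)
  qed
  have "finite_measure (density n h)"
    using i by (intro finite_measureI) (simp add: emeasure_density cong: nn_integral_cong)
  then have "\<exists>n'. finite_measure n' \<and> sets n' = sets n \<and> absolutely_continuous n n' \<and> absolutely_continuous n' n"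
    using * by (intro exI[of _ "density n h"]) (auto simp: absolutely_continuous_def)
  from someI_ex[OF this, folded finite_equiv_def]
  show "finite_measure (finite_equiv n)" "sets (finite_equiv n) = sets n"
    "null_sets (finite_equiv n) = null_sets n" by (auto simp: absolutely_continuous_def)
qed

lemma AE_finite_equiv:
  assumes "sigma_finite_measure n"
  shows "(AE x in finite_equiv n. P x) \<longleftrightarrow> (AE x in n. P x)"
  using null_sets_finite_equiv[OF assms] sets_eq_imp_space_eq[OF sets_finite_equiv[OF assms]]
  by (simp add: eventually_ae_filter)

lemma measurable_finite_equiv:
  "sigma_finite_measure n \<Longrightarrow> borel_measurable (finite_equiv n) = borel_measurable n"
  using sets_finite_equiv by (intro measurable_cong_sets) auto

text \<open>Countable infima minimising the integral of \<open>arctan\<close> against a finite measure attain the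
  essential infimum.\<close>

lemma essential_infimum:
  fixes S :: "('z \<Rightarrow> real) set"
  assumes sf: "sigma_finite_measure n" and ne: "S \<noteq> {}" and Sm: "S \<subseteq> borel_measurable n"
    and l [measurable]: "l \<in> borel_measurable n" and lS: "\<And>f. f \<in> S \<Longrightarrow> AE x in n. l x \<le> f x"
  obtains s f where "s \<in> borel_measurable n" "\<And>k::nat. f k \<in> S"
    "\<And>x. s x = (INF k. max (l x) (f k x))"
    "\<And>g. g \<in> S \<Longrightarrow> AE x in n. s x \<le> g x"
    "\<And>t. (\<And>g. g \<in> S \<Longrightarrow> AE x in n. t x \<le> g x) \<Longrightarrow> AE x in n. t x \<le> s x"
proof -
  define n' where "n' = finite_equiv n"
  interpret n': finite_measure n' unfolding n'_def by (rule finite_measure_finite_equiv[OF sf])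
  have ms: "borel_measurable n' = borel_measurable n" unfolding n'_def by (rule measurable_finite_equiv[OF sf])
  \<comment> \<open>The cap from below by \<open>l\<close> keeps every pointwise infimum a real
    number. It is harmless because \<open>l\<close> is a.e. a lower bound of every member of
    \<open>S\<close>.\<close>
  define s where "s f x = (INF k. max (l x) (f k x))" for f :: "nat \<Rightarrow> 'z \<Rightarrow> real" and x
  have bb: "bdd_below (range (\<lambda>k::nat. max (l x) (f k x)))" for f :: "nat \<Rightarrow> 'z \<Rightarrow> real" and x
    by (rule bdd_belowI[of _ "l x"]) auto
  have s_le: "s f x \<le> max (l x) (f k x)" for f k x
    unfolding s_def by (rule cINF_lower[OF bb]) simp
  have s_ge: "t \<le> s f x" if "\<And>k. t \<le> max (l x) (f k x)" for t f x
    unfolding s_def using that by (intro cINF_greatest) auto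
  define Q where "Q = {f. \<forall>k::nat. f k \<in> S}"
  have sm: "s f \<in> borel_measurable n" if "f \<in> Q" for f
  proof -
    have [measurable]: "f k \<in> borel_measurable n" for k using that Sm by (auto simp: Q_def)
    show ?thesis unfolding s_def by measurable
  qed
  define I where "I f = (\<integral>x. arctan (s f x) \<partial>n')" for f
  have int: "integrable n' (\<lambda>x. arctan (s f x))" if "f \<in> Q" for f
  proof (rule n'.integrable_const_bound[of _ "pi/2"])
    show "AE x in n'. norm (arctan (s f x)) \<le> pi / 2"
    proof (intro always_eventually allI)
      show "norm (arctan (s f x)) \<le> pi / 2" for x using arctan_bounded[of "s f x"] by (simp add: abs_if)
    qed
    show "(\<lambda>x. arctan (s f x)) \<in> borel_measurable n'" unfolding ms using sm[OF that] by measurable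
  qed
  have bI: "bdd_below (I ` Q)"
  proof (rule bdd_belowI2)
    fix f assume "f \<in> Q"
    show "(\<integral>x. - (pi/2) \<partial>n') \<le> I f" unfolding I_def
      by (intro integral_mono int[OF \<open>f \<in> Q\<close>]) (auto intro: less_imp_le arctan_lbound)
  qed
  obtain f0 where "f0 \<in> S" using ne by blast
  then have Qne: "Q \<noteq> {}" by (auto simp: Q_def intro!: exI[of _ "\<lambda>_. f0"])
  have "\<exists>f\<in>Q. I f < Inf (I ` Q) + 1 / real (Suc i)" for i
    using cINF_less_iff[OF Qne bI, of "Inf (I ` Q) + 1 / real (Suc i)"] by simp
  then obtain c where cQ: "\<And>i. c i \<in> Q" and cI: "\<And>i. I (c i) < Inf (I ` Q) + 1 / real (Suc i)"
    by metis
  \<comment> \<open>Decoding pairs merges the countably many near-minimising sequences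
    \<open>c i\<close> into one. Its infimum lies below each of theirs, so it attains the infimum of
    \<open>I\<close>.\<close>
  define f where "f p = c (fst (prod_decode p)) (snd (prod_decode p))" for p
  have fQ: "f \<in> Q" using cQ by (auto simp: f_def Q_def)
  have If: "I f \<le> I h" if "h \<in> Q" for h
  proof -
    have "I f \<le> I (c i)" for i unfolding I_def
    proof (rule integral_mono[OF int[OF fQ] int[OF cQ]])
      fix x
      have "s f x \<le> s (c i) x"
        by (rule s_ge) (use s_le[of f x "prod_encode (i, _)"] in \<open>simp add: f_def\<close>)
      then show "arctan (s f x) \<le> arctan (s (c i) x)" by (rule arctan_monotone')
    qed
    then have *: "I f \<le> Inf (I ` Q) + 1 / real (Suc i)" for i using cI[of i] order_trans less_imp_le by blast
    have "I f \<le> Inf (I ` Q)"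
      by (rule LIMSEQ_le_const[OF _ exI[of _ 0]])
        (use * tendsto_add[OF tendsto_const LIMSEQ_Suc[OF lim_1_over_n], of "Inf (I ` Q)"] in auto)
    then show ?thesis using cINF_lower[OF bI that] by simp
  qed
  show thesis
  proof (rule that[of "s f" f])
    show "s f \<in> borel_measurable n" by (rule sm[OF fQ])
    show "f k \<in> S" for k using fQ by (simp add: Q_def)
    show "s f x = (INF k. max (l x) (f k x))" for x by (simp add: s_def)
  next
    fix g assume g: "g \<in> S"
    \<comment> \<open>Putting \<open>g\<close> in front of the sequence can only lower the infimum,
      yet the integral was already minimal; so both infima agree a.e., and the new one is at most
      \<open>g\<close>.\<close>
    define h where "h = case_nat g f"
    have hQ: "h \<in> Q" using g fQ by (auto simp: h_def Q_def split: nat.split)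
    have hf: "s h x \<le> s f x" for x
      by (rule s_ge) (use s_le[of h x "Suc _"] in \<open>simp add: h_def\<close>)
    have "(\<integral>x. arctan (s f x) - arctan (s h x) \<partial>n') = 0"
    proof (rule antisym)
      show "(\<integral>x. arctan (s f x) - arctan (s h x) \<partial>n') \<le> 0"
        using If[OF hQ] int[OF fQ] int[OF hQ] by (simp add: I_def)
      show "0 \<le> (\<integral>x. arctan (s f x) - arctan (s h x) \<partial>n')"
        using hf by (intro Bochner_Integration.integral_nonneg) (simp add: arctan_monotone')
    qed
    then have "AE x in n'. arctan (s f x) - arctan (s h x) = 0"
      using hf int[OF fQ] int[OF hQ]
      by (subst (asm) integral_nonneg_eq_0_iff_AE) (auto simp: arctan_monotone')
    then have "AE x in n. arctan (s f x) - arctan (s h x) = 0"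
      unfolding n'_def AE_finite_equiv[OF sf] .
    with lS[OF g] show "AE x in n. s f x \<le> g x"
    proof eventually_elim
      case (elim x)
      then have "s f x = s h x" by (simp add: arctan_eq_iff)
      also have "\<dots> \<le> max (l x) (h 0 x)" by (rule s_le)
      finally show ?case using elim(1) by (simp add: h_def)
    qed
  next
    fix t assume t: "\<And>g. g \<in> S \<Longrightarrow> AE x in n. t x \<le> g x"
    have "AE x in n. \<forall>k. t x \<le> f k x" using fQ t by (auto simp: AE_all_countable Q_def)
    then show "AE x in n. t x \<le> s f x" by eventually_elim (rule s_ge, simp add: le_max_iff_disj)
  qed
qed

lemma essential_infimum_ex:
  fixes S :: "('z \<Rightarrow> real) set"
  assumes "sigma_finite_measure n" "S \<noteq> {}" "S \<subseteq> borel_measurable n"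
    and "l \<in> borel_measurable n" "\<And>f. f \<in> S \<Longrightarrow> AE x in n. l x \<le> f x"
  shows "\<exists>s\<in>borel_measurable n. (\<forall>g\<in>S. AE x in n. s x \<le> g x) \<and>
    (\<forall>t. (\<forall>g\<in>S. AE x in n. t x \<le> g x) \<longrightarrow> (AE x in n. t x \<le> s x))"
proof (rule essential_infimum[OF assms])
  fix s f
  assume s: "s \<in> borel_measurable n" "\<And>g. g \<in> S \<Longrightarrow> AE x in n. s x \<le> g x"
    "\<And>t. (\<And>g. g \<in> S \<Longrightarrow> AE x in n. t x \<le> g x) \<Longrightarrow> AE x in n. t x \<le> s x"
  show ?thesis
  proof (intro bexI[OF _ s(1)] conjI ballI allI impI)
    show "AE x in n. s x \<le> g x" if "g \<in> S" for g by (rule s(2)[OF that])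
    show "AE x in n. t x \<le> s x" if "\<forall>g\<in>S. AE x in n. t x \<le> g x" for t by (rule s(3)) (use that in blast)
  qed
qed auto

text \<open>The essential supremum is the essential infimum of the upper bounds of \<open>S\<close>:
  \<open>b\<close> shows that there are some, and any member of \<open>S\<close> bounds them from
  below.\<close>

lemma L0_esssup_props:
  assumes sf: "sigma_finite_measure n" and ne: "S \<noteq> {}" and S: "S \<subseteq> carrier (L0 n)"
    and b: "b \<in> borel_measurable n" "\<And>F. F \<in> S \<Longrightarrow> AE x in n. L0_rep F x \<le> b x"
  shows "L0_esssup n S \<in> carrier (L0 n)"
    and "F \<in> S \<Longrightarrow> L0_le n F (L0_esssup n S)"
    and "(\<And>F. F \<in> S \<Longrightarrow> AE x in n. L0_rep F x \<le> c x) \<Longrightarrow> c \<in> borel_measurable n \<Longrightarrow>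
      AE x in n. L0_rep (L0_esssup n S) x \<le> c x"
proof -
  define U where "U = {G \<in> carrier (L0 n). \<forall>F\<in>S. L0_le n F G}"
  have inU: "L0_cls n h \<in> U" if "h \<in> borel_measurable n" "\<And>F. F \<in> S \<Longrightarrow> AE x in n. L0_rep F x \<le> h x" for h
  proof -
    have "L0_le n F (L0_cls n h)" if "F \<in> S" for F
      unfolding L0_le_def using L0_rep_cls[OF \<open>h \<in> _\<close>] \<open>\<And>F. F \<in> S \<Longrightarrow> AE x in n. L0_rep F x \<le> h x\<close>[OF that]
      by eventually_elim simp
    then show ?thesis using that by (auto simp: U_def)
  qed
  obtain F0 where F0: "F0 \<in> S" using ne by blast
  obtain s where s: "s \<in> borel_measurable n" "\<And>g. g \<in> L0_rep ` U \<Longrightarrow> AE x in n. s x \<le> g x"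
    "\<And>t. (\<And>g. g \<in> L0_rep ` U \<Longrightarrow> AE x in n. t x \<le> g x) \<Longrightarrow> AE x in n. t x \<le> s x"
  proof (rule essential_infimum[OF sf, of "L0_rep ` U" "L0_rep F0"])
    show "L0_rep ` U \<noteq> {}" using inU[OF b] by blast
    show "L0_rep ` U \<subseteq> borel_measurable n" using L0_rep_measurable by (auto simp: U_def)
    show "L0_rep F0 \<in> borel_measurable n" using S F0 L0_rep_measurable by blast
    show "\<And>f. f \<in> L0_rep ` U \<Longrightarrow> AE x in n. L0_rep F0 x \<le> f x" using F0 by (auto simp: U_def L0_le_def)
  qed blast
  have sU: "L0_cls n s \<in> U"
    by (rule inU[OF s(1)], rule s(3)) (auto simp: U_def L0_le_def)
  have "L0_le n (L0_cls n s) G" if "G \<in> U" for G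
    unfolding L0_le_def using L0_rep_cls[OF s(1)] s(2)[OF imageI[OF that]] by eventually_elim simp
  note least2 = this
  have "L0_least n U = L0_cls n s" by (rule L0_least_eqI[OF _ sU least2]) (auto simp: U_def)
  then have least: "L0_esssup n S = L0_cls n s" unfolding L0_esssup_def U_def .
  show "L0_esssup n S \<in> carrier (L0 n)" "F \<in> S \<Longrightarrow> L0_le n F (L0_esssup n S)"
    using sU by (auto simp: least U_def)
  assume c: "\<And>F. F \<in> S \<Longrightarrow> AE x in n. L0_rep F x \<le> c x" "c \<in> borel_measurable n"
  have "L0_le n (L0_esssup n S) (L0_cls n c)" unfolding least by (rule least2[OF inU[OF c(2,1)]])
  then show "AE x in n. L0_rep (L0_esssup n S) x \<le> c x"
    unfolding L0_le_def using L0_rep_cls[OF c(2)] by eventually_elim simp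
qed

section \<open>The asymptotic Lipschitz constant\<close>

text \<open>For locally Lipschitz functions \<open>lip_a f x\<close> is the infimum of these
  constants (\<open>lip_a_less_iff\<close>); all estimates are made with them rather than with the
  limsup in the extended reals.\<close>

definition lip_near :: "('z::metric_space \<Rightarrow> real) \<Rightarrow> 'z \<Rightarrow> real \<Rightarrow> bool" where
  "lip_near f x c \<longleftrightarrow> (\<exists>r>0. c-lipschitz_on (ball x r) f)"

lemma lip_near_nonneg: "lip_near f x c \<Longrightarrow> 0 \<le> c"
  by (auto simp: lip_near_def dest: lipschitz_on_nonneg)

lemma lip_near_mono: "lip_near f x c \<Longrightarrow> c \<le> d \<Longrightarrow> lip_near f x d"
  unfolding lip_near_def by (blast intro: lipschitz_on_mono)

lemma lip_nearI:
  assumes "r > 0" "0 \<le> c"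
    "\<And>y z. dist x y < r \<Longrightarrow> dist x z < r \<Longrightarrow> \<bar>f y - f z\<bar> \<le> c * dist y z"
  shows "lip_near f x c"
  unfolding lip_near_def using assms by (intro exI[of _ r]) (auto intro!: lipschitz_onI simp: dist_real_def)

lemma lip_nearE:
  assumes "lip_near f x c"
  obtains r where "r > 0"
    "\<And>y z. dist x y < r \<Longrightarrow> dist x z < r \<Longrightarrow> \<bar>f y - f z\<bar> \<le> c * dist y z"
proof -
  obtain r where "r > 0" and r: "c-lipschitz_on (ball x r) f" using assms unfolding lip_near_def by blast
  show thesis by (rule that[OF \<open>r > 0\<close>]) (use lipschitz_onD[OF r] in \<open>simp add: dist_real_def\<close>)
qed

lemma LIP_bd_lip_near:
  assumes "f \<in> LIP_bd" shows "\<exists>c. lip_near f x c"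
proof -
  obtain L where "L-lipschitz_on (ball x 1) f" using assms bounded_ball[of x 1] unfolding LIP_bd_def by blast
  then show ?thesis unfolding lip_near_def by (intro exI[of _ L] exI[of _ 1]) simp
qed

lemma LIP_bd_continuous:
  fixes f :: "'z::metric_space \<Rightarrow> real"
  assumes "f \<in> LIP_bd" shows "continuous_on UNIV f"
  unfolding continuous_on_eq_continuous_at[OF open_UNIV]
proof
  fix x :: 'z
  obtain L where "L-lipschitz_on (ball x 1) f" using assms bounded_ball[of x 1] unfolding LIP_bd_def by blast
  from lipschitz_on_continuous_on[OF this] show "isCont f x"
    by (simp add: continuous_on_eq_continuous_at)
qed

lemma LIP_bd_measurable: "f \<in> LIP_bd \<Longrightarrow> sets n = sets borel \<Longrightarrow> f \<in> borel_measurable n"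
  using borel_measurable_continuous_onI[OF LIP_bd_continuous] measurable_cong_sets by blast

text \<open>Translates the filter of the limsup in \<open>lip_a\<close> into balls, to make it
  comparable with \<open>lip_near\<close>.\<close>

lemma eventually_pairs_iff:
  fixes x :: "'z::metric_space"
  shows "eventually P (inf (nhds x \<times>\<^sub>F nhds x) (principal {(y, z). y \<noteq> z})) \<longleftrightarrow>
    (\<exists>r>0. \<forall>y z. dist x y < r \<longrightarrow> dist x z < r \<longrightarrow> y \<noteq> z \<longrightarrow> P (y, z))"
proof -
  have "eventually P (inf (nhds x \<times>\<^sub>F nhds x) (principal {(y, z). y \<noteq> z})) \<longleftrightarrow>
    (\<exists>Q. eventually Q (nhds x) \<and> (\<forall>y z. Q y \<longrightarrow> Q z \<longrightarrow> y \<noteq> z \<longrightarrow> P (y, z)))"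
    by (simp add: eventually_inf_principal eventually_prod_same)
  also have "\<dots> \<longleftrightarrow> (\<exists>r>0. \<forall>y z. dist x y < r \<longrightarrow> dist x z < r \<longrightarrow> y \<noteq> z \<longrightarrow> P (y, z))"
  proof safe
    fix Q assume "eventually Q (nhds x)" "\<forall>y z. Q y \<longrightarrow> Q z \<longrightarrow> y \<noteq> z \<longrightarrow> P (y, z)"
    then show "\<exists>r>0. \<forall>y z. dist x y < r \<longrightarrow> dist x z < r \<longrightarrow> y \<noteq> z \<longrightarrow> P (y, z)"
      unfolding eventually_nhds_metric by (fastforce simp: dist_commute)
  next
    fix r :: real assume "r > 0" "\<forall>y z. dist x y < r \<longrightarrow> dist x z < r \<longrightarrow> y \<noteq> z \<longrightarrow> P (y, z)"
    then show "\<exists>Q. eventually Q (nhds x) \<and> (\<forall>y z. Q y \<longrightarrow> Q z \<longrightarrow> y \<noteq> z \<longrightarrow> P (y, z))"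
      by (intro exI[of _ "\<lambda>y. dist x y < r"]) (auto simp: eventually_nhds_metric dist_commute)
  qed
  finally show ?thesis .
qed

text \<open>A limsup strictly below \<open>c\<close> lies below some smaller \<open>c'\<close>,
  which then eventually bounds the difference quotients. At an isolated point a small ball is a
  single point, so the constant 0 is admissible, in accordance with the default value of
  \<open>lip_a\<close>.\<close>

lemma lip_a_less_iff:
  fixes f :: "'z::metric_space \<Rightarrow> real"
  assumes f: "f \<in> LIP_bd"
  shows "lip_a f x < c \<longleftrightarrow> (\<exists>c'<c. lip_near f x c')"
proof (cases "x islimpt UNIV")
  case False
  then obtain r where r: "r > 0" "\<And>y. dist x y < r \<Longrightarrow> y = x"
    unfolding islimpt_approachable by (auto simp: dist_commute)
  then have "lip_near f x 0" by (intro lip_nearI[of r]) auto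
  then show ?thesis using False by (auto simp: lip_a_def dest: lip_near_nonneg)
next
  case True
  define F where "F = inf (nhds x \<times>\<^sub>F nhds x) (principal {(y, z). y \<noteq> z})"
  define Q where "Q = (\<lambda>(y, z). ennreal (\<bar>f y - f z\<bar> / dist y z))"
  have eq: "lip_a f x = enn2real (Limsup F Q)" using True by (simp add: lip_a_def F_def Q_def)
  have le: "Limsup F Q \<le> ennreal c'" if "lip_near f x c'" for c'
  proof (rule Limsup_bounded)
    from that obtain r where "r > 0" "\<And>y z. dist x y < r \<Longrightarrow> dist x z < r \<Longrightarrow> \<bar>f y - f z\<bar> \<le> c' * dist y z"
      by (rule lip_nearE) blast
    then show "\<forall>\<^sub>F p in F. Q p \<le> ennreal c'"
      unfolding F_def eventually_pairs_iff Q_def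
      by (intro exI[of _ r]) (auto intro!: ennreal_leI simp: divide_le_eq)
  qed
  obtain c0 where c0: "lip_near f x c0" using LIP_bd_lip_near[OF f] by blast
  \<comment> \<open>Finiteness is essential here, since \<open>enn2real\<close> would send an
    infinite limsup to 0.\<close>
  have fin: "Limsup F Q < \<infinity>" by (rule le_less_trans[OF le[OF c0]]) simp
  show ?thesis
  proof
    assume lt: "lip_a f x < c"
    define c' where "c' = (lip_a f x + c) / 2"
    have c': "lip_a f x < c'" "c' < c" "0 \<le> lip_a f x" using lt by (auto simp: c'_def eq)
    have "Limsup F Q = ennreal (lip_a f x)" using fin by (simp add: eq)
    then have "Limsup F Q < ennreal c'" using c' by (simp add: ennreal_lessI)
    then have "\<forall>\<^sub>F p in F. Q p < ennreal c'" by (rule Limsup_lessD)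
    then obtain r where r: "r > 0"
      "\<And>y z. dist x y < r \<Longrightarrow> dist x z < r \<Longrightarrow> y \<noteq> z \<Longrightarrow> ennreal (\<bar>f y - f z\<bar> / dist y z) < ennreal c'"
      unfolding F_def eventually_pairs_iff Q_def by auto
    have "\<bar>f y - f z\<bar> \<le> c' * dist y z" if "dist x y < r" "dist x z < r" for y z
    proof (cases "y = z")
      case False
      then have "\<bar>f y - f z\<bar> / dist y z < c'" using r(2)[OF that False] by (simp add: ennreal_less_iff)
      then show ?thesis using False by (simp add: divide_less_eq less_imp_le)
    qed simp
    then have "lip_near f x c'" using r(1) c' by (intro lip_nearI[of r]) auto
    then show "\<exists>c'<c. lip_near f x c'" using c'(2) by blast
  next
    assume "\<exists>c'<c. lip_near f x c'"
    then obtain c' where c': "c' < c" "lip_near f x c'" by blast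
    have "lip_a f x \<le> c'" unfolding eq
      using enn2real_mono[OF le[OF c'(2)]] lip_near_nonneg[OF c'(2)] by simp
    then show "lip_a f x < c" using c' by simp
  qed
qed

lemma lip_a_nonneg: "0 \<le> lip_a f x"
  by (simp add: lip_a_def)

lemma lip_near_lip_a: "f \<in> LIP_bd \<Longrightarrow> e > 0 \<Longrightarrow> lip_near f x (lip_a f x + e)"
  using lip_a_less_iff[of f x "lip_a f x + e"] by (auto elim: lip_near_mono)

lemma lip_a_leI:
  assumes "f \<in> LIP_bd" "\<And>e. e > 0 \<Longrightarrow> lip_near f x (c + e)" shows "lip_a f x \<le> c"
proof (rule ccontr)
  assume "\<not> lip_a f x \<le> c"
  then have "(lip_a f x - c) / 2 > 0" "c + (lip_a f x - c) / 2 < lip_a f x" by (simp_all add: field_simps)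
  then show False using assms(2)[of "(lip_a f x - c) / 2"] lip_a_less_iff[OF assms(1), of x "lip_a f x"] by blast
qed

text \<open>\<open>lip_a f\<close> is upper semicontinuous: a Lipschitz constant valid on a ball is
  valid on smaller balls around all points of that ball, so strict sublevel sets are open.\<close>

lemma lip_a_measurable [measurable (raw)]:
  fixes f :: "'z::metric_space \<Rightarrow> real"
  assumes f: "f \<in> LIP_bd"
  shows "lip_a f \<in> borel_measurable borel"
proof (rule borel_measurableI_less)
  fix c :: real
  have "open {x. lip_a f x < c}"
    unfolding open_dist
  proof safe
    fix x assume "lip_a f x < c"
    then obtain c' where c': "c' < c" "lip_near f x c'" using lip_a_less_iff[OF f] by blast
    then obtain r where r: "r > 0" "c'-lipschitz_on (ball x r) f" by (auto simp: lip_near_def)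
    have "lip_a f y < c" if "dist y x < r" for y
    proof -
      have "ball y (r - dist x y) \<subseteq> ball x r"
      proof
        show "z \<in> ball x r" if "z \<in> ball y (r - dist x y)" for z using dist_triangle[of x z y] that by simp
      qed
      then have "lip_near f y c'"
        unfolding lip_near_def using that r(2)
        by (intro exI[of _ "r - dist x y"]) (auto simp: dist_commute intro: lipschitz_on_subset)
      then show ?thesis using lip_a_less_iff[OF f] c'(1) by blast
    qed
    then show "\<exists>e>0. \<forall>y. dist y x < e \<longrightarrow> y \<in> {x. lip_a f x < c}" using r(1) by auto
  qed
  then show "{x \<in> space borel. lip_a f x < c} \<in> sets borel" by simp
qed

lemma LIP_bdI:
  assumes "\<And>B. bounded B \<Longrightarrow> B \<noteq> {} \<Longrightarrow> \<exists>L. L-lipschitz_on B f" shows "f \<in> LIP_bd"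
proof -
  have "\<exists>L. L-lipschitz_on B f" if "bounded B" for B
    using assms[OF that] by (cases "B = {}") (auto intro: exI[of _ 0])
  then show ?thesis by (simp add: LIP_bd_def)
qed

lemma LIP_subset_LIP_bd: "LIP \<subseteq> LIP_bd"
  unfolding LIP_def LIP_bd_def by (blast intro: lipschitz_on_subset)

lemma lipschitz_LIP_bd: "L-lipschitz_on UNIV f \<Longrightarrow> f \<in> LIP_bd"
  using LIP_subset_LIP_bd by (auto simp: LIP_def)

lemma LIP_bd_const: "(\<lambda>_. c) \<in> LIP_bd"
  by (rule lipschitz_LIP_bd[OF lipschitz_on_constant])

lemma LIP_bd_add: "f \<in> LIP_bd \<Longrightarrow> g \<in> LIP_bd \<Longrightarrow> (\<lambda>x. f x + g x) \<in> LIP_bd"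
  unfolding LIP_bd_def using lipschitz_on_add[of _ _ f _ g] by blast

lemma LIP_bd_cmult: "f \<in> LIP_bd \<Longrightarrow> (\<lambda>x. c * f x) \<in> LIP_bd"
  unfolding LIP_bd_def using lipschitz_on_cmult_real[of _ _ f c] by blast

lemma LIP_bd_compose:
  "f \<in> LIP_bd \<Longrightarrow> L-lipschitz_on UNIV \<phi> \<Longrightarrow> (\<lambda>x. \<phi> (f x)) \<in> LIP_bd"
  unfolding LIP_bd_def using lipschitz_on_compose2[of _ _ f L \<phi>] lipschitz_on_subset[of L UNIV \<phi>] by blast

text \<open>On a bounded set both factors are bounded as well as Lipschitz, and the product rule
  gives a constant there. Globally Lipschitz functions would not be closed under products.\<close>

lemma LIP_bd_mult:
  fixes f g :: "'z::metric_space \<Rightarrow> real"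
  assumes f: "f \<in> LIP_bd" and g: "g \<in> LIP_bd"
  shows "(\<lambda>x. f x * g x) \<in> LIP_bd"
proof (rule LIP_bdI)
  fix B :: "'z set" assume B: "bounded B" "B \<noteq> {}"
  have bd: "\<exists>L C. L-lipschitz_on B h \<and> 0 \<le> C \<and> (\<forall>x\<in>B. \<bar>h x\<bar> \<le> C)" if h: "h \<in> LIP_bd" for h :: "'z \<Rightarrow> real"
  proof -
    obtain L where L: "L-lipschitz_on B h" using h B(1) unfolding LIP_bd_def by blast
    obtain x0 where x0: "x0 \<in> B" using B(2) by blast
    obtain e where e: "\<And>y. y \<in> B \<Longrightarrow> dist x0 y \<le> e" using B(1) bounded_any_center[of B x0] by blast
    define C where "C = \<bar>h x0\<bar> + L * e"
    have "\<bar>h y\<bar> \<le> C" if "y \<in> B" for y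
    proof -
      have "\<bar>h x0 - h y\<bar> \<le> L * dist x0 y" using lipschitz_onD[OF L x0 that] by (simp add: dist_real_def)
      also have "\<dots> \<le> L * e" using e[OF that] lipschitz_on_nonneg[OF L] by (rule mult_left_mono)
      finally show ?thesis by (simp add: C_def abs_if split: if_splits)
    qed
    moreover from this[OF x0] have "0 \<le> C" by linarith
    ultimately show ?thesis using L by blast
  qed
  obtain L C where "L-lipschitz_on B f" "0 \<le> C" "\<forall>x\<in>B. \<bar>f x\<bar> \<le> C" using bd[OF f] by (elim exE conjE)
  moreover obtain L' C' where "L'-lipschitz_on B g" "0 \<le> C'" "\<forall>x\<in>B. \<bar>g x\<bar> \<le> C'" using bd[OF g] by (elim exE conjE)
  ultimately have L: "L-lipschitz_on B f" "0 \<le> C" "\<And>x. x \<in> B \<Longrightarrow> \<bar>f x\<bar> \<le> C"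
    "L'-lipschitz_on B g" "0 \<le> C'" "\<And>x. x \<in> B \<Longrightarrow> \<bar>g x\<bar> \<le> C'" by auto
  note nn = lipschitz_on_nonneg[OF L(1)] lipschitz_on_nonneg[OF L(4)]
  have "(C * L' + C' * L)-lipschitz_on B (\<lambda>x. f x * g x)"
  proof (rule lipschitz_onI)
    fix x y assume xy: "x \<in> B" "y \<in> B"
    have "\<bar>f x * g x - f y * g y\<bar> = \<bar>f x * (g x - g y) + g y * (f x - f y)\<bar>" by (simp add: algebra_simps)
    also have "\<dots> \<le> \<bar>f x\<bar> * \<bar>g x - g y\<bar> + \<bar>g y\<bar> * \<bar>f x - f y\<bar>"
      unfolding abs_mult[symmetric] by (rule abs_triangle_ineq)
    also have "\<dots> \<le> C * (L' * dist x y) + C' * (L * dist x y)"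
      using lipschitz_onD[OF L(1) xy] lipschitz_onD[OF L(4) xy] xy L nn
      by (intro add_mono mult_mono) (auto simp: dist_real_def)
    finally show "dist (f x * g x) (f y * g y) \<le> (C * L' + C' * L) * dist x y"
      by (simp add: dist_real_def algebra_simps)
  qed (use L nn in auto)
  then show "\<exists>L. L-lipschitz_on B (\<lambda>x. f x * g x)" by blast
qed

lemma lipschitz_on_max_min:
  fixes f g :: "'z::metric_space \<Rightarrow> real"
  assumes "c-lipschitz_on B f" "c-lipschitz_on B g"
  shows "c-lipschitz_on B (\<lambda>x. max (f x) (g x))" "c-lipschitz_on B (\<lambda>x. min (f x) (g x))"
proof -
  have *: "\<bar>max a b - max a' b'\<bar> \<le> C" "\<bar>min a b - min a' b'\<bar> \<le> C"
    if "\<bar>a - a'\<bar> \<le> C" "\<bar>b - b'\<bar> \<le> C" for a b a' b' C :: real using that by linarith+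
  show "c-lipschitz_on B (\<lambda>x. max (f x) (g x))" "c-lipschitz_on B (\<lambda>x. min (f x) (g x))"
    using lipschitz_onD[OF assms(1)] lipschitz_onD[OF assms(2)]
    unfolding dist_real_def
    by (intro lipschitz_onI lipschitz_on_nonneg[OF assms(1)]; simp only: dist_real_def; intro *; blast)+
qed

lemma LIP_bd_max: "f \<in> LIP_bd \<Longrightarrow> g \<in> LIP_bd \<Longrightarrow> (\<lambda>x. max (f x) (g x)) \<in> LIP_bd"
  and LIP_bd_min: "f \<in> LIP_bd \<Longrightarrow> g \<in> LIP_bd \<Longrightarrow> (\<lambda>x. min (f x) (g x)) \<in> LIP_bd"
proof -
  assume fg: "f \<in> LIP_bd" "g \<in> LIP_bd"
  have *: "\<exists>L. L-lipschitz_on B f \<and> L-lipschitz_on B g" if B: "bounded B" for B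
  proof -
    obtain L L' where "L-lipschitz_on B f" "L'-lipschitz_on B g"
      using fg[unfolded LIP_bd_def, simplified, rule_format, OF B] by (elim exE)
    then have "(max L L')-lipschitz_on B f \<and> (max L L')-lipschitz_on B g"
      using lipschitz_on_mono[of L B f B "max L L'"] lipschitz_on_mono[of L' B g B "max L L'"] by simp
    then show ?thesis by blast
  qed
  show "(\<lambda>x. max (f x) (g x)) \<in> LIP_bd"
  proof (rule LIP_bdI)
    fix B :: "'a set" assume "bounded B"
    from *[OF this] obtain L where "L-lipschitz_on B f" "L-lipschitz_on B g" by (elim exE conjE)
    from lipschitz_on_max_min(1)[OF this] show "\<exists>L. L-lipschitz_on B (\<lambda>x. max (f x) (g x))" by (rule exI)
  qed
  show "(\<lambda>x. min (f x) (g x)) \<in> LIP_bd"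
  proof (rule LIP_bdI)
    fix B :: "'a set" assume "bounded B"
    from *[OF this] obtain L where "L-lipschitz_on B f" "L-lipschitz_on B g" by (elim exE conjE)
    from lipschitz_on_max_min(2)[OF this] show "\<exists>L. L-lipschitz_on B (\<lambda>x. min (f x) (g x))" by (rule exI)
  qed
qed

lemma lip_a_add:
  assumes f: "f \<in> LIP_bd" and g: "g \<in> LIP_bd"
  shows "lip_a (\<lambda>x. f x + g x) x \<le> lip_a f x + lip_a g x"
proof (rule lip_a_leI[OF LIP_bd_add[OF f g]])
  fix e :: real assume "e > 0"
  then obtain r s where "r > 0" "(lip_a f x + e/2)-lipschitz_on (ball x r) f"
    "s > 0" "(lip_a g x + e/2)-lipschitz_on (ball x s) g"
    using lip_near_lip_a[OF f, of "e/2" x] lip_near_lip_a[OF g, of "e/2" x] by (auto simp: lip_near_def)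
  then have "(lip_a f x + e/2 + (lip_a g x + e/2))-lipschitz_on (ball x (min r s)) (\<lambda>x. f x + g x)"
    by (intro lipschitz_on_add) (auto intro: lipschitz_on_subset)
  then show "lip_near (\<lambda>x. f x + g x) x (lip_a f x + lip_a g x + e)"
    unfolding lip_near_def using \<open>r > 0\<close> \<open>s > 0\<close> by (intro exI[of _ "min r s"]) (auto simp: algebra_simps)
qed

text \<open>The factor \<open>k\<close> bounds the local Lipschitz constant of \<open>\<phi>\<close>
  at the single value \<open>f x\<close>. This pointwise form is what later produces the factors
  1/(1 + t^2) for arctan and 1 + t^2 for tan.\<close>

lemma lip_a_compose:
  assumes f: "f \<in> LIP_bd" and \<phi>: "L-lipschitz_on UNIV \<phi>" and k: "\<And>e. e > 0 \<Longrightarrow> lip_near \<phi> (f x) (k + e)" "0 \<le> k"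
  shows "lip_a (\<lambda>x. \<phi> (f x)) x \<le> k * lip_a f x"
proof (rule lip_a_leI[OF LIP_bd_compose[OF f \<phi>]])
  fix e :: real assume e: "e > 0"
  define a where "a = lip_a f x"
  \<comment> \<open>With \<open>d\<close> at most 1, the excess of \<open>(k + d) * (a + d)\<close>
    over \<open>k * a\<close> is at most \<open>d * (k + a + 1)\<close>, hence at most
    \<open>e\<close>.\<close>
  define d where "d = min 1 (e / (k + a + 1))"
  have a: "0 \<le> a" by (simp add: a_def lip_a_nonneg)
  then have d: "d > 0" using e k by (simp add: d_def)
  obtain r where r: "r > 0" "\<And>y z. dist x y < r \<Longrightarrow> dist x z < r \<Longrightarrow> \<bar>f y - f z\<bar> \<le> (a + d) * dist y z"
    using lip_near_lip_a[OF f d, of x, folded a_def] by (rule lip_nearE) blast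
  obtain s where s: "s > 0" "\<And>y z. dist (f x) y < s \<Longrightarrow> dist (f x) z < s \<Longrightarrow> \<bar>\<phi> y - \<phi> z\<bar> \<le> (k + d) * dist y z"
    using k(1)[OF d] by (rule lip_nearE) blast
  \<comment> \<open>The second bound on the radius makes \<open>f\<close> map the ball into the ball
    of radius \<open>s\<close> around \<open>f x\<close>, where the estimate for
    \<open>\<phi>\<close> holds.\<close>
  define t where "t = min r (s / (a + d))"
  have t: "t > 0" using r s a d by (simp add: t_def)
  have "(k + d) * (a + d) \<le> k * a + e"
  proof -
    have "(k + d) * (a + d) = k * a + d * (k + a + d)" by (simp add: algebra_simps)
    also have "d * (k + a + d) \<le> e / (k + a + 1) * (k + a + 1)"
      using a k d e by (intro mult_mono) (auto simp: d_def)
    also have "\<dots> = e" using a k by simp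
    finally show ?thesis by simp
  qed
  moreover have "lip_near (\<lambda>x. \<phi> (f x)) x ((k + d) * (a + d))"
  proof (rule lip_nearI[OF t])
    show "0 \<le> (k + d) * (a + d)" using a k d by simp
    fix y z assume y: "dist x y < t" and z: "dist x z < t"
    have in_s: "dist (f x) (f w) < s" if "dist x w < t" for w
    proof -
      have "\<bar>f x - f w\<bar> \<le> (a + d) * dist x w" using r that by (simp add: t_def)
      also have "\<dots> < (a + d) * (s / (a + d))" using that a d by (intro mult_strict_left_mono) (auto simp: t_def)
      also have "\<dots> = s" using a d by simp
      finally show ?thesis by (simp add: dist_real_def)
    qed
    have "\<bar>\<phi> (f y) - \<phi> (f z)\<bar> \<le> (k + d) * \<bar>f y - f z\<bar>"
      using s(2)[OF in_s[OF y] in_s[OF z]] by (simp add: dist_real_def)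
    also have "\<dots> \<le> (k + d) * ((a + d) * dist y z)" using r(2)[of y z] y z k d by (intro mult_left_mono) (auto simp: t_def)
    finally show "\<bar>\<phi> (f y) - \<phi> (f z)\<bar> \<le> (k + d) * (a + d) * dist y z" by (simp add: mult.assoc)
  qed
  ultimately show "lip_near (\<lambda>x. \<phi> (f x)) x (k * lip_a f x + e)"
    unfolding a_def using lip_near_mono by blast
qed

lemma lip_a_cmult:
  assumes "f \<in> LIP_bd" shows "lip_a (\<lambda>x. c * f x) x \<le> \<bar>c\<bar> * lip_a f x"
proof (rule lip_a_compose[OF assms])
  show L: "\<bar>c\<bar>-lipschitz_on UNIV (\<lambda>x. c * x)"
    by (intro lipschitz_onI) (auto simp: dist_real_def abs_mult simp flip: right_diff_distrib)
  show "lip_near (\<lambda>x. c * x) (f x) (\<bar>c\<bar> + e)" if "e > 0" for e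
    unfolding lip_near_def by (intro exI[of _ 1] conjI lipschitz_on_mono[OF L]) (use that in auto)
qed simp

lemma lip_a_le_lipschitz:
  assumes "L-lipschitz_on UNIV f" shows "lip_a f x \<le> L"
proof (rule lip_a_leI[OF lipschitz_LIP_bd[OF assms]])
  show "lip_near f x (L + e)" if "e > 0" for e
    unfolding lip_near_def by (intro exI[of _ 1] conjI lipschitz_on_mono[OF assms]) (use that in auto)
qed

lemma lip_a_local:
  assumes f: "f \<in> LIP_bd" and g: "g \<in> LIP_bd" and r: "r > 0" and eq: "\<And>y. dist x y < r \<Longrightarrow> f y = g y"
  shows "lip_a f x \<le> lip_a g x"
proof (rule lip_a_leI[OF f])
  fix e :: real assume "e > 0"
  then obtain s where "s > 0" "\<And>y z. dist x y < s \<Longrightarrow> dist x z < s \<Longrightarrow> \<bar>g y - g z\<bar> \<le> (lip_a g x + e) * dist y z"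
    using lip_near_lip_a[OF g, of e x] by (auto elim: lip_nearE)
  then show "lip_near f x (lip_a g x + e)"
    using r eq \<open>e > 0\<close> lip_a_nonneg[of g x] by (intro lip_nearI[of "min r s"]) auto
qed

lemma lip_a_max_min:
  fixes f g :: "'z::metric_space \<Rightarrow> real"
  assumes f: "f \<in> LIP_bd" and g: "g \<in> LIP_bd"
  shows "lip_a (\<lambda>x. max (f x) (g x)) x \<le> max (lip_a f x) (lip_a g x)"
    and "lip_a (\<lambda>x. min (f x) (g x)) x \<le> max (lip_a f x) (lip_a g x)"
proof -
  have "lip_near (\<lambda>x. max (f x) (g x)) x (max (lip_a f x) (lip_a g x) + e) \<and>
    lip_near (\<lambda>x. min (f x) (g x)) x (max (lip_a f x) (lip_a g x) + e)" if "e > 0" for e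
  proof -
    have "lip_near f x (max (lip_a f x) (lip_a g x) + e)" "lip_near g x (max (lip_a f x) (lip_a g x) + e)"
      by (rule lip_near_mono[OF lip_near_lip_a[OF f that]] lip_near_mono[OF lip_near_lip_a[OF g that]], simp)+
    then obtain r s where "r > 0" "(max (lip_a f x) (lip_a g x) + e)-lipschitz_on (ball x r) f"
      "s > 0" "(max (lip_a f x) (lip_a g x) + e)-lipschitz_on (ball x s) g" by (auto simp: lip_near_def)
    then have "(max (lip_a f x) (lip_a g x) + e)-lipschitz_on (ball x (min r s)) f"
      "(max (lip_a f x) (lip_a g x) + e)-lipschitz_on (ball x (min r s)) g" by (auto intro: lipschitz_on_subset)
    from lipschitz_on_max_min[OF this] show ?thesis
      unfolding lip_near_def using \<open>r > 0\<close> \<open>s > 0\<close> by (intro conjI exI[of _ "min r s"]) simp_all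
  qed
  then show "lip_a (\<lambda>x. max (f x) (g x)) x \<le> max (lip_a f x) (lip_a g x)"
    "lip_a (\<lambda>x. min (f x) (g x)) x \<le> max (lip_a f x) (lip_a g x)"
    using lip_a_leI[OF LIP_bd_max[OF f g]] lip_a_leI[OF LIP_bd_min[OF f g]] by blast+
qed

text \<open>A Leibniz rule in which the slope of the cut-off multiplies only the difference
  \<open>f - g\<close>. When \<open>f\<close> and \<open>g\<close> approximate the same function
  this difference can be made small, so cutting off costs nothing in the limit.\<close>

lemma lip_a_interpolate:
  fixes f g \<eta> :: "'z::metric_space \<Rightarrow> real"
  assumes f: "f \<in> LIP_bd" and g: "g \<in> LIP_bd" and \<eta>: "L-lipschitz_on UNIV \<eta>" "\<And>y. 0 \<le> \<eta> y" "\<And>y. \<eta> y \<le> 1"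
    and d: "\<And>y. \<bar>f y - g y\<bar> \<le> \<delta>"
  shows "(\<lambda>x. \<eta> x * f x + (1 - \<eta> x) * g x) \<in> LIP_bd"
    and "lip_a (\<lambda>x. \<eta> x * f x + (1 - \<eta> x) * g x) x \<le> \<eta> x * lip_a f x + (1 - \<eta> x) * lip_a g x + L * \<delta>"
proof -
  have L0: "0 \<le> L" by (rule lipschitz_on_nonneg[OF \<eta>(1)])
  have \<delta>0: "0 \<le> \<delta>" using d[of undefined] by linarith
  have "(\<lambda>x. 1 + (-1) * \<eta> x) \<in> LIP_bd" by (intro LIP_bd_add LIP_bd_const LIP_bd_cmult lipschitz_LIP_bd[OF \<eta>(1)])
  then show bd: "(\<lambda>x. \<eta> x * f x + (1 - \<eta> x) * g x) \<in> LIP_bd"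
    by (intro LIP_bd_add LIP_bd_mult lipschitz_LIP_bd[OF \<eta>(1)] f g) simp_all
  show "lip_a (\<lambda>x. \<eta> x * f x + (1 - \<eta> x) * g x) x \<le> \<eta> x * lip_a f x + (1 - \<eta> x) * lip_a g x + L * \<delta>"
  proof (rule lip_a_leI[OF bd])
    fix e :: real assume e: "e > 0"
    define a b where "a = lip_a f x" and "b = lip_a g x"
    have ab: "0 \<le> a" "0 \<le> b" by (simp_all add: a_def b_def lip_a_nonneg)
    define d' where "d' = e / (1 + a + b)"
    have d': "d' > 0" using e ab by (simp add: d'_def)
    obtain r where r: "r > 0" "\<And>y z. dist x y < r \<Longrightarrow> dist x z < r \<Longrightarrow> \<bar>f y - f z\<bar> \<le> (a + d') * dist y z"
      using lip_near_lip_a[OF f d', of x, folded a_def] by (rule lip_nearE) blast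
    obtain s where s: "s > 0" "\<And>y z. dist x y < s \<Longrightarrow> dist x z < s \<Longrightarrow> \<bar>g y - g z\<bar> \<le> (b + d') * dist y z"
      using lip_near_lip_a[OF g d', of x, folded b_def] by (rule lip_nearE) blast
    define t where "t = min (min r s) (d' / (L + 1))"
    show "lip_near (\<lambda>x. \<eta> x * f x + (1 - \<eta> x) * g x) x (\<eta> x * lip_a f x + (1 - \<eta> x) * lip_a g x + L * \<delta> + e)"
    proof (rule lip_nearI[of t])
      show "t > 0" using r s d' L0 by (simp add: t_def)
      show "0 \<le> \<eta> x * lip_a f x + (1 - \<eta> x) * lip_a g x + L * \<delta> + e"
        using \<eta> lip_a_nonneg[of f x] lip_a_nonneg[of g x] L0 \<delta>0 e by (intro add_nonneg_nonneg mult_nonneg_nonneg) auto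
      fix y z assume y: "dist x y < t" and z: "dist x z < t"
      have \<eta>yx: "\<bar>\<eta> y - \<eta> x\<bar> \<le> d'"
      proof -
        have "\<bar>\<eta> y - \<eta> x\<bar> \<le> L * dist y x" using lipschitz_onD[OF \<eta>(1), of y x] by (simp add: dist_real_def)
        also have "\<dots> \<le> (L + 1) * (d' / (L + 1))" using y L0 d' by (intro mult_mono) (auto simp: t_def dist_commute)
        also have "\<dots> = d'" using L0 by simp
        finally show ?thesis .
      qed
      \<comment> \<open>The increment is split so that the increment of \<open>\<eta>\<close> meets
        \<open>f - g\<close> at one point and the increments of \<open>f\<close> and
        \<open>g\<close> receive convex weights.\<close>
      have "(\<eta> y * f y + (1 - \<eta> y) * g y) - (\<eta> z * f z + (1 - \<eta> z) * g z) =
        \<eta> y * (f y - f z) + (1 - \<eta> y) * (g y - g z) + (\<eta> y - \<eta> z) * (f z - g z)" by (simp add: algebra_simps)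
      also have "\<bar>\<dots>\<bar> \<le> \<eta> y * \<bar>f y - f z\<bar> + (1 - \<eta> y) * \<bar>g y - g z\<bar> + \<bar>\<eta> y - \<eta> z\<bar> * \<bar>f z - g z\<bar>"
        using \<eta>(2,3)[of y] by (intro order_trans[OF abs_triangle_ineq] add_mono) (auto simp: abs_mult)
      also have "\<dots> \<le> \<eta> y * ((a + d') * dist y z) + (1 - \<eta> y) * ((b + d') * dist y z) + (L * dist y z) * \<delta>"
        using \<eta>(2,3)[of y] r(2)[of y z] s(2)[of y z] y z d lipschitz_onD[OF \<eta>(1), of y z] L0
        by (intro add_mono mult_mono) (auto simp: t_def dist_real_def)
      also have "\<dots> = (\<eta> y * a + (1 - \<eta> y) * b + d' + L * \<delta>) * dist y z" by (simp add: algebra_simps)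
      also have "\<dots> \<le> (\<eta> x * a + (1 - \<eta> x) * b + L * \<delta> + e) * dist y z"
      proof (rule mult_right_mono)
        have "\<eta> y * a + (1 - \<eta> y) * b + d' = \<eta> x * a + (1 - \<eta> x) * b + (\<eta> y - \<eta> x) * a + (\<eta> x - \<eta> y) * b + d'"
          by (simp add: algebra_simps)
        also have "(\<eta> y - \<eta> x) * a \<le> d' * a" using \<eta>yx ab by (intro mult_right_mono) auto
        also have "(\<eta> x - \<eta> y) * b \<le> d' * b" using \<eta>yx ab by (intro mult_right_mono) auto
        also have "\<eta> x * a + (1 - \<eta> x) * b + d' * a + d' * b + d' = \<eta> x * a + (1 - \<eta> x) * b + d' * (1 + a + b)"
          by (simp add: algebra_simps)
        also have "d' * (1 + a + b) = e" using ab by (simp add: d'_def)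
        finally show "\<eta> y * a + (1 - \<eta> y) * b + d' + L * \<delta> \<le> \<eta> x * a + (1 - \<eta> x) * b + L * \<delta> + e" by simp
      qed simp
      finally show "\<bar>(\<eta> y * f y + (1 - \<eta> y) * g y) - (\<eta> z * f z + (1 - \<eta> z) * g z)\<bar>
        \<le> (\<eta> x * lip_a f x + (1 - \<eta> x) * lip_a g x + L * \<delta> + e) * dist y z" by (simp add: a_def b_def)
    qed
  qed
qed

text \<open>The lower envelope of the cones \<open>f z + L * dist y z\<close> over \<open>z\<close>
  in \<open>B\<close>. It lets a function be replaced near a point by one whose global constant is
  the local one.\<close>

lemma McShane_extension:
  fixes f :: "'z::metric_space \<Rightarrow> real"
  assumes L: "L-lipschitz_on B f"
  obtains g where "L-lipschitz_on UNIV g" "\<And>x. x \<in> B \<Longrightarrow> g x = f x"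
proof (cases "B = {}")
  case True
  show thesis by (rule that[of "\<lambda>_. 0"]) (use True lipschitz_on_nonneg[OF L] in \<open>auto intro!: lipschitz_onI\<close>)
next
  case False
  have L0: "0 \<le> L" by (rule lipschitz_on_nonneg[OF L])
  define g where "g y = (INF z\<in>B. f z + L * dist y z)" for y
  have lower: "f x - L * dist y x \<le> f z + L * dist y z" if "x \<in> B" "z \<in> B" for x y z
  proof -
    have "f x - f z \<le> L * dist x z" using lipschitz_onD[OF L that] by (simp add: dist_real_def)
    also have "\<dots> \<le> L * (dist y x + dist y z)" using L0 dist_triangle3[of x z y] by (intro mult_left_mono) auto
    finally show ?thesis by (simp add: algebra_simps)
  qed
  have bb: "bdd_below ((\<lambda>z. f z + L * dist y z) ` B)" for y
  proof -
    obtain x where "x \<in> B" using False by blast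
    then show ?thesis by (intro bdd_belowI2[of _ "f x - L * dist y x"] lower)
  qed
  have le: "g y \<le> f z + L * dist y z" if "z \<in> B" for y z
    unfolding g_def by (rule cINF_lower[OF bb that])
  have *: "g y \<le> g y' + L * dist y y'" for y y'
  proof -
    have "g y - L * dist y y' \<le> g y'"
      unfolding g_def[of y']
    proof (rule cINF_greatest[OF False])
      fix z assume "z \<in> B"
      have "L * dist y z \<le> L * (dist y y' + dist y' z)" using L0 dist_triangle by (intro mult_left_mono) auto
      then show "g y - L * dist y y' \<le> f z + L * dist y' z"
        using le[OF \<open>z \<in> B\<close>, of y] by (simp add: algebra_simps)
    qed
    then show ?thesis by simp
  qed
  show thesis
  proof
    show "L-lipschitz_on UNIV g"
    proof (rule lipschitz_onI[OF _ L0])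
      fix y z
      show "dist (g y) (g z) \<le> L * dist y z"
        using *[of y z] *[of z y] by (auto simp: dist_real_def dist_commute abs_le_iff)
    qed
    show "g x = f x" if "x \<in> B" for x
    proof (rule antisym)
      show "g x \<le> f x" using le[OF that, of x] by simp
      show "f x \<le> g x" unfolding g_def using False lower[OF that, of _ x] by (intro cINF_greatest) auto
    qed
  qed
qed

section \<open>Upper slopes\<close>

text \<open>\<open>upper_slope n F G\<close>: some \<open>f\<^sub>k \<in> LIP_bd\<close> converge to \<open>F\<close> while functions above \<open>lip_a f\<^sub>k\<close> converge
  \<^emph>\<open>strongly\<close> to \<open>G\<close>. Being a closure, this notion needs no diagonal arguments.\<close>

definition upper_slope :: "'z::metric_space measure \<Rightarrow> ('z \<Rightarrow> real) \<Rightarrow> ('z \<Rightarrow> real) \<Rightarrow> bool" where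
  "upper_slope n F G \<longleftrightarrow> F \<in> borel_measurable n \<and> sqi n G \<and>
     (\<forall>e>0. \<exists>f\<in>LIP_bd. \<exists>g. sqi n g \<and> (AE x in n. lip_a f x \<le> g x) \<and>
        nsq n (\<lambda>x. g x - G x) < e \<and> (\<integral>x. min 1 \<bar>f x - F x\<bar> \<partial>finite_equiv n) < e)"

section \<open>Sums, bounded multiples and order under convergence in L2\<close>

lemma nsq_tendsto_0_le:
  assumes "\<And>k::nat. nsq n (a k) \<le> c k" "c \<longlonglongrightarrow> 0" shows "(\<lambda>k. nsq n (a k)) \<longlonglongrightarrow> 0"
proof (rule tendsto_sandwich[OF _ _ tendsto_const assms(2)])
  show "\<forall>\<^sub>F k in sequentially. 0 \<le> nsq n (a k)" by simp
  show "\<forall>\<^sub>F k in sequentially. nsq n (a k) \<le> c k" by (intro always_eventually allI assms(1))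
qed

lemma nsq_tendsto_add:
  assumes sq: "\<And>k. sqi n (a k)" "\<And>k. sqi n (b k)" "sqi n A" "sqi n B"
    and lim: "(\<lambda>k. nsq n (\<lambda>x. a k x - A x)) \<longlonglongrightarrow> 0" "(\<lambda>k. nsq n (\<lambda>x. b k x - B x)) \<longlonglongrightarrow> 0"
  shows "(\<lambda>k. nsq n (\<lambda>x. (a k x + b k x) - (A x + B x))) \<longlonglongrightarrow> 0"
proof (rule nsq_tendsto_0_le)
  show "nsq n (\<lambda>x. (a k x + b k x) - (A x + B x)) \<le>
    2 * nsq n (\<lambda>x. a k x - A x) + 2 * nsq n (\<lambda>x. b k x - B x)" for k
    unfolding add_diff_add by (rule nsq_add_le[OF sqi_diff[OF sq(1) sq(3)] sqi_diff[OF sq(2) sq(4)]])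
  show "(\<lambda>k. 2 * nsq n (\<lambda>x. a k x - A x) + 2 * nsq n (\<lambda>x. b k x - B x)) \<longlonglongrightarrow> 0"
    by (rule tendsto_eq_rhs[OF tendsto_add[OF tendsto_mult_left[OF lim(1)] tendsto_mult_left[OF lim(2)]]]) simp
qed

lemma sqi_mult_bounded:
  assumes "sqi n a" "h \<in> borel_measurable n" "AE x in n. \<bar>h x\<bar> \<le> K"
  shows "sqi n (\<lambda>x. h x * a x)"
proof (rule sqi_bound[OF sqi_cmult[OF assms(1), of K]])
  show "AE x in n. \<bar>h x * a x\<bar> \<le> \<bar>K * a x\<bar>"
    using assms(3) by eventually_elim (auto simp: abs_mult intro!: mult_right_mono)
qed (use assms in measurable)

text \<open>Split the difference into \<open>h k * (a k - A)\<close>, small because the factors are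
  bounded by \<open>K\<close>, and \<open>(h k - H) * A\<close>, which tends to 0 by dominated
  convergence with majorant \<open>(2 * K * A x)\<^sup>2\<close>.\<close>

lemma nsq_tendsto_mult_bounded:
  assumes sq: "\<And>k. sqi n (a k)" "sqi n A" and hm [measurable]: "\<And>k. h k \<in> borel_measurable n" "H \<in> borel_measurable n"
    and bd: "\<And>k. AE x in n. \<bar>h k x\<bar> \<le> K" "AE x in n. \<bar>H x\<bar> \<le> K"
    and ptw: "AE x in n. (\<lambda>k. h k x) \<longlonglongrightarrow> H x" and lim: "(\<lambda>k. nsq n (\<lambda>x. a k x - A x)) \<longlonglongrightarrow> 0"
  shows "(\<lambda>k. nsq n (\<lambda>x. h k x * a k x - H x * A x)) \<longlonglongrightarrow> 0"
proof (rule nsq_tendsto_0_le)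
  note [measurable] = sqi_measurable[OF sq(1)] sqi_measurable[OF sq(2)]
  have s1: "sqi n (\<lambda>x. h k x * (a k x - A x))" for k
    by (rule sqi_mult_bounded[OF sqi_diff[OF sq] hm(1) bd(1)])
  have dm [measurable]: "(\<lambda>x. h k x - H x) \<in> borel_measurable n" for k by measurable
  have b2: "AE x in n. \<bar>h k x - H x\<bar> \<le> 2 * K" for k using bd(1)[of k] bd(2) by eventually_elim linarith
  have s2: "sqi n (\<lambda>x. (h k x - H x) * A x)" for k
    by (rule sqi_mult_bounded[OF sq(2) dm b2])
  show "nsq n (\<lambda>x. h k x * a k x - H x * A x) \<le>
    2 * (K\<^sup>2 * nsq n (\<lambda>x. a k x - A x)) + 2 * nsq n (\<lambda>x. (h k x - H x) * A x)" for k
  proof -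
    have "nsq n (\<lambda>x. h k x * (a k x - A x)) \<le> nsq n (\<lambda>x. K * (a k x - A x))"
    proof (rule nsq_mono[OF sqi_cmult[OF sqi_diff[OF sq]]])
      show "AE x in n. \<bar>h k x * (a k x - A x)\<bar> \<le> \<bar>K * (a k x - A x)\<bar>"
        using bd(1)[of k] by eventually_elim (auto simp: abs_mult intro!: mult_right_mono)
    qed measurable
    moreover have "h k x * a k x - H x * A x = h k x * (a k x - A x) + (h k x - H x) * A x" for x
      by (simp add: algebra_simps)
    ultimately show ?thesis
      using nsq_add_le[OF s1 s2, of k k] nsq_cmult[of n K "\<lambda>x. a k x - A x"] by simp
  qed
  have "(\<lambda>k. nsq n (\<lambda>x. (h k x - H x) * A x)) \<longlonglongrightarrow> (\<integral>x. 0 \<partial>n)"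
  proof (rule integral_dominated_convergence[where w = "\<lambda>x. (2 * K * A x)\<^sup>2"])
    show "integrable n (\<lambda>x. (2 * K * A x)\<^sup>2)" by (rule sqi_integrable[OF sqi_cmult[OF sq(2)]])
    show "AE x in n. (\<lambda>k. ((h k x - H x) * A x)\<^sup>2) \<longlonglongrightarrow> 0"
      using ptw
    proof eventually_elim
      case (elim x)
      have "(\<lambda>k. ((h k x - H x) * A x)\<^sup>2) \<longlonglongrightarrow> ((H x - H x) * A x)\<^sup>2" by (intro tendsto_intros elim)
      then show ?case by simp
    qed
    show "AE x in n. norm (((h k x - H x) * A x)\<^sup>2) \<le> (2 * K * A x)\<^sup>2" for k
      using b2[of k]
    proof eventually_elim
      case (elim x)
      then have "\<bar>(h k x - H x) * A x\<bar> \<le> \<bar>2 * K * A x\<bar>" by (auto simp: abs_mult intro!: mult_right_mono)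
      then show ?case by (simp add: abs_le_square_iff)
    qed
  qed measurable
  then show "(\<lambda>k. 2 * (K\<^sup>2 * nsq n (\<lambda>x. a k x - A x)) + 2 * nsq n (\<lambda>x. (h k x - H x) * A x)) \<longlonglongrightarrow> 0"
    by (intro tendsto_eq_rhs[OF tendsto_add[OF tendsto_mult_left[OF tendsto_mult_left[OF lim]] tendsto_mult_left]]) simp_all
qed

text \<open>The positive part of \<open>h - A\<close> is dominated by \<open>|a k - A|\<close> for
  every \<open>k\<close>, so its norm is 0.\<close>

lemma AE_le_nsq_limit:
  assumes a: "\<And>k. sqi n (a k)" "sqi n A" and h [measurable]: "h \<in> borel_measurable n"
    and le: "\<And>k. AE x in n. h x \<le> a k x" and lim: "(\<lambda>k. nsq n (\<lambda>x. a k x - A x)) \<longlonglongrightarrow> 0"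
  shows "AE x in n. h x \<le> A x"
proof -
  note [measurable] = sqi_measurable[OF a(1)] sqi_measurable[OF a(2)]
  have ae: "AE x in n. \<bar>max 0 (h x - A x)\<bar> \<le> \<bar>a k x - A x\<bar>" for k using le[of k] by eventually_elim linarith
  have m: "(\<lambda>x. max 0 (h x - A x)) \<in> borel_measurable n" by measurable
  have "sqi n (\<lambda>x. max 0 (h x - A x))" by (rule sqi_bound[OF sqi_diff[OF a] m ae])
  moreover have "nsq n (\<lambda>x. max 0 (h x - A x)) = 0"
  proof (rule antisym)
    show "nsq n (\<lambda>x. max 0 (h x - A x)) \<le> 0"
      by (rule LIMSEQ_le_const[OF lim], intro exI[of _ 0] allI impI nsq_mono[OF sqi_diff[OF a] m ae])
  qed simp
  ultimately have "AE x in n. max 0 (h x - A x) = 0" by (simp only: nsq_eq_0_iff)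
  then show ?thesis by eventually_elim linarith
qed

text \<open>Instantiated both with \<open>m\<close> and with the finite measure
  \<open>map_meas m u\<close>, so that slopes on X and on Y share one theory.\<close>

locale bounded_finite =
  fixes n :: "'z::metric_space measure"
  assumes sets_n: "sets n = sets borel"
    and bounded_fin: "\<And>B. B \<in> sets borel \<Longrightarrow> bounded B \<Longrightarrow> emeasure n B < \<infinity>"
begin

lemma space_n: "space n = UNIV" using sets_eq_imp_space_eq[OF sets_n] by simp

lemma measurable_n: "borel_measurable n = borel_measurable borel"
  by (rule measurable_cong_sets[OF sets_n refl])

lemma sigma_finite: "sigma_finite_measure n"
proof
  define A where "A k = (ball undefined (real k) :: 'z set)" for k
  have "x \<in> \<Union>(range A)" for x
    using reals_Archimedean2[of "dist undefined x"] by (auto simp: A_def)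
  then have "\<Union>(range A) = space n" unfolding space_n by blast
  moreover have "range A \<subseteq> sets n" by (auto simp: A_def sets_n)
  moreover have "emeasure n (A k) \<noteq> \<infinity>" for k
    using bounded_fin[of "A k"] by (simp add: A_def)
  ultimately show "\<exists>A. countable A \<and> A \<subseteq> sets n \<and> \<Union>A = space n \<and> (\<forall>a\<in>A. emeasure n a \<noteq> \<infinity>)"
    by (intro exI[of _ "range A"]) blast
qed

sublocale fe: finite_measure "finite_equiv n"
  by (rule finite_measure_finite_equiv[OF sigma_finite])

lemma LIP_bd_meas [measurable_dest]: "f \<in> LIP_bd \<Longrightarrow> f \<in> borel_measurable n"
  by (rule LIP_bd_measurable[OF _ sets_n])

lemma lip_a_meas [measurable (raw)]: "f \<in> LIP_bd \<Longrightarrow> lip_a f \<in> borel_measurable n"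
  unfolding measurable_n by (rule lip_a_measurable)

text \<open>The distance to 0 in a metric for convergence in measure on sets of finite measure. It
  is linked to a.e. convergence in both directions: a.e. limits give \<open>dev\<close> tending to
  0, and conversely along a subsequence.\<close>

definition dev :: "('z \<Rightarrow> real) \<Rightarrow> real" where
  "dev f = (\<integral>x. min 1 \<bar>f x\<bar> \<partial>finite_equiv n)"

lemma integrable_dev: "(f :: 'z \<Rightarrow> real) \<in> borel_measurable n \<Longrightarrow> integrable (finite_equiv n) (\<lambda>x. min 1 \<bar>f x\<bar>)"
proof (rule fe.integrable_const_bound[where B = 1])
  assume "f \<in> borel_measurable n"
  then show "(\<lambda>x. min 1 \<bar>f x\<bar>) \<in> borel_measurable (finite_equiv n)"
    unfolding measurable_finite_equiv[OF sigma_finite] by measurable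
qed simp

lemma dev_triangle:
  assumes [measurable]: "f \<in> borel_measurable n" "g \<in> borel_measurable n"
  shows "dev (\<lambda>x. f x + g x) \<le> dev f + dev g"
proof -
  have "min 1 \<bar>a + b\<bar> \<le> min 1 \<bar>a\<bar> + min 1 \<bar>b\<bar>" for a b :: real by linarith
  then have "dev (\<lambda>x. f x + g x) \<le> (\<integral>x. min 1 \<bar>f x\<bar> + min 1 \<bar>g x\<bar> \<partial>finite_equiv n)"
    unfolding dev_def
    by (intro integral_mono Bochner_Integration.integrable_add integrable_dev assms borel_measurable_add)
  also have "\<dots> = dev f + dev g"
    unfolding dev_def by (intro Bochner_Integration.integral_add integrable_dev assms)
  finally show ?thesis .
qed

lemma dev_tendsto:
  assumes [measurable]: "\<And>k. f k \<in> borel_measurable n" and lim: "AE x in n. (\<lambda>k. f k x) \<longlonglongrightarrow> 0"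
  shows "(\<lambda>k. dev (f k)) \<longlonglongrightarrow> 0"
proof -
  have "(\<lambda>k. dev (f k)) \<longlonglongrightarrow> (\<integral>x. 0 \<partial>finite_equiv n)"
    unfolding dev_def
  proof (rule integral_dominated_convergence[where w = "\<lambda>_. 1"])
    show "AE x in finite_equiv n. (\<lambda>k. min 1 \<bar>f k x\<bar>) \<longlonglongrightarrow> 0"
      unfolding AE_finite_equiv[OF sigma_finite] using lim
    proof eventually_elim
      case (elim x)
      have "(\<lambda>k. min 1 \<bar>f k x\<bar>) \<longlonglongrightarrow> min 1 \<bar>0\<bar>" by (intro tendsto_intros elim)
      then show ?case by simp
    qed
    show "integrable (finite_equiv n) (\<lambda>_. 1 :: real)" by simp
    show "(\<lambda>x. min 1 \<bar>f k x\<bar>) \<in> borel_measurable (finite_equiv n)" for k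
      unfolding measurable_finite_equiv[OF sigma_finite] by measurable
    show "AE x in finite_equiv n. norm (min 1 \<bar>f k x\<bar>) \<le> 1" for k by (intro always_eventually allI) simp
  qed simp
  then show ?thesis by simp
qed

lemma dev_tendsto_subseq:
  assumes [measurable]: "\<And>k. f k \<in> borel_measurable n" and lim: "(\<lambda>k. dev (f k)) \<longlonglongrightarrow> 0"
  obtains r :: "nat \<Rightarrow> nat" where "strict_mono r" "AE x in n. (\<lambda>k. f (r k) x) \<longlonglongrightarrow> 0"
proof -
  have "(\<lambda>k. \<integral>x. norm (min 1 \<bar>f k x\<bar>) \<partial>finite_equiv n) \<longlonglongrightarrow> 0"
    using lim unfolding dev_def by (simp only: real_norm_def abs_of_nonneg[OF min.boundedI[OF zero_le_one abs_ge_zero]])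
  from tendsto_L1_AE_subseq[OF integrable_dev[OF assms(1)] this] obtain r :: "nat \<Rightarrow> nat"
    where r: "strict_mono r" "AE x in finite_equiv n. (\<lambda>k. min 1 \<bar>f (r k) x\<bar>) \<longlonglongrightarrow> 0" by blast
  from r(2) have "AE x in n. (\<lambda>k. f (r k) x) \<longlonglongrightarrow> 0"
    unfolding AE_finite_equiv[OF sigma_finite]
  proof eventually_elim
    case (elim x)
    then have "\<forall>\<^sub>F k in sequentially. min 1 \<bar>f (r k) x\<bar> < 1" by (rule order_tendstoD) simp
    then have "\<forall>\<^sub>F k in sequentially. \<bar>f (r k) x\<bar> = min 1 \<bar>f (r k) x\<bar>" by eventually_elim simp
    with elim have "(\<lambda>k. \<bar>f (r k) x\<bar>) \<longlonglongrightarrow> 0" by (simp add: tendsto_cong)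
    then show ?case by (rule tendsto_rabs_zero_cancel)
  qed
  with r(1) show thesis by (rule that)
qed

section \<open>Calculus of upper slopes: closure, sums, chain rule, locality and gluing\<close>

lemma upper_slope_D: "upper_slope n F G \<Longrightarrow> F \<in> borel_measurable n" "upper_slope n F G \<Longrightarrow> sqi n G"
  by (auto simp: upper_slope_def)

lemma upper_slope_LIP_bd:
  assumes "f \<in> LIP_bd" "sqi n g" "AE x in n. lip_a f x \<le> g x" shows "upper_slope n f g"
  unfolding upper_slope_def
  by (intro conjI allI impI bexI[of _ f] exI[of _ g]) (use assms LIP_bd_meas in simp_all)

text \<open>Choose approximations of precision \<open>1 / real (Suc k)\<close> and pass to a
  subsequence along which convergence in measure becomes a.e. convergence.\<close>

lemma upper_slope_seqE:
  assumes "upper_slope n F G"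
  obtains f g where "\<And>k::nat. f k \<in> LIP_bd" "\<And>k. sqi n (g k)" "\<And>k. AE x in n. lip_a (f k) x \<le> g k x"
    "AE x in n. (\<lambda>k. f k x) \<longlonglongrightarrow> F x" "(\<lambda>k. nsq n (\<lambda>x. g k x - G x)) \<longlonglongrightarrow> 0"
proof -
  have F [measurable]: "F \<in> borel_measurable n" by (rule upper_slope_D[OF assms])
  define A where "A k p \<longleftrightarrow> fst p \<in> LIP_bd \<and> sqi n (snd p) \<and> (AE x in n. lip_a (fst p) x \<le> snd p x) \<and>
    nsq n (\<lambda>x. snd p x - G x) < 1 / real (Suc k) \<and> dev (\<lambda>x. fst p x - F x) < 1 / real (Suc k)"
    for k and p :: "('z \<Rightarrow> real) \<times> ('z \<Rightarrow> real)"
  have "\<exists>p. A k p" for k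
  proof -
    have "1 / real (Suc k) > 0" by simp
    then obtain f g where "f \<in> LIP_bd" "sqi n g" "AE x in n. lip_a f x \<le> g x"
      "nsq n (\<lambda>x. g x - G x) < 1 / real (Suc k)" "(\<integral>x. min 1 \<bar>f x - F x\<bar> \<partial>finite_equiv n) < 1 / real (Suc k)"
      using assms unfolding upper_slope_def by blast
    then have "A k (f, g)" unfolding A_def dev_def fst_conv snd_conv by (intro conjI)
    then show ?thesis ..
  qed
  then obtain p where p: "\<And>k. A k (p k)" by metis
  define f g where "f k = fst (p k)" and "g k = snd (p k)" for k
  have fg: "f k \<in> LIP_bd" "sqi n (g k)" "AE x in n. lip_a (f k) x \<le> g k x"
    "nsq n (\<lambda>x. g k x - G x) < 1 / real (Suc k)" "dev (\<lambda>x. f k x - F x) < 1 / real (Suc k)" for k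
    using p[of k] unfolding A_def f_def g_def by blast+
  note [measurable] = LIP_bd_meas[OF fg(1)]
  have l1: "(\<lambda>k. nsq n (\<lambda>x. g k x - G x)) \<longlonglongrightarrow> 0"
    by (rule nsq_tendsto_0_le[OF less_imp_le[OF fg(4)] LIMSEQ_Suc[OF lim_1_over_n]])
  have "(\<lambda>k. dev (\<lambda>x. f k x - F x)) \<longlonglongrightarrow> 0"
  proof (rule tendsto_sandwich[OF _ _ tendsto_const LIMSEQ_Suc[OF lim_1_over_n]])
    show "\<forall>\<^sub>F k in sequentially. dev (\<lambda>x. f k x - F x) \<le> 1 / real (Suc k)" by (intro always_eventually allI less_imp_le fg(5))
  qed (simp add: dev_def)
  then obtain r :: "nat \<Rightarrow> nat" where r: "strict_mono r" "AE x in n. (\<lambda>k. f (r k) x - F x) \<longlonglongrightarrow> 0"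
    by (rule dev_tendsto_subseq[rotated]) measurable
  show thesis
  proof (rule that[of "\<lambda>k. f (r k)" "\<lambda>k. g (r k)"])
    show "AE x in n. (\<lambda>k. f (r k) x) \<longlonglongrightarrow> F x" using r(2) by eventually_elim (rule LIM_zero_cancel)
    show "(\<lambda>k. nsq n (\<lambda>x. g (r k) x - G x)) \<longlonglongrightarrow> 0"
      using LIMSEQ_subseq_LIMSEQ[OF l1 r(1)] unfolding o_def .
  qed (rule fg)+
qed

text \<open>The definition asks only for approximations within each \<open>e\<close>, so an
  approximation of a close member of the sequence is one of the limit; this is the closure property
  that spares diagonal sequences.\<close>

lemma upper_slope_closed:
  assumes u: "\<And>k::nat. upper_slope n (F k) (G k)" and F [measurable]: "F' \<in> borel_measurable n" and G: "sqi n G'"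
    and lim: "AE x in n. (\<lambda>k. F k x) \<longlonglongrightarrow> F' x" "(\<lambda>k. nsq n (\<lambda>x. G k x - G' x)) \<longlonglongrightarrow> 0"
  shows "upper_slope n F' G'"
  unfolding upper_slope_def
proof (intro conjI allI impI F G)
  fix e :: real assume e: "e > 0"
  note [measurable] = upper_slope_D(1)[OF u]
  have "AE x in n. (\<lambda>k. F k x - F' x) \<longlonglongrightarrow> 0" using lim(1) by eventually_elim (rule LIM_zero)
  then have "(\<lambda>k. dev (\<lambda>x. F k x - F' x)) \<longlonglongrightarrow> 0" by (rule dev_tendsto[rotated]) measurable
  then have "\<forall>\<^sub>F k in sequentially. dev (\<lambda>x. F k x - F' x) < e / 2" using e by (intro order_tendstoD) auto
  moreover have "\<forall>\<^sub>F k in sequentially. nsq n (\<lambda>x. G k x - G' x) < e / 4" using e by (intro order_tendstoD(2)[OF lim(2)]) simp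
  ultimately have "\<forall>\<^sub>F k in sequentially. dev (\<lambda>x. F k x - F' x) < e / 2 \<and> nsq n (\<lambda>x. G k x - G' x) < e / 4"
    by (rule eventually_conj)
  then obtain k where k: "dev (\<lambda>x. F k x - F' x) < e / 2" "nsq n (\<lambda>x. G k x - G' x) < e / 4"
    by (rule eventually_happens'[OF sequentially_bot, THEN exE]) (elim conjE, rule that)
  obtain f g where fg: "f \<in> LIP_bd" "sqi n g" "AE x in n. lip_a f x \<le> g x"
    "nsq n (\<lambda>x. g x - G k x) < e / 4" "dev (\<lambda>x. f x - F k x) < e / 4"
  proof -
    have "e / 4 > 0" using e by simp
    with u[of k] obtain f g where "f \<in> LIP_bd" "sqi n g" "AE x in n. lip_a f x \<le> g x"
      "nsq n (\<lambda>x. g x - G k x) < e / 4" "(\<integral>x. min 1 \<bar>f x - F k x\<bar> \<partial>finite_equiv n) < e / 4"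
      unfolding upper_slope_def by blast
    then show thesis by (rule that[unfolded dev_def])
  qed
  note [measurable] = LIP_bd_meas[OF fg(1)]
  have Gk: "sqi n (G k)" by (rule upper_slope_D[OF u])
  show "\<exists>f\<in>LIP_bd. \<exists>g. sqi n g \<and> (AE x in n. lip_a f x \<le> g x) \<and>
        nsq n (\<lambda>x. g x - G' x) < e \<and> (\<integral>x. min 1 \<bar>f x - F' x\<bar> \<partial>finite_equiv n) < e"
  proof (intro bexI[of _ f] exI[of _ g] conjI fg)
    \<comment> \<open>Squared norms satisfy the triangle inequality with a factor 2 on each term,
      whence the tolerances \<open>e / 4\<close>.\<close>
    show "nsq n (\<lambda>x. g x - G' x) < e"
      using nsq_add_le[OF sqi_diff[OF fg(2) Gk] sqi_diff[OF Gk G]] k fg by simp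
    have "dev (\<lambda>x. f x - F' x) \<le> dev (\<lambda>x. f x - F k x) + dev (\<lambda>x. F k x - F' x)"
      using dev_triangle[of "\<lambda>x. f x - F k x" "\<lambda>x. F k x - F' x"] by simp
    also have "\<dots> < e" using k fg e by linarith
    finally show "(\<integral>x. min 1 \<bar>f x - F' x\<bar> \<partial>finite_equiv n) < e" by (simp add: dev_def)
  qed
qed

lemma upper_slope_seqI:
  assumes "\<And>k::nat. f k \<in> LIP_bd" "\<And>k. sqi n (g k)" "\<And>k. AE x in n. lip_a (f k) x \<le> g k x"
    and "F \<in> borel_measurable n" "sqi n G"
    and "AE x in n. (\<lambda>k. f k x) \<longlonglongrightarrow> F x" "(\<lambda>k. nsq n (\<lambda>x. g k x - G x)) \<longlonglongrightarrow> 0"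
  shows "upper_slope n F G"
  by (rule upper_slope_closed[OF upper_slope_LIP_bd[OF assms(1-3)] assms(4-7)])

lemma upper_slope_cong_AE:
  assumes u: "upper_slope n F G" and "F' \<in> borel_measurable n" "AE x in n. F x = F' x"
    and "G' \<in> borel_measurable n" "AE x in n. G x = G' x"
  shows "upper_slope n F' G'"
proof -
  have G': "sqi n G'"
    by (rule sqi_bound[OF upper_slope_D(2)[OF u] assms(4)]) (use assms(5) in \<open>eventually_elim, simp\<close>)
  have "nsq n (\<lambda>x. G x - G' x) = 0"
    by (rule integral_eq_zero_AE) (use assms(5) in \<open>eventually_elim, simp\<close>)
  then show ?thesis
    by (intro upper_slope_closed[OF u assms(2) G']) (use assms(3) in \<open>eventually_elim, simp\<close>, simp)
qed

lemma upper_slope_nonneg: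
  assumes "upper_slope n F G" shows "AE x in n. 0 \<le> G x"
proof -
  obtain f g where fg: "\<And>k::nat. f k \<in> LIP_bd" "\<And>k. sqi n (g k)" "\<And>k. AE x in n. lip_a (f k) x \<le> g k x"
    "AE x in n. (\<lambda>k. f k x) \<longlonglongrightarrow> F x" "(\<lambda>k. nsq n (\<lambda>x. g k x - G x)) \<longlonglongrightarrow> 0"
    by (rule upper_slope_seqE[OF assms], rule that)
  have "AE x in n. 0 \<le> g k x" for k
    using fg(3)[of k]
  proof eventually_elim
    case (elim x) then show ?case using lip_a_nonneg[of "f k" x] by linarith
  qed
  from AE_le_nsq_limit[OF fg(2) upper_slope_D(2)[OF assms] _ this fg(5)] show ?thesis by simp
qed

text \<open>The nonnegative difference \<open>G' - G\<close> is simply added to the dominating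
  functions, which would be impossible if these had to equal \<open>lip_a\<close>.\<close>

lemma upper_slope_mono:
  assumes u: "upper_slope n F G" and G': "sqi n G'" "AE x in n. G x \<le> G' x"
  shows "upper_slope n F G'"
proof -
  obtain f g where fg: "\<And>k::nat. f k \<in> LIP_bd" "\<And>k. sqi n (g k)" "\<And>k. AE x in n. lip_a (f k) x \<le> g k x"
    "AE x in n. (\<lambda>k. f k x) \<longlonglongrightarrow> F x" "(\<lambda>k. nsq n (\<lambda>x. g k x - G x)) \<longlonglongrightarrow> 0"
    by (rule upper_slope_seqE[OF u], rule that)
  note G = upper_slope_D[OF u]
  show ?thesis
  proof (rule upper_slope_seqI[of f "\<lambda>k x. g k x + (G' x - G x)"])
    show "sqi n (\<lambda>x. g k x + (G' x - G x))" for k by (intro sqi_add sqi_diff fg G G')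
    show "AE x in n. lip_a (f k) x \<le> g k x + (G' x - G x)" for k
      using fg(3)[of k] G'(2) by eventually_elim linarith
    have "g k x + (G' x - G x) - G' x = g k x - G x" for k x by simp
    then show "(\<lambda>k. nsq n (\<lambda>x. g k x + (G' x - G x) - G' x)) \<longlonglongrightarrow> 0" using fg(5) by (simp only:)
  qed (rule fg G G')+
qed

lemma upper_slope_add:
  assumes u: "upper_slope n F G" and u': "upper_slope n F' G'"
  shows "upper_slope n (\<lambda>x. F x + F' x) (\<lambda>x. G x + G' x)"
proof -
  obtain f g where fg: "\<And>k::nat. f k \<in> LIP_bd" "\<And>k. sqi n (g k)" "\<And>k. AE x in n. lip_a (f k) x \<le> g k x"
    "AE x in n. (\<lambda>k. f k x) \<longlonglongrightarrow> F x" "(\<lambda>k. nsq n (\<lambda>x. g k x - G x)) \<longlonglongrightarrow> 0"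
    by (rule upper_slope_seqE[OF u], rule that)
  obtain f' g' where fg': "\<And>k::nat. f' k \<in> LIP_bd" "\<And>k. sqi n (g' k)" "\<And>k. AE x in n. lip_a (f' k) x \<le> g' k x"
    "AE x in n. (\<lambda>k. f' k x) \<longlonglongrightarrow> F' x" "(\<lambda>k. nsq n (\<lambda>x. g' k x - G' x)) \<longlonglongrightarrow> 0"
    by (rule upper_slope_seqE[OF u'], rule that)
  note [measurable] = upper_slope_D(1)[OF u] upper_slope_D(1)[OF u']
  show ?thesis
  proof (rule upper_slope_seqI[of "\<lambda>k x. f k x + f' k x" "\<lambda>k x. g k x + g' k x"])
    show "AE x in n. lip_a (\<lambda>x. f k x + f' k x) x \<le> g k x + g' k x" for k
      using fg(3)[of k] fg'(3)[of k]
    proof eventually_elim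
      case (elim x) then show ?case using lip_a_add[OF fg(1) fg'(1), of k k x] by linarith
    qed
    show "AE x in n. (\<lambda>k. f k x + f' k x) \<longlonglongrightarrow> F x + F' x"
      using fg(4) fg'(4) by eventually_elim (rule tendsto_add)
  qed (auto intro!: LIP_bd_add fg fg' sqi_add nsq_tendsto_add upper_slope_D(2)[OF u] upper_slope_D(2)[OF u'])
qed

text \<open>Continuity of \<open>\<kappa>\<close> makes \<open>\<kappa> (f\<^sub>k)\<close> converge along an approximating sequence.\<close>

lemma upper_slope_chain:
  fixes \<phi> \<kappa> :: "real \<Rightarrow> real"
  assumes u: "upper_slope n F G" and \<phi>: "L-lipschitz_on UNIV \<phi>"
    and \<kappa>: "continuous_on UNIV \<kappa>" "\<And>t. 0 \<le> \<kappa> t" "\<And>t. \<kappa> t \<le> K" "\<And>t e. e > 0 \<Longrightarrow> lip_near \<phi> t (\<kappa> t + e)"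
  shows "upper_slope n (\<lambda>x. \<phi> (F x)) (\<lambda>x. \<kappa> (F x) * G x)"
proof -
  obtain f g where fg: "\<And>k::nat. f k \<in> LIP_bd" "\<And>k. sqi n (g k)" "\<And>k. AE x in n. lip_a (f k) x \<le> g k x"
    "AE x in n. (\<lambda>k. f k x) \<longlonglongrightarrow> F x" "(\<lambda>k. nsq n (\<lambda>x. g k x - G x)) \<longlonglongrightarrow> 0"
    by (rule upper_slope_seqE[OF u], rule that)
  note F [measurable] = upper_slope_D(1)[OF u] and G = upper_slope_D(2)[OF u]
  note [measurable] = LIP_bd_meas[OF fg(1)]
  have \<phi>c: "continuous_on UNIV \<phi>" by (rule lipschitz_on_continuous_on[OF \<phi>])
  have [measurable]: "\<kappa> \<in> borel_measurable borel" "\<phi> \<in> borel_measurable borel"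
    using \<kappa>(1) \<phi>c by (auto intro: borel_measurable_continuous_onI)
  have lim: "(\<lambda>k. \<psi> (f k x)) \<longlonglongrightarrow> \<psi> (F x)" if "(\<lambda>k. f k x) \<longlonglongrightarrow> F x" "continuous_on UNIV \<psi>" for x and \<psi> :: "real \<Rightarrow> real"
    using that by (auto intro!: isCont_tendsto_compose[of _ \<psi>] simp: continuous_on_eq_continuous_at)
  have m: "(\<lambda>x. \<kappa> (f k x)) \<in> borel_measurable n" "(\<lambda>x. \<kappa> (F x)) \<in> borel_measurable n" for k by measurable
  have bd: "\<bar>\<kappa> t\<bar> \<le> K" for t using \<kappa>(2,3)[of t] by simp
  show ?thesis
  proof (rule upper_slope_seqI[of "\<lambda>k x. \<phi> (f k x)" "\<lambda>k x. \<kappa> (f k x) * g k x"])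
    show "(\<lambda>x. \<phi> (f k x)) \<in> LIP_bd" for k by (rule LIP_bd_compose[OF fg(1) \<phi>])
    show "sqi n (\<lambda>x. \<kappa> (f k x) * g k x)" for k by (rule sqi_mult_bounded[OF fg(2) m(1)]) (use bd in auto)
    show "sqi n (\<lambda>x. \<kappa> (F x) * G x)" by (rule sqi_mult_bounded[OF G m(2)]) (use bd in auto)
    show "AE x in n. lip_a (\<lambda>x. \<phi> (f k x)) x \<le> \<kappa> (f k x) * g k x" for k
      using fg(3)[of k]
    proof eventually_elim
      case (elim x)
      have "lip_a (\<lambda>x. \<phi> (f k x)) x \<le> \<kappa> (f k x) * lip_a (f k) x" by (rule lip_a_compose[OF fg(1) \<phi> \<kappa>(4,2)])
      also have "\<dots> \<le> \<kappa> (f k x) * g k x" using elim \<kappa>(2) by (rule mult_left_mono)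
      finally show ?case .
    qed
    show "AE x in n. (\<lambda>k. \<phi> (f k x)) \<longlonglongrightarrow> \<phi> (F x)" using fg(4) by eventually_elim (rule lim[OF _ \<phi>c])
    show "(\<lambda>k. nsq n (\<lambda>x. \<kappa> (f k x) * g k x - \<kappa> (F x) * G x)) \<longlonglongrightarrow> 0"
    proof (rule nsq_tendsto_mult_bounded[OF fg(2) G m])
      show "AE x in n. (\<lambda>k. \<kappa> (f k x)) \<longlonglongrightarrow> \<kappa> (F x)" using fg(4) by eventually_elim (rule lim[OF _ \<kappa>(1)])
    qed (use bd fg(5) in auto)
  qed measurable
qed

lemma upper_slope_cmult:
  assumes "upper_slope n F G" shows "upper_slope n (\<lambda>x. c * F x) (\<lambda>x. \<bar>c\<bar> * G x)"
proof (rule upper_slope_chain[OF assms, where K = "\<bar>c\<bar>"])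
  show L: "\<bar>c\<bar>-lipschitz_on UNIV (\<lambda>x. c * x)"
    by (intro lipschitz_onI) (auto simp: dist_real_def abs_mult simp flip: right_diff_distrib)
  show "lip_near (\<lambda>x. c * x) t (\<bar>c\<bar> + e)" if "e > 0" for e t
    unfolding lip_near_def by (intro exI[of _ 1] conjI lipschitz_on_mono[OF L]) (use that in auto)
qed auto

text \<open>The source of locality: the slope may be set to 0 on {F = 0}. Compose \<open>F\<close>
  with maps that vanish near 0 and converge to the identity; the chain rule removes the slope near
  the value 0, and closure passes to the limit.\<close>

lemma upper_slope_nonzero:
  assumes u: "upper_slope n F G" shows "upper_slope n F (\<lambda>x. if F x = 0 then 0 else G x)"
proof -
  note F [measurable] = upper_slope_D(1)[OF u] and G = upper_slope_D(2)[OF u]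
  define \<epsilon> where "\<epsilon> k = 1 / real (Suc k)" for k
  have \<epsilon>: "\<epsilon> k > 0" for k by (simp add: \<epsilon>_def)
  define \<phi> where "\<phi> k t = max 0 (t - \<epsilon> k) + min 0 (t + \<epsilon> k)" for k t
  \<comment> \<open>\<open>\<phi> k\<close> is soft thresholding at level
    \<open>\<epsilon> k\<close>. Its local Lipschitz constant jumps, whereas the chain rule wants a
    continuous bound: \<open>\<kappa> k\<close> is 0 up to half the level, 1 from the level on, and
    linear in |t| between.\<close>
  define \<kappa> where "\<kappa> k t = min 1 (max 0 (2 * \<bar>t\<bar> / \<epsilon> k - 1))" for k t
  have \<phi>1: "1-lipschitz_on UNIV (\<phi> k)" for k
  proof (rule lipschitz_onI)
    show "dist (\<phi> k s) (\<phi> k t) \<le> 1 * dist s t" for s t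
      unfolding dist_real_def \<phi>_def using \<epsilon>[of k] by (auto simp: max_def min_def abs_if)
  qed simp
  have near: "lip_near (\<phi> k) t (\<kappa> k t + e)" if "e > 0" for k t e
  proof (cases "\<bar>t\<bar> < \<epsilon> k")
    case True
    have "\<phi> k s = 0" if "\<bar>s\<bar> < \<epsilon> k" for s using that by (simp add: \<phi>_def)
    moreover have "\<bar>s\<bar> < \<epsilon> k" if "dist t s < \<epsilon> k - \<bar>t\<bar>" for s using that by (simp add: dist_real_def)
    ultimately show ?thesis using True that
      by (intro lip_nearI[of "\<epsilon> k - \<bar>t\<bar>"]) (auto simp: \<kappa>_def)
  next
    case False
    then have "2 * \<bar>t\<bar> / \<epsilon> k - 1 \<ge> 1" using \<epsilon>[of k] by (simp add: field_simps)
    then have "\<kappa> k t = 1" by (simp add: \<kappa>_def)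
    then show ?thesis unfolding lip_near_def
      by (intro exI[of _ 1] conjI lipschitz_on_mono[OF \<phi>1]) (use that in auto)
  qed
  have u': "upper_slope n (\<lambda>x. \<phi> k (F x)) (\<lambda>x. \<kappa> k (F x) * G x)" for k
  proof (rule upper_slope_chain[OF u \<phi>1, where K = 1])
    show "continuous_on UNIV (\<kappa> k)" unfolding \<kappa>_def using \<epsilon>[of k] by (intro continuous_intros) auto
  qed (use near in \<open>auto simp: \<kappa>_def\<close>)
  have \<epsilon>0: "\<epsilon> \<longlonglongrightarrow> 0" unfolding \<epsilon>_def by (rule LIMSEQ_Suc[OF lim_1_over_n])
  define H where "H x = (if F x = 0 then 0 else 1 :: real)" for x
  have [measurable]: "H \<in> borel_measurable n" "(\<lambda>x. \<kappa> k (F x)) \<in> borel_measurable n" for k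
    unfolding H_def \<kappa>_def by measurable
  have HG: "sqi n (\<lambda>x. H x * G x)" by (rule sqi_mult_bounded[OF G, of _ 1]) (auto simp: H_def)
  have "upper_slope n F (\<lambda>x. H x * G x)"
  proof (rule upper_slope_closed[OF u' F HG])
    show "AE x in n. (\<lambda>k. \<phi> k (F x)) \<longlonglongrightarrow> F x"
    proof (intro always_eventually allI)
      fix x
      have "(\<lambda>k. \<phi> k (F x)) \<longlonglongrightarrow> max 0 (F x - 0) + min 0 (F x + 0)"
        unfolding \<phi>_def by (intro tendsto_intros \<epsilon>0)
      then show "(\<lambda>k. \<phi> k (F x)) \<longlonglongrightarrow> F x" by (simp add: max_def min_def split: if_splits)
    qed
    show "(\<lambda>k. nsq n (\<lambda>x. \<kappa> k (F x) * G x - H x * G x)) \<longlonglongrightarrow> 0"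
    proof (rule nsq_tendsto_mult_bounded[OF G G, of _ _ 1])
      show "AE x in n. (\<lambda>k. \<kappa> k (F x)) \<longlonglongrightarrow> H x"
      proof (intro always_eventually allI)
        fix x
        show "(\<lambda>k. \<kappa> k (F x)) \<longlonglongrightarrow> H x"
        proof (cases "F x = 0")
          case True then show ?thesis by (simp add: \<kappa>_def H_def)
        next
          case False
          have "\<forall>\<^sub>F k in sequentially. \<epsilon> k < \<bar>F x\<bar>" by (rule order_tendstoD[OF \<epsilon>0]) (use False in simp)
          then have "\<forall>\<^sub>F k in sequentially. \<kappa> k (F x) = 1"
          proof eventually_elim
            case (elim k)
            then have "2 * \<bar>F x\<bar> / \<epsilon> k - 1 \<ge> 1" using \<epsilon>[of k] by (simp add: field_simps)
            then show ?case by (simp add: \<kappa>_def)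
          qed
          then show ?thesis using False by (simp add: H_def tendsto_eventually)
        qed
      qed
    qed (auto simp: \<kappa>_def H_def)
  qed
  then show ?thesis by (simp add: H_def if_distrib if_distribR cong: if_cong)
qed

text \<open>The two approximating sequences are close only a.e. and not uniformly, as
  \<open>lip_a_interpolate\<close> requires. So \<open>f k\<close> is first truncated to within
  \<open>\<epsilon>\<close> of \<open>f' k\<close>. Where the truncation may act, the slope of
  \<open>f' k\<close> has to be added, but at a.e. point this stops for large \<open>k\<close>. What
  remains is an error of size \<open>L * \<epsilon>\<close> on a bounded set, removed by a second
  limit.\<close>

lemma upper_slope_interpolate:
  assumes u1: "upper_slope n F G1" and u2: "upper_slope n F G2"
    and \<eta>: "L-lipschitz_on UNIV \<eta>" "\<And>y. 0 \<le> \<eta> y" "\<And>y. \<eta> y \<le> 1" and supp: "\<And>y. dist x0 y > R \<Longrightarrow> \<eta> y = 0"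
  shows "upper_slope n F (\<lambda>x. \<eta> x * G1 x + (1 - \<eta> x) * G2 x)"
proof -
  obtain f g where fg: "\<And>k::nat. f k \<in> LIP_bd" "\<And>k. sqi n (g k)" "\<And>k. AE x in n. lip_a (f k) x \<le> g k x"
    "AE x in n. (\<lambda>k. f k x) \<longlonglongrightarrow> F x" "(\<lambda>k. nsq n (\<lambda>x. g k x - G1 x)) \<longlonglongrightarrow> 0"
    by (rule upper_slope_seqE[OF u1], rule that)
  obtain f' g' where fg': "\<And>k::nat. f' k \<in> LIP_bd" "\<And>k. sqi n (g' k)" "\<And>k. AE x in n. lip_a (f' k) x \<le> g' k x"
    "AE x in n. (\<lambda>k. f' k x) \<longlonglongrightarrow> F x" "(\<lambda>k. nsq n (\<lambda>x. g' k x - G2 x)) \<longlonglongrightarrow> 0"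
    by (rule upper_slope_seqE[OF u2], rule that)
  note F [measurable] = upper_slope_D(1)[OF u1] and G1 = upper_slope_D(2)[OF u1] and G2 = upper_slope_D(2)[OF u2]
  note [measurable] = LIP_bd_meas[OF fg(1)] LIP_bd_meas[OF fg'(1)] LIP_bd_meas[OF lipschitz_LIP_bd[OF \<eta>(1)]]
  have L0: "0 \<le> L" by (rule lipschitz_on_nonneg[OF \<eta>(1)])
  \<comment> \<open>The constant error must be confined to a bounded set to be square integrable.
    The margin 1 beyond \<open>R\<close> guarantees that \<open>\<eta>\<close> vanishes on a whole
    ball around each point outside, where the interpolation then coincides with
    \<open>f' k\<close>.\<close>
  define S where "S x = indicat_real (cball x0 (R + 1)) x" for x
  have [measurable]: "cball x0 (R + 1) \<in> sets n" by (simp add: sets_n)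
  have S: "sqi n S"
  proof -
    have "integrable n (indicat_real (cball x0 (R + 1)))"
      using bounded_fin[of "cball x0 (R + 1)"] by (intro integrable_real_indicator) auto
    moreover have "(\<lambda>x. (S x)\<^sup>2) = indicat_real (cball x0 (R + 1))" by (auto simp: S_def indicator_def)
    moreover have "S \<in> borel_measurable n" unfolding S_def by measurable
    ultimately show ?thesis unfolding sqi_def by simp
  qed
  have bd\<eta>: "\<bar>\<eta> x\<bar> \<le> 1" "\<bar>1 - \<eta> x\<bar> \<le> 1" for x using \<eta>(2,3)[of x] by auto
  note [measurable] = sqi_measurable[OF S]
  have s\<eta>: "sqi n (\<lambda>x. \<eta> x * h x)" "sqi n (\<lambda>x. (1 - \<eta> x) * h x)" if "sqi n h" for h
    by (rule sqi_mult_bounded[OF that, of _ 1]; use bd\<eta> in \<open>simp\<close>)+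
  have main: "upper_slope n F (\<lambda>x. (\<eta> x * G1 x + (1 - \<eta> x) * G2 x) + (L * \<epsilon>) * S x)" if \<epsilon>: "\<epsilon> > 0" for \<epsilon>
  proof -
    define h where "h k x = max (min (f k x) (f' k x + \<epsilon>)) (f' k x + (-\<epsilon>))" for k x
    define w where "w k x = \<eta> x * h k x + (1 - \<eta> x) * f' k x" for k x
    \<comment> \<open>Where \<open>J\<close> is 0 the strict inequality persists nearby, so
      \<open>h k\<close> equals \<open>f k\<close> near the point and only the slope of
      \<open>f k\<close> counts.\<close>
    define J where "J k x = (if \<bar>f k x - f' k x\<bar> < \<epsilon> then 0 else 1 :: real)" for k x
    define p where "p k x = (\<eta> x * (g k x + J k x * g' k x) + (1 - \<eta> x) * g' k x) + (L * \<epsilon>) * S x" for k x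
    have hb: "h k \<in> LIP_bd" for k
      unfolding h_def by (intro LIP_bd_max LIP_bd_min LIP_bd_add fg fg' LIP_bd_const)
    have hd: "\<bar>h k y - f' k y\<bar> \<le> \<epsilon>" for k y unfolding h_def using \<epsilon> by auto
    have wb: "w k \<in> LIP_bd" for k unfolding w_def by (rule lip_a_interpolate(1)[OF hb fg'(1) \<eta> hd])
    have Jm [measurable]: "J k \<in> borel_measurable n" for k unfolding J_def by measurable
    have sJ: "sqi n (\<lambda>x. J k x * g' k x)" for k by (rule sqi_mult_bounded[OF fg'(2), of _ 1]) (auto simp: J_def)
    have lip_shift: "lip_a (\<lambda>x. f' k x + c) x \<le> lip_a (f' k) x" for k c x
      using lip_a_add[OF fg'(1) LIP_bd_const, of k c x] lip_a_le_lipschitz[OF lipschitz_on_constant, of c x] by simp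
    have lip_h: "AE x in n. lip_a (h k) x \<le> g k x + J k x * g' k x" for k
      using fg(3)[of k] fg'(3)[of k]
    proof eventually_elim
      case (elim x)
      show ?case
      proof (cases "\<bar>f k x - f' k x\<bar> < \<epsilon>")
        case True
        have "open {y. \<bar>f k y - f' k y\<bar> < \<epsilon>}"
          using LIP_bd_continuous[OF fg(1)] LIP_bd_continuous[OF fg'(1)]
          by (intro open_Collect_less continuous_intros)
        then obtain r where "r > 0" "\<And>y. dist y x < r \<Longrightarrow> \<bar>f k y - f' k y\<bar> < \<epsilon>"
          using True unfolding open_dist by blast
        moreover have "h k y = f k y" if "\<bar>f k y - f' k y\<bar> < \<epsilon>" for y
          using that unfolding h_def by (simp add: abs_less_iff min_def max_def)
        ultimately have "lip_a (h k) x \<le> lip_a (f k) x"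
          by (intro lip_a_local[OF hb fg(1), of r]) (simp_all add: dist_commute)
        then show ?thesis using elim True by (simp add: J_def)
      next
        case False
        have "lip_a (h k) x \<le> max (lip_a (\<lambda>x. min (f k x) (f' k x + \<epsilon>)) x) (lip_a (\<lambda>x. f' k x + (-\<epsilon>)) x)"
          unfolding h_def by (intro lip_a_max_min(1) LIP_bd_min LIP_bd_add fg fg' LIP_bd_const)
        also have "\<dots> \<le> max (max (lip_a (f k) x) (lip_a (\<lambda>x. f' k x + \<epsilon>) x)) (lip_a (\<lambda>x. f' k x + (-\<epsilon>)) x)"
          by (intro max.mono lip_a_max_min(2) LIP_bd_add fg fg' LIP_bd_const order_refl)
        also have "\<dots> \<le> max (lip_a (f k) x) (lip_a (f' k) x)"
          using lip_shift[of k \<epsilon> x] lip_shift[of k "-\<epsilon>" x] by linarith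
        also have "\<dots> \<le> lip_a (f k) x + lip_a (f' k) x" using lip_a_nonneg[of "f k" x] lip_a_nonneg[of "f' k" x] by simp
        finally show ?thesis using elim False by (simp add: J_def)
      qed
    qed
    have lip_w: "AE x in n. lip_a (w k) x \<le> p k x" for k
      using lip_h[of k] fg'(3)[of k]
    proof eventually_elim
      case (elim x)
      have *: "\<eta> x * lip_a (h k) x + (1 - \<eta> x) * lip_a (f' k) x \<le>
          \<eta> x * (g k x + J k x * g' k x) + (1 - \<eta> x) * g' k x"
        using \<eta>(2,3)[of x] elim by (intro add_mono mult_left_mono) auto
      show ?case
      proof (cases "x \<in> cball x0 (R + 1)")
        case True
        have "lip_a (w k) x \<le> \<eta> x * lip_a (h k) x + (1 - \<eta> x) * lip_a (f' k) x + L * \<epsilon>"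
          unfolding w_def by (rule lip_a_interpolate(2)[OF hb fg'(1) \<eta> hd])
        then show ?thesis using * True by (simp add: p_def S_def)
      next
        case False
        have "\<eta> y = 0" if "dist x y < 1" for y
          using supp[of y] False that dist_triangle[of x0 x y] by (simp add: dist_commute)
        then have "lip_a (w k) x \<le> lip_a (f' k) x" "\<eta> x = 0"
          by (auto intro!: lip_a_local[OF wb fg'(1), of 1] simp: w_def)
        then show ?thesis using * False by (simp add: p_def S_def)
      qed
    qed
    have ev: "AE x in n. \<forall>\<^sub>F k in sequentially. \<bar>f k x - f' k x\<bar> < \<epsilon>"
      using fg(4) fg'(4)
    proof eventually_elim
      case (elim x)
      have "(\<lambda>k. \<bar>f k x - f' k x\<bar>) \<longlonglongrightarrow> \<bar>F x - F x\<bar>" by (intro tendsto_intros elim)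
      then show ?case by (rule order_tendstoD(2)) (simp add: \<epsilon>)
    qed
    show ?thesis
    proof (rule upper_slope_seqI[OF wb _ lip_w F])
      show "sqi n (p k)" for k unfolding p_def by (intro sqi_add s\<eta> sJ fg fg' sqi_cmult S)
      show "sqi n (\<lambda>x. (\<eta> x * G1 x + (1 - \<eta> x) * G2 x) + (L * \<epsilon>) * S x)"
        by (intro sqi_add s\<eta> G1 G2 sqi_cmult S)
      show "AE x in n. (\<lambda>k. w k x) \<longlonglongrightarrow> F x"
        using fg(4) fg'(4)
      proof eventually_elim
        case (elim x)
        have "(\<lambda>k. w k x) \<longlonglongrightarrow> \<eta> x * max (min (F x) (F x + \<epsilon>)) (F x + (-\<epsilon>)) + (1 - \<eta> x) * F x"
          unfolding w_def h_def by (intro tendsto_intros elim)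
        moreover have "max (min (F x) (F x + \<epsilon>)) (F x + (-\<epsilon>)) = F x" using \<epsilon> by auto
        ultimately show ?case by (simp add: algebra_simps)
      qed
      have J0: "(\<lambda>k. nsq n (\<lambda>x. J k x * g' k x - 0 * G2 x)) \<longlonglongrightarrow> 0"
      proof (rule nsq_tendsto_mult_bounded[OF fg'(2) G2 Jm, where H = "\<lambda>_. 0" and K = 1])
        show "AE x in n. (\<lambda>k. J k x) \<longlonglongrightarrow> 0"
          using ev
        proof eventually_elim
          case (elim x)
          then have "\<forall>\<^sub>F k in sequentially. J k x = 0" by eventually_elim (simp add: J_def)
          then show ?case by (rule tendsto_eventually)
        qed
      qed (auto simp: J_def intro: fg'(5))
      have A: "(\<lambda>k. nsq n (\<lambda>x. (g k x + J k x * g' k x) - (G1 x + 0 * G2 x))) \<longlonglongrightarrow> 0"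
        by (rule nsq_tendsto_add[OF fg(2) sJ G1 _ fg(5) J0]) (simp add: sqi_zero)
      have s0: "sqi n (\<lambda>x. G1 x + 0 * G2 x)" using G1 by simp
      have B: "(\<lambda>k. nsq n (\<lambda>x. \<eta> x * (g k x + J k x * g' k x) - \<eta> x * (G1 x + 0 * G2 x))) \<longlonglongrightarrow> 0"
        by (rule nsq_tendsto_mult_bounded[OF sqi_add[OF fg(2) sJ] s0 _ _ _ _ _ A, where K = 1]) (use bd\<eta> in auto)
      have C: "(\<lambda>k. nsq n (\<lambda>x. (1 - \<eta> x) * g' k x - (1 - \<eta> x) * G2 x)) \<longlonglongrightarrow> 0"
        by (rule nsq_tendsto_mult_bounded[OF fg'(2) G2 _ _ _ _ _ fg'(5), where K = 1]) (use bd\<eta> in auto)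
      have "(\<lambda>k. nsq n (\<lambda>x. (\<eta> x * (g k x + J k x * g' k x) + (1 - \<eta> x) * g' k x) -
          (\<eta> x * (G1 x + 0 * G2 x) + (1 - \<eta> x) * G2 x))) \<longlonglongrightarrow> 0"
        by (rule nsq_tendsto_add[OF s\<eta>(1)[OF sqi_add[OF fg(2) sJ]] s\<eta>(2)[OF fg'(2)] s\<eta>(1)[OF s0] s\<eta>(2)[OF G2] B C])
      moreover have "p k x - ((\<eta> x * G1 x + (1 - \<eta> x) * G2 x) + (L * \<epsilon>) * S x) =
        (\<eta> x * (g k x + J k x * g' k x) + (1 - \<eta> x) * g' k x) - (\<eta> x * (G1 x + 0 * G2 x) + (1 - \<eta> x) * G2 x)" for k x
        by (simp add: p_def)
      ultimately show "(\<lambda>k. nsq n (\<lambda>x. p k x - ((\<eta> x * G1 x + (1 - \<eta> x) * G2 x) + (L * \<epsilon>) * S x))) \<longlonglongrightarrow> 0"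
        by (simp only:)
    qed
  qed
  show ?thesis
  proof (rule upper_slope_closed[OF main F])
    show "1 / real (Suc k) > 0" for k by simp
    show "sqi n (\<lambda>x. \<eta> x * G1 x + (1 - \<eta> x) * G2 x)" by (intro sqi_add s\<eta> G1 G2)
    have "(\<lambda>k. (L * (1 / real (Suc k)))\<^sup>2 * nsq n S) \<longlonglongrightarrow> (L * 0)\<^sup>2 * nsq n S"
      by (intro tendsto_intros LIMSEQ_Suc[OF lim_1_over_n])
    then have "(\<lambda>k. nsq n (\<lambda>x. L * (1 / real (Suc k)) * S x)) \<longlonglongrightarrow> 0" unfolding nsq_cmult by simp
    moreover have "(\<eta> x * G1 x + (1 - \<eta> x) * G2 x) + c * S x - (\<eta> x * G1 x + (1 - \<eta> x) * G2 x) = c * S x" for x c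
      by simp
    ultimately show "(\<lambda>k. nsq n (\<lambda>x. (\<eta> x * G1 x + (1 - \<eta> x) * G2 x) + L * (1 / real (Suc k)) * S x -
      (\<eta> x * G1 x + (1 - \<eta> x) * G2 x))) \<longlonglongrightarrow> 0" by (simp only:)
  qed simp
qed

text \<open>The sets along which upper slopes can be glued contain the closed sets and form a
  \<open>\<sigma>\<close>-algebra.\<close>

lemma upper_slope_glue:
  assumes u1: "upper_slope n F G1" and u2: "upper_slope n F G2" and B: "B \<in> sets borel"
  shows "upper_slope n F (\<lambda>x. if x \<in> B then G1 x else G2 x)"
proof -
  have F [measurable]: "F \<in> borel_measurable n" by (rule upper_slope_D[OF u1])
  have ind: "(\<lambda>x. indicat_real B x * G1 x + (1 - indicat_real B x) * G2 x) = (\<lambda>x. if x \<in> B then G1 x else G2 x)"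
    for B :: "'z set" and G1 G2 by (auto simp: indicator_def)
  have lim: "upper_slope n F (\<lambda>x. if x \<in> B then G1 x else G2 x)"
    if u: "\<And>k::nat. upper_slope n F (\<lambda>x. \<eta> k x * G1 x + (1 - \<eta> k x) * G2 x)" and G: "sqi n G1" "sqi n G2"
      and \<eta>: "\<And>k. \<eta> k \<in> borel_measurable n" "\<And>k x. 0 \<le> \<eta> k x" "\<And>k x. \<eta> k x \<le> 1"
      and B: "B \<in> sets borel" and l: "\<And>x. (\<lambda>k. \<eta> k x) \<longlonglongrightarrow> indicator B x" for \<eta> B G1 G2
  proof -
    have [measurable]: "B \<in> sets n" using B by (simp add: sets_n)
    note \<eta>(1)[measurable]
    have bd: "\<bar>\<eta> k x\<bar> \<le> 1" "\<bar>1 - \<eta> k x\<bar> \<le> 1" "\<bar>indicat_real B x\<bar> \<le> 1" "\<bar>1 - indicat_real B x\<bar> \<le> 1" for k x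
      using \<eta>(2,3)[of k x] by (auto simp: indicator_def)
    have l': "(\<lambda>k. 1 - \<eta> k x) \<longlonglongrightarrow> 1 - indicat_real B x" for x by (intro tendsto_intros l)
    have s: "sqi n (\<lambda>x. \<eta> k x * G1 x)" "sqi n (\<lambda>x. (1 - \<eta> k x) * G2 x)"
      "sqi n (\<lambda>x. indicat_real B x * G1 x)" "sqi n (\<lambda>x. (1 - indicat_real B x) * G2 x)" for k
      by (rule sqi_mult_bounded[OF G(1), of _ 1] sqi_mult_bounded[OF G(2), of _ 1]; use bd in simp)+
    have "upper_slope n F (\<lambda>x. indicat_real B x * G1 x + (1 - indicat_real B x) * G2 x)"
    proof (rule upper_slope_closed[OF u F sqi_add[OF s(3,4)]])
      show "(\<lambda>k. nsq n (\<lambda>x. \<eta> k x * G1 x + (1 - \<eta> k x) * G2 x -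
        (indicat_real B x * G1 x + (1 - indicat_real B x) * G2 x))) \<longlonglongrightarrow> 0"
      proof (rule nsq_tendsto_add[OF s])
        show "(\<lambda>k. nsq n (\<lambda>x. \<eta> k x * G1 x - indicat_real B x * G1 x)) \<longlonglongrightarrow> 0"
          by (rule nsq_tendsto_mult_bounded[OF G(1) G(1), where K = 1]) (use bd l in auto)
        show "(\<lambda>k. nsq n (\<lambda>x. (1 - \<eta> k x) * G2 x - (1 - indicat_real B x) * G2 x)) \<longlonglongrightarrow> 0"
          by (rule nsq_tendsto_mult_bounded[OF G(2) G(2), where K = 1]) (use bd l' in auto)
      qed
    qed simp
    then show ?thesis unfolding ind .
  qed
  define P where "P B \<longleftrightarrow> B \<in> sets borel \<and> (\<forall>G1 G2. upper_slope n F G1 \<longrightarrow> upper_slope n F G2 \<longrightarrow>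
    upper_slope n F (\<lambda>x. if x \<in> B then G1 x else G2 x))" for B :: "'z set"
  have empty: "P {}" by (simp add: P_def)
  have "B \<in> sigma_sets UNIV (Collect closed)" using B borel_eq_closed by (metis sets_measure_of top_greatest Pow_UNIV)
  then have "P B"
  proof induction
    case (Basic C)
    then have C: "closed C" by simp
    show "P C"
    proof (cases "C = {}")
      case True then show ?thesis using empty by simp
    next
      case False
      define x0 :: 'z where "x0 = undefined"
      \<comment> \<open>The functions \<open>a k\<close> tend to the indicator of \<open>C\<close>
        because \<open>C\<close> is closed; the factor \<open>b k\<close> supplies the bounded
        support demanded by \<open>upper_slope_interpolate\<close> and is eventually 1 at each
        point.\<close>
      define a where "a k x = max 0 (1 + (- real k) * infdist x C)" for k x
      define b where "b k x = max 0 (min 1 (real k + (-1) * dist x x0))" for k x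
      define \<eta> where "\<eta> k x = min (a k x) (b k x)" for k x
      have d: "1-lipschitz_on UNIV (\<lambda>x. infdist x C)" "1-lipschitz_on UNIV (\<lambda>x. dist x x0)"
      proof (rule lipschitz_onI)
        show "dist (infdist x C) (infdist y C) \<le> 1 * dist x y" for x y
          using infdist_triangle_abs[of x C y] by (simp add: dist_real_def)
      next
        show "1-lipschitz_on UNIV (\<lambda>x. dist x x0)"
        proof (rule lipschitz_onI)
          show "dist (dist x x0) (dist y x0) \<le> 1 * dist x y" for x y
            using dist_triangle[of x x0 y] dist_triangle[of y x0 x] by (simp add: dist_real_def abs_le_iff dist_commute)
        qed simp
      qed simp
      have "\<exists>L. L-lipschitz_on UNIV (\<eta> k)" for k
      proof -
        let ?L = "real k + 1"
        have c: "?L-lipschitz_on UNIV (\<lambda>_. c)" for c :: real by (rule lipschitz_on_mono[OF lipschitz_on_constant]) auto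
        have "(0 + \<bar>- real k\<bar> * 1)-lipschitz_on UNIV (\<lambda>x. 1 + (- real k) * infdist x C)"
          by (intro lipschitz_on_add lipschitz_on_constant lipschitz_on_cmult_real d)
        then have 1: "?L-lipschitz_on UNIV (\<lambda>x. 1 + (- real k) * infdist x C)" by (rule lipschitz_on_mono) auto
        have "(0 + \<bar>-1\<bar> * 1)-lipschitz_on UNIV (\<lambda>x. real k + (-1) * dist x x0)"
          by (intro lipschitz_on_add lipschitz_on_constant lipschitz_on_cmult_real d)
        then have 2: "?L-lipschitz_on UNIV (\<lambda>x. real k + (-1) * dist x x0)" by (rule lipschitz_on_mono) auto
        have "?L-lipschitz_on UNIV (\<eta> k)"
          unfolding \<eta>_def a_def b_def by (intro lipschitz_on_max_min c 1 2)
        then show ?thesis by blast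
      qed
      then obtain L :: "nat \<Rightarrow> real" where L: "\<And>k. (L k)-lipschitz_on UNIV (\<eta> k)" by metis
      have r: "0 \<le> \<eta> k x" "\<eta> k x \<le> 1" for k x by (auto simp: \<eta>_def a_def b_def infdist_nonneg)
      have l: "(\<lambda>k. \<eta> k x) \<longlonglongrightarrow> indicator C x" for x
      proof -
        have "\<forall>\<^sub>F k in sequentially. \<eta> k x = indicator C x"
        proof -
          obtain N1 :: nat where N1: "dist x x0 + 1 < real N1" using reals_Archimedean2 by blast
          have "\<exists>N2. \<forall>k\<ge>N2. a k x = indicator C x"
          proof (cases "x \<in> C")
            case True then show ?thesis by (simp add: a_def)
          next
            case False2: False
            have pos: "infdist x C > 0"
              using in_closed_iff_infdist_zero[OF C \<open>C \<noteq> {}\<close>, of x] False2 infdist_nonneg[of x C] by linarith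
            then obtain N2 :: nat where N2: "1 / infdist x C < real N2" using reals_Archimedean2 by blast
            have "a k x = 0" if "k \<ge> N2" for k
            proof -
              have "1 / infdist x C < real k" using N2 that by linarith
              then have "1 < real k * infdist x C" using pos by (simp add: divide_less_eq)
              then show ?thesis by (simp add: a_def)
            qed
            then show ?thesis using False2 by auto
          qed
          then obtain N2 where N2: "\<And>k. k \<ge> N2 \<Longrightarrow> a k x = indicator C x" by blast
          have "\<eta> k x = indicator C x" if "k \<ge> max N1 N2" for k
          proof -
            have "real k \<ge> real N1" using that by simp
            then have "b k x = 1" using N1 unfolding b_def by linarith
            then show ?thesis using N2[of k] that by (simp add: \<eta>_def indicator_def)
          qed
          then show ?thesis unfolding eventually_sequentially by blast
        qed
        then show ?thesis by (rule tendsto_eventually)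
      qed
      have "upper_slope n F (\<lambda>x. if x \<in> C then G1 x else G2 x)"
        if u: "upper_slope n F G1" "upper_slope n F G2" for G1 G2
      proof (rule lim[of \<eta>])
        show "upper_slope n F (\<lambda>x. \<eta> k x * G1 x + (1 - \<eta> k x) * G2 x)" for k
        proof (rule upper_slope_interpolate[OF u L r])
          show "\<eta> k y = 0" if "dist x0 y > real k" for y
            using that by (simp add: \<eta>_def b_def a_def dist_commute)
        qed
        show "\<eta> k \<in> borel_measurable n" for k by (rule LIP_bd_meas[OF lipschitz_LIP_bd[OF L]])
      qed (use C r l upper_slope_D(2) u in auto)
      then show ?thesis using C by (simp add: P_def)
    qed
  next
    case Empty then show ?case by (rule empty)
  next
    case (Compl C)
    then have C: "C \<in> sets borel" and g: "\<And>G1 G2. upper_slope n F G1 \<Longrightarrow> upper_slope n F G2 \<Longrightarrow>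
      upper_slope n F (\<lambda>x. if x \<in> C then G1 x else G2 x)" by (auto simp: P_def)
    have "UNIV - C \<in> sets borel" using C by auto
    moreover have "(if x \<in> UNIV - C then a else b) = (if x \<in> C then b else a)" for x and a b :: real by simp
    ultimately show ?case unfolding P_def using g by (simp only:) blast
  next
    case (Union A)
    have m: "\<Union>(range A) \<in> sets borel" using Union by (auto simp: P_def)
    have "upper_slope n F (\<lambda>x. if x \<in> \<Union>(range A) then G1 x else G2 x)"
      if u: "upper_slope n F G1" "upper_slope n F G2" for G1 G2
    proof (rule lim[of "\<lambda>k. indicator (\<Union>i<k. A i)"])
      \<comment> \<open>Gluing along one set after the other handles finite unions; the sets need
        not be disjoint, since \<open>G1\<close> is chosen on all of them.\<close>
      have fin: "upper_slope n F (\<lambda>x. if x \<in> (\<Union>i<k. A i) then G1 x else G2 x)" for k :: nat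
      proof (induction k)
        case 0 then show ?case using u by simp
      next
        case (Suc k)
        have "upper_slope n F (\<lambda>x. if x \<in> A k then G1 x else (if x \<in> (\<Union>i<k. A i) then G1 x else G2 x))"
          using Union[of k] u(1) Suc unfolding P_def by blast
        moreover have "(if x \<in> A k then G1 x else (if x \<in> (\<Union>i<k. A i) then G1 x else G2 x)) =
          (if x \<in> (\<Union>i<Suc k. A i) then G1 x else G2 x)" for x by (auto simp: less_Suc_eq)
        ultimately show ?case by (simp only:)
      qed
      then show "upper_slope n F (\<lambda>x. indicat_real (\<Union>i<k. A i) x * G1 x + (1 - indicat_real (\<Union>i<k. A i) x) * G2 x)" for k
        unfolding ind .
      have Am: "A i \<in> sets n" for i using Union[of i] by (simp add: P_def sets_n)
      then show "indicat_real (\<Union>i<k. A i) \<in> borel_measurable n" for k by measurable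
      show "(\<lambda>k. indicat_real (\<Union>i<k. A i) x) \<longlonglongrightarrow> indicat_real (\<Union>(range A)) x" for x
      proof (rule tendsto_eventually)
        show "\<forall>\<^sub>F k in sequentially. indicat_real (\<Union>i<k. A i) x = indicat_real (\<Union>(range A)) x"
        proof (cases "x \<in> \<Union>(range A)")
          case True
          then obtain i where "x \<in> A i" by blast
          then have "\<forall>k\<ge>Suc i. indicat_real (\<Union>i<k. A i) x = indicat_real (\<Union>(range A)) x"
            by (auto simp: indicator_def)
          then show ?thesis unfolding eventually_sequentially by blast
        qed (auto simp: indicator_def)
      qed
    qed (use m upper_slope_D(2) u in \<open>auto simp: indicator_def\<close>)
    then show ?case using m by (simp add: P_def)
  qed
  then show ?thesis using u1 u2 by (simp add: P_def)
qed

section \<open>Least upper slopes, semicontinuity and Mazur's lemma\<close>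

lemma upper_slope_midpoint:
  assumes "upper_slope n F G1" "upper_slope n F G2"
  shows "upper_slope n F (\<lambda>x. (G1 x + G2 x) / 2)"
  using upper_slope_add[OF upper_slope_cmult[OF assms(1), of "1/2"] upper_slope_cmult[OF assms(2), of "1/2"]]
  by (simp add: field_simps)

text \<open>Take the upper slope of least norm, found by minimising along a constant sequence of
  sets. If another upper slope were smaller on a set of positive measure, gluing it in there would
  lower the norm.\<close>

lemma least_upper_slope_exists:
  assumes u: "upper_slope n F G"
  obtains G0 where "upper_slope n F G0" "\<And>H. upper_slope n F H \<Longrightarrow> AE x in n. G0 x \<le> H x"
proof -
  define C where "C k = {G. upper_slope n F G}" for k :: nat
  obtain f G0 where f: "\<And>N. f N \<in> C N" and G0: "sqi n G0" "(\<lambda>N. nsq n (\<lambda>x. f N x - G0 x)) \<longlonglongrightarrow> 0"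
    and min: "\<And>B'. (\<And>N. \<exists>f\<in>C N. nsq n f \<le> B') \<Longrightarrow> nsq n G0 \<le> B'"
  proof (rule midpoint_convex_minimising[of C n "nsq n G"])
    show "\<And>N f. f \<in> C N \<Longrightarrow> sqi n f" unfolding C_def using upper_slope_D(2) by blast
    show "\<And>N f g. f \<in> C N \<Longrightarrow> g \<in> C N \<Longrightarrow> (\<lambda>x. (f x + g x) / 2) \<in> C N"
      unfolding C_def using upper_slope_midpoint by blast
    show "\<And>N. \<exists>f\<in>C N. nsq n f \<le> nsq n G" unfolding C_def using u by blast
  qed (auto simp: C_def)
  have uf: "upper_slope n F (f N)" for N using f[of N] by (simp add: C_def)
  have u0: "upper_slope n F G0"
    by (rule upper_slope_closed[OF uf upper_slope_D(1)[OF u] G0(1) _ G0(2)]) simp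
  show thesis
  proof (rule that[OF u0])
    fix H assume H: "upper_slope n F H"
    note [measurable] = sqi_measurable[OF upper_slope_D(2)[OF H]] sqi_measurable[OF G0(1)]
    \<comment> \<open>On \<open>B\<close> the competitor wins. The glued function \<open>K\<close>
      has a norm no smaller than that of \<open>G0\<close> although it lies below \<open>G0\<close>
      and is nonnegative, so they agree a.e. and \<open>B\<close> is null.\<close>
    define B where "B = {x. H x < G0 x}"
    have "{x \<in> space n. H x < G0 x} \<in> sets n" by measurable
    then have B: "B \<in> sets borel" by (simp add: B_def space_n sets_n)
    define K where "K x = (if x \<in> B then H x else G0 x)" for x
    have K: "upper_slope n F K" unfolding K_def by (rule upper_slope_glue[OF H u0 B])
    have le: "nsq n G0 \<le> nsq n K" by (rule min) (auto simp: C_def intro: K)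
    have nn: "AE x in n. 0 \<le> (G0 x)\<^sup>2 - (K x)\<^sup>2"
      using upper_slope_nonneg[OF H]
    proof eventually_elim
      case (elim x)
      then show ?case by (auto simp: K_def B_def intro!: power_mono)
    qed
    have i: "integrable n (\<lambda>x. (G0 x)\<^sup>2 - (K x)\<^sup>2)"
      by (intro Bochner_Integration.integrable_diff sqi_integrable G0 upper_slope_D(2)[OF K])
    have "(\<integral>x. (G0 x)\<^sup>2 - (K x)\<^sup>2 \<partial>n) = nsq n G0 - nsq n K"
      by (intro Bochner_Integration.integral_diff sqi_integrable G0 upper_slope_D(2)[OF K])
    moreover have "0 \<le> (\<integral>x. (G0 x)\<^sup>2 - (K x)\<^sup>2 \<partial>n)" by (rule integral_nonneg_AE[OF nn])
    ultimately have "(\<integral>x. (G0 x)\<^sup>2 - (K x)\<^sup>2 \<partial>n) = 0" using le by linarith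
    then have "AE x in n. (G0 x)\<^sup>2 - (K x)\<^sup>2 = 0" using integral_nonneg_eq_0_iff_AE[OF i nn] by simp
    then show "AE x in n. G0 x \<le> H x"
      using upper_slope_nonneg[OF H]
    proof eventually_elim
      case (elim x)
      show ?case
      proof (rule ccontr)
        assume "\<not> G0 x \<le> H x"
        then have "(G0 x)\<^sup>2 = (H x)\<^sup>2" "H x < G0 x" using elim by (auto simp: K_def B_def)
        then show False using elim(2) power_strict_mono[of "H x" "G0 x" 2] by simp
      qed
    qed
  qed
qed

text \<open>Convex combinations of the \<open>f k\<close> with \<open>k\<close> at least
  \<open>N\<close>, described without coefficients: at a.e. point, \<open>h\<close> is as close to
  \<open>F\<close> as any uniform bound for the tail. This survives convex combinations and still
  forces a sequence chosen from successive tails to converge to \<open>F\<close>.\<close>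

definition tail_slopes :: "(nat \<Rightarrow> 'z \<Rightarrow> real) \<Rightarrow> ('z \<Rightarrow> real) \<Rightarrow> nat \<Rightarrow> ('z \<Rightarrow> real) set" where
  "tail_slopes f F N = {l. sqi n l \<and> (\<exists>h\<in>LIP_bd. (AE x in n. lip_a h x \<le> l x) \<and>
     (AE x in n. \<forall>e. (\<forall>k\<ge>N. \<bar>f k x - F x\<bar> \<le> e) \<longrightarrow> \<bar>h x - F x\<bar> \<le> e))}"

lemma tail_slopes_convex:
  assumes l: "l \<in> tail_slopes f F N" and l': "l' \<in> tail_slopes f F N" and t: "0 \<le> t" "t \<le> 1"
  shows "(\<lambda>x. (1 - t) * l x + t * l' x) \<in> tail_slopes f F N"
proof -
  obtain h h' where h: "h \<in> LIP_bd" "AE x in n. lip_a h x \<le> l x"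
      "AE x in n. \<forall>e. (\<forall>k\<ge>N. \<bar>f k x - F x\<bar> \<le> e) \<longrightarrow> \<bar>h x - F x\<bar> \<le> e"
    and h': "h' \<in> LIP_bd" "AE x in n. lip_a h' x \<le> l' x"
      "AE x in n. \<forall>e. (\<forall>k\<ge>N. \<bar>f k x - F x\<bar> \<le> e) \<longrightarrow> \<bar>h' x - F x\<bar> \<le> e"
    using l l' unfolding tail_slopes_def by blast
  have b: "(\<lambda>x. (1 - t) * h x + t * h' x) \<in> LIP_bd" by (intro LIP_bd_add LIP_bd_cmult h h')
  have s: "sqi n (\<lambda>x. (1 - t) * l x + t * l' x)"
    using l l' unfolding tail_slopes_def by (intro sqi_add sqi_cmult) auto
  have "AE x in n. lip_a (\<lambda>x. (1 - t) * h x + t * h' x) x \<le> (1 - t) * l x + t * l' x"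
    using h(2) h'(2)
  proof eventually_elim
    case (elim x)
    have "lip_a (\<lambda>x. (1 - t) * h x + t * h' x) x \<le> lip_a (\<lambda>x. (1 - t) * h x) x + lip_a (\<lambda>x. t * h' x) x"
      by (intro lip_a_add LIP_bd_cmult h h')
    also have "\<dots> \<le> \<bar>1 - t\<bar> * lip_a h x + \<bar>t\<bar> * lip_a h' x" by (intro add_mono lip_a_cmult h h')
    also have "\<dots> \<le> (1 - t) * l x + t * l' x" using elim t by (intro add_mono mult_mono) (auto simp: lip_a_nonneg)
    finally show ?case .
  qed
  moreover have "AE x in n. \<forall>e. (\<forall>k\<ge>N. \<bar>f k x - F x\<bar> \<le> e) \<longrightarrow> \<bar>(1 - t) * h x + t * h' x - F x\<bar> \<le> e"
    using h(3) h'(3)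
  proof eventually_elim
    case (elim x)
    show ?case
    proof (intro allI impI)
      fix e assume "\<forall>k\<ge>N. \<bar>f k x - F x\<bar> \<le> e"
      then have "\<bar>h x - F x\<bar> \<le> e" "\<bar>h' x - F x\<bar> \<le> e" using elim by blast+
      then have "(1 - t) * \<bar>h x - F x\<bar> + t * \<bar>h' x - F x\<bar> \<le> (1 - t) * e + t * e"
        using t by (intro add_mono mult_left_mono) auto
      moreover have "(1 - t) * h x + t * h' x - F x = (1 - t) * (h x - F x) + t * (h' x - F x)"
        by (simp add: algebra_simps)
      moreover have "\<bar>(1 - t) * (h x - F x) + t * (h' x - F x)\<bar> \<le> (1 - t) * \<bar>h x - F x\<bar> + t * \<bar>h' x - F x\<bar>"
        using t by (intro order_trans[OF abs_triangle_ineq]) (simp add: abs_mult)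
      ultimately show "\<bar>(1 - t) * h x + t * h' x - F x\<bar> \<le> e" by (simp add: algebra_simps)
    qed
  qed
  ultimately show ?thesis unfolding tail_slopes_def using b s by blast
qed

lemma tail_slopes_memI:
  assumes "f k \<in> LIP_bd" "sqi n l" "AE x in n. lip_a (f k) x \<le> l x" "N \<le> k"
  shows "l \<in> tail_slopes f F N"
  unfolding tail_slopes_def using assms by (auto intro!: bexI[of _ "f k"])

lemma tail_slopes_dec: "tail_slopes f F (Suc N) \<subseteq> tail_slopes f F N"
proof
  fix l assume "l \<in> tail_slopes f F (Suc N)"
  then obtain h where h: "sqi n l" "h \<in> LIP_bd" "AE x in n. lip_a h x \<le> l x"
    "AE x in n. \<forall>e. (\<forall>k\<ge>Suc N. \<bar>f k x - F x\<bar> \<le> e) \<longrightarrow> \<bar>h x - F x\<bar> \<le> e" unfolding tail_slopes_def by blast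
  from h(4) have "AE x in n. \<forall>e. (\<forall>k\<ge>N. \<bar>f k x - F x\<bar> \<le> e) \<longrightarrow> \<bar>h x - F x\<bar> \<le> e"
    by eventually_elim simp
  then show "l \<in> tail_slopes f F N" unfolding tail_slopes_def using h by blast
qed

lemma tail_slopes_limit:
  assumes F: "F \<in> borel_measurable n" and fF: "AE x in n. (\<lambda>k. f k x) \<longlonglongrightarrow> F x"
    and l: "\<And>N. l N \<in> tail_slopes f F N" and lim: "sqi n G" "(\<lambda>N. nsq n (\<lambda>x. l N x - G x)) \<longlonglongrightarrow> 0"
  shows "upper_slope n F G"
proof -
  have "\<forall>N. \<exists>h. h \<in> LIP_bd \<and> (AE x in n. lip_a h x \<le> l N x) \<and>
     (AE x in n. \<forall>e. (\<forall>k\<ge>N. \<bar>f k x - F x\<bar> \<le> e) \<longrightarrow> \<bar>h x - F x\<bar> \<le> e)"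
    using l unfolding tail_slopes_def by blast
  from choice[OF this] obtain h where h: "\<And>N. h N \<in> LIP_bd" "\<And>N. AE x in n. lip_a (h N) x \<le> l N x"
    "\<And>N. AE x in n. \<forall>e. (\<forall>k\<ge>N. \<bar>f k x - F x\<bar> \<le> e) \<longrightarrow> \<bar>h N x - F x\<bar> \<le> e" by blast
  have ls: "sqi n (l N)" for N using l[of N] unfolding tail_slopes_def by blast
  show ?thesis
  proof (rule upper_slope_seqI[OF h(1) ls h(2) F lim(1) _ lim(2)])
    have "AE x in n. \<forall>N e. (\<forall>k\<ge>N. \<bar>f k x - F x\<bar> \<le> e) \<longrightarrow> \<bar>h N x - F x\<bar> \<le> e"
      using h(3) by (simp add: AE_all_countable)
    then show "AE x in n. (\<lambda>N. h N x) \<longlonglongrightarrow> F x"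
      using fF
    proof eventually_elim
      case (elim x)
      show ?case
      proof (rule LIMSEQ_I)
        fix e :: real assume "e > 0"
        then obtain N where N: "\<And>k. k \<ge> N \<Longrightarrow> \<bar>f k x - F x\<bar> < e / 2"
          using LIMSEQ_D[OF elim(2), of "e / 2"] by auto
        have "norm (h M x - F x) < e" if "M \<ge> N" for M
        proof -
          have "\<forall>k\<ge>M. \<bar>f k x - F x\<bar> \<le> e / 2" using N that by (meson less_imp_le order_trans)
          then have "\<bar>h M x - F x\<bar> \<le> e / 2" using elim(1) by blast
          then show ?thesis using \<open>e > 0\<close> by simp
        qed
        then show "\<exists>N. \<forall>M\<ge>N. norm (h M x - F x) < e" by blast
      qed
    qed
  qed
qed

text \<open>Only a norm bound on the slopes is given. Near-minimisers of the norm in the tail sets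
  converge strongly, and their limit inherits the bound.\<close>

lemma upper_slope_lsc:
  assumes F: "F \<in> borel_measurable n" and f: "\<And>k. f k \<in> LIP_bd" "AE x in n. (\<lambda>k. f k x) \<longlonglongrightarrow> F x"
    and l: "\<And>k. sqi n (l k)" "\<And>k. AE x in n. lip_a (f k) x \<le> l k x" "\<And>k. nsq n (l k) \<le> B"
  obtains G where "upper_slope n F G" "nsq n G \<le> B"
proof -
  have mem: "l N \<in> tail_slopes f F N" for N by (rule tail_slopes_memI[OF f(1) l(1,2)]) simp
  obtain p G where p: "\<And>N. p N \<in> tail_slopes f F N" and G: "sqi n G" "(\<lambda>N. nsq n (\<lambda>x. p N x - G x)) \<longlonglongrightarrow> 0"
    and min: "\<And>B'. (\<And>N. \<exists>f\<in>tail_slopes f F N. nsq n f \<le> B') \<Longrightarrow> nsq n G \<le> B'"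
  proof (rule midpoint_convex_minimising[of "tail_slopes f F" n B])
    show "\<And>N g. g \<in> tail_slopes f F N \<Longrightarrow> sqi n g" unfolding tail_slopes_def by blast
    show "\<And>N. tail_slopes f F (Suc N) \<subseteq> tail_slopes f F N" by (rule tail_slopes_dec)
    show "(\<lambda>x. (g x + g' x) / 2) \<in> tail_slopes f F N"
      if "g \<in> tail_slopes f F N" "g' \<in> tail_slopes f F N" for N g g'
    proof -
      have "(\<lambda>x. (1 - 1 / 2) * g x + 1 / 2 * g' x) = (\<lambda>x. (g x + g' x) / 2)" by (auto simp: field_simps)
      with tail_slopes_convex[OF that, of "1/2"] show ?thesis by (simp only:)
    qed
    show "\<And>N. \<exists>g\<in>tail_slopes f F N. nsq n g \<le> B" using mem l(3) by blast
  qed (rule that, assumption+, blast)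
  show thesis
  proof (rule that)
    show "upper_slope n F G" by (rule tail_slopes_limit[OF F f(2) p G])
    show "nsq n G \<le> B" using min mem l(3) by blast
  qed
qed

text \<open>Mazur's lemma: if \<open>p\<close> is the element of least norm of the closure of \<open>tail_slopes f F N - G\<close>, then
  \<open>\<langle>p, y\<rangle> \<ge> \<parallel>p\<parallel>\<^sup>2\<close> on this set, so \<open>p = 0\<close> by weak convergence. No boundedness is needed.\<close>

lemma upper_slope_weak_limit:
  assumes F: "F \<in> borel_measurable n" and f: "\<And>k. f k \<in> LIP_bd" "AE x in n. (\<lambda>k. f k x) \<longlonglongrightarrow> F x"
    and l: "\<And>k. sqi n (l k)" "\<And>k. AE x in n. lip_a (f k) x \<le> l k x" and G: "sqi n G"
    and w: "\<And>h. sqi n h \<Longrightarrow> (\<lambda>k. \<integral>x. l k x * h x \<partial>n) \<longlonglongrightarrow> (\<integral>x. G x * h x \<partial>n)"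
  shows "upper_slope n F G"
proof -
  have ex: "\<exists>q\<in>tail_slopes f F N. nsq n (\<lambda>x. q x - G x) < e" if e: "e > 0" for N and e :: real
  proof -
    define C where "C (k::nat) = {y. \<exists>q\<in>tail_slopes f F N. y = (\<lambda>x. q x - G x)}" for k
    have Cs: "sqi n y" if "y \<in> C k" for y k
      using that G unfolding C_def tail_slopes_def by (auto intro: sqi_diff)
    have conv: "(\<lambda>x. (1 - t) * y x + t * z x) \<in> C k" if yz: "y \<in> C k" "z \<in> C k" and t: "0 \<le> t" "t \<le> 1" for y z k t
    proof -
      obtain q q' where q: "q \<in> tail_slopes f F N" "y = (\<lambda>x. q x - G x)" "q' \<in> tail_slopes f F N" "z = (\<lambda>x. q' x - G x)"
        using yz unfolding C_def by blast
      have eq: "(\<lambda>x. (1 - t) * y x + t * z x) = (\<lambda>x. ((1 - t) * q x + t * q' x) - G x)"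
        by (auto simp: q algebra_simps)
      show ?thesis unfolding C_def eq 
        by (rule CollectI, rule bexI[of _ "\<lambda>x. (1 - t) * q x + t * q' x"], rule refl, rule tail_slopes_convex[OF q(1,3) t])
    qed
    have mem: "(\<lambda>x. l k x - G x) \<in> C j" if "k \<ge> N" for k j
      unfolding C_def using tail_slopes_memI[where f = f and F = F, OF f(1) l(1,2) that] by blast
    obtain y p where y: "\<And>k. y k \<in> C k" and p: "sqi n p" "(\<lambda>k. nsq n (\<lambda>x. y k x - p x)) \<longlonglongrightarrow> 0"
      and min: "\<And>B'. (\<And>k. \<exists>y\<in>C k. nsq n y \<le> B') \<Longrightarrow> nsq n p \<le> B'"
    proof (rule midpoint_convex_minimising[of C n "nsq n (\<lambda>x. l N x - G x)"])
      show "\<And>k y. y \<in> C k \<Longrightarrow> sqi n y" by (rule Cs)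
      show "\<And>k. C (Suc k) \<subseteq> C k" by (simp add: C_def)
      show "(\<lambda>x. (g x + g' x) / 2) \<in> C k" if "g \<in> C k" "g' \<in> C k" for k g g'
      proof -
        have "(\<lambda>x. (1 - 1 / 2) * g x + 1 / 2 * g' x) = (\<lambda>x. (g x + g' x) / 2)" by (auto simp: field_simps)
        with conv[OF that, of "1/2"] show ?thesis by (simp only:)
      qed
      show "\<exists>y\<in>C k. nsq n y \<le> nsq n (\<lambda>x. l N x - G x)" for k
        by (rule bexI[of _ "\<lambda>x. l N x - G x"], rule order_refl, rule mem, simp)
    qed (rule that, assumption+, blast)
    \<comment> \<open>The variational inequality for the nearest point: compare \<open>p\<close>
      with \<open>(1 - t) * p + t * z\<close>, divide by \<open>t\<close> and let \<open>t\<close>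
      tend to 0.\<close>
    have inner: "nsq n p \<le> (\<integral>x. z x * p x \<partial>n)" if z: "z \<in> C 0" for z
    proof -
      have zs: "sqi n z" by (rule Cs[OF z])
      have D: "sqi n (\<lambda>x. z x - p x)" by (rule sqi_diff[OF zs p(1)])
      have le: "nsq n p \<le> nsq n (\<lambda>x. (1 - t) * p x + t * z x)" if t: "0 \<le> t" "t \<le> 1" for t
      proof (rule LIMSEQ_le_const)
        have Y: "sqi n (\<lambda>x. (1 - t) * y k x + t * z x)" for k by (intro sqi_add sqi_cmult zs Cs[OF y])
        have "(\<lambda>k. nsq n (\<lambda>x. (1 - t) * (y k x - p x))) \<longlonglongrightarrow> (1 - t)\<^sup>2 * 0"
          unfolding nsq_cmult by (intro tendsto_mult_left p)
        moreover have "((1 - t) * y k x + t * z x) - ((1 - t) * p x + t * z x) = (1 - t) * (y k x - p x)" for k x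
          by (simp add: algebra_simps)
        ultimately have "(\<lambda>k. nsq n (\<lambda>x. ((1 - t) * y k x + t * z x) - ((1 - t) * p x + t * z x))) \<longlonglongrightarrow> 0"
          by (simp only: mult_zero_right)
        then show "(\<lambda>k. nsq n (\<lambda>x. (1 - t) * y k x + t * z x)) \<longlonglongrightarrow> nsq n (\<lambda>x. (1 - t) * p x + t * z x)"
          by (intro sqi_tendsto_nsq Y sqi_add sqi_cmult zs p)
        have "nsq n p \<le> nsq n (\<lambda>x. (1 - t) * y k x + t * z x)" for k
          by (rule min, rule bexI[of _ "\<lambda>x. (1 - t) * y k x + t * z x"], rule order_refl)
            (use conv[OF _ _ t] y z in \<open>auto simp: C_def\<close>)
        then show "\<exists>N. \<forall>k\<ge>N. nsq n p \<le> nsq n (\<lambda>x. (1 - t) * y k x + t * z x)" by blast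
      qed
      have pos: "0 \<le> 2 * ((\<integral>x. z x * p x \<partial>n) - nsq n p) + t * nsq n (\<lambda>x. z x - p x)" if t: "0 < t" "t \<le> 1" for t
      proof -
        have "((1 - t) * p x + t * z x)\<^sup>2 = (p x)\<^sup>2 + (2 * t) * (z x * p x) - (2 * t) * (p x)\<^sup>2 + t\<^sup>2 * (z x - p x)\<^sup>2" for x
          by (simp add: power2_eq_square algebra_simps)
        then have "nsq n (\<lambda>x. (1 - t) * p x + t * z x) =
          nsq n p + (2 * t) * (\<integral>x. z x * p x \<partial>n) - (2 * t) * nsq n p + t\<^sup>2 * nsq n (\<lambda>x. z x - p x)"
          using sqi_integrable[OF p(1)] integrable_sqi_mult[OF zs p(1)] sqi_integrable[OF D] by simp
        with le[of t] t have "0 \<le> t * (2 * ((\<integral>x. z x * p x \<partial>n) - nsq n p) + t * nsq n (\<lambda>x. z x - p x))"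
          by (simp add: power2_eq_square algebra_simps)
        then show ?thesis using t by (simp add: zero_le_mult_iff)
      qed
      have *: "0 \<le> 2 * ((\<integral>x. z x * p x \<partial>n) - nsq n p) + 1 / real (Suc k) * nsq n (\<lambda>x. z x - p x)" for k
        by (rule pos) simp_all
      have "(\<lambda>k. 2 * ((\<integral>x. z x * p x \<partial>n) - nsq n p) + 1 / real (Suc k) * nsq n (\<lambda>x. z x - p x))
        \<longlonglongrightarrow> 2 * ((\<integral>x. z x * p x \<partial>n) - nsq n p) + 0 * nsq n (\<lambda>x. z x - p x)"
        by (intro tendsto_intros LIMSEQ_Suc[OF lim_1_over_n])
      from LIMSEQ_le_const[OF this, of 0] * show ?thesis by auto
    qed
    \<comment> \<open>The weak convergence is tested against \<open>p\<close> itself; all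
      differences \<open>l k - G\<close> with \<open>k\<close> at least \<open>N\<close> belong to
      the set, so the pairings stay above the squared norm of \<open>p\<close> while tending to
      0.\<close>
    have "nsq n p \<le> 0"
    proof (rule LIMSEQ_le_const)
      have "(\<lambda>k. (\<integral>x. l k x * p x \<partial>n) - (\<integral>x. G x * p x \<partial>n)) \<longlonglongrightarrow> (\<integral>x. G x * p x \<partial>n) - (\<integral>x. G x * p x \<partial>n)"
        by (intro tendsto_intros w p)
      moreover have "(\<integral>x. l k x * p x \<partial>n) - (\<integral>x. G x * p x \<partial>n) = (\<integral>x. (l k x - G x) * p x \<partial>n)" for k
        using integrable_sqi_mult[OF l(1) p(1)] integrable_sqi_mult[OF G p(1)] by (simp add: left_diff_distrib)
      ultimately show "(\<lambda>k. \<integral>x. (l k x - G x) * p x \<partial>n) \<longlonglongrightarrow> 0" by (simp only: diff_self)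
      show "\<exists>M. \<forall>k\<ge>M. nsq n p \<le> (\<integral>x. (l k x - G x) * p x \<partial>n)" using inner mem by blast
    qed
    then have p0: "nsq n p = 0" by (intro antisym) auto
    have "(\<lambda>k. nsq n (y k)) \<longlonglongrightarrow> nsq n p" by (rule sqi_tendsto_nsq[OF Cs[OF y] p])
    then have "\<forall>\<^sub>F k in sequentially. nsq n (y k) < e" using e p0 by (intro order_tendstoD(2)) auto
    then obtain k where "nsq n (y k) < e" by (rule eventually_happens'[OF sequentially_bot, THEN exE])
    then show ?thesis using y[of k] unfolding C_def by auto
  qed
  have "\<forall>N. \<exists>q. q \<in> tail_slopes f F N \<and> nsq n (\<lambda>x. q x - G x) < 1 / real (Suc N)"
    using ex[of "1 / real (Suc _)"] by (auto simp: Bex_def)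
  from choice[OF this] obtain q where q: "\<And>N. q N \<in> tail_slopes f F N"
    "\<And>N. nsq n (\<lambda>x. q N x - G x) < 1 / real (Suc N)" by blast
  show ?thesis
    by (rule tail_slopes_limit[OF F f(2) q(1) G nsq_tendsto_0_le[OF less_imp_le[OF q(2)] LIMSEQ_Suc[OF lim_1_over_n]]])
qed

text \<open>Needed because the definition of relaxed slopes mentions \<open>lip_a\<close> itself. If
  \<open>lip_a (f k)\<close> stayed away from the dominating functions, its norm would fall short of
  that of \<open>G\<close> by a fixed amount along a subsequence, and semicontinuity would yield an
  upper slope of smaller norm than the least one.\<close>

lemma least_upper_slope_attained:
  assumes u: "upper_slope n F G" and least: "\<And>H. upper_slope n F H \<Longrightarrow> AE x in n. G x \<le> H x"
  obtains f where "\<And>k::nat. f k \<in> LIP_bd" "\<And>k. sqi n (lip_a (f k))" "AE x in n. (\<lambda>k. f k x) \<longlonglongrightarrow> F x"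
    "(\<lambda>k. nsq n (\<lambda>x. lip_a (f k) x - G x)) \<longlonglongrightarrow> 0"
proof -
  obtain f g where fg: "\<And>k::nat. f k \<in> LIP_bd" "\<And>k. sqi n (g k)" "\<And>k. AE x in n. lip_a (f k) x \<le> g k x"
    "AE x in n. (\<lambda>k. f k x) \<longlonglongrightarrow> F x" "(\<lambda>k. nsq n (\<lambda>x. g k x - G x)) \<longlonglongrightarrow> 0"
    by (rule upper_slope_seqE[OF u], rule that)
  note F = upper_slope_D(1)[OF u] and G = upper_slope_D(2)[OF u]
  define l where "l k = lip_a (f k)" for k
  have l: "sqi n (l k)" for k
    unfolding l_def
  proof (rule sqi_bound[OF fg(2) lip_a_meas[OF fg(1)]])
    show "AE x in n. \<bar>lip_a (f k) x\<bar> \<le> \<bar>g k x\<bar>"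
      using fg(3)[of k]
    proof eventually_elim
      case (elim x) then show ?case using lip_a_nonneg[of "f k" x] by simp
    qed
  qed
  \<comment> \<open>For \<open>0 \<le> l \<le> g\<close> one has
    \<open>(g - l)\<^sup>2 \<le> g\<^sup>2 - l\<^sup>2\<close>, so a distance in norm becomes a loss
    of norm.\<close>
  have gl: "nsq n (\<lambda>x. g k x - l k x) \<le> nsq n (g k) - nsq n (l k)" for k
  proof -
    have "nsq n (\<lambda>x. g k x - l k x) \<le> (\<integral>x. (g k x)\<^sup>2 - (l k x)\<^sup>2 \<partial>n)"
    proof (rule integral_mono_AE)
      show "AE x in n. (g k x - l k x)\<^sup>2 \<le> (g k x)\<^sup>2 - (l k x)\<^sup>2"
        using fg(3)[of k]
      proof eventually_elim
        case (elim x)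
        have "0 \<le> 2 * (l k x * (g k x - l k x))" using elim lip_a_nonneg[of "f k" x] by (simp add: l_def)
        then show ?case by (simp add: power2_eq_square algebra_simps)
      qed
    qed (intro sqi_integrable sqi_diff fg l Bochner_Integration.integrable_diff)+
    also have "\<dots> = nsq n (g k) - nsq n (l k)" by (intro Bochner_Integration.integral_diff sqi_integrable fg l)
    finally show ?thesis .
  qed
  have gG: "(\<lambda>k. nsq n (g k)) \<longlonglongrightarrow> nsq n G" by (rule sqi_tendsto_nsq[OF fg(2) G fg(5)])
  have "(\<lambda>k. nsq n (\<lambda>x. g k x - l k x)) \<longlonglongrightarrow> 0"
  proof (rule ccontr)
    assume "\<not> (\<lambda>k. nsq n (\<lambda>x. g k x - l k x)) \<longlonglongrightarrow> 0"
    then obtain e where e: "e > 0" "\<And>N. \<exists>k\<ge>N. nsq n (\<lambda>x. g k x - l k x) \<ge> e"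
      unfolding LIMSEQ_def dist_real_def by (force simp: not_less)
    have "\<forall>\<^sub>F k in sequentially. nsq n (g k) < nsq n G + e / 2" using e by (intro order_tendstoD(2)[OF gG]) simp
    then obtain M where M: "\<And>k. k \<ge> M \<Longrightarrow> nsq n (g k) < nsq n G + e / 2" by (auto simp: eventually_sequentially)
    have "\<forall>j. \<exists>k. k \<ge> max M j \<and> nsq n (\<lambda>x. g k x - l k x) \<ge> e" using e(2) by blast
    from choice[OF this] obtain r where r: "\<And>j. r j \<ge> max M j" "\<And>j. nsq n (\<lambda>x. g (r j) x - l (r j) x) \<ge> e" by blast
    \<comment> \<open>Of the loss \<open>e\<close>, one half pays for \<open>nsq n (g k)\<close>
      exceeding its limit; the other half remains as the contradiction.\<close>
    have small: "nsq n (l (r j)) \<le> nsq n G - e / 2" for j using gl[of "r j"] r(2)[of j] M[of "r j"] r(1)[of j] by simp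
    have "filterlim r at_top sequentially"
      by (rule filterlim_at_top_mono[OF filterlim_ident]) (use r(1) in \<open>auto intro!: always_eventually\<close>)
    then have conv: "AE x in n. (\<lambda>j. f (r j) x) \<longlonglongrightarrow> F x"
      using fg(4) by (auto elim!: eventually_mono intro: filterlim_compose)
    obtain H where H: "upper_slope n F H" "nsq n H \<le> nsq n G - e / 2"
      by (rule upper_slope_lsc[OF F, where f = "\<lambda>j. f (r j)" and l = "\<lambda>j. l (r j)"])
        (use conv fg(1) l small that in \<open>simp_all add: l_def\<close>)
    have "nsq n G \<le> nsq n H"
    proof (rule nsq_mono[OF upper_slope_D(2)[OF H(1)]])
      show "AE x in n. \<bar>G x\<bar> \<le> \<bar>H x\<bar>"
        using least[OF H(1)] upper_slope_nonneg[OF u] by eventually_elim simp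
    qed (use G in measurable)
    then show False using H(2) e(1) by simp
  qed
  then have gl0: "(\<lambda>k. nsq n (\<lambda>x. l k x - g k x)) \<longlonglongrightarrow> 0" by (subst nsq_minus_commute)
  have "(\<lambda>k. nsq n (\<lambda>x. ((l k x - g k x) + g k x) - (0 + G x))) \<longlonglongrightarrow> 0"
    by (rule nsq_tendsto_add[OF sqi_diff[OF l fg(2)] fg(2) sqi_zero G _ fg(5)]) (use gl0 in simp)
  then have "(\<lambda>k. nsq n (\<lambda>x. l k x - G x)) \<longlonglongrightarrow> 0" by simp
  then show thesis using that[of f] fg(1,4) l unfolding l_def by blast
qed

section \<open>Relaxed slopes\<close>

text \<open>Borel-Cantelli on growing balls: the index \<open>r j\<close> is chosen so that, inside
  the ball of radius \<open>j\<close>, the set of error above \<open>1 / real (Suc j)\<close> has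
  measure below 2^-j. Every point lies in all large balls.\<close>

lemma L0_tendsto_subseq:
  assumes f: "\<And>k::nat. f k \<in> borel_measurable n" and F: "F \<in> carrier (L0 n)"
    and lim: "L0_tendsto_in_measure n (\<lambda>k. L0_cls n (f k)) F"
  obtains r :: "nat \<Rightarrow> nat" where "\<And>j. j \<le> r j" "AE x in n. (\<lambda>j. f (r j) x) \<longlonglongrightarrow> L0_rep F x"
proof -
  define h where "h k = L0_rep (L0_cls n (f k))" for k
  have hm: "h k \<in> borel_measurable n" for k unfolding h_def by (rule L0_rep_measurable[OF L0_cls_carrier[OF f]])
  note [measurable] = hm L0_rep_measurable[OF F]
  define A where "A j = (ball undefined (real j) :: 'z set)" for j :: nat
  have [measurable]: "A j \<in> sets n" for j by (simp add: A_def sets_n)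
  have Afin: "emeasure n (A j) < \<infinity>" for j using bounded_fin[of "A j"] by (simp add: A_def)
  define E where "E j k = {x \<in> A j. \<bar>h k x - L0_rep F x\<bar> > 1 / real (Suc j)}" for j k
  have Em [measurable]: "E j k \<in> sets n" for j k
  proof -
    have "E j k = {x \<in> space n. x \<in> A j \<and> \<bar>h k x - L0_rep F x\<bar> > 1 / real (Suc j)}"
      by (auto simp: E_def space_n)
    also have "\<dots> \<in> sets n" by measurable
    finally show ?thesis .
  qed
  have "\<exists>k\<ge>j. emeasure n (E j k) < ennreal ((1/2) ^ j)" for j
  proof -
    have "(\<lambda>k. emeasure n (E j k)) \<longlonglongrightarrow> 0"
      using lim Afin[of j] unfolding L0_tendsto_in_measure_def E_def h_def by auto
    then have "\<forall>\<^sub>F k in sequentially. emeasure n (E j k) < ennreal ((1/2) ^ j)"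
      by (rule order_tendstoD(2)) simp
    then obtain N where N: "\<And>k. k \<ge> N \<Longrightarrow> emeasure n (E j k) < ennreal ((1/2) ^ j)"
      by (auto simp: eventually_sequentially)
    show ?thesis by (rule exI[of _ "max N j"]) (simp add: N)
  qed
  then obtain r where r: "\<And>j. j \<le> r j" "\<And>j. emeasure n (E j (r j)) < ennreal ((1/2) ^ j)" by metis
  have m: "measure n (E j (r j)) \<le> (1/2) ^ j" for j
    using less_imp_le[OF r(2)[of j]] unfolding measure_def by (intro enn2real_leI) auto
  have "AE x in n. eventually (\<lambda>j. x \<in> space n - E j (r j)) sequentially"
  proof (rule borel_cantelli_AE1)
    show "emeasure n (E j (r j)) < \<infinity>" for j using order.strict_trans[OF r(2)[of j]] by auto
    show "summable (\<lambda>j. measure n (E j (r j)))"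
      by (rule summable_comparison_test'[of "\<lambda>j. (1/2) ^ j" 0]) (use m in \<open>auto simp: summable_geometric\<close>)
  qed measurable
  moreover have "AE x in n. \<forall>k. h k x = f k x"
    unfolding AE_all_countable h_def using L0_rep_cls[OF f] by blast
  ultimately have "AE x in n. (\<lambda>j. f (r j) x) \<longlonglongrightarrow> L0_rep F x"
  proof eventually_elim
    case (elim x)
    obtain M :: nat where M: "dist undefined x < real M" using reals_Archimedean2 by blast
    have "\<forall>\<^sub>F j in sequentially. norm (f (r j) x - L0_rep F x) \<le> 1 / real (Suc j)"
      using elim(1) eventually_ge_at_top[of M]
    proof eventually_elim
      case (elim j)
      have "dist undefined x < real j" using M elim(2) by (meson less_le_trans of_nat_le_iff)
      then have "\<not> \<bar>h (r j) x - L0_rep F x\<bar> > 1 / real (Suc j)" using elim(1) by (simp add: E_def A_def)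
      then show ?case using \<open>\<forall>k. h k x = f k x\<close> by simp
    qed
    then have "(\<lambda>j. f (r j) x - L0_rep F x) \<longlonglongrightarrow> 0"
      by (rule Lim_null_comparison[OF _ LIMSEQ_Suc[OF lim_1_over_n]])
    then show ?case by (rule LIM_zero_cancel)
  qed
  with r(1) show thesis by (rule that)
qed

text \<open>On a set of finite measure the indicators of the exceptional sets tend to 0 a.e. and are
  dominated by the indicator of that set.\<close>

lemma L0_tendsto_in_measureI:
  assumes f: "\<And>k::nat. f k \<in> borel_measurable n" and F: "F \<in> carrier (L0 n)"
    and lim: "AE x in n. (\<lambda>k. f k x) \<longlonglongrightarrow> L0_rep F x"
  shows "L0_tendsto_in_measure n (\<lambda>k. L0_cls n (f k)) F"
  unfolding L0_tendsto_in_measure_def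
proof (intro ballI impI allI)
  fix A and \<epsilon> :: real assume A [measurable]: "A \<in> sets n" and fin: "emeasure n A < \<infinity>" and \<epsilon>: "\<epsilon> > 0"
  define h where "h k = L0_rep (L0_cls n (f k))" for k
  have hm: "h k \<in> borel_measurable n" for k unfolding h_def by (rule L0_rep_measurable[OF L0_cls_carrier[OF f]])
  note [measurable] = hm L0_rep_measurable[OF F]
  define E where "E k = {x \<in> A. \<bar>h k x - L0_rep F x\<bar> > \<epsilon>}" for k
  have Em [measurable]: "E k \<in> sets n" for k
  proof -
    have "E k = {x \<in> space n. x \<in> A \<and> \<bar>h k x - L0_rep F x\<bar> > \<epsilon>}" by (auto simp: E_def space_n)
    also have "\<dots> \<in> sets n" by measurable
    finally show ?thesis .
  qed
  have sub: "emeasure n (E k) \<le> emeasure n A" for k by (intro emeasure_mono) (auto simp: E_def)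
  have "(\<lambda>k. \<integral>x. indicat_real (E k) x \<partial>n) \<longlonglongrightarrow> (\<integral>x. 0 \<partial>n)"
  proof (rule integral_dominated_convergence[where w = "indicat_real A"])
    show "integrable n (indicat_real A)" using fin by (intro integrable_real_indicator) auto
    have "AE x in n. \<forall>k. h k x = f k x"
      unfolding AE_all_countable h_def using L0_rep_cls[OF f] by blast
    then show "AE x in n. (\<lambda>k. indicat_real (E k) x) \<longlonglongrightarrow> 0"
      using lim
    proof eventually_elim
      case (elim x)
      obtain N where "\<And>k. k \<ge> N \<Longrightarrow> norm (f k x - L0_rep F x) < \<epsilon>" using LIMSEQ_D[OF elim(2) \<epsilon>] by blast
      then have "\<not> \<epsilon> < \<bar>h k x - L0_rep F x\<bar>" if "k \<ge> N" for k
        using elim(1) that by (simp add: not_less less_imp_le)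
      then have "\<forall>k\<ge>N. indicat_real (E k) x = 0" by (simp add: E_def indicator_def)
      then show ?case by (intro tendsto_eventually) (auto simp: eventually_sequentially)
    qed
    show "AE x in n. norm (indicat_real (E k) x) \<le> indicat_real A x" for k
      by (intro always_eventually allI) (auto simp: E_def indicator_def)
  qed measurable
  then have "(\<lambda>k. measure n (E k)) \<longlonglongrightarrow> 0" by (simp add: space_n)
  then have "(\<lambda>k. ennreal (measure n (E k))) \<longlonglongrightarrow> ennreal 0" by (rule tendsto_ennrealI)
  moreover have "ennreal (measure n (E k)) = emeasure n (E k)" for k
    using le_less_trans[OF sub[of k] fin] by (intro emeasure_eq_ennreal_measure[symmetric]) auto
  ultimately have "(\<lambda>k. emeasure n (E k)) \<longlonglongrightarrow> 0" by simp
  then show "(\<lambda>k. emeasure n {x \<in> A. \<epsilon> < \<bar>L0_rep (L0_cls n (f k)) x - L0_rep F x\<bar>}) \<longlonglongrightarrow> 0"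
    by (simp add: E_def h_def)
qed

lemma L2_iff: "G \<in> L2 n \<longleftrightarrow> G \<in> carrier (L0 n) \<and> sqi n (L0_rep G)"
  by (auto simp: L2_def sqi_def dest: L0_rep_measurable)

lemma sqi_cong_AE: "sqi n f \<Longrightarrow> g \<in> borel_measurable n \<Longrightarrow> AE x in n. g x = f x \<Longrightarrow> sqi n g"
  by (erule (1) sqi_bound, erule AE_mp) simp

lemma L2_cls: "sqi n g \<Longrightarrow> L0_cls n g \<in> L2 n"
proof -
  assume g: "sqi n g"
  then have m: "g \<in> borel_measurable n" by (rule sqi_measurable)
  show ?thesis
    unfolding L2_iff using sqi_cong_AE[OF g L0_rep_measurable[OF L0_cls_carrier[OF m]] L0_rep_cls[OF m]] m by simp
qed

lemma L2_cls_D: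
  assumes g: "g \<in> borel_measurable n" and "L0_cls n g \<in> L2 n" shows "sqi n g"
proof (rule sqi_cong_AE[of "L0_rep (L0_cls n g)"])
  show "AE x in n. g x = L0_rep (L0_cls n g) x" using L0_rep_cls[OF g] by eventually_elim simp
qed (use assms in \<open>simp_all add: L2_iff\<close>)

lemma integral_rep_cls_mult:
  assumes f: "f \<in> borel_measurable n" and h: "h \<in> borel_measurable n"
  shows "(\<integral>x. L0_rep (L0_cls n f) x * L0_rep (L0_cls n h) x \<partial>n) = (\<integral>x. f x * h x \<partial>n)"
proof (rule integral_cong_AE)
  show "AE x in n. L0_rep (L0_cls n f) x * L0_rep (L0_cls n h) x = f x * h x"
    using L0_rep_cls[OF f] L0_rep_cls[OF h] by eventually_elim simp
qed (intro borel_measurable_times L0_rep_measurable[OF L0_cls_carrier] assms)+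

text \<open>One half of the bridge to the given definition: along an a.e. convergent subsequence,
  Mazur's lemma replaces the weak limit of slopes by a strong one.\<close>

lemma relaxed_slope_upper:
  assumes F: "F \<in> carrier (L0 n)" and G: "G \<in> relaxed_slopes n F"
  shows "upper_slope n (L0_rep F) (L0_rep G)"
proof -
  obtain fs where fs: "range fs \<subseteq> LIP_bd" "L0_tendsto_in_measure n (\<lambda>k. L0_cls n (fs k)) F"
    "L2_weakly_tendsto n (\<lambda>k. L0_cls n (lip_a (fs k))) G" and GL: "G \<in> L2 n"
    using G unfolding relaxed_slopes_def by blast
  have b: "fs k \<in> LIP_bd" for k using fs(1) by blast
  obtain r :: "nat \<Rightarrow> nat" where r: "\<And>j. j \<le> r j" "AE x in n. (\<lambda>j. fs (r j) x) \<longlonglongrightarrow> L0_rep F x"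
    by (rule L0_tendsto_subseq[OF LIP_bd_meas[OF b] F fs(2)], rule that)
  have l: "sqi n (lip_a (fs k))" for k
    using fs(3) by (intro L2_cls_D lip_a_meas b) (auto simp: L2_weakly_tendsto_def)
  have rlim: "filterlim r at_top sequentially"
    by (rule filterlim_at_top_mono[OF filterlim_ident]) (use r(1) in \<open>auto intro!: always_eventually\<close>)
  have g: "sqi n (L0_rep G)" using GL by (simp add: L2_iff)
  show ?thesis
  proof (rule upper_slope_weak_limit[OF L0_rep_measurable[OF F] b r(2) l _ g])
    fix h assume h: "sqi n h"
    have "(\<lambda>k. \<integral>x. L0_rep (L0_cls n (lip_a (fs k))) x * L0_rep (L0_cls n h) x \<partial>n)
      \<longlonglongrightarrow> (\<integral>x. L0_rep G x * L0_rep (L0_cls n h) x \<partial>n)"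
      using fs(3) L2_cls[OF h] unfolding L2_weakly_tendsto_def by blast
    moreover have "(\<integral>x. L0_rep G x * L0_rep (L0_cls n h) x \<partial>n) = (\<integral>x. L0_rep G x * h x \<partial>n)"
      using integral_rep_cls_mult[OF sqi_measurable[OF g] sqi_measurable[OF h]] L0_cls_rep[of G n] GL by (simp add: L2_iff)
    ultimately have "(\<lambda>k. \<integral>x. lip_a (fs k) x * h x \<partial>n) \<longlonglongrightarrow> (\<integral>x. L0_rep G x * h x \<partial>n)"
      unfolding integral_rep_cls_mult[OF lip_a_meas[OF b] sqi_measurable[OF h]] by (simp only:)
    from filterlim_compose[OF this rlim]
    show "(\<lambda>j. \<integral>x. lip_a (fs (r j)) x * h x \<partial>n) \<longlonglongrightarrow> (\<integral>x. L0_rep G x * h x \<partial>n)" .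
  qed simp
qed

text \<open>The other half: the least upper slope is a strong, hence weak, limit of genuine
  asymptotic Lipschitz constants, so it is a relaxed slope; as every relaxed slope is an upper
  slope, the two minima coincide.\<close>

lemma min_slope_aux:
  assumes F: "F \<in> carrier (L0 n)" and u: "upper_slope n (L0_rep F) G"
  shows "min_slope n F \<in> relaxed_slopes n F"
    and "\<And>H. upper_slope n (L0_rep F) H \<Longrightarrow> AE x in n. L0_rep (min_slope n F) x \<le> H x"
proof -
  obtain G0 where G0: "upper_slope n (L0_rep F) G0" "\<And>H. upper_slope n (L0_rep F) H \<Longrightarrow> AE x in n. G0 x \<le> H x"
    by (rule least_upper_slope_exists[OF u], rule that)
  obtain f where f: "\<And>k::nat. f k \<in> LIP_bd" "\<And>k. sqi n (lip_a (f k))" "AE x in n. (\<lambda>k. f k x) \<longlonglongrightarrow> L0_rep F x"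
    "(\<lambda>k. nsq n (\<lambda>x. lip_a (f k) x - G0 x)) \<longlonglongrightarrow> 0"
    by (rule least_upper_slope_attained[OF G0], assumption, rule that)
  note g0 = upper_slope_D(2)[OF G0(1)]
  have rep: "AE x in n. L0_rep (L0_cls n G0) x = G0 x" by (rule L0_rep_cls[OF sqi_measurable[OF g0]])
  have mem: "L0_cls n G0 \<in> relaxed_slopes n F"
    unfolding relaxed_slopes_def
  proof (intro CollectI conjI exI[of _ f])
    show "L0_cls n G0 \<in> L2 n" by (rule L2_cls[OF g0])
    show "range f \<subseteq> LIP_bd" using f(1) by blast
    show "L0_tendsto_in_measure n (\<lambda>k. L0_cls n (f k)) F"
      by (rule L0_tendsto_in_measureI[OF LIP_bd_meas[OF f(1)] F f(3)])
    show "L2_weakly_tendsto n (\<lambda>k. L0_cls n (lip_a (f k))) (L0_cls n G0)"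
      unfolding L2_weakly_tendsto_def
    proof (intro conjI ballI)
      show "range (\<lambda>k. L0_cls n (lip_a (f k))) \<subseteq> L2 n" using L2_cls[OF f(2)] by blast
      show "L0_cls n G0 \<in> L2 n" by (rule L2_cls[OF g0])
      fix H assume "H \<in> L2 n"
      then have H: "H \<in> carrier (L0 n)" "sqi n (L0_rep H)" by (auto simp: L2_iff)
      have "(\<integral>x. L0_rep (L0_cls n q) x * L0_rep H x \<partial>n) = (\<integral>x. q x * L0_rep H x \<partial>n)"
        if "q \<in> borel_measurable n" for q
        using integral_rep_cls_mult[OF that sqi_measurable[OF H(2)]] L0_cls_rep[OF H(1)] by simp
      note eq = this[OF lip_a_meas[OF f(1)]] this[OF sqi_measurable[OF g0]]
      show "(\<lambda>k. \<integral>x. L0_rep (L0_cls n (lip_a (f k))) x * L0_rep H x \<partial>n)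
        \<longlonglongrightarrow> (\<integral>x. L0_rep (L0_cls n G0) x * L0_rep H x \<partial>n)"
        unfolding eq by (rule sqi_tendsto_integral[OF f(2) g0 H(2) f(4)])
    qed
  qed
  have "min_slope n F = L0_cls n G0"
    unfolding min_slope_def
  proof (rule L0_least_eqI[OF _ mem])
    show "relaxed_slopes n F \<subseteq> carrier (L0 n)" by (auto simp: relaxed_slopes_def L2_def)
    fix H assume "H \<in> relaxed_slopes n F"
    from G0(2)[OF relaxed_slope_upper[OF F this]] rep show "L0_le n (L0_cls n G0) H"
      unfolding L0_le_def by eventually_elim simp
  qed
  then show "min_slope n F \<in> relaxed_slopes n F"
    and "\<And>H. upper_slope n (L0_rep F) H \<Longrightarrow> AE x in n. L0_rep (min_slope n F) x \<le> H x"
    using mem AE_mp[OF rep AE_mp[OF G0(2)]] by simp_all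
qed

text \<open>With \<open>min_slope_props\<close> this lets the Sobolev class and the minimal slope be
  handled through \<open>upper_slope\<close> alone.\<close>

lemma S2_iff: "F \<in> S2 n \<longleftrightarrow> F \<in> carrier (L0 n) \<and> (\<exists>G. upper_slope n (L0_rep F) G)"
  unfolding S2_def using relaxed_slope_upper min_slope_aux(1) by blast

lemma S2_carrier: "F \<in> S2 n \<Longrightarrow> F \<in> carrier (L0 n)"
  by (simp add: S2_iff)

lemma min_slope_props:
  assumes "F \<in> S2 n"
  shows upper_slope_min_slope: "upper_slope n (L0_rep F) (L0_rep (min_slope n F))"
    and min_slope_least: "\<And>H. upper_slope n (L0_rep F) H \<Longrightarrow> AE x in n. L0_rep (min_slope n F) x \<le> H x"
proof -
  have F: "F \<in> carrier (L0 n)" using assms by (simp add: S2_iff)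
  obtain G where G: "upper_slope n (L0_rep F) G" using assms by (auto simp: S2_iff)
  show "upper_slope n (L0_rep F) (L0_rep (min_slope n F))" by (rule relaxed_slope_upper[OF F min_slope_aux(1)[OF F G]])
  show "\<And>H. upper_slope n (L0_rep F) H \<Longrightarrow> AE x in n. L0_rep (min_slope n F) x \<le> H x" by (rule min_slope_aux(2)[OF F G])
qed

lemma upper_slope_rep_cls:
  assumes "upper_slope n f G" shows "upper_slope n (L0_rep (L0_cls n f)) G"
proof -
  note f = upper_slope_D(1)[OF assms]
  show ?thesis
    by (rule upper_slope_cong_AE[OF assms L0_rep_measurable[OF L0_cls_carrier[OF f]]])
      (use L0_rep_cls[OF f] upper_slope_D(2)[OF assms] in \<open>auto dest: sqi_measurable\<close>)
qed

lemma S2_clsI: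
  assumes "upper_slope n f G"
  shows "L0_cls n f \<in> S2 n" "AE x in n. L0_rep (min_slope n (L0_cls n f)) x \<le> G x"
proof -
  show s: "L0_cls n f \<in> S2 n" unfolding S2_iff using upper_slope_rep_cls[OF assms] upper_slope_D(1)[OF assms] by blast
  show "AE x in n. L0_rep (min_slope n (L0_cls n f)) x \<le> G x"
    by (rule min_slope_least[OF s upper_slope_rep_cls[OF assms]])
qed

lemma S2_add:
  assumes F: "F \<in> S2 n" and G: "G \<in> S2 n"
  shows "F \<oplus>\<^bsub>L0 n\<^esub> G \<in> S2 n"
proof -
  note c = S2_carrier[OF F] S2_carrier[OF G]
  note u = upper_slope_add[OF upper_slope_min_slope[OF F] upper_slope_min_slope[OF G]]
  have "upper_slope n (L0_rep (F \<oplus>\<^bsub>L0 n\<^esub> G)) (\<lambda>x. L0_rep (min_slope n F) x + L0_rep (min_slope n G) x)"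
    by (rule upper_slope_cong_AE[OF u L0_rep_measurable[OF L0_add_carrier[OF c]]])
      (use L0_rep_add[OF c] sqi_measurable[OF upper_slope_D(2)[OF u]] in auto)
  then show ?thesis unfolding S2_iff using L0_add_carrier[OF c] by blast
qed

lemma S2_cmult:
  assumes F: "F \<in> S2 n"
  shows "L0_cls n (\<lambda>_. c) \<otimes>\<^bsub>L0 n\<^esub> F \<in> S2 n"
proof -
  have m: "L0_cls n (\<lambda>_. c) \<in> carrier (L0 n)" by simp
  note C = S2_carrier[OF F]
  note u = upper_slope_cmult[OF upper_slope_min_slope[OF F], of c]
  have "upper_slope n (L0_rep (L0_cls n (\<lambda>_. c) \<otimes>\<^bsub>L0 n\<^esub> F)) (\<lambda>x. \<bar>c\<bar> * L0_rep (min_slope n F) x)"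
    by (rule upper_slope_cong_AE[OF u L0_rep_measurable[OF L0_mult_carrier[OF m C]]])
      (use L0_cls_cmult[OF C, of c] sqi_measurable[OF upper_slope_D(2)[OF u]] in auto)
  then show ?thesis unfolding S2_iff using L0_mult_carrier[OF m C] by blast
qed

text \<open>Write \<open>F = g + (F - g)\<close>; by \<open>upper_slope_nonzero\<close> the second
  summand contributes no slope where \<open>F = g\<close>.\<close>

lemma min_slope_local_le:
  assumes F: "F \<in> S2 n" and G: "upper_slope n g G"
  shows "AE x in n. L0_rep F x = g x \<longrightarrow> L0_rep (min_slope n F) x \<le> G x"
proof -
  define f where "f = L0_rep F"
  have u: "upper_slope n (\<lambda>x. f x + (-1) * g x) (\<lambda>x. L0_rep (min_slope n F) x + \<bar>-1\<bar> * G x)"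
    unfolding f_def by (intro upper_slope_add upper_slope_cmult upper_slope_min_slope F G)
  have "upper_slope n (\<lambda>x. g x + (f x + (-1) * g x))
    (\<lambda>x. G x + (if f x + (-1) * g x = 0 then 0 else L0_rep (min_slope n F) x + \<bar>-1\<bar> * G x))"
    by (rule upper_slope_add[OF G upper_slope_nonzero[OF u]])
  then have "upper_slope n (L0_rep F)
    (\<lambda>x. G x + (if f x + (-1) * g x = 0 then 0 else L0_rep (min_slope n F) x + \<bar>-1\<bar> * G x))"
    by (simp add: f_def)
  from min_slope_least[OF F this] show ?thesis by eventually_elim (auto simp: f_def split: if_splits)
qed

lemma min_slope_local:
  assumes F: "F \<in> S2 n" and G: "G \<in> S2 n"
  shows "AE x in n. L0_rep F x = L0_rep G x \<longrightarrow> L0_rep (min_slope n F) x = L0_rep (min_slope n G) x"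
  using min_slope_local_le[OF F upper_slope_min_slope[OF G]] min_slope_local_le[OF G upper_slope_min_slope[OF F]]
  by eventually_elim auto

end

section \<open>Local Lipschitz bounds for functions on the real line\<close>

lemma lip_near_deriv:
  fixes \<phi> \<phi>' :: "real \<Rightarrow> real"
  assumes d: "r > 0" "\<And>s. dist t s < r \<Longrightarrow> (\<phi> has_real_derivative \<phi>' s) (at s)" and c: "isCont \<phi>' t" and e: "e > 0"
  shows "lip_near \<phi> t (\<bar>\<phi>' t\<bar> + e)"
proof -
  have "\<exists>s>0. \<forall>x. dist x t < s \<longrightarrow> dist (\<phi>' x) (\<phi>' t) < e"
    using c e unfolding continuous_at_eps_delta by blast
  then obtain s where s: "s > 0" "\<And>x. dist x t < s \<Longrightarrow> dist (\<phi>' x) (\<phi>' t) < e" by blast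
  have b: "\<bar>\<phi>' x\<bar> \<le> \<bar>\<phi>' t\<bar> + e" if "dist x t < s" for x using s(2)[OF that] by (simp add: dist_real_def)
  show ?thesis
  proof (rule lip_nearI[of "min r s"])
    fix y z assume yz: "dist t y < min r s" "dist t z < min r s"
    have "norm (\<phi> y - \<phi> z) \<le> (\<bar>\<phi>' t\<bar> + e) * norm (y - z)"
    proof (rule field_differentiable_bound[of "ball t (min r s)" \<phi> \<phi>'])
      show "(\<phi> has_field_derivative \<phi>' w) (at w within ball t (min r s))" if "w \<in> ball t (min r s)" for w
        using that by (intro has_field_derivative_at_within[OF d(2)]) simp
      show "norm (\<phi>' w) \<le> \<bar>\<phi>' t\<bar> + e" if "w \<in> ball t (min r s)" for w using b[of w] that by (simp add: dist_commute)
    qed (use yz in auto)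
    then show "\<bar>\<phi> y - \<phi> z\<bar> \<le> (\<bar>\<phi>' t\<bar> + e) * dist y z" by (simp add: dist_real_def)
  qed (use d s e in auto)
qed

lemma lip_near_comp_left:
  fixes \<phi> \<psi> :: "real \<Rightarrow> real"
  assumes "lip_near \<phi> t c" "1-lipschitz_on UNIV \<psi>" shows "lip_near (\<lambda>s. \<psi> (\<phi> s)) t c"
proof -
  obtain r where r: "r > 0" "c-lipschitz_on (ball t r) \<phi>" using assms(1) by (auto simp: lip_near_def)
  have "(1 * c)-lipschitz_on (ball t r) (\<lambda>s. \<psi> (\<phi> s))"
    by (rule lipschitz_on_compose2[OF r(2) lipschitz_on_subset[OF assms(2)]]) simp
  then show ?thesis using r(1) by (auto simp: lip_near_def)
qed

lemma lip_near_comp_right: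
  fixes \<phi> \<psi> :: "real \<Rightarrow> real"
  assumes "lip_near \<phi> (\<psi> t) c" "1-lipschitz_on UNIV \<psi>" shows "lip_near (\<lambda>s. \<phi> (\<psi> s)) t c"
proof -
  obtain r where r: "r > 0" "c-lipschitz_on (ball (\<psi> t) r) \<phi>" using assms(1) by (auto simp: lip_near_def)
  have "\<psi> ` ball t r \<subseteq> ball (\<psi> t) r"
  proof safe
    fix s assume "s \<in> ball t r"
    then show "\<psi> s \<in> ball (\<psi> t) r" using lipschitz_onD[OF assms(2), of t s] by simp
  qed
  then have "(c * 1)-lipschitz_on (ball t r) (\<lambda>s. \<phi> (\<psi> s))"
    by (intro lipschitz_on_compose2[OF lipschitz_on_subset[OF assms(2)]] lipschitz_on_subset[OF r(2)]) auto
  then show ?thesis using r(1) by (auto simp: lip_near_def)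
qed

section \<open>Limits of uniformly bounded functions with convergent slopes\<close>

context bounded_finite
begin

lemma dev_le_sqrt_nsq:
  assumes "sqi (finite_equiv n) f"
  shows "dev f \<le> sqrt (nsq (finite_equiv n) f) * sqrt (measure (finite_equiv n) (space n))"
proof -
  have one: "sqi (finite_equiv n) (\<lambda>_. 1)" by (simp add: sqi_def)
  have m: "f \<in> borel_measurable n"
    using sqi_measurable[OF assms] by (simp add: measurable_finite_equiv[OF sigma_finite])
  have "dev f \<le> (\<integral>x. \<bar>f x\<bar> * 1 \<partial>finite_equiv n)"
    unfolding dev_def
    by (intro integral_mono integrable_dev m integrable_sqi_mult sqi_abs assms one) simp
  also have "\<dots> \<le> \<bar>\<integral>x. \<bar>f x\<bar> * 1 \<partial>finite_equiv n\<bar>" by simp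
  also have "\<dots> \<le> sqrt (nsq (finite_equiv n) (\<lambda>x. \<bar>f x\<bar>)) * sqrt (nsq (finite_equiv n) (\<lambda>_. 1))"
    by (rule Cauchy_Schwarz_sqi[OF sqi_abs[OF assms] one])
  finally show ?thesis by (simp add: sets_eq_imp_space_eq[OF sets_finite_equiv[OF sigma_finite]])
qed

text \<open>No convergence is known off \<open>E\<close>. A uniform bound places the functions in a
  ball of L2 for the equivalent finite measure, where the minimisation argument supplies convergent
  combinations. The predicate \<open>good\<close> collects what must survive these combinations:
  having a slope, the bound, closeness to \<open>a\<close> on \<open>E\<close>, and closeness of the
  slopes to \<open>W'\<close>.\<close>

lemma bounded_upper_slopes_limit:
  assumes u: "\<And>k::nat. upper_slope n (\<theta> k) (W k)" and bd: "\<And>k. AE x in n. \<bar>\<theta> k x\<bar> \<le> c"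
    and W': "sqi n W'" "(\<lambda>k. nsq n (\<lambda>x. W k x - W' x)) \<longlonglongrightarrow> 0"
    and E: "AE x in n. x \<in> E \<longrightarrow> (\<lambda>k. \<theta> k x) \<longlonglongrightarrow> a x"
  obtains \<theta>' where "upper_slope n \<theta>' W'" "AE x in n. \<bar>\<theta>' x\<bar> \<le> c" "AE x in n. x \<in> E \<longrightarrow> \<theta>' x = a x"
proof -
  let ?n = "finite_equiv n"
  define near where "near N h x \<longleftrightarrow> (\<forall>e. (\<forall>k\<ge>N. \<bar>\<theta> k x - a x\<bar> \<le> e) \<longrightarrow> \<bar>h x - a x\<bar> \<le> e)" for N h x
  define good where "good N h V \<longleftrightarrow> upper_slope n h V \<and> (AE x in n. \<bar>h x\<bar> \<le> c) \<and> (AE x in n. x \<in> E \<longrightarrow> near N h x) \<and>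
    (\<forall>e. (\<forall>k\<ge>N. nsq n (\<lambda>x. W k x - W' x) \<le> e) \<longrightarrow> nsq n (\<lambda>x. V x - W' x) \<le> e)" for N h V
  define C where "C N = {h. \<exists>V. good N h V}" for N
  have sq: "sqi ?n h \<and> nsq ?n h \<le> (\<integral>x. c\<^sup>2 \<partial>?n)" if "h \<in> borel_measurable n" "AE x in n. \<bar>h x\<bar> \<le> c" for h
  proof -
    have c: "sqi ?n (\<lambda>_. c)" by (simp add: sqi_def)
    have ae: "AE x in ?n. \<bar>h x\<bar> \<le> \<bar>c\<bar>"
      unfolding AE_finite_equiv[OF sigma_finite] using that(2) by eventually_elim simp
    have m: "h \<in> borel_measurable ?n" using that(1) by (simp add: measurable_finite_equiv[OF sigma_finite])
    show ?thesis using sqi_bound[OF c m ae] nsq_mono[OF c m ae] by blast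
  qed
  have good_sq: "sqi ?n h \<and> nsq ?n h \<le> (\<integral>x. c\<^sup>2 \<partial>?n)" if "h \<in> C N" for h N
    using that sq upper_slope_D(1) unfolding C_def good_def by blast
  have mem: "\<theta> N \<in> C N" for N
    unfolding C_def good_def near_def using u bd by (intro CollectI exI[of _ "W N"]) auto
  obtain f \<theta>' where f: "\<And>N. f N \<in> C N" and \<theta>': "sqi ?n \<theta>'" "(\<lambda>N. nsq ?n (\<lambda>x. f N x - \<theta>' x)) \<longlonglongrightarrow> 0"
  proof (rule midpoint_convex_minimising[of C ?n "\<integral>x. c\<^sup>2 \<partial>?n"])
    show "\<And>N f. f \<in> C N \<Longrightarrow> sqi ?n f" using good_sq by blast
    show "C (Suc N) \<subseteq> C N" for N
    proof
      fix h assume "h \<in> C (Suc N)"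
      then obtain V where V: "good (Suc N) h V" by (auto simp: C_def)
      then have "AE x in n. x \<in> E \<longrightarrow> near (Suc N) h x" by (simp add: good_def)
      then have "AE x in n. x \<in> E \<longrightarrow> near N h x" by eventually_elim (simp add: near_def)
      then have "good N h V" using V unfolding good_def by simp
      then show "h \<in> C N" by (auto simp: C_def)
    qed
    show "(\<lambda>x. (h x + h' x) / 2) \<in> C N" if hh: "h \<in> C N" "h' \<in> C N" for N h h'
    proof -
      obtain V V' where V: "good N h V" "good N h' V'" using hh by (auto simp: C_def)
      have up: "upper_slope n (\<lambda>x. (h x + h' x) / 2) (\<lambda>x. (V x + V' x) / 2)"
        using upper_slope_add[OF upper_slope_cmult[of h V "1/2"] upper_slope_cmult[of h' V' "1/2"]] V
        unfolding good_def by (simp add: field_simps)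
      have s: "sqi n V" "sqi n V'" using V upper_slope_D(2) unfolding good_def by blast+
      have "good N (\<lambda>x. (h x + h' x) / 2) (\<lambda>x. (V x + V' x) / 2)"
        unfolding good_def
      proof (intro conjI up allI impI)
        have "AE x in n. \<bar>h x\<bar> \<le> c" "AE x in n. \<bar>h' x\<bar> \<le> c" using V by (auto simp: good_def)
        then show "AE x in n. \<bar>(h x + h' x) / 2\<bar> \<le> c" by eventually_elim simp
        have "AE x in n. x \<in> E \<longrightarrow> near N h x" "AE x in n. x \<in> E \<longrightarrow> near N h' x" using V by (auto simp: good_def)
        then show "AE x in n. x \<in> E \<longrightarrow> near N (\<lambda>x. (h x + h' x) / 2) x"
        proof eventually_elim
          case (elim x)
          show ?case
            unfolding near_def
          proof (intro allI impI)
            fix e assume "x \<in> E" "\<forall>k\<ge>N. \<bar>\<theta> k x - a x\<bar> \<le> e"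
            then have "\<bar>h x - a x\<bar> \<le> e" "\<bar>h' x - a x\<bar> \<le> e" using elim by (auto simp: near_def)
            then show "\<bar>(h x + h' x) / 2 - a x\<bar> \<le> e" by (simp add: abs_le_iff field_simps)
          qed
        qed
        \<comment> \<open>Balls around \<open>W'\<close> are midpoint convex by the parallelogram
          law, so the slopes of the combinations remain as close to \<open>W'\<close> as the tail
          is.\<close>
        fix e assume e: "\<forall>k\<ge>N. nsq n (\<lambda>x. W k x - W' x) \<le> e"
        have "nsq n (\<lambda>x. V x - W' x) \<le> e" "nsq n (\<lambda>x. V' x - W' x) \<le> e" using V e unfolding good_def by blast+
        moreover have "nsq n (\<lambda>x. (V x - W' x) - (V' x - W' x)) =
          2 * nsq n (\<lambda>x. V x - W' x) + 2 * nsq n (\<lambda>x. V' x - W' x) - 4 * nsq n (\<lambda>x. ((V x - W' x) + (V' x - W' x)) / 2)"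
          by (rule nsq_parallelogram[OF sqi_diff[OF s(1) W'(1)] sqi_diff[OF s(2) W'(1)]])
        moreover have "0 \<le> nsq n (\<lambda>x. (V x - W' x) - (V' x - W' x))" by simp
        moreover have eq: "((V x - W' x) + (V' x - W' x)) / 2 = (V x + V' x) / 2 - W' x" for x
          by (simp add: field_simps)
        ultimately show "nsq n (\<lambda>x. (V x + V' x) / 2 - W' x) \<le> e" unfolding eq by linarith
      qed
      then show ?thesis by (auto simp: C_def)
    qed
    show "\<And>N. \<exists>f\<in>C N. nsq ?n f \<le> (\<integral>x. c\<^sup>2 \<partial>?n)" using mem good_sq by blast
  qed (rule that)
  have "\<forall>N. \<exists>V. good N (f N) V" using f by (simp add: C_def)
  from choice[OF this] obtain V where V: "\<And>N. good N (f N) (V N)" by blast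
  have uf: "upper_slope n (f N) (V N)" for N using V[of N] by (simp add: good_def)
  have fm: "f N \<in> borel_measurable n" for N by (rule upper_slope_D[OF uf])
  have \<theta>m: "\<theta>' \<in> borel_measurable n" using sqi_measurable[OF \<theta>'(1)] by (simp add: measurable_finite_equiv[OF sigma_finite])
  have fs: "sqi ?n (\<lambda>x. f N x - \<theta>' x)" for N using good_sq[OF f] \<theta>'(1) by (blast intro: sqi_diff)
  have "(\<lambda>N. dev (\<lambda>x. f N x - \<theta>' x)) \<longlonglongrightarrow> 0"
  proof (rule tendsto_sandwich[OF _ _ tendsto_const])
    show "\<forall>\<^sub>F N in sequentially. 0 \<le> dev (\<lambda>x. f N x - \<theta>' x)" by (simp add: dev_def)
    show "\<forall>\<^sub>F N in sequentially. dev (\<lambda>x. f N x - \<theta>' x) \<le>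
      sqrt (nsq ?n (\<lambda>x. f N x - \<theta>' x)) * sqrt (measure ?n (space n))"
      by (intro always_eventually allI dev_le_sqrt_nsq fs)
    have "(\<lambda>N. sqrt (nsq ?n (\<lambda>x. f N x - \<theta>' x)) * sqrt (measure ?n (space n)))
      \<longlonglongrightarrow> sqrt 0 * sqrt (measure ?n (space n))"
      by (intro tendsto_intros \<theta>')
    then show "(\<lambda>N. sqrt (nsq ?n (\<lambda>x. f N x - \<theta>' x)) * sqrt (measure ?n (space n))) \<longlonglongrightarrow> 0" by simp
  qed
  then obtain r :: "nat \<Rightarrow> nat" where r: "strict_mono r" "AE x in n. (\<lambda>k. f (r k) x - \<theta>' x) \<longlonglongrightarrow> 0"
    by (rule dev_tendsto_subseq[rotated]) (use fm \<theta>m in measurable)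
  from r(2) have conv: "AE x in n. (\<lambda>k. f (r k) x) \<longlonglongrightarrow> \<theta>' x" by eventually_elim (rule LIM_zero_cancel)
  have "(\<lambda>N. nsq n (\<lambda>x. V N x - W' x)) \<longlonglongrightarrow> 0"
  proof (rule LIMSEQ_I)
    fix e :: real assume "e > 0"
    then obtain M where M: "\<And>k. k \<ge> M \<Longrightarrow> norm (nsq n (\<lambda>x. W k x - W' x) - 0) < e / 2"
      using LIMSEQ_D[OF W'(2), of "e / 2"] by auto
    have "norm (nsq n (\<lambda>x. V N x - W' x) - 0) < e" if "N \<ge> M" for N
    proof -
      have "nsq n (\<lambda>x. W k x - W' x) \<le> e / 2" if "k \<ge> N" for k
        using M[of k] that \<open>N \<ge> M\<close> by simp
      then have "nsq n (\<lambda>x. V N x - W' x) \<le> e / 2" using V[of N] unfolding good_def by blast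
      then show ?thesis using \<open>e > 0\<close> by simp
    qed
    then show "\<exists>M. \<forall>N\<ge>M. norm (nsq n (\<lambda>x. V N x - W' x) - 0) < e" by blast
  qed
  from LIMSEQ_subseq_LIMSEQ[OF this r(1)] have Vr: "(\<lambda>k. nsq n (\<lambda>x. V (r k) x - W' x)) \<longlonglongrightarrow> 0"
    unfolding o_def .
  show thesis
  proof (rule that)
    show "upper_slope n \<theta>' W'" by (rule upper_slope_closed[OF uf \<theta>m W'(1) conv Vr])
    have "AE x in n. \<forall>k. \<bar>f k x\<bar> \<le> c" unfolding AE_all_countable using V by (auto simp: good_def)
    then show "AE x in n. \<bar>\<theta>' x\<bar> \<le> c"
      using conv
    proof eventually_elim
      case (elim x)
      show ?case by (rule LIMSEQ_le_const2[OF tendsto_rabs[OF elim(2)]]) (use elim(1) in blast)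
    qed
    have "AE x in n. \<forall>k. x \<in> E \<longrightarrow> near k (f k) x" unfolding AE_all_countable using V by (auto simp: good_def)
    then show "AE x in n. x \<in> E \<longrightarrow> \<theta>' x = a x"
      using conv E
    proof eventually_elim
      case (elim x)
      show ?case
      proof
        assume x: "x \<in> E"
        have "(\<lambda>k. f (r k) x) \<longlonglongrightarrow> a x"
        proof (rule LIMSEQ_I)
          fix e :: real assume "e > 0"
          then obtain M where M: "\<And>k. k \<ge> M \<Longrightarrow> norm (\<theta> k x - a x) < e / 2"
            using LIMSEQ_D[of "\<lambda>k. \<theta> k x" "a x" "e / 2"] elim(3) x by auto
          have "norm (f (r k) x - a x) < e" if "k \<ge> M" for k
          proof -
            have "r k \<ge> M" using seq_suble[OF r(1), of k] that by simp
            then have "\<forall>j\<ge>r k. \<bar>\<theta> j x - a x\<bar> \<le> e / 2" using M by (auto intro!: less_imp_le)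
            then have "\<bar>f (r k) x - a x\<bar> \<le> e / 2" using elim(1) x unfolding near_def by blast
            then show ?thesis using \<open>e > 0\<close> by simp
          qed
          then show "\<exists>M. \<forall>k\<ge>M. norm (f (r k) x - a x) < e" by blast
        qed
        then show "\<theta>' x = a x" using LIMSEQ_unique elim(2) by blast
      qed
    qed
  qed
qed

end

section \<open>Sobolev maps\<close>

lemma Lip_lipschitz:
  assumes "f \<in> LIP" shows "(Lip f)-lipschitz_on UNIV f"
proof -
  obtain L where L: "L-lipschitz_on UNIV f" using assms by (auto simp: LIP_def)
  have ne: "{L. L-lipschitz_on UNIV f} \<noteq> {}" using L by blast
  show ?thesis
  proof (rule lipschitz_onI)
    show "0 \<le> Lip f" unfolding Lip_def by (rule cInf_greatest[OF ne]) (auto dest: lipschitz_on_nonneg)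
    fix x y
    show "dist (f x) (f y) \<le> Lip f * dist x y"
    proof (cases "x = y")
      case False
      have "dist (f x) (f y) / dist x y \<le> Lip f" unfolding Lip_def
      proof (rule cInf_greatest[OF ne])
        fix M assume "M \<in> {L. L-lipschitz_on UNIV f}"
        then have "dist (f x) (f y) \<le> M * dist x y" by (auto dest: lipschitz_onD)
        then show "dist (f x) (f y) / dist x y \<le> M" using False by (simp add: divide_le_eq)
      qed
      then show ?thesis using False by (simp add: divide_le_eq)
    qed simp
  qed
qed

lemma Lip_le: "L-lipschitz_on UNIV f \<Longrightarrow> Lip f \<le> L"
  unfolding Lip_def by (rule cInf_lower) (auto intro!: bdd_belowI[of _ 0] dest: lipschitz_on_nonneg)

locale sobolev_map = bounded_finite m for m :: "'x::metric_space measure" +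
  fixes u :: "'x \<Rightarrow> 'y::metric_space"
  assumes u_S2: "u \<in> S2_map m"
begin

definition Du :: "'x \<Rightarrow> real" where "Du = L0_rep (map_slope m u)"

lemma u_measurable [measurable]: "u \<in> borel_measurable m"
  using u_S2 by (simp add: S2_map_def)

lemma comp_u_measurable: "f \<in> borel_measurable borel \<Longrightarrow> (\<lambda>x. f (u x)) \<in> borel_measurable m" for f :: "'y \<Rightarrow> real"
  by (rule measurable_compose[OF u_measurable])

lemma LIP_comp_measurable: "f \<in> LIP_bd \<Longrightarrow> (\<lambda>x. f (u x)) \<in> borel_measurable m"
  by (rule comp_u_measurable[OF LIP_bd_measurable]) simp_all

lemma map_slopes_iff:
  "G \<in> map_slopes m u \<longleftrightarrow> G \<in> carrier (L0 m) \<and> sqi m (L0_rep G) \<and> (AE x in m. 0 \<le> L0_rep G x) \<and>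
    (\<forall>f\<in>LIP. L0_cls m (f \<circ> u) \<in> S2 m \<and>
      (AE x in m. L0_rep (min_slope m (L0_cls m (f \<circ> u))) x \<le> Lip f * L0_rep G x))"
proof -
  have 1: "L0_le m \<zero>\<^bsub>L0 m\<^esub> G \<longleftrightarrow> (AE x in m. 0 \<le> L0_rep G x)" for G
    unfolding L0_le_def using L0_rep_zero[of m] by (intro iffI) (erule (1) AE_mp[OF AE_conjI], simp)+
  have 2: "L0_le m S (L0_cls m (\<lambda>_. c) \<otimes>\<^bsub>L0 m\<^esub> G) \<longleftrightarrow> (AE x in m. L0_rep S x \<le> c * L0_rep G x)"
    if "G \<in> carrier (L0 m)" for S G c
    unfolding L0_le_def using L0_cls_cmult[OF that, of c] by (intro iffI) (erule (1) AE_mp[OF AE_conjI], simp)+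
  show ?thesis unfolding map_slopes_def L2_iff using 1 2 by blast
qed

text \<open>The essential infimum of the admissible bounds is admissible: for each \<open>f\<close>
  the inequality is divided by \<open>Lip f\<close> and passed to the infimum. If
  \<open>Lip f = 0\<close>, its right-hand side is 0 for every bound, so one admissible bound
  suffices.\<close>

lemma map_slope_in: "map_slope m u \<in> map_slopes m u"
  and map_slope_least: "G \<in> map_slopes m u \<Longrightarrow> L0_le m (map_slope m u) G"
proof -
  let ?S = "L0_rep ` map_slopes m u"
  obtain G0 where G0: "G0 \<in> map_slopes m u" using u_S2 by (auto simp: S2_map_def)
  obtain s where s: "s \<in> borel_measurable m" "\<And>g. g \<in> ?S \<Longrightarrow> AE x in m. s x \<le> g x"
    "\<And>t. (\<And>g. g \<in> ?S \<Longrightarrow> AE x in m. t x \<le> g x) \<Longrightarrow> AE x in m. t x \<le> s x"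
  proof (rule essential_infimum[OF sigma_finite, of ?S "\<lambda>_. 0"])
    show "?S \<noteq> {}" using G0 by blast
    show "?S \<subseteq> borel_measurable m" using map_slopes_iff by (auto dest: L0_rep_measurable)
    show "\<And>f. f \<in> ?S \<Longrightarrow> AE x in m. 0 \<le> f x" using map_slopes_iff by auto
  qed (simp, blast)
  have rep: "AE x in m. L0_rep (L0_cls m s) x = s x" by (rule L0_rep_cls[OF s(1)])
  have s0: "AE x in m. 0 \<le> s x" by (rule s(3)) (auto simp: map_slopes_iff)
  have sqs: "sqi m s"
  proof (rule sqi_bound[OF _ s(1)])
    show "sqi m (L0_rep G0)" using G0 by (simp add: map_slopes_iff)
    show "AE x in m. \<bar>s x\<bar> \<le> \<bar>L0_rep G0 x\<bar>" using s0 s(2)[OF imageI[OF G0]] by eventually_elim simp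
  qed
  have mem: "L0_cls m s \<in> map_slopes m u"
    unfolding map_slopes_iff
  proof (intro conjI ballI)
    show "L0_cls m s \<in> carrier (L0 m)" using s(1) by simp
    show "sqi m (L0_rep (L0_cls m s))" using L2_cls[OF sqs] by (simp add: L2_iff)
    show "AE x in m. 0 \<le> L0_rep (L0_cls m s) x" using rep s0 by eventually_elim simp
    fix f :: "'y \<Rightarrow> real" assume f: "f \<in> LIP"
    show "L0_cls m (f \<circ> u) \<in> S2 m" using G0 f by (simp add: map_slopes_iff)
    have L0: "0 \<le> Lip f" by (rule lipschitz_on_nonneg[OF Lip_lipschitz[OF f]])
    let ?D = "L0_rep (min_slope m (L0_cls m (f \<circ> u)))"
    have b: "AE x in m. ?D x \<le> Lip f * L0_rep G x" if "G \<in> map_slopes m u" for G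
      using that f by (simp add: map_slopes_iff)
    have "AE x in m. ?D x \<le> Lip f * s x"
    proof (cases "Lip f = 0")
      case True then show ?thesis using b[OF G0] by simp
    next
      case False
      have "AE x in m. ?D x / Lip f \<le> s x"
      proof (rule s(3))
        fix g assume "g \<in> ?S"
        then obtain G where G: "G \<in> map_slopes m u" "g = L0_rep G" by blast
        show "AE x in m. ?D x / Lip f \<le> g x"
          using b[OF G(1)] unfolding G(2) by eventually_elim (use False L0 in \<open>simp add: divide_le_eq mult.commute\<close>)
      qed
      then show ?thesis by eventually_elim (use False L0 in \<open>simp add: divide_le_eq mult.commute\<close>)
    qed
    then show "AE x in m. ?D x \<le> Lip f * L0_rep (L0_cls m s) x" using rep by eventually_elim simp
  qed
  have le: "L0_le m (L0_cls m s) G" if "G \<in> map_slopes m u" for G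
    unfolding L0_le_def using rep s(2)[OF imageI[OF that]] by eventually_elim simp
  have "map_slope m u = L0_cls m s"
    unfolding map_slope_def by (rule L0_least_eqI[OF _ mem le]) (auto simp: map_slopes_iff)
  then show "map_slope m u \<in> map_slopes m u" "G \<in> map_slopes m u \<Longrightarrow> L0_le m (map_slope m u) G"
    using mem le by auto
qed

lemma map_slope_carrier: "map_slope m u \<in> carrier (L0 m)"
  and sqi_Du: "sqi m Du"
  and Du_nonneg: "AE x in m. 0 \<le> Du x"
  using map_slope_in by (auto simp: map_slopes_iff Du_def)

lemma Du_measurable [measurable]: "Du \<in> borel_measurable m"
  by (rule sqi_measurable[OF sqi_Du])

lemma LIP_comp_S2: "f \<in> LIP \<Longrightarrow> L0_cls m (f \<circ> u) \<in> S2 m"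
  using map_slope_in by (simp add: map_slopes_iff)

lemma upper_slope_LIP_comp:
  assumes L: "L-lipschitz_on UNIV f"
  shows "upper_slope m (\<lambda>x. f (u x)) (\<lambda>x. L * Du x)"
proof -
  have f: "f \<in> LIP" using L by (auto simp: LIP_def)
  have fm: "(\<lambda>x. f (u x)) \<in> borel_measurable m" by (rule LIP_comp_measurable[OF lipschitz_LIP_bd[OF L]])
  define F where "F = L0_cls m (f \<circ> u)"
  have F: "F \<in> S2 m" unfolding F_def by (rule LIP_comp_S2[OF f])
  have le: "AE x in m. L0_rep (min_slope m F) x \<le> Lip f * Du x"
    using map_slope_in f by (simp add: map_slopes_iff F_def Du_def)
  have "upper_slope m (L0_rep F) (\<lambda>x. L * Du x)"
  proof (rule upper_slope_mono[OF upper_slope_min_slope[OF F] sqi_cmult[OF sqi_Du]])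
    show "AE x in m. L0_rep (min_slope m F) x \<le> L * Du x"
      using le Du_nonneg
    proof eventually_elim
      case (elim x)
      then show ?case using mult_right_mono[OF Lip_le[OF L], of "Du x"] by linarith
    qed
  qed
  then show ?thesis
  proof (rule upper_slope_cong_AE[OF _ fm])
    show "AE x in m. L0_rep F x = f (u x)" using L0_rep_cls[OF fm] by (simp add: F_def comp_def)
  qed simp_all
qed

text \<open>Near any point of its essential range \<open>u\<close> may be composed with a McShane extension of the
  restriction of \<open>f\<close> to a small ball instead of \<open>f\<close>; locality compares the two slopes.\<close>

lemma upper_slope_LIP_comp_lip_a:
  assumes f: "f \<in> LIP"
  shows "upper_slope m (\<lambda>x. f (u x)) (\<lambda>x. lip_a f (u x) * Du x)"
proof -
  obtain L where L: "L-lipschitz_on UNIV f" using f by (auto simp: LIP_def)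
  have fb: "f \<in> LIP_bd" by (rule lipschitz_LIP_bd[OF L])
  have fm: "(\<lambda>x. f (u x)) \<in> borel_measurable m" by (rule LIP_comp_measurable[OF fb])
  have lm [measurable]: "(\<lambda>x. lip_a f (u x)) \<in> borel_measurable m" by (rule comp_u_measurable[OF lip_a_measurable[OF fb]])
  define F where "F = L0_cls m (\<lambda>x. f (u x))"
  have F: "F \<in> S2 m" unfolding F_def by (rule S2_clsI(1)[OF upper_slope_LIP_comp[OF L]])
  have rep: "AE x in m. L0_rep F x = f (u x)" unfolding F_def by (rule L0_rep_cls[OF fm])
  define S where "S = L0_rep (min_slope m F)"
  obtain N where N: "N \<in> null_sets m" "separable_space (top_of_set (u ` (UNIV - N)))"
    using u_S2 by (auto simp: S2_map_def)
  then obtain D where D: "countable D" "D \<subseteq> u ` (UNIV - N)"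
    "top_of_set (u ` (UNIV - N)) closure_of D = u ` (UNIV - N)" by (auto simp: separable_space_def)
  have dense: "\<exists>d\<in>D. dist d (u x) < r" if x: "x \<notin> N" and r: "r > 0" for x r
  proof -
    have "u x \<in> top_of_set (u ` (UNIV - N)) closure_of D" unfolding D(3) using x by blast
    then have "u x \<in> closure (u ` (UNIV - N) \<inter> D)" by (simp add: closure_of_subtopology)
    then have "u x \<in> closure D" using closure_mono[OF Int_lower2] by blast
    then show ?thesis using r by (auto simp: closure_approachable)
  qed
  \<comment> \<open>Centres in a countable dense set, radii \<open>1 / real (Suc j)\<close> and
    rational constants: countably many comparisons, so that a single null set serves for all of
    them.\<close>
  define Q where "Q = {(d, j, q). d \<in> D \<and> q \<in> \<rat> \<and> q-lipschitz_on (ball d (1 / real (Suc j))) f}"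
  have "countable (D \<times> (UNIV :: nat set) \<times> (\<rat> :: real set))"
    using D(1) countable_rat by (intro countable_SIGMA) auto
  then have Q: "countable Q" by (rule countable_subset[rotated]) (auto simp: Q_def)
  have "AE x in m. u x \<in> ball d (1 / real (Suc j)) \<longrightarrow> S x \<le> q * Du x" if "(d, j, q) \<in> Q" for d j q
  proof -
    have "q-lipschitz_on (ball d (1 / real (Suc j))) f" using that by (simp add: Q_def)
    then obtain g where g: "q-lipschitz_on UNIV g" "\<And>y. y \<in> ball d (1 / real (Suc j)) \<Longrightarrow> g y = f y"
      by (rule McShane_extension) (erule that, blast)
    from min_slope_local_le[OF F upper_slope_LIP_comp[OF g(1)]] rep
    show ?thesis by eventually_elim (use g(2) in \<open>auto simp: S_def\<close>)
  qed
  then have "\<forall>p\<in>Q. AE x in m. case p of (d, j, q) \<Rightarrow> u x \<in> ball d (1 / real (Suc j)) \<longrightarrow> S x \<le> q * Du x" by auto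
  then have "AE x in m. \<forall>p\<in>Q. case p of (d, j, q) \<Rightarrow> u x \<in> ball d (1 / real (Suc j)) \<longrightarrow> S x \<le> q * Du x"
    by (simp only: AE_ball_countable[OF Q])
  then have main: "AE x in m. S x \<le> lip_a f (u x) * Du x"
    using AE_not_in[OF N(1)] Du_nonneg
  proof eventually_elim
    case (elim x)
    have step: "S x \<le> (lip_a f (u x) + e) * Du x" if e: "e > 0" for e
    proof -
      obtain r where r: "r > 0" "(lip_a f (u x) + e/2)-lipschitz_on (ball (u x) r) f"
        using lip_near_lip_a[OF fb, of "e/2" "u x"] e by (auto simp: lip_near_def)
      obtain q where q: "q \<in> \<rat>" "lip_a f (u x) + e/2 < q" "q < lip_a f (u x) + e"
        using Rats_dense_in_real[of "lip_a f (u x) + e/2" "lip_a f (u x) + e"] e by auto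
      \<comment> \<open>Both the radius of the ball around \<open>d\<close> and the distance from
        \<open>d\<close> to \<open>u x\<close> will be below \<open>r / 2\<close>, which keeps that
        ball inside the one where the local constant is known.\<close>
      obtain j :: nat where j: "1 / (r / 2) < real j" using reals_Archimedean2 by blast
      have j': "1 / real (Suc j) < r / 2"
      proof -
        have "1 / (r / 2) < real (Suc j)" using j by simp
        then show ?thesis using r(1) by (simp add: field_simps)
      qed
      obtain d where d: "d \<in> D" "dist d (u x) < 1 / real (Suc j)" using dense[OF elim(2), of "1 / real (Suc j)"] by auto
      have "ball d (1 / real (Suc j)) \<subseteq> ball (u x) r"
      proof
        fix y assume "y \<in> ball d (1 / real (Suc j))"
        then show "y \<in> ball (u x) r" using d(2) j' dist_triangle[of "u x" y d] by (simp add: dist_commute)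
      qed
      then have "q-lipschitz_on (ball d (1 / real (Suc j))) f"
        using q(2) by (intro lipschitz_on_mono[OF r(2)]) auto
      then have "(d, j, q) \<in> Q" using d q by (simp add: Q_def)
      then have "S x \<le> q * Du x" using elim(1) d(2) by fastforce
      also have "\<dots> \<le> (lip_a f (u x) + e) * Du x" using q elim(3) by (intro mult_right_mono) auto
      finally show ?thesis .
    qed
    show ?case
    proof (rule LIMSEQ_le_const)
      show "(\<lambda>k. (lip_a f (u x) + 1 / real (Suc k)) * Du x) \<longlonglongrightarrow> lip_a f (u x) * Du x"
        by (rule tendsto_eq_rhs[OF tendsto_mult_right[OF tendsto_add[OF tendsto_const LIMSEQ_Suc[OF lim_1_over_n]]]]) simp
      show "\<exists>N. \<forall>k\<ge>N. S x \<le> (lip_a f (u x) + 1 / real (Suc k)) * Du x"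
        by (intro exI[of _ 0] allI impI step) simp
    qed
  qed
  have sq: "sqi m (\<lambda>x. lip_a f (u x) * Du x)"
    by (rule sqi_mult_bounded[OF sqi_Du lm, of L]) (use lip_a_le_lipschitz[OF L] lip_a_nonneg[of f] in simp)
  have "upper_slope m (L0_rep F) (\<lambda>x. lip_a f (u x) * Du x)"
    by (rule upper_slope_mono[OF upper_slope_min_slope[OF F] sq]) (use main in \<open>simp add: S_def\<close>)
  then show ?thesis by (rule upper_slope_cong_AE[OF _ fm rep]) (use sq in \<open>auto dest: sqi_measurable\<close>)
qed

text \<open>The assumption on \<open>u\<close> concerns globally Lipschitz functions, so a function
  that is Lipschitz only on bounded sets is multiplied by a cut-off. Because \<open>f\<close> is
  bounded by \<open>c\<close>, the extra slope is at most \<open>c\<close>, and it occurs only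
  outside the ball of radius \<open>R\<close>.\<close>

lemma cutoff_LIP:
  fixes f :: "'y \<Rightarrow> real"
  assumes f: "f \<in> LIP_bd" and c: "\<And>y. \<bar>f y\<bar> \<le> c"
  defines "\<eta> \<equiv> \<lambda>R y. max 0 (min 1 (R + 1 + (-1) * dist y undefined))"
  shows "(\<lambda>y. \<eta> R y * f y) \<in> LIP"
    and "lip_a (\<lambda>y. \<eta> R y * f y) y \<le> lip_a f y + (if dist y undefined < R then 0 else c)"
proof -
  have c0: "0 \<le> c" using c[of undefined] by linarith
  have d: "1-lipschitz_on UNIV (\<lambda>y::'y. dist y undefined)"
  proof (rule lipschitz_onI)
    show "dist (dist x undefined) (dist y undefined) \<le> 1 * dist x y" for x y :: 'y
      using dist_triangle[of x undefined y] dist_triangle[of y undefined x] by (simp add: dist_real_def abs_le_iff dist_commute)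
  qed simp
  have "(0 + \<bar>-1\<bar> * 1)-lipschitz_on UNIV (\<lambda>y::'y. R + 1 + (-1) * dist y undefined)"
    by (intro lipschitz_on_add lipschitz_on_constant lipschitz_on_cmult_real d)
  then have "1-lipschitz_on UNIV (\<lambda>y::'y. R + 1 + (-1) * dist y undefined)" by (rule lipschitz_on_mono) auto
  moreover have "1-lipschitz_on UNIV (\<lambda>_::'y. a)" for a :: real by (rule lipschitz_on_mono[OF lipschitz_on_constant]) auto
  ultimately have \<eta>: "1-lipschitz_on UNIV (\<eta> R)" unfolding \<eta>_def by (intro lipschitz_on_max_min)
  have r: "0 \<le> \<eta> R y" "\<eta> R y \<le> 1" for y by (auto simp: \<eta>_def)
  have prod: "\<bar>\<eta> R x * f x - \<eta> R y * f y\<bar> \<le> \<bar>f x - f y\<bar> + c * dist x y" for x y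
  proof -
    have "\<eta> R x * f x - \<eta> R y * f y = \<eta> R x * (f x - f y) + f y * (\<eta> R x - \<eta> R y)" by (simp add: algebra_simps)
    also have "\<bar>\<dots>\<bar> \<le> \<bar>\<eta> R x\<bar> * \<bar>f x - f y\<bar> + \<bar>f y\<bar> * \<bar>\<eta> R x - \<eta> R y\<bar>"
      by (intro order_trans[OF abs_triangle_ineq]) (simp add: abs_mult)
    also have "\<dots> \<le> 1 * \<bar>f x - f y\<bar> + c * dist x y"
      using r[of x] c[of y] lipschitz_onD[OF \<eta>, of x y] c0 by (intro add_mono mult_mono) (auto simp: dist_real_def)
    finally show ?thesis by simp
  qed
  \<comment> \<open>The cut-off vanishes from radius \<open>R + 1\<close> on. The further unit means
    that a point beyond \<open>R + 2\<close> is at distance at least 1 from the support, where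
    boundedness by \<open>c\<close> replaces the Lipschitz estimate.\<close>
  obtain L where L: "L-lipschitz_on (ball undefined (R + 2)) f"
    using f bounded_ball unfolding LIP_bd_def by blast
  have zero: "\<eta> R y = 0" if "dist y undefined \<ge> R + 1" for y using that by (simp add: \<eta>_def)
  have "(L + c + c)-lipschitz_on UNIV (\<lambda>y. \<eta> R y * f y)"
  proof (rule lipschitz_onI)
    show "0 \<le> L + c + c" using lipschitz_on_nonneg[OF L] c0 by simp
    have bnd: "\<bar>\<eta> R x * f x\<bar> \<le> c" for x
      using mult_mono[of "\<bar>\<eta> R x\<bar>" 1 "\<bar>f x\<bar>" c] r[of x] c[of x] by (simp add: abs_mult)
    have half: "\<bar>\<eta> R x * f x - \<eta> R y * f y\<bar> \<le> (L + c + c) * dist x y"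
      if x: "dist x undefined < R + 1" for x y
    proof (cases "dist y undefined < R + 2")
      case True
      then have "\<bar>f x - f y\<bar> \<le> L * dist x y"
        using lipschitz_onD[OF L, of x y] x by (simp add: dist_real_def dist_commute)
      then have "\<bar>\<eta> R x * f x - \<eta> R y * f y\<bar> \<le> L * dist x y + c * dist x y" using prod[of x y] by linarith
      moreover have "0 \<le> c * dist x y" using c0 by simp
      ultimately show ?thesis by (simp add: algebra_simps)
    next
      case False
      then have far: "dist x y \<ge> 1" using x dist_triangle[of y undefined x] by (simp add: dist_commute)
      have "\<bar>\<eta> R x * f x - \<eta> R y * f y\<bar> \<le> c" using zero[of y] False bnd[of x] by simp
      also have "\<dots> \<le> c * dist x y" using far c0 by (simp add: mult_le_cancel_left1)
      also have "\<dots> \<le> (L + c + c) * dist x y" using lipschitz_on_nonneg[OF L] c0 by (intro mult_right_mono) auto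
      finally show ?thesis .
    qed
    show "dist (\<eta> R x * f x) (\<eta> R y * f y) \<le> (L + c + c) * dist x y" for x y
    proof (cases "dist x undefined < R + 1")
      case True then show ?thesis using half by (simp add: dist_real_def)
    next
      case nx: False
      show ?thesis
      proof (cases "dist y undefined < R + 1")
        case True then show ?thesis using half[of y x] by (simp add: dist_real_def dist_commute abs_minus_commute)
      next
        case False
        then show ?thesis using nx zero[of x] zero[of y] lipschitz_on_nonneg[OF L] c0 by simp
      qed
    qed
  qed
  then show L': "(\<lambda>y. \<eta> R y * f y) \<in> LIP" by (auto simp: LIP_def)
  then have b: "(\<lambda>y. \<eta> R y * f y) \<in> LIP_bd" using LIP_subset_LIP_bd by blast
  show "lip_a (\<lambda>y. \<eta> R y * f y) y \<le> lip_a f y + (if dist y undefined < R then 0 else c)"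
  proof (cases "dist y undefined < R")
    case True
    have "\<eta> R z = 1" if "dist y z < R - dist y undefined" for z
      using that dist_triangle[of z undefined y] by (simp add: \<eta>_def dist_commute)
    then have "lip_a (\<lambda>y. \<eta> R y * f y) y \<le> lip_a f y"
      using True by (intro lip_a_local[OF b f, of "R - dist y undefined"]) auto
    then show ?thesis using True by simp
  next
    case False
    have "lip_a (\<lambda>y. \<eta> R y * f y) y \<le> lip_a f y + c"
    proof (rule lip_a_leI[OF b])
      fix e :: real assume e: "e > 0"
      obtain s where s: "s > 0" "\<And>x z. dist y x < s \<Longrightarrow> dist y z < s \<Longrightarrow> \<bar>f x - f z\<bar> \<le> (lip_a f y + e) * dist x z"
        using lip_near_lip_a[OF f e, of y] by (rule lip_nearE) blast
      show "lip_near (\<lambda>y. \<eta> R y * f y) y (lip_a f y + c + e)"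
      proof (rule lip_nearI[OF s(1)])
        show "0 \<le> lip_a f y + c + e" using lip_a_nonneg[of f y] c0 e by simp
        show "\<bar>\<eta> R x * f x - \<eta> R z * f z\<bar> \<le> (lip_a f y + c + e) * dist x z" if "dist y x < s" "dist y z < s" for x z
          using s(2)[OF that] prod[of x z] by (simp add: algebra_simps)
      qed
    qed
    then show ?thesis using False by simp
  qed
qed

text \<open>Removal of the cut-off: the error \<open>J k * Du\<close> is dominated by
  \<open>c * Du\<close> and is eventually 0 at each point, since the radius \<open>k\<close> grows.
  Boundedness of \<open>f\<close> is what makes the majorant square integrable.\<close>

lemma upper_slope_bounded_comp:
  fixes f :: "'y \<Rightarrow> real"
  assumes f: "f \<in> LIP_bd" and c: "\<And>y. \<bar>f y\<bar> \<le> c" and W: "sqi m W" "AE x in m. lip_a f (u x) * Du x \<le> W x"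
  shows "upper_slope m (\<lambda>x. f (u x)) W"
proof -
  define \<eta> where "\<eta> R y = max 0 (min 1 (R + 1 + (-1) * dist y undefined))" for R and y :: 'y
  have c0: "0 \<le> c" using c[of undefined] by linarith
  note cut = cutoff_LIP[OF f c, folded \<eta>_def]
  define J where "J k x = (if dist (u x) undefined < real k then 0 else c)" for k x
  have Jm: "J k \<in> borel_measurable m" for k
  proof -
    have "(\<lambda>y::'y. dist y undefined) \<in> borel_measurable borel"
      by (intro borel_measurable_continuous_onI continuous_intros)
    note this[measurable]
    show ?thesis unfolding J_def by (rule comp_u_measurable[of "\<lambda>y. if dist y undefined < real k then 0 else c"]) measurable
  qed
  have sJ: "sqi m (\<lambda>x. J k x * Du x)" for k
    by (rule sqi_mult_bounded[OF sqi_Du Jm, where K = c]) (auto simp: J_def c0)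
  have uk: "upper_slope m (\<lambda>x. \<eta> (real k) (u x) * f (u x)) (\<lambda>x. W x + J k x * Du x)" for k
  proof (rule upper_slope_mono[OF upper_slope_LIP_comp_lip_a[OF cut(1)] sqi_add[OF W(1) sJ]])
    show "AE x in m. lip_a (\<lambda>y. \<eta> (real k) y * f y) (u x) * Du x \<le> W x + J k x * Du x"
      using W(2) Du_nonneg
    proof eventually_elim
      case (elim x)
      have "lip_a (\<lambda>y. \<eta> (real k) y * f y) (u x) * Du x \<le> (lip_a f (u x) + J k x) * Du x"
        using cut(2)[of "real k" "u x"] elim by (intro mult_right_mono) (auto simp: J_def)
      then show ?case using elim by (simp add: algebra_simps)
    qed
  qed
  have ev: "\<exists>K. \<forall>k\<ge>K. dist (u x) undefined < real k" for x
  proof -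
    obtain K :: nat where "dist (u x) undefined < real K" using reals_Archimedean2 by blast
    then show ?thesis by (intro exI[of _ K] allI impI) (meson less_le_trans of_nat_le_iff)
  qed
  show ?thesis
  proof (rule upper_slope_closed[OF uk LIP_comp_measurable[OF f] W(1)])
    show "AE x in m. (\<lambda>k. \<eta> (real k) (u x) * f (u x)) \<longlonglongrightarrow> f (u x)"
    proof (rule always_eventually, rule allI, rule tendsto_eventually)
      fix x
      obtain K where "\<forall>k\<ge>K. dist (u x) undefined < real k" using ev by blast
      then have "\<forall>k\<ge>K. \<eta> (real k) (u x) * f (u x) = f (u x)" by (auto simp: \<eta>_def)
      then show "\<forall>\<^sub>F k in sequentially. \<eta> (real k) (u x) * f (u x) = f (u x)"
        unfolding eventually_sequentially by blast
    qed
    have "(\<lambda>k. nsq m (\<lambda>x. J k x * Du x - 0 * Du x)) \<longlonglongrightarrow> 0"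
    proof (rule nsq_tendsto_mult_bounded[OF sqi_Du sqi_Du Jm, where K = c and H = "\<lambda>_. 0"])
      show "AE x in m. (\<lambda>k. J k x) \<longlonglongrightarrow> 0"
      proof (rule always_eventually, rule allI, rule tendsto_eventually)
        fix x
        obtain K where "\<forall>k\<ge>K. dist (u x) undefined < real k" using ev by blast
        then have "\<forall>k\<ge>K. J k x = 0" by (auto simp: J_def)
        then show "\<forall>\<^sub>F k in sequentially. J k x = 0" unfolding eventually_sequentially by blast
      qed
    qed (auto simp: J_def c0)
    moreover have "W x + J k x * Du x - W x = J k x * Du x - 0 * Du x" for x k by simp
    ultimately show "(\<lambda>k. nsq m (\<lambda>x. W x + J k x * Du x - W x)) \<longlonglongrightarrow> 0" by (simp only:)
  qed
qed

section \<open>The image measure\<close>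

abbreviation \<mu> where "\<mu> \<equiv> map_meas m u"

lemma sets_map_meas: "sets \<mu> = sets borel"
  by (simp add: map_meas_def)

lemma measurable_map_meas: "borel_measurable \<mu> = borel_measurable borel"
  by (rule measurable_cong_sets[OF sets_map_meas refl])

lemma AE_map_measD:
  assumes "AE y in \<mu>. P y" shows "AE x in m. Du x \<noteq> 0 \<longrightarrow> P (u x)"
proof -
  have "AE x in density m (\<lambda>x. ennreal ((Du x)\<^sup>2)). P (u x)"
    by (rule AE_distrD[OF _ assms[unfolded map_meas_def, folded Du_def]]) measurable
  then show ?thesis by (subst (asm) AE_density) auto
qed

text \<open>Change of variables: multiplying \<open>h \<circ> u\<close> by \<open>Du\<close> is an
  isometry from L2 of the image measure into L2 of \<open>m\<close>. Strong convergence of slopes on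
  Y is carried to X through it.\<close>

lemma map_meas_integral:
  assumes h: "h \<in> borel_measurable borel"
  shows "sqi \<mu> h \<longleftrightarrow> sqi m (\<lambda>x. h (u x) * Du x)"
    and "nsq \<mu> h = nsq m (\<lambda>x. h (u x) * Du x)"
proof -
  have hu: "(\<lambda>x. (h (u x))\<^sup>2) \<in> borel_measurable m"
    using comp_u_measurable[OF h] by measurable
  have h2: "(\<lambda>y. (h y)\<^sup>2) \<in> borel_measurable borel" using h by measurable
  have um: "u \<in> measurable (density m (\<lambda>x. ennreal ((Du x)\<^sup>2))) borel" by measurable
  have eq: "(Du x)\<^sup>2 *\<^sub>R (h (u x))\<^sup>2 = (h (u x) * Du x)\<^sup>2" for x by (simp add: power_mult_distrib)
  have "integrable \<mu> (\<lambda>y. (h y)\<^sup>2) \<longleftrightarrow> integrable (density m (\<lambda>x. ennreal ((Du x)\<^sup>2))) (\<lambda>x. (h (u x))\<^sup>2)"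
    unfolding map_meas_def Du_def[symmetric] by (rule integrable_distr_eq[OF um h2])
  also have "\<dots> \<longleftrightarrow> integrable m (\<lambda>x. (Du x)\<^sup>2 *\<^sub>R (h (u x))\<^sup>2)"
    by (rule integrable_density[OF hu]) measurable
  finally show "sqi \<mu> h \<longleftrightarrow> sqi m (\<lambda>x. h (u x) * Du x)"
    unfolding sqi_def eq using h comp_u_measurable[OF h] by (simp add: measurable_map_meas)
  have "nsq \<mu> h = (\<integral>x. (h (u x))\<^sup>2 \<partial>density m (\<lambda>x. ennreal ((Du x)\<^sup>2)))"
    unfolding map_meas_def Du_def[symmetric] by (rule integral_distr[OF um h2])
  also have "\<dots> = (\<integral>x. (Du x)\<^sup>2 *\<^sub>R (h (u x))\<^sup>2 \<partial>m)"
    by (rule integral_density[OF hu]) measurable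
  finally show "nsq \<mu> h = nsq m (\<lambda>x. h (u x) * Du x)" unfolding eq .
qed

lemma emeasure_map_meas_finite: "emeasure \<mu> B < \<infinity>"
proof -
  have "emeasure \<mu> B \<le> emeasure \<mu> (space \<mu>)" by (rule emeasure_space)
  also have "emeasure \<mu> (space \<mu>) = emeasure (density m (\<lambda>x. ennreal ((Du x)\<^sup>2))) (space m)"
    unfolding map_meas_def Du_def[symmetric] by (subst emeasure_distr) (auto simp: space_n)
  also have "\<dots> = (\<integral>\<^sup>+x. ennreal ((Du x)\<^sup>2) \<partial>m)"
    by (subst emeasure_density) (auto simp: nn_integral_set_ennreal[symmetric] indicator_def intro!: nn_integral_cong)
  also have "\<dots> = ennreal (nsq m Du)"
    by (rule nn_integral_eq_integral[OF sqi_integrable[OF sqi_Du]]) simp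
  also have "\<dots> < \<infinity>" by simp
  finally show ?thesis .
qed

sublocale Y: bounded_finite "map_meas m u"
  using emeasure_map_meas_finite by unfold_locales (auto simp: sets_map_meas)

section \<open>Arctan, the truncated and folded tangent, and associated functions\<close>

lemma lip_near_arctan: "e > 0 \<Longrightarrow> lip_near arctan t (inverse (1 + t\<^sup>2) + e)"
proof -
  assume e: "e > 0"
  have "lip_near arctan t (\<bar>inverse (1 + t\<^sup>2)\<bar> + e)"
  proof (rule lip_near_deriv[of 1 t arctan "\<lambda>s. inverse (1 + s\<^sup>2)"])
    show "isCont (\<lambda>s. inverse (1 + s\<^sup>2)) t"
      by (intro continuous_intros) (metis add_nonneg_eq_0_iff power_zero_numeral zero_le_one zero_le_power2 zero_neq_one)
  qed (auto intro: DERIV_arctan e)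
  then show ?thesis by (simp add: abs_of_pos add_pos_nonneg)
qed

lemma arctan_lipschitz: "1-lipschitz_on UNIV arctan"
proof (rule lipschitz_onI)
  fix s t :: real
  have "norm (arctan s - arctan t) \<le> 1 * norm (s - t)"
  proof (rule field_differentiable_bound[of UNIV arctan "\<lambda>s. inverse (1 + s\<^sup>2)"])
    show "norm (inverse (1 + z\<^sup>2)) \<le> 1" for z :: real by (simp add: inverse_le_1_iff add_pos_nonneg)
  qed (auto intro: DERIV_arctan)
  then show "dist (arctan s) (arctan t) \<le> 1 * dist s t" by (simp add: dist_real_def)
qed simp

text \<open>The cut-off tangent \<open>tan (clamp s)\<close> with values in \<open>[-2j, 2j]\<close>, folded back so that it vanishes
  at \<open>\<pm>\<pi>/2\<close>; as \<open>j \<rightarrow> \<infinity>\<close> it tends to \<open>tan\<close> inside and to \<open>0\<close> at the end points.\<close>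

definition ctan :: "nat \<Rightarrow> real \<Rightarrow> real" where
  "ctan j s = tan (max (- arctan (2 * real j)) (min s (arctan (2 * real j))))"

definition ftan :: "nat \<Rightarrow> real \<Rightarrow> real" where
  "ftan j s = max (min (ctan j s) (2 * real j - ctan j s)) (- 2 * real j - ctan j s)"

lemma ctan_arctan: "ctan j (arctan v) = max (- 2 * real j) (min v (2 * real j))"
proof -
  have "min (arctan v) (arctan (2 * real j)) = arctan (min v (2 * real j))"
    by (simp add: min_def arctan_le_iff)
  moreover have "max (- arctan (2 * real j)) (arctan w) = arctan (max (- 2 * real j) w)" for w
    by (simp add: max_def arctan_le_iff flip: arctan_minus)
  ultimately show ?thesis by (simp add: ctan_def tan_arctan)
qed

lemma ctan_end: "ctan j (pi / 2) = 2 * real j" "ctan j (- (pi / 2)) = - 2 * real j"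
proof -
  define A where "A = arctan (2 * real j)"
  have "0 \<le> A" "A < pi / 2" unfolding A_def using arctan_ubound[of "2 * real j"] by simp_all
  then have "max (- A) (min (pi / 2) A) = A" "max (- A) (min (- (pi / 2)) A) = - A" by linarith+
  then show "ctan j (pi / 2) = 2 * real j" "ctan j (- (pi / 2)) = - 2 * real j"
    unfolding ctan_def A_def by (simp_all add: tan_arctan)
qed

lemma ctan_abs_le: "\<bar>ctan j s\<bar> \<le> 2 * real j"
proof -
  define v where "v = tan (max (- arctan (2 * real j)) (min s (arctan (2 * real j))))"
  have "- (pi / 2) < max (- arctan (2 * real j)) (min s (arctan (2 * real j)))"
    "max (- arctan (2 * real j)) (min s (arctan (2 * real j))) < pi / 2"
    using arctan_bounded[of "2 * real j"] by (auto simp: min_def max_def)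
  then have "arctan v = max (- arctan (2 * real j)) (min s (arctan (2 * real j)))"
    unfolding v_def by (rule arctan_tan)
  then have "- arctan (2 * real j) \<le> arctan v" "arctan v \<le> arctan (2 * real j)" by auto
  then show ?thesis unfolding ctan_def v_def[symmetric] by (simp add: arctan_le_iff abs_le_iff flip: arctan_minus)
qed

lemma clamp_lipschitz: "1-lipschitz_on UNIV (\<lambda>s::real. max (- a) (min s a))"
proof -
  have "1-lipschitz_on UNIV (\<lambda>_::real. b)" for b :: real by (rule lipschitz_on_mono[OF lipschitz_on_constant]) auto
  then show ?thesis by (intro lipschitz_on_max_min lipschitz_on_id)
qed

lemma clamp_arctan_bounds:
  "- (pi / 2) < max (- arctan b) (min s (arctan b))" "max (- arctan b) (min s (arctan b)) < pi / 2"
  using arctan_bounded[of b] by (auto simp: min_def max_def)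

lemma fold_lipschitz: "1-lipschitz_on UNIV (\<lambda>t::real. max (min t (c - t)) (- c - t))"
  by (rule lipschitz_onI) (auto simp: dist_real_def min_def max_def abs_if)

lemma deriv_tan: "- (pi / 2) < s \<Longrightarrow> s < pi / 2 \<Longrightarrow> (tan has_real_derivative 1 + (tan s)\<^sup>2) (at s)"
proof -
  assume s: "- (pi / 2) < s" "s < pi / 2"
  have c: "cos s > 0" using cos_gt_zero_pi[OF s] .
  have "inverse ((cos s)\<^sup>2) = 1 + (tan s)\<^sup>2" using tan_sec[of s] c by (simp add: power_inverse)
  then show ?thesis using DERIV_tan[of s] c by simp
qed

text \<open>The clamp is 1-Lipschitz, so the derivative 1 + tan^2 at the clamped point bounds the
  local constant. Beyond the clamp the function is constant, but this larger bound is continuous, as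
  \<open>upper_slope_chain\<close> requires.\<close>

lemma ctan_near: "e > 0 \<Longrightarrow> lip_near (ctan j) s (1 + (ctan j s)\<^sup>2 + e)"
proof -
  assume e: "e > 0"
  define cl where "cl s = max (- arctan (2 * real j)) (min s (arctan (2 * real j)))" for s
  have b: "- (pi / 2) < cl s" "cl s < pi / 2" unfolding cl_def by (rule clamp_arctan_bounds)+
  have c: "cos (cl s) \<noteq> 0" using cos_gt_zero_pi[OF b] by simp
  have "lip_near tan (cl s) (\<bar>1 + (tan (cl s))\<^sup>2\<bar> + e)"
  proof (rule lip_near_deriv[OF _ _ _ e])
    show "min (pi / 2 - cl s) (pi / 2 + cl s) > 0" using b by simp
    show "(tan has_real_derivative 1 + (tan w)\<^sup>2) (at w)"
      if "dist (cl s) w < min (pi / 2 - cl s) (pi / 2 + cl s)" for w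
      using that by (intro deriv_tan) (auto simp: dist_real_def)
    show "isCont (\<lambda>w. 1 + (tan w)\<^sup>2) (cl s)" using c by (intro continuous_intros isCont_tan)
  qed
  then have "lip_near (\<lambda>s. tan (cl s)) s (\<bar>1 + (tan (cl s))\<^sup>2\<bar> + e)"
    by (rule lip_near_comp_right) (unfold cl_def, rule clamp_lipschitz)
  moreover have "ctan j = (\<lambda>s. tan (cl s))" by (auto simp: ctan_def cl_def)
  moreover have "\<bar>1 + (tan (cl s))\<^sup>2\<bar> = 1 + (tan (cl s))\<^sup>2" by (simp add: add_nonneg_nonneg)
  ultimately show ?thesis by simp
qed

lemma ctan_lipschitz: "(1 + (2 * real j)\<^sup>2)-lipschitz_on UNIV (ctan j)"
proof -
  define a where "a = arctan (2 * real j)"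
  have "(1 + (2 * real j)\<^sup>2)-lipschitz_on {-a..a} tan"
  proof (rule lipschitz_onI)
    fix s t assume st: "s \<in> {-a..a}" "t \<in> {-a..a}"
    have "norm (tan s - tan t) \<le> (1 + (2 * real j)\<^sup>2) * norm (s - t)"
    proof (rule field_differentiable_bound[OF _ _ _ st])
      show "convex {-a..a}" by simp
      fix z assume z: "z \<in> {-a..a}"
      have b: "- (pi / 2) < z" "z < pi / 2" using z arctan_bounded[of "2 * real j"] by (auto simp: a_def)
      show "(tan has_field_derivative 1 + (tan z)\<^sup>2) (at z within {-a..a})"
        by (rule has_field_derivative_at_within[OF deriv_tan[OF b]])
      have "max (- a) (min z a) = z" using z by auto
      then have "\<bar>tan z\<bar> \<le> \<bar>2 * real j\<bar>" using ctan_abs_le[of j z] by (simp add: ctan_def a_def)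
      then have "(tan z)\<^sup>2 \<le> (2 * real j)\<^sup>2" by (simp only: abs_le_square_iff)
      then show "norm (1 + (tan z)\<^sup>2) \<le> 1 + (2 * real j)\<^sup>2" by (simp add: add_nonneg_nonneg)
    qed
    then show "dist (tan s) (tan t) \<le> (1 + (2 * real j)\<^sup>2) * dist s t" by (simp add: dist_real_def)
  qed simp
  then have "((1 + (2 * real j)\<^sup>2) * 1)-lipschitz_on UNIV (\<lambda>s. tan (max (- a) (min s a)))"
    by (rule lipschitz_on_compose2[OF clamp_lipschitz lipschitz_on_subset])
      (use arctan_bounded in \<open>auto simp: a_def max_def min_def\<close>)
  then show ?thesis by (simp add: ctan_def[abs_def] a_def)
qed

text \<open>Inside, the tangent eventually lies between -j and j, where the fold is the identity. At
  the end points the clamped values are -2j and 2j, which fold to 0; without the fold there would be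
  no limit there.\<close>

lemma ftan_limit:
  assumes "\<bar>s\<bar> \<le> pi / 2"
  shows "(\<lambda>j. ftan j s) \<longlonglongrightarrow> (if \<bar>s\<bar> < pi / 2 then tan s else 0)"
proof (rule tendsto_eventually)
  show "\<forall>\<^sub>F j in sequentially. ftan j s = (if \<bar>s\<bar> < pi / 2 then tan s else 0)"
  proof (cases "\<bar>s\<bar> < pi / 2")
    case True
    define v where "v = tan s"
    have s: "s = arctan v" unfolding v_def using True by (intro arctan_tan[symmetric]) auto
    obtain K :: nat where K: "\<bar>v\<bar> < real K" using reals_Archimedean2 by blast
    have "ftan j s = v" if "j \<ge> K" for j
    proof -
      have "real j \<ge> real K" using that by simp
      then have "\<bar>v\<bar> < real j" using K by linarith
      then show ?thesis unfolding ftan_def s ctan_arctan by (auto simp: min_def max_def abs_if split: if_splits)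
    qed
    then show ?thesis using True unfolding eventually_sequentially v_def by auto
  next
    case False
    then have "s = pi / 2 \<or> s = - (pi / 2)" using assms by (auto simp: abs_if split: if_splits)
    then have "ctan j s = 2 * real j \<or> ctan j s = - 2 * real j" for j using ctan_end[of j] by metis
    note ends = this
    have "ftan j s = 0" for j using ends[of j] by (elim disjE) (simp_all add: ftan_def)
    then show ?thesis using False by simp
  qed
qed

text \<open>Off \<open>{|Du| > 0}\<close> nothing is known about \<open>f\<^sub>k \<circ> u\<close>. The bounded functions \<open>arctan \<circ> f\<^sub>k \<circ> u\<close> have
  convex combinations converging to some \<open>\<theta>\<close>, and \<open>tan \<circ> \<theta>\<close>, set to \<open>0\<close> where \<open>\<bar>\<theta>\<bar> = \<pi>/2\<close>, is the
  associated function.\<close>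

lemma associated_function_exists:
  assumes up: "upper_slope \<mu> F \<Gamma>"
  obtains g where "upper_slope m g (\<lambda>x. \<Gamma> (u x) * Du x)" "AE x in m. Du x > 0 \<longrightarrow> g x = F (u x)"
proof -
  obtain f h where fh: "\<And>k::nat. f k \<in> LIP_bd" "\<And>k. sqi \<mu> (h k)" "\<And>k. AE y in \<mu>. lip_a (f k) y \<le> h k y"
    "AE y in \<mu>. (\<lambda>k. f k y) \<longlonglongrightarrow> F y" "(\<lambda>k. nsq \<mu> (\<lambda>y. h k y - \<Gamma> y)) \<longlonglongrightarrow> 0"
    by (rule Y.upper_slope_seqE[OF up], rule that)
  have F: "F \<in> borel_measurable borel" using Y.upper_slope_D(1)[OF up] by (simp add: measurable_map_meas)
  note \<Gamma> = Y.upper_slope_D(2)[OF up]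
  have \<Gamma>m: "\<Gamma> \<in> borel_measurable borel" using sqi_measurable[OF \<Gamma>] by (simp add: measurable_map_meas)
  have fm: "f k \<in> borel_measurable borel" for k by (rule LIP_bd_measurable[OF fh(1)]) simp
  have hm: "h k \<in> borel_measurable borel" for k using sqi_measurable[OF fh(2)] by (simp add: measurable_map_meas)
  note [measurable] = F \<Gamma>m fm hm
  \<comment> \<open>\<open>c\<close> is the derivative of arctan; being bounded and continuous it
    can multiply the strongly convergent slopes \<open>h k\<close> without destroying their
    convergence.\<close>
  define c where "c t = inverse (1 + t\<^sup>2)" for t :: real
  have pos: "1 + t\<^sup>2 > 0" for t :: real by (simp add: add_pos_nonneg)
  have c01: "0 < c t" "c t \<le> 1" for t using pos[of t] by (simp_all add: c_def inverse_le_1_iff)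
  have [measurable]: "c \<in> borel_measurable borel" unfolding c_def by measurable
  have cc: "isCont c t" for t unfolding c_def using pos[of t] by (intro continuous_intros) simp
  have limY: "(\<lambda>k. nsq \<mu> (\<lambda>y. c (f k y) * h k y - c (F y) * \<Gamma> y)) \<longlonglongrightarrow> 0"
  proof (rule nsq_tendsto_mult_bounded[OF fh(2) \<Gamma> _ _ _ _ _ fh(5), where K = 1])
    show "AE y in \<mu>. (\<lambda>k. c (f k y)) \<longlonglongrightarrow> c (F y)"
      using fh(4) by eventually_elim (rule isCont_tendsto_compose[OF cc])
  qed (use c01 in \<open>auto simp: measurable_map_meas less_imp_le\<close>)
  define W where "W k x = c (f k (u x)) * h k (u x) * Du x" for k x
  define W' where "W' x = c (F (u x)) * \<Gamma> (u x) * Du x" for x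
  have sqc: "sqi \<mu> (\<lambda>y. c (g y) * k y)" if "g \<in> borel_measurable borel" "sqi \<mu> k" for g k
    by (rule sqi_mult_bounded[OF that(2), of _ 1])
      (use that c01 in \<open>auto simp: measurable_map_meas less_imp_le\<close>)
  have Ws: "sqi m (W k)" for k
    using sqc[OF fm fh(2), of k k] unfolding W_def by (subst (asm) map_meas_integral(1)) measurable
  have W's: "sqi m W'"
    using sqc[OF F \<Gamma>] unfolding W'_def by (subst (asm) map_meas_integral(1)) measurable
  \<comment> \<open>The isometry between L2 of the image measure and L2 of \<open>m\<close>
    transports the convergence.\<close>
  have Wlim: "(\<lambda>k. nsq m (\<lambda>x. W k x - W' x)) \<longlonglongrightarrow> 0"
  proof -
    have "nsq \<mu> (\<lambda>y. c (f k y) * h k y - c (F y) * \<Gamma> y) = nsq m (\<lambda>x. W k x - W' x)" for k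
      unfolding W_def W'_def left_diff_distrib[symmetric] by (rule map_meas_integral(2)) measurable
    then show ?thesis using limY by (simp only:)
  qed
  have up_k: "upper_slope m (\<lambda>x. arctan (f k (u x))) (W k)" for k
  proof (rule upper_slope_bounded_comp[OF LIP_bd_compose[OF fh(1) arctan_lipschitz] _ Ws])
    show "\<bar>arctan (f k y)\<bar> \<le> pi / 2" for y using arctan_bounded[of "f k y"] by (simp add: abs_if)
    show "AE x in m. lip_a (\<lambda>y. arctan (f k y)) (u x) * Du x \<le> W k x"
      using AE_map_measD[OF fh(3)[of k]] Du_nonneg
    proof eventually_elim
      case (elim x)
      show ?case
      proof (cases "Du x = 0")
        case False
        have "lip_a (\<lambda>y. arctan (f k y)) (u x) \<le> c (f k (u x)) * lip_a (f k) (u x)"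
          unfolding c_def by (rule lip_a_compose[OF fh(1) arctan_lipschitz lip_near_arctan]) (use pos in \<open>auto simp: less_imp_le\<close>)
        also have "\<dots> \<le> c (f k (u x)) * h k (u x)" using elim False c01 by (intro mult_left_mono) (auto simp: less_imp_le)
        finally show ?thesis unfolding W_def using elim(2) by (rule mult_right_mono)
      qed (simp add: W_def)
    qed
  qed
  \<comment> \<open>Convergence of the compositions is known only where \<open>Du\<close> is
    nonzero, because that is all that a mu-a.e. statement says about points of X.\<close>
  obtain \<theta> where \<theta>: "upper_slope m \<theta> W'" "AE x in m. \<bar>\<theta> x\<bar> \<le> pi / 2"
    "AE x in m. x \<in> {x. Du x \<noteq> 0} \<longrightarrow> \<theta> x = arctan (F (u x))"
  proof (rule bounded_upper_slopes_limit[OF up_k _ W's Wlim])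
    show "AE x in m. \<bar>arctan (f k (u x))\<bar> \<le> pi / 2" for k
    proof (rule AE_I2)
      show "\<bar>arctan (f k (u x))\<bar> \<le> pi / 2" for x using arctan_bounded[of "f k (u x)"] by (simp add: abs_if)
    qed
    show "AE x in m. x \<in> {x. Du x \<noteq> 0} \<longrightarrow> (\<lambda>k. arctan (f k (u x))) \<longlonglongrightarrow> arctan (F (u x))"
      using AE_map_measD[OF fh(4)] by eventually_elim (auto intro: tendsto_arctan)
  qed (rule that)
  have \<theta>m [measurable]: "\<theta> \<in> borel_measurable m" by (rule upper_slope_D[OF \<theta>(1)])
  define L where "L x = \<Gamma> (u x) * Du x" for x
  have Ls: "sqi m L" unfolding L_def using \<Gamma> map_meas_integral(1)[OF \<Gamma>m] by simp
  have \<Gamma>0: "AE x in m. Du x \<noteq> 0 \<longrightarrow> 0 \<le> \<Gamma> (u x)" by (rule AE_map_measD[OF Y.upper_slope_nonneg[OF up]])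
  have contT: "continuous_on UNIV (ctan j)" for j by (rule lipschitz_on_continuous_on[OF ctan_lipschitz])
  have ftan_alt: "ftan j = (\<lambda>s. (\<lambda>t. max (min t (2 * real j - t)) (- (2 * real j) - t)) (ctan j s))" for j
    by (auto simp: ftan_def)
  have up_j: "upper_slope m (\<lambda>x. ftan j (\<theta> x)) L" for j
  proof (rule upper_slope_mono[OF upper_slope_chain[OF \<theta>(1)] Ls])
    have "(1 * (1 + (2 * real j)\<^sup>2))-lipschitz_on UNIV (ftan j)"
      unfolding ftan_alt by (rule lipschitz_on_compose2[OF ctan_lipschitz lipschitz_on_subset[OF fold_lipschitz]]) simp
    then show "(1 * (1 + (2 * real j)\<^sup>2))-lipschitz_on UNIV (ftan j)" .
    show "continuous_on UNIV (\<lambda>s. 1 + (ctan j s)\<^sup>2)" by (intro continuous_intros contT)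
    show "0 \<le> 1 + (ctan j t)\<^sup>2" for t by (simp add: add_nonneg_nonneg)
    show "1 + (ctan j t)\<^sup>2 \<le> 1 + (2 * real j)\<^sup>2" for t
      using ctan_abs_le[of j t] abs_le_square_iff[of "ctan j t" "2 * real j"] by simp
    show "lip_near (ftan j) t (1 + (ctan j t)\<^sup>2 + e)" if "e > 0" for t e
      unfolding ftan_alt by (rule lip_near_comp_left[OF ctan_near[OF that] fold_lipschitz])
    show "AE x in m. (1 + (ctan j (\<theta> x))\<^sup>2) * W' x \<le> L x"
      using \<theta>(3) \<Gamma>0 Du_nonneg
    proof eventually_elim
      case (elim x)
      show ?case
      proof (cases "Du x = 0")
        case False
        define v where "v = F (u x)"
        \<comment> \<open>Truncation makes the tangent no larger than \<open>v\<close>, so the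
          factor \<open>1 + v\<^sup>2\<close> coming from tan cancels against \<open>c v\<close>
          coming from arctan, and the original bound \<open>L\<close> returns.\<close>
        have "\<bar>ctan j (\<theta> x)\<bar> \<le> \<bar>v\<bar>" using elim(1) False by (simp add: ctan_arctan v_def) 
        then have "1 + (ctan j (\<theta> x))\<^sup>2 \<le> 1 + v\<^sup>2" by (simp add: abs_le_square_iff)
        then have "(1 + (ctan j (\<theta> x))\<^sup>2) * W' x \<le> (1 + v\<^sup>2) * W' x"
          using elim False c01[of "F (u x)"] unfolding W'_def by (intro mult_right_mono) (auto intro!: mult_nonneg_nonneg)
        also have "\<dots> = ((1 + v\<^sup>2) * c v) * L x" by (simp add: W'_def L_def v_def)
        also have "(1 + v\<^sup>2) * c v = 1" using pos[of v] by (simp add: c_def)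
        finally show ?thesis by simp
      qed (simp add: W'_def L_def)
    qed
  qed
  define g where "g x = (if \<bar>\<theta> x\<bar> < pi / 2 then tan (\<theta> x) else 0)" for x
  show thesis
  proof (rule that)
    have "upper_slope m g L"
    proof (rule upper_slope_closed[OF up_j _ Ls])
      show "g \<in> borel_measurable m" unfolding g_def tan_def by measurable
      show "AE x in m. (\<lambda>j. ftan j (\<theta> x)) \<longlonglongrightarrow> g x"
        using \<theta>(2) unfolding g_def by eventually_elim (rule ftan_limit)
    qed simp
    then show "upper_slope m g (\<lambda>x. \<Gamma> (u x) * Du x)" unfolding L_def .
    show "AE x in m. Du x > 0 \<longrightarrow> g x = F (u x)"
      using \<theta>(3)
    proof eventually_elim
      case (elim x)
      show ?case
      proof
        assume "Du x > 0"
        then have "\<theta> x = arctan (F (u x))" using elim by simp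
        then show "g x = F (u x)" using arctan_bounded[of "F (u x)"] by (simp add: g_def abs_if tan_arctan minus_less_iff)
      qed
    qed
  qed
qed

end

section \<open>Normed groups and modules\<close>

abbreviation nm :: "('z L0_elt, 'v, 'm) normed_module_scheme \<Rightarrow> 'v \<Rightarrow> 'z \<Rightarrow> real" where
  "nm M v \<equiv> L0_rep (pnorm M v)"

text \<open>The level at which distance, topology and continuity live. The tangent module and the
  target, a dual and an extension by zero, enter the continuity argument in this form.\<close>

locale L0_normed_group = M?: abelian_group M for n :: "'z measure" and M :: "('z L0_elt, 'v, 'm) normed_module_scheme" (structure) +
  assumes sf: "sigma_finite_measure n"
    and pn_carrier: "v \<in> carrier M \<Longrightarrow> pnorm M v \<in> carrier (L0 n)"
    and nm_nonneg: "v \<in> carrier M \<Longrightarrow> AE x in n. 0 \<le> nm M v x"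
    and nm_0: "AE x in n. nm M \<zero> x = 0"
    and nm_eq_0: "v \<in> carrier M \<Longrightarrow> AE x in n. nm M v x = 0 \<Longrightarrow> v = \<zero>"
    and nm_triangle: "v \<in> carrier M \<Longrightarrow> w \<in> carrier M \<Longrightarrow> AE x in n. nm M (v \<oplus> w) x \<le> nm M v x + nm M w x"
    and nm_uminus: "v \<in> carrier M \<Longrightarrow> AE x in n. nm M (\<ominus> v) x = nm M v x"
begin

sublocale fe: finite_measure "finite_equiv n" by (rule finite_measure_finite_equiv[OF sf])

lemma nm_measurable [measurable (raw)]: "v \<in> carrier M \<Longrightarrow> nm M v \<in> borel_measurable n"
  by (rule L0_rep_measurable[OF pn_carrier])

lemma nm_minus_commute: "v \<in> carrier M \<Longrightarrow> w \<in> carrier M \<Longrightarrow> AE x in n. nm M (v \<ominus> w) x = nm M (w \<ominus> v) x"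
proof -
  assume v: "v \<in> carrier M" "w \<in> carrier M"
  then have eq: "\<ominus> (v \<ominus> w) = w \<ominus> v" by (simp add: minus_add minus_eq a_comm)
  have "AE x in n. nm M (\<ominus> (v \<ominus> w)) x = nm M (v \<ominus> w) x" using v by (intro nm_uminus) simp
  then show ?thesis unfolding eq by eventually_elim simp
qed

lemma minus_triangle_eq:
  "v \<in> carrier M \<Longrightarrow> w \<in> carrier M \<Longrightarrow> z \<in> carrier M \<Longrightarrow> (v \<ominus> w) \<oplus> (w \<ominus> z) = v \<ominus> z"
  by (simp add: minus_eq a_assoc r_neg2 a_ac)

lemma nm_minus_triangle:
  assumes "v \<in> carrier M" "w \<in> carrier M" "z \<in> carrier M"
  shows "AE x in n. nm M (v \<ominus> z) x \<le> nm M (v \<ominus> w) x + nm M (w \<ominus> z) x"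
  using nm_triangle[of "v \<ominus> w" "w \<ominus> z"] minus_triangle_eq[OF assms] assms by simp

definition idist :: "('z \<Rightarrow> real) \<Rightarrow> real" where
  "idist f = (\<integral>x. min 1 (f x) \<partial>finite_equiv n)"

lemma idist_integrable:
  fixes f :: "'z \<Rightarrow> real"
  assumes f: "f \<in> borel_measurable n" "AE x in n. 0 \<le> f x"
  shows "integrable (finite_equiv n) (\<lambda>x. min 1 (f x))"
proof (rule fe.integrable_const_bound[where B = 1])
  show "(\<lambda>x. min 1 (f x)) \<in> borel_measurable (finite_equiv n)"
    unfolding measurable_finite_equiv[OF sf] using f by measurable
  show "AE x in finite_equiv n. norm (min 1 (f x)) \<le> 1"
    unfolding AE_finite_equiv[OF sf] using f(2) by eventually_elim simp
qed

lemma idist_mono: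
  assumes "f \<in> borel_measurable n" "AE x in n. 0 \<le> f x" "g \<in> borel_measurable n" "AE x in n. f x \<le> g x"
  shows "idist f \<le> idist g"
  unfolding idist_def
proof (rule integral_mono_AE)
  have "AE x in n. 0 \<le> g x" using assms(2,4) by eventually_elim simp
  then show "integrable (finite_equiv n) (\<lambda>x. min 1 (g x))" by (rule idist_integrable[OF assms(3)])
  show "AE x in finite_equiv n. min 1 (f x) \<le> min 1 (g x)"
    unfolding AE_finite_equiv[OF sf] using assms(4) by eventually_elim simp
qed (rule idist_integrable[OF assms(1,2)])

lemma idist_eq_0:
  assumes "f \<in> borel_measurable n" "AE x in n. 0 \<le> f x" "idist f \<le> 0"
  shows "AE x in n. f x = 0"
proof -
  have nn: "AE x in finite_equiv n. 0 \<le> min 1 (f x)"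
    unfolding AE_finite_equiv[OF sf] using assms(2) by eventually_elim simp
  have "(\<integral>x. min 1 (f x) \<partial>finite_equiv n) = 0"
    using assms(3) integral_nonneg_AE[OF nn] unfolding idist_def by linarith
  then have "AE x in finite_equiv n. min 1 (f x) = 0"
    using integral_nonneg_eq_0_iff_AE[OF idist_integrable[OF assms(1,2)] nn] by simp
  then show ?thesis unfolding AE_finite_equiv[OF sf] by eventually_elim (simp add: min_def split: if_splits)
qed

lemma idist_add_le:
  assumes "f \<in> borel_measurable n" "AE x in n. 0 \<le> f x" "g \<in> borel_measurable n" "AE x in n. 0 \<le> g x"
    and h: "h \<in> borel_measurable n" "AE x in n. 0 \<le> h x" "AE x in n. h x \<le> f x + g x"
  shows "idist h \<le> idist f + idist g"
proof -
  note i = idist_integrable[OF assms(1,2)] idist_integrable[OF assms(3,4)]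
  have "idist h \<le> (\<integral>x. min 1 (f x) + min 1 (g x) \<partial>finite_equiv n)"
    unfolding idist_def
  proof (rule integral_mono_AE[OF idist_integrable[OF h(1,2)] Bochner_Integration.integrable_add[OF i]])
    show "AE x in finite_equiv n. min 1 (h x) \<le> min 1 (f x) + min 1 (g x)"
      unfolding AE_finite_equiv[OF sf] using assms(2,4) h(3) by eventually_elim linarith
  qed
  also have "\<dots> = idist f + idist g" unfolding idist_def by (rule Bochner_Integration.integral_add[OF i])
  finally show ?thesis .
qed

lemma L0_dist_eq: "v \<in> carrier M \<Longrightarrow> w \<in> carrier M \<Longrightarrow> L0_dist n M v w = idist (nm M (v \<ominus> w))"
  by (simp add: L0_dist_def idist_def)

lemma minus_zero_iff: "v \<in> carrier M \<Longrightarrow> w \<in> carrier M \<Longrightarrow> v \<ominus> w = \<zero> \<longleftrightarrow> v = w"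
  by (metis a_inv_closed minus_eq minus_equality minus_minus r_neg)

lemma metric: "Metric_space (carrier M) (L0_dist n M)"
proof
  fix v w
  show "0 \<le> L0_dist n M v w"
  proof (cases "v \<in> carrier M \<and> w \<in> carrier M")
    case True
    then have "AE x in n. 0 \<le> nm M (v \<ominus> w) x" by (intro nm_nonneg) simp
    then have "AE x in finite_equiv n. 0 \<le> min 1 (nm M (v \<ominus> w) x)"
      unfolding AE_finite_equiv[OF sf] by eventually_elim simp
    then show ?thesis using True by (simp add: L0_dist_eq idist_def integral_nonneg_AE)
  qed (auto simp: L0_dist_def)
  show "L0_dist n M v w = L0_dist n M w v"
  proof (cases "v \<in> carrier M \<and> w \<in> carrier M")
    case True
    then have "AE x in n. nm M (v \<ominus> w) x = nm M (w \<ominus> v) x" by (intro nm_minus_commute) simp_all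
    then have "AE x in finite_equiv n. min 1 (nm M (v \<ominus> w) x) = min 1 (nm M (w \<ominus> v) x)"
      unfolding AE_finite_equiv[OF sf] by eventually_elim simp
    then show ?thesis
      unfolding L0_dist_def using True
      by (auto intro!: integral_cong_AE simp: measurable_finite_equiv[OF sf] nm_measurable)
  qed (auto simp: L0_dist_def)
next
  fix v w assume vw: "v \<in> carrier M" "w \<in> carrier M"
  show "L0_dist n M v w = 0 \<longleftrightarrow> v = w"
  proof
    assume "L0_dist n M v w = 0"
    then have "AE x in n. nm M (v \<ominus> w) x = 0"
      using vw by (intro idist_eq_0) (simp_all add: L0_dist_eq nm_nonneg nm_measurable)
    then have "v \<ominus> w = \<zero>" using vw by (intro nm_eq_0) simp_all
    then show "v = w" using vw by (simp add: minus_zero_iff)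
  next
    assume "v = w"
    then have "v \<ominus> w = \<zero>" using vw by (simp add: minus_zero_iff)
    moreover have "AE x in finite_equiv n. min 1 (nm M \<zero> x) = 0"
      unfolding AE_finite_equiv[OF sf] using nm_0 by eventually_elim simp
    ultimately show "L0_dist n M v w = 0" using vw by (simp add: L0_dist_eq idist_def integral_eq_zero_AE)
  qed
  fix z assume z: "z \<in> carrier M"
  show "L0_dist n M v z \<le> L0_dist n M v w + L0_dist n M w z"
    using vw z unfolding L0_dist_eq[OF vw(1) z] L0_dist_eq[OF vw] L0_dist_eq[OF vw(2) z]
    by (intro idist_add_le nm_minus_triangle nm_measurable nm_nonneg) simp_all
qed

lemma topology_eq: "L0_topology n M = Metric_space.mtopology (carrier M) (L0_dist n M)"
  by (simp add: L0_topology_def)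

lemma closure_of_approx:
  assumes "p \<in> L0_topology n M closure_of S" "e > 0"
  obtains s where "s \<in> S" "s \<in> carrier M" "p \<in> carrier M" "idist (nm M (p \<ominus> s)) < e"
proof -
  interpret Metric_space "carrier M" "L0_dist n M" by (rule metric)
  obtain s where "p \<in> carrier M" "s \<in> S" "s \<in> mball p e"
    using assms unfolding topology_eq metric_closure_of by blast
  then show thesis using that by (auto simp: in_mball L0_dist_eq)
qed

text \<open>Membership in a closure is exploited through this test: a function below all
  \<open>|p - s|\<close> has a positive part of arbitrarily small integral.\<close>

lemma AE_le_0_closure:
  assumes p: "p \<in> L0_topology n M closure_of S" and t: "t \<in> borel_measurable n"
    and le: "\<And>s. s \<in> S \<Longrightarrow> s \<in> carrier M \<Longrightarrow> AE x in n. t x \<le> nm M (p \<ominus> s) x"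
  shows "AE x in n. t x \<le> 0"
proof -
  define t' where "t' x = max 0 (t x)" for x
  have t': "t' \<in> borel_measurable n" "AE x in n. 0 \<le> t' x" unfolding t'_def using t by auto
  have "idist t' \<le> e" if e: "e > 0" for e
  proof -
    obtain s where s: "s \<in> S" "s \<in> carrier M" "p \<in> carrier M" "idist (nm M (p \<ominus> s)) < e"
      by (rule closure_of_approx[OF p e])
    have "idist t' \<le> idist (nm M (p \<ominus> s))"
    proof (rule idist_mono[OF t'])
      have "AE x in n. 0 \<le> nm M (p \<ominus> s) x" using s by (intro nm_nonneg) simp
      then show "AE x in n. t' x \<le> nm M (p \<ominus> s) x"
        using le[OF s(1,2)] by eventually_elim (simp add: t'_def)
    qed (use s in \<open>simp add: nm_measurable\<close>)
    then show ?thesis using s(4) by simp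
  qed
  then have "idist t' \<le> 0" by (rule field_le_epsilon[of _ 0, simplified])
  from idist_eq_0[OF t' this] show ?thesis by eventually_elim (simp add: t'_def)
qed

end

text \<open>Scalars are left out because the two sides may be modules over different rings, as for
  the pullback map.\<close>

definition additive_map :: "('z L0_elt, 'v, 'm) normed_module_scheme \<Rightarrow> ('y L0_elt, 'w, 'k) normed_module_scheme \<Rightarrow>
  ('v \<Rightarrow> 'w) \<Rightarrow> bool" where
  "additive_map M N T \<longleftrightarrow> T \<in> carrier M \<rightarrow> carrier N \<and>
     (\<forall>v\<in>carrier M. \<forall>w\<in>carrier M. T (v \<oplus>\<^bsub>M\<^esub> w) = T v \<oplus>\<^bsub>N\<^esub> T w)"

lemma additive_map_minus:
  assumes "abelian_group M" "abelian_group N" and T: "additive_map M N T" and v: "v \<in> carrier M" "w \<in> carrier M"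
  shows "T (v \<ominus>\<^bsub>M\<^esub> w) = T v \<ominus>\<^bsub>N\<^esub> T w"
proof -
  interpret M: abelian_group M by fact
  interpret N: abelian_group N by fact
  have c: "T v \<in> carrier N" "T w \<in> carrier N" "T (v \<ominus>\<^bsub>M\<^esub> w) \<in> carrier N" using T v by (auto simp: additive_map_def)
  have "(v \<ominus>\<^bsub>M\<^esub> w) \<oplus>\<^bsub>M\<^esub> w = v" using v by (simp add: M.minus_eq M.a_assoc M.l_neg)
  then have "T (v \<ominus>\<^bsub>M\<^esub> w) \<oplus>\<^bsub>N\<^esub> T w = T v" using T v by (metis M.minus_closed additive_map_def)
  then have "T v \<ominus>\<^bsub>N\<^esub> T w = (T (v \<ominus>\<^bsub>M\<^esub> w) \<oplus>\<^bsub>N\<^esub> T w) \<oplus>\<^bsub>N\<^esub> \<ominus>\<^bsub>N\<^esub> T w" by (simp add: N.minus_eq)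
  also have "\<dots> = T (v \<ominus>\<^bsub>M\<^esub> w)" using c by (simp add: N.a_assoc N.r_neg)
  finally show ?thesis by simp
qed

lemma additive_map_zero:
  assumes "abelian_group M" "abelian_group N" and T: "additive_map M N T"
  shows "T \<zero>\<^bsub>M\<^esub> = \<zero>\<^bsub>N\<^esub>"
proof -
  interpret M: abelian_group M by fact
  interpret N: abelian_group N by fact
  have c: "T \<zero>\<^bsub>M\<^esub> \<in> carrier N" using T by (auto simp: additive_map_def)
  have "T (\<zero>\<^bsub>M\<^esub> \<ominus>\<^bsub>M\<^esub> \<zero>\<^bsub>M\<^esub>) = T \<zero>\<^bsub>M\<^esub> \<ominus>\<^bsub>N\<^esub> T \<zero>\<^bsub>M\<^esub>" by (rule additive_map_minus[OF assms]) simp_all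
  then show ?thesis using c by (simp add: M.minus_eq M.r_neg N.minus_eq N.r_neg)
qed

text \<open>The weight \<open>b\<close> is finite at each point but possibly unbounded. On the set
  where it exceeds a large \<open>k\<close>, of small finite measure, the integrand is at most 1;
  elsewhere \<open>k\<close> serves as a uniform constant.\<close>

lemma bounded_additive_continuous:
  assumes M: "L0_normed_group n M" and N: "L0_normed_group n N" and T: "additive_map M N T"
    and b: "b \<in> borel_measurable n" "\<And>v. v \<in> carrier M \<Longrightarrow> AE x in n. nm N (T v) x \<le> b x * nm M v x"
  shows "L0_continuous n M N T"
proof -
  interpret M: L0_normed_group n M by (rule M)
  interpret N: L0_normed_group n N by (rule N)
  let ?n = "finite_equiv n"
  have sp: "space ?n = space n" by (rule sets_eq_imp_space_eq[OF sets_finite_equiv[OF M.sf]])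
  have Tc: "T v \<in> carrier N" if "v \<in> carrier M" for v using T that by (auto simp: additive_map_def)
  have key: "\<exists>d>0. \<forall>v\<in>carrier M. M.idist (nm M v) < d \<longrightarrow> M.idist (nm N (T v)) < e" if e: "e > 0" for e
  proof -
    define B where "B k = {x \<in> space ?n. b x > real k}" for k :: nat
    have [measurable]: "b \<in> borel_measurable ?n" using b(1) by (simp add: measurable_finite_equiv[OF M.sf])
    have Bm [measurable]: "B k \<in> sets ?n" for k unfolding B_def by measurable
    have "(\<lambda>k. measure ?n (B k)) \<longlonglongrightarrow> measure ?n (\<Inter>k. B k)"
      by (rule M.fe.finite_Lim_measure_decseq) (auto simp: decseq_def B_def)
    also have "(\<Inter>k. B k) = {}"
    proof -
      have "\<exists>k. \<not> b x > real k" for x using real_arch_simple[of "b x"] by (auto simp: not_less)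
      then show ?thesis by (auto simp: B_def)
    qed
    finally have "\<forall>\<^sub>F k in sequentially. measure ?n (B k) < e / 2" using e by (intro order_tendstoD(2)) auto
    then obtain k0 where k0: "\<And>k. k \<ge> k0 \<Longrightarrow> measure ?n (B k) < e / 2" by (auto simp: eventually_sequentially)
    \<comment> \<open>Being at least 1, \<open>k\<close> satisfies
      \<open>min 1 (k * t) \<le> k * min 1 t\<close> for \<open>t \<ge> 0\<close>.\<close>
    define k where "k = max 1 k0"
    have k: "measure ?n (B k) < e / 2" "k \<ge> 1" using k0[of k] by (auto simp: k_def)
    have "M.idist (nm N (T v)) < e" if v: "v \<in> carrier M" and d: "M.idist (nm M v) < e / (2 * real k)" for v
    proof -
      have i: "integrable ?n (\<lambda>x. min 1 (nm M v x))" by (rule M.idist_integrable[OF M.nm_measurable[OF v] M.nm_nonneg[OF v]])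
      have i2: "integrable ?n (indicat_real (B k))" by (simp add: M.fe.emeasure_finite less_top[symmetric])
      have "M.idist (nm N (T v)) \<le> (\<integral>x. indicat_real (B k) x + real k * min 1 (nm M v x) \<partial>?n)"
        unfolding M.idist_def
      proof (rule integral_mono_AE)
        show "integrable ?n (\<lambda>x. min 1 (nm N (T v) x))"
          by (rule M.idist_integrable[OF N.nm_measurable[OF Tc[OF v]] N.nm_nonneg[OF Tc[OF v]]])
        show "integrable ?n (\<lambda>x. indicat_real (B k) x + real k * min 1 (nm M v x))" using i i2 by simp
        show "AE x in ?n. min 1 (nm N (T v) x) \<le> indicat_real (B k) x + real k * min 1 (nm M v x)"
          unfolding AE_finite_equiv[OF M.sf] using b(2)[OF v] M.nm_nonneg[OF v] AE_space
        proof eventually_elim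
          case (elim x)
          show ?case
          proof (cases "b x > real k")
            case True
            then have "indicat_real (B k) x = 1" using elim(3) sp by (simp add: B_def)
            then show ?thesis using elim(2) by (simp add: add_increasing2 min_le_iff_disj)
          next
            case False
            have "nm N (T v) x \<le> real k * nm M v x" using elim False by (meson mult_right_mono not_less order_trans)
            moreover have "1 \<le> real k" using k by simp
            ultimately have "min 1 (nm N (T v) x) \<le> real k * min 1 (nm M v x)"
              by (auto simp: min_def)
            then show ?thesis by (simp add: indicator_def)
          qed
        qed
      qed
      also have "\<dots> = measure ?n (B k) + real k * M.idist (nm M v)"
        using i i2 by (simp add: M.idist_def)
      also have "\<dots> < e / 2 + real k * (e / (2 * real k))"
        using k d by (intro add_strict_mono mult_strict_left_mono) auto
      also have "\<dots> = e" using k by simp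
      finally show ?thesis .
    qed
    moreover have "e / (2 * real k) > 0" using e k by simp
    ultimately show ?thesis by blast
  qed
  have "continuous_map (Metric_space.mtopology (carrier M) (L0_dist n M))
    (Metric_space.mtopology (carrier N) (L0_dist n N)) T"
    unfolding Metric_space.metric_continuous_map[OF M.metric N.metric]
  proof (intro conjI ballI allI impI)
    show "T ` carrier M \<subseteq> carrier N" using Tc by blast
    fix v and e :: real assume v: "v \<in> carrier M" and e: "e > 0"
    obtain d where d: "d > 0" "\<And>v. v \<in> carrier M \<Longrightarrow> M.idist (nm M v) < d \<Longrightarrow> M.idist (nm N (T v)) < e"
      using key[OF e] by blast
    show "\<exists>d>0. \<forall>x. x \<in> carrier M \<and> L0_dist n M v x < d \<longrightarrow> L0_dist n N (T v) (T x) < e"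
    proof (intro exI[of _ d] conjI allI impI d(1))
      fix w assume w: "w \<in> carrier M \<and> L0_dist n M v w < d"
      have "M.idist (nm N (T (v \<ominus>\<^bsub>M\<^esub> w))) < e"
        by (rule d(2)) (use v w in \<open>auto simp: M.L0_dist_eq\<close>)
      moreover have "T (v \<ominus>\<^bsub>M\<^esub> w) = T v \<ominus>\<^bsub>N\<^esub> T w"
        using additive_map_minus[OF M.abelian_group_axioms N.abelian_group_axioms T] v w by simp
      ultimately show "L0_dist n N (T v) (T w) < e"
        using v w Tc by (simp add: N.L0_dist_eq M.idist_def N.idist_def)
    qed
  qed
  then show ?thesis by (simp add: L0_continuous_def L0_topology_def)
qed

lemma L0_normed_group_L0:
  assumes "sigma_finite_measure n" shows "L0_normed_group n (L0 n)"
proof -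
  interpret cring "L0 n" by (rule L0_cring)
  show ?thesis
  proof (intro L0_normed_group.intro L0_normed_group_axioms.intro abelian_group_axioms)
    fix F G assume F: "F \<in> carrier (L0 n)"
    show "AE x in n. 0 \<le> nm (L0 n) F x" using L0_rep_pnorm[OF F] by eventually_elim simp
    show "AE x in n. nm (L0 n) F x = 0 \<Longrightarrow> F = \<zero>\<^bsub>L0 n\<^esub>"
    proof -
      assume "AE x in n. nm (L0 n) F x = 0"
      with L0_rep_pnorm[OF F] L0_rep_zero[of n] have "AE x in n. L0_rep F x = L0_rep \<zero>\<^bsub>L0 n\<^esub> x"
        by eventually_elim simp
      then show ?thesis by (rule L0_eqI[OF F L0_zero_carrier])
    qed
    have F': "\<ominus>\<^bsub>L0 n\<^esub> F \<in> carrier (L0 n)" using F by simp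
    have "\<ominus>\<^bsub>L0 n\<^esub> F = \<zero>\<^bsub>L0 n\<^esub> \<ominus>\<^bsub>L0 n\<^esub> F" using F by (simp add: minus_eq)
    then have "AE x in n. L0_rep (\<ominus>\<^bsub>L0 n\<^esub> F) x = L0_rep \<zero>\<^bsub>L0 n\<^esub> x - L0_rep F x"
      using L0_rep_minus(2)[OF L0_zero_carrier F] by simp
    with L0_rep_pnorm[OF F] L0_rep_pnorm[OF F'] L0_rep_zero[of n]
    show "AE x in n. nm (L0 n) (\<ominus>\<^bsub>L0 n\<^esub> F) x = nm (L0 n) F x" by eventually_elim simp
    assume G: "G \<in> carrier (L0 n)"
    show "AE x in n. nm (L0 n) (F \<oplus>\<^bsub>L0 n\<^esub> G) x \<le> nm (L0 n) F x + nm (L0 n) G x"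
      using L0_rep_pnorm[OF F] L0_rep_pnorm[OF G] L0_rep_pnorm[OF L0_add_carrier[OF F G]] L0_rep_add[OF F G]
      by eventually_elim simp
  next
    show "AE x in n. nm (L0 n) \<zero>\<^bsub>L0 n\<^esub> x = 0"
      using L0_rep_pnorm[OF L0_zero_carrier[of n]] L0_rep_zero[of n] by eventually_elim simp
  qed (simp_all add: assms L0_pnorm_carrier)
qed

locale L0_normed = L0_normed_group n M + module "L0 n" M
  for n :: "'z measure" and M :: "('z L0_elt, 'v, 'm) normed_module_scheme" (structure) +
  assumes nm_smult: "h \<in> carrier (L0 n) \<Longrightarrow> v \<in> carrier M \<Longrightarrow> AE x in n. nm M (h \<odot>\<^bsub>M\<^esub> v) x = \<bar>L0_rep h x\<bar> * nm M v x"

lemma L0_normedI: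
  assumes sf: "sigma_finite_measure n" and M: "L0_normed_module n M"
  shows "L0_normed n M"
proof -
  interpret module "L0 n" M using M by (simp add: L0_normed_module_def)
  note M' = M[unfolded L0_normed_module_def]
  have pc: "pnorm M v \<in> carrier (L0 n)" if "v \<in> carrier M" for v using M' that by blast
  have sm: "AE x in n. nm M (h \<odot>\<^bsub>M\<^esub> v) x = \<bar>L0_rep h x\<bar> * nm M v x" if h: "h \<in> carrier (L0 n)" and v: "v \<in> carrier M" for h v
  proof -
    have eq: "pnorm M (h \<odot>\<^bsub>M\<^esub> v) = pnorm (L0 n) h \<otimes>\<^bsub>L0 n\<^esub> pnorm M v" using M' h v by blast
    show ?thesis
      unfolding eq using L0_rep_mult[OF L0_pnorm_carrier[OF h] pc[OF v]] L0_rep_pnorm[OF h] by eventually_elim simp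
  qed
  show ?thesis
  proof (intro L0_normed.intro L0_normed_group.intro L0_normed_group_axioms.intro L0_normed_axioms.intro
      M.abelian_group_axioms module_axioms)
    fix v w assume v: "v \<in> carrier M"
    show "pnorm M v \<in> carrier (L0 n)" by (rule pc[OF v])
    have "L0_le n \<zero>\<^bsub>L0 n\<^esub> (pnorm M v)" using M' v by blast
    then show "AE x in n. 0 \<le> nm M v x" unfolding L0_le_def using L0_rep_zero[of n] by eventually_elim simp
    show "v = \<zero>\<^bsub>M\<^esub>" if "AE x in n. nm M v x = 0"
    proof -
      have "AE x in n. nm M v x = L0_rep \<zero>\<^bsub>L0 n\<^esub> x" using that L0_rep_zero[of n] by eventually_elim simp
      then have "pnorm M v = \<zero>\<^bsub>L0 n\<^esub>" by (rule L0_eqI[OF pc[OF v] L0_zero_carrier])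
      then show ?thesis using M' v by blast
    qed
    have one: "\<ominus>\<^bsub>L0 n\<^esub> \<one>\<^bsub>L0 n\<^esub> \<in> carrier (L0 n)" by simp
    have "\<ominus>\<^bsub>L0 n\<^esub> \<one>\<^bsub>L0 n\<^esub> = \<zero>\<^bsub>L0 n\<^esub> \<ominus>\<^bsub>L0 n\<^esub> \<one>\<^bsub>L0 n\<^esub>" by (simp add: R.minus_eq)
    then have r: "AE x in n. L0_rep (\<ominus>\<^bsub>L0 n\<^esub> \<one>\<^bsub>L0 n\<^esub>) x = L0_rep \<zero>\<^bsub>L0 n\<^esub> x - L0_rep \<one>\<^bsub>L0 n\<^esub> x"
      using L0_rep_minus(2)[OF L0_zero_carrier L0_one_carrier, of n] by simp
    have eq: "\<ominus>\<^bsub>M\<^esub> v = (\<ominus>\<^bsub>L0 n\<^esub> \<one>\<^bsub>L0 n\<^esub>) \<odot>\<^bsub>M\<^esub> v" using smult_l_minus[OF L0_one_carrier v] v by simp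
    show "AE x in n. nm M (\<ominus>\<^bsub>M\<^esub> v) x = nm M v x"
      unfolding eq using sm[OF one v] r L0_rep_zero[of n] L0_rep_one[of n] by eventually_elim simp
    assume w: "w \<in> carrier M"
    have "L0_le n (pnorm M (v \<oplus>\<^bsub>M\<^esub> w)) (pnorm M v \<oplus>\<^bsub>L0 n\<^esub> pnorm M w)" using M' v w by blast
    then show "AE x in n. nm M (v \<oplus>\<^bsub>M\<^esub> w) x \<le> nm M v x + nm M w x"
      unfolding L0_le_def using L0_rep_add[OF pc[OF v] pc[OF w]] by eventually_elim simp
  next
    have "pnorm M \<zero>\<^bsub>M\<^esub> = \<zero>\<^bsub>L0 n\<^esub>" using M' M.zero_closed by blast
    then show "AE x in n. nm M \<zero>\<^bsub>M\<^esub> x = 0" using L0_rep_zero[of n] by simp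
  qed (use sf sm in auto)
qed

section \<open>Functionals\<close>

abbreviation cst :: "'z measure \<Rightarrow> real \<Rightarrow> 'z L0_elt" where
  "cst n c \<equiv> L0_cls n (\<lambda>_. c)"

lemma cst_carrier: "cst n c \<in> carrier (L0 n)" by simp

lemma rep_cst: "AE x in n. L0_rep (cst n c) x = c" by (rule L0_rep_cls) simp

lemma cst_add: "cst n c \<oplus>\<^bsub>L0 n\<^esub> cst n d = cst n (c + d)"
  using L0_rep_add[OF cst_carrier cst_carrier, of n c d] rep_cst[of n c] rep_cst[of n d] rep_cst[of n "c + d"]
  by (intro L0_eqI[of _ n] L0_add_carrier cst_carrier) (elim AE_mp, simp)

lemma cst_mult: "cst n c \<otimes>\<^bsub>L0 n\<^esub> cst n d = cst n (c * d)"
  using L0_rep_mult[OF cst_carrier cst_carrier, of n c d] rep_cst[of n c] rep_cst[of n d] rep_cst[of n "c * d"]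
  by (intro L0_eqI[of _ n] L0_mult_carrier cst_carrier) (elim AE_mp, simp)

lemma cst_1: "cst n 1 = \<one>\<^bsub>L0 n\<^esub>" and cst_0: "cst n 0 = \<zero>\<^bsub>L0 n\<^esub>"
  by (simp_all add: L0_def)

text \<open>Take a rational \<open>c\<close> within \<open>z / (|K| + 1)\<close> of
  \<open>h\<close>. Restricting to rationals allows estimates whose null sets depend on
  \<open>c\<close> to be used all at once.\<close>

lemma rational_approx_nonpos:
  fixes z h K :: real
  assumes "\<And>c. c \<in> \<rat> \<Longrightarrow> z \<le> \<bar>h - c\<bar> * K" shows "z \<le> 0"
proof (rule ccontr)
  assume "\<not> z \<le> 0"
  then have z: "z > 0" by simp
  have "0 < z / (\<bar>K\<bar> + 1)" using z by simp
  then obtain c where c: "c \<in> \<rat>" "h < c" "c < h + z / (\<bar>K\<bar> + 1)"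
    using Rats_dense_in_real[of h "h + z / (\<bar>K\<bar> + 1)"] by auto
  have "z \<le> \<bar>h - c\<bar> * K" by (rule assms[OF c(1)])
  also have "\<dots> \<le> \<bar>h - c\<bar> * (\<bar>K\<bar> + 1)" by (intro mult_left_mono) auto
  also have "\<dots> < z / (\<bar>K\<bar> + 1) * (\<bar>K\<bar> + 1)" using c by (intro mult_strict_right_mono) auto
  also have "\<dots> = z" by simp
  finally show False by simp
qed

lemma L0_normed_L0:
  assumes "sigma_finite_measure n" shows "L0_normed n (L0 n)"
proof -
  interpret N: L0_normed_group n "L0 n" by (rule L0_normed_group_L0[OF assms])
  interpret R: cring "L0 n" by (rule L0_cring)
  have "module (L0 n) (L0 n)"
    by (rule moduleI) (simp_all add: R.is_cring N.abelian_group_axioms L0_smult_eq L0_mult_carrier R.l_distr R.r_distr R.m_assoc)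
  then show ?thesis
  proof (intro L0_normed.intro N.L0_normed_group_axioms L0_normed_axioms.intro)
    fix h v assume c: "h \<in> carrier (L0 n)" "v \<in> carrier (L0 n)"
    show "AE x in n. nm (L0 n) (h \<odot>\<^bsub>L0 n\<^esub> v) x = \<bar>L0_rep h x\<bar> * nm (L0 n) v x"
      unfolding L0_smult_eq
      using L0_rep_pnorm[OF L0_mult_carrier[OF c]] L0_rep_mult[OF c] L0_rep_pnorm[OF c(2)]
      by eventually_elim (simp add: abs_mult)
  qed
qed

context L0_normed
begin

lemma nm_cst: "v \<in> carrier M \<Longrightarrow> AE x in n. nm M (cst n c \<odot> v) x = \<bar>c\<bar> * nm M v x"
  using nm_smult[OF cst_carrier[of n c], of v] rep_cst[of n c] by simp (elim AE_mp, simp)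

lemma smult_diff:
  assumes "a \<in> carrier (L0 n)" "b \<in> carrier (L0 n)" "v \<in> carrier M"
  shows "(a \<ominus>\<^bsub>L0 n\<^esub> b) \<odot> v = a \<odot> v \<ominus> b \<odot> v"
  using assms by (simp add: R.minus_eq M.minus_eq smult_l_distr smult_l_minus)

lemma nm_diff_smult:
  assumes "a \<in> carrier (L0 n)" "b \<in> carrier (L0 n)" "v \<in> carrier M"
  shows "AE x in n. nm M (a \<odot> v \<ominus> b \<odot> v) x = \<bar>L0_rep a x - L0_rep b x\<bar> * nm M v x"
  using nm_smult[OF L0_rep_minus(1)[OF assms(1,2)] assms(3)] L0_rep_minus(2)[OF assms(1,2)]
  unfolding smult_diff[OF assms] by eventually_elim simp

end

text \<open>Approximating the scalar \<open>h\<close> pointwise by rational constants shows that a bounded \<open>\<real>\<close>-linear map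
  is \<open>L\<^sup>0\<close>-linear.\<close>

lemma real_linear_bounded_homogeneous:
  assumes M: "L0_normed n M" and N: "L0_normed n' N"
    and u: "\<And>Q. AE y in n. Q y \<Longrightarrow> AE x in n'. Q (u x)"
    and T: "additive_map M N T" "\<And>c v. v \<in> carrier M \<Longrightarrow> T (cst n c \<odot>\<^bsub>M\<^esub> v) = cst n' c \<odot>\<^bsub>N\<^esub> T v"
    and b: "\<And>v. v \<in> carrier M \<Longrightarrow> AE x in n'. nm N (T v) x \<le> b x * nm M v (u x)"
    and h: "h \<in> carrier (L0 n)" and k: "k \<in> carrier (L0 n')" "AE x in n'. L0_rep k x = L0_rep h (u x)"
    and v: "v \<in> carrier M"
  shows "T (h \<odot>\<^bsub>M\<^esub> v) = k \<odot>\<^bsub>N\<^esub> T v"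
proof -
  interpret M: L0_normed n M by (rule M)
  interpret N: L0_normed n' N by (rule N)
  have Tc: "T v \<in> carrier N" if "v \<in> carrier M" for v using T that by (auto simp: additive_map_def)
  define z where "z = T (h \<odot>\<^bsub>M\<^esub> v) \<ominus>\<^bsub>N\<^esub> k \<odot>\<^bsub>N\<^esub> T v"
  have hv: "h \<odot>\<^bsub>M\<^esub> v \<in> carrier M" using h v by simp
  have kv: "k \<odot>\<^bsub>N\<^esub> T v \<in> carrier N" using k Tc[OF v] by simp
  have zc: "z \<in> carrier N" unfolding z_def using Tc[OF hv] kv by simp
  \<comment> \<open>Both terms of the difference are compared with the value for the constant scalar
    \<open>c\<close>, for which \<open>T\<close> is homogeneous; each comparison costs
    \<open>|h - c|\<close> times the bound.\<close>
  have step: "AE x in n'. nm N z x \<le> \<bar>L0_rep h (u x) - c\<bar> * (2 * (b x * nm M v (u x)))" for c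
  proof -
    have cv: "cst n c \<odot>\<^bsub>M\<^esub> v \<in> carrier M" "cst n' c \<odot>\<^bsub>N\<^esub> T v \<in> carrier N" using v Tc by simp_all
    have "T (h \<odot>\<^bsub>M\<^esub> v) \<ominus>\<^bsub>N\<^esub> cst n' c \<odot>\<^bsub>N\<^esub> T v = T (h \<odot>\<^bsub>M\<^esub> v \<ominus>\<^bsub>M\<^esub> cst n c \<odot>\<^bsub>M\<^esub> v)"
      using additive_map_minus[OF M.M.abelian_group_axioms N.M.abelian_group_axioms T(1) hv cv(1)] T(2)[OF v] by simp
    then have "AE x in n'. nm N (T (h \<odot>\<^bsub>M\<^esub> v) \<ominus>\<^bsub>N\<^esub> cst n' c \<odot>\<^bsub>N\<^esub> T v) x \<le>
        b x * nm M (h \<odot>\<^bsub>M\<^esub> v \<ominus>\<^bsub>M\<^esub> cst n c \<odot>\<^bsub>M\<^esub> v) (u x)"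
      using b[of "h \<odot>\<^bsub>M\<^esub> v \<ominus>\<^bsub>M\<^esub> cst n c \<odot>\<^bsub>M\<^esub> v"] hv cv by simp
    moreover have "AE x in n'. nm M (h \<odot>\<^bsub>M\<^esub> v \<ominus>\<^bsub>M\<^esub> cst n c \<odot>\<^bsub>M\<^esub> v) (u x) = \<bar>L0_rep h (u x) - c\<bar> * nm M v (u x)"
      by (rule u) (use M.nm_diff_smult[OF h cst_carrier[of n c] v] rep_cst[of n c] in \<open>eventually_elim, simp\<close>)
    moreover have "AE x in n'. nm N (cst n' c \<odot>\<^bsub>N\<^esub> T v \<ominus>\<^bsub>N\<^esub> k \<odot>\<^bsub>N\<^esub> T v) x = \<bar>c - L0_rep h (u x)\<bar> * nm N (T v) x"
      using N.nm_diff_smult[OF cst_carrier[of n' c] k(1) Tc[OF v]] rep_cst[of n' c] k(2) by eventually_elim simp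
    moreover have "AE x in n'. nm N z x \<le> nm N (T (h \<odot>\<^bsub>M\<^esub> v) \<ominus>\<^bsub>N\<^esub> cst n' c \<odot>\<^bsub>N\<^esub> T v) x +
        nm N (cst n' c \<odot>\<^bsub>N\<^esub> T v \<ominus>\<^bsub>N\<^esub> k \<odot>\<^bsub>N\<^esub> T v) x"
      unfolding z_def by (rule N.nm_minus_triangle[OF Tc[OF hv] cv(2) kv])
    moreover note b[OF v]
    ultimately show ?thesis
    proof eventually_elim
      case (elim x)
      have "\<bar>c - L0_rep h (u x)\<bar> * nm N (T v) x \<le> \<bar>c - L0_rep h (u x)\<bar> * (b x * nm M v (u x))"
        using elim(5) by (rule mult_left_mono) simp
      then show ?case using elim by (simp add: abs_minus_commute algebra_simps)
    qed
  qed
  have "AE x in n'. \<forall>c\<in>\<rat>. nm N z x \<le> \<bar>L0_rep h (u x) - c\<bar> * (2 * (b x * nm M v (u x)))"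
    using step by (simp add: AE_ball_countable[OF countable_rat])
  then have "AE x in n'. nm N z x = 0"
    using N.nm_nonneg[OF zc]
  proof eventually_elim
    case (elim x)
    then show ?case using rational_approx_nonpos[of "nm N z x" "L0_rep h (u x)"] by fastforce
  qed
  then have "z = \<zero>\<^bsub>N\<^esub>" by (rule N.nm_eq_0[OF zc])
  then show ?thesis unfolding z_def using N.minus_zero_iff[OF Tc[OF hv] kv] by simp
qed

section \<open>Continuous functionals have a pointwise bound\<close>

context L0_normed
begin

lemma linear_props:
  assumes T: "L0_linear n M (L0 n) T"
  shows "v \<in> carrier M \<Longrightarrow> T v \<in> carrier (L0 n)" "additive_map M (L0 n) T"
    "v \<in> carrier M \<Longrightarrow> w \<in> carrier M \<Longrightarrow> AE x in n. L0_rep (T (v \<oplus> w)) x = L0_rep (T v) x + L0_rep (T w) x"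
    "h \<in> carrier (L0 n) \<Longrightarrow> v \<in> carrier M \<Longrightarrow> AE x in n. L0_rep (T (h \<odot> v)) x = L0_rep h x * L0_rep (T v) x"
proof -
  show c: "v \<in> carrier M \<Longrightarrow> T v \<in> carrier (L0 n)" for v using T by (auto simp: L0_linear_def)
  show "additive_map M (L0 n) T" using T by (auto simp: L0_linear_def additive_map_def)
  show "v \<in> carrier M \<Longrightarrow> w \<in> carrier M \<Longrightarrow> AE x in n. L0_rep (T (v \<oplus> w)) x = L0_rep (T v) x + L0_rep (T w) x"
    using T L0_rep_add[OF c c] by (simp add: L0_linear_def)
  show "h \<in> carrier (L0 n) \<Longrightarrow> v \<in> carrier M \<Longrightarrow> AE x in n. L0_rep (T (h \<odot> v)) x = L0_rep h x * L0_rep (T v) x"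
    using T L0_rep_mult[OF _ c] by (simp add: L0_linear_def L0_smult_eq)
qed

lemma linear_minus:
  assumes T: "L0_linear n M (L0 n) T" and v: "v \<in> carrier M" "w \<in> carrier M"
  shows "AE x in n. L0_rep (T (v \<ominus> w)) x = L0_rep (T v) x - L0_rep (T w) x"
  using additive_map_minus[OF M.abelian_group_axioms _ linear_props(2)[OF T] v]
    L0_rep_minus(2)[OF linear_props(1)[OF T v(1)] linear_props(1)[OF T v(2)]] R.abelian_group_axioms by simp

text \<open>Gluing vectors of the unit ball shows that \<open>{|T v| : |v| \<le> 1}\<close> is upwards directed. If it had no
  finite essential supremum, then \<open>|T v|\<close> would be large, for one \<open>v\<close> in the unit ball, on a set of
  fixed measure.\<close>

lemma continuous_functional_bounded:
  assumes T: "L0_linear n M (L0 n) T" and cont: "L0_continuous n M (L0 n) T"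
  obtains b where "b \<in> borel_measurable n" "\<And>x. 0 \<le> b x"
    "\<And>v. v \<in> carrier M \<Longrightarrow> AE x in n. \<bar>L0_rep (T v) x\<bar> \<le> b x * nm M v x"
proof -
  interpret N: L0_normed n "L0 n" by (rule L0_normed_L0[OF sf])
  let ?n = "finite_equiv n"
  have sp: "space ?n = space n" by (rule sets_eq_imp_space_eq[OF sets_finite_equiv[OF sf]])
  note Tc = linear_props(1)[OF T] and Tadd = linear_props(3)[OF T] and Tsm = linear_props(4)[OF T]
  define t where "t v x = \<bar>L0_rep (T v) x\<bar>" for v x
  have tm: "t v \<in> borel_measurable n" if "v \<in> carrier M" for v
    unfolding t_def using L0_rep_measurable[OF Tc[OF that]] by measurable
  have tm': "t v \<in> borel_measurable ?n" if "v \<in> carrier M" for v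
    using tm[OF that] by (simp add: measurable_finite_equiv[OF sf])
  define U where "U = {v \<in> carrier M. AE x in n. nm M v x \<le> 1}"
  have small: "\<exists>d>0. \<forall>v\<in>carrier M. idist (nm M v) < d \<longrightarrow> idist (t v) < e" if e: "e > 0" for e
  proof -
    have "\<exists>d>0. \<forall>x. x \<in> carrier M \<and> L0_dist n M \<zero> x < d \<longrightarrow> L0_dist n (L0 n) (T \<zero>) (T x) < e"
      using cont e unfolding L0_continuous_def topology_eq N.topology_eq Metric_space.metric_continuous_map[OF metric N.metric]
      by blast
    then obtain d where d: "d > 0" "\<And>x. x \<in> carrier M \<Longrightarrow> L0_dist n M \<zero> x < d \<Longrightarrow> L0_dist n (L0 n) (T \<zero>) (T x) < e"
      by blast
    have T0: "T \<zero> = \<zero>\<^bsub>L0 n\<^esub>"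
      by (rule additive_map_zero[OF M.abelian_group_axioms R.abelian_group_axioms linear_props(2)[OF T]])
    have "idist (t v) < e" if v: "v \<in> carrier M" "idist (nm M v) < d" for v
    proof -
      have "\<ominus> \<zero> = \<zero>" by (rule M.minus_equality) simp_all
      then have "v \<ominus> \<zero> = v" using v by (simp add: M.minus_eq)
      then have "L0_dist n M v \<zero> = idist (nm M v)" using v by (simp add: L0_dist_eq)
      with Metric_space.commute[OF metric, of "\<zero>" v]
      have "L0_dist n M \<zero> v = idist (nm M v)" by simp
      then have "L0_dist n (L0 n) \<zero>\<^bsub>L0 n\<^esub> (T v) < e" using d(2)[OF v(1)] v(2) T0 by simp
      moreover have "L0_dist n (L0 n) \<zero>\<^bsub>L0 n\<^esub> (T v) = L0_dist n (L0 n) (T v) \<zero>\<^bsub>L0 n\<^esub>"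
        by (rule Metric_space.commute[OF N.metric])
      moreover have "\<dots> = idist (nm (L0 n) (T v))"
        using Tc[OF v(1)] by (simp add: N.L0_dist_eq R.minus_eq)
      moreover have "idist (nm (L0 n) (T v)) = idist (t v)"
        unfolding idist_def
      proof (rule integral_cong_AE)
        show "AE x in ?n. min 1 (nm (L0 n) (T v) x) = min 1 (t v x)"
          unfolding AE_finite_equiv[OF sf] t_def using L0_rep_pnorm[OF Tc[OF v(1)]] by eventually_elim simp
      qed (use tm[OF v(1)] N.nm_measurable[OF Tc[OF v(1)]] in \<open>simp_all add: measurable_finite_equiv[OF sf]\<close>)
      ultimately show ?thesis by simp
    qed
    then show ?thesis using d(1) by blast
  qed
  have level: "\<exists>c>0. \<forall>v\<in>U. measure ?n {x \<in> space ?n. c \<le> t v x} \<le> e" if e: "e > 0" for e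
  proof -
    obtain d where d: "d > 0" "\<And>v. v \<in> carrier M \<Longrightarrow> idist (nm M v) < d \<Longrightarrow> idist (t v) < e"
      using small[OF e] by blast
    \<comment> \<open>Dividing a vector of the unit ball by this \<open>c\<close> makes its distance
      to 0 less than \<open>d\<close>, by the total mass of the finite measure; where
      \<open>t v\<close> is at least \<open>c\<close>, the image of the scaled vector has modulus at
      least 1.\<close>
    define c where "c = (measure ?n (space ?n) + 1) / d"
    have c: "c > 0" using d(1) by (simp add: c_def add_nonneg_pos)
    have "measure ?n {x \<in> space ?n. c \<le> t v x} \<le> e" if v: "v \<in> U" for v
    proof -
      have vc: "v \<in> carrier M" "AE x in n. nm M v x \<le> 1" using v by (auto simp: U_def)
      define w where "w = cst n (1/c) \<odot> v"
      have w: "w \<in> carrier M" using vc by (simp add: w_def)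
      have nw: "AE x in n. nm M w x \<le> 1 / c"
        using nm_cst[OF vc(1), of "1/c"] vc(2) unfolding w_def
        by eventually_elim (use c in \<open>simp add: field_simps\<close>)
      have "idist (nm M w) \<le> (\<integral>x. 1 / c \<partial>?n)"
        unfolding idist_def
      proof (rule integral_mono_AE[OF idist_integrable[OF nm_measurable[OF w] nm_nonneg[OF w]]])
        show "AE x in ?n. min 1 (nm M w x) \<le> 1 / c"
          unfolding AE_finite_equiv[OF sf] using nw by eventually_elim simp
      qed simp
      also have "\<dots> = measure ?n (space ?n) / c" by simp
      also have "\<dots> < d"
      proof -
        have "measure ?n (space ?n) < d * c" using d(1) by (simp add: c_def)
        then show ?thesis using c by (simp add: divide_less_eq)
      qed
      finally have lt: "idist (t w) < e" by (rule d(2)[OF w])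
      have tw: "AE x in n. t w x = t v x / c"
        using Tsm[OF cst_carrier[of n "1/c"] vc(1)] rep_cst[of n "1/c"] unfolding w_def t_def
        by eventually_elim (use c in \<open>simp add: abs_mult\<close>)
      have [measurable]: "t v \<in> borel_measurable ?n" by (rule tm'[OF vc(1)])
      have "measure ?n {x \<in> space ?n. c \<le> t v x} = (\<integral>x. indicat_real {x \<in> space ?n. c \<le> t v x} x \<partial>?n)"
        by simp
      also have "\<dots> \<le> idist (t w)"
        unfolding idist_def
      proof (rule integral_mono_AE)
        have "{x \<in> space ?n. c \<le> t v x} \<in> sets ?n" by measurable
        then show "integrable ?n (indicat_real {x \<in> space ?n. c \<le> t v x})"
          by (simp add: fe.emeasure_finite less_top[symmetric])
        show "integrable ?n (\<lambda>x. min 1 (t w x))"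
          by (rule idist_integrable[OF tm[OF w]]) (simp add: t_def)
        show "AE x in ?n. indicat_real {x \<in> space ?n. c \<le> t v x} x \<le> min 1 (t w x)"
          unfolding AE_finite_equiv[OF sf] using tw
          by eventually_elim (use c in \<open>auto simp: indicator_def t_def le_divide_eq\<close>)
      qed
      finally show ?thesis using lt by simp
    qed
    then show ?thesis using c by blast
  qed
  \<comment> \<open>Use \<open>v\<close> where its image is the larger one and \<open>w\<close>
    elsewhere, with the indicators of the two regions as scalars.\<close>
  have glue: "\<exists>z\<in>U. (AE x in n. t v x \<le> t z x) \<and> (AE x in n. t w x \<le> t z x)" if v: "v \<in> U" and w: "w \<in> U" for v w
  proof -
    have vc: "v \<in> carrier M" "w \<in> carrier M" using v w by (auto simp: U_def)
    define i where "i x = (if t w x \<le> t v x then 1 else 0 :: real)" for x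
    have im: "i \<in> borel_measurable n" "(\<lambda>x. 1 - i x) \<in> borel_measurable n"
      unfolding i_def using tm[OF vc(1)] tm[OF vc(2)] by measurable
    define a where "a = L0_cls n i"
    define b where "b = L0_cls n (\<lambda>x. 1 - i x)"
    have ab: "a \<in> carrier (L0 n)" "b \<in> carrier (L0 n)" unfolding a_def b_def using im by (auto intro: L0_cls_carrier)
    have ra: "AE x in n. L0_rep a x = i x" "AE x in n. L0_rep b x = 1 - i x"
      unfolding a_def b_def by (rule L0_rep_cls[OF im(1)], rule L0_rep_cls[OF im(2)])
    define z where "z = a \<odot> v \<oplus> b \<odot> w"
    have c: "a \<odot> v \<in> carrier M" "b \<odot> w \<in> carrier M" using ab vc by simp_all
    then have zc: "z \<in> carrier M" by (simp add: z_def)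
    have "AE x in n. nm M v x \<le> 1" "AE x in n. nm M w x \<le> 1" using v w by (auto simp: U_def)
    then have "AE x in n. nm M z x \<le> 1"
      using nm_triangle[OF c] nm_smult[OF ab(1) vc(1)] nm_smult[OF ab(2) vc(2)] ra unfolding z_def
      by eventually_elim (auto simp: i_def split: if_splits)
    then have zU: "z \<in> U" using zc by (simp add: U_def)
    have "AE x in n. L0_rep (T z) x = i x * L0_rep (T v) x + (1 - i x) * L0_rep (T w) x"
      using Tadd[OF c] Tsm[OF ab(1) vc(1)] Tsm[OF ab(2) vc(2)] ra unfolding z_def by eventually_elim simp
    then have "AE x in n. t v x \<le> t z x" "AE x in n. t w x \<le> t z x"
      by (eventually_elim, simp add: t_def i_def split: if_splits)+
    then show ?thesis using zU by blast
  qed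
  \<comment> \<open>Arctan makes a possibly infinite supremum finite, and the sign turns it into an
    infimum; the value \<open>- (pi / 2)\<close> will mark the points where the supremum is
    infinite.\<close>
  define S where "S = (\<lambda>v x. - arctan (t v x)) ` U"
  have zU: "\<zero> \<in> U" unfolding U_def using nm_0 by (auto elim: AE_mp)
  obtain s f where sm: "s \<in> borel_measurable n" and f: "\<And>k::nat. f k \<in> S"
    and sf_eq: "\<And>x. s x = (INF k. max (- (pi/2)) (f k x))"
    and sle: "\<And>g. g \<in> S \<Longrightarrow> AE x in n. s x \<le> g x"
  proof (rule essential_infimum[OF sf, of S "\<lambda>_. - (pi/2)"])
    show "S \<noteq> {}" using zU by (auto simp: S_def)
    have "(\<lambda>x. - arctan (t v x)) \<in> borel_measurable n" if "v \<in> U" for v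
      using tm[of v] that by (auto simp: U_def)
    then show "S \<subseteq> borel_measurable n" by (auto simp: S_def)
    show "AE x in n. - (pi / 2) \<le> g x" if "g \<in> S" for g
      using that arctan_ubound by (auto simp: S_def less_imp_le intro!: AE_I2)
  qed (simp, rule that)
  have "\<forall>k. \<exists>v. v \<in> U \<and> f k = (\<lambda>x. - arctan (t v x))" using f by (auto simp: S_def)
  from choice[OF this] obtain v where v: "\<And>k. v k \<in> U" "\<And>k. f k = (\<lambda>x. - arctan (t (v k) x))" by blast
  have vc: "v k \<in> carrier M" for k using v(1)[of k] by (simp add: U_def)
  have s_le: "s x \<le> - arctan (t (v k) x)" for k x
  proof -
    have "s x \<le> max (- (pi/2)) (f k x)"
      unfolding sf_eq by (rule cINF_lower) (auto intro!: bdd_belowI[of _ "- (pi/2)"])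
    also have "\<dots> = - arctan (t (v k) x)" using arctan_ubound[of "t (v k) x"] by (simp add: v(2) max_def)
    finally show ?thesis .
  qed
  have s_less: "\<exists>k. a < arctan (t (v k) x)" if "s x < - a" for a x
  proof -
    have "\<exists>k\<in>UNIV. max (- (pi/2)) (f k x) < - a"
      using that unfolding sf_eq by (subst (asm) cINF_less_iff) (auto intro!: bdd_belowI[of _ "- (pi/2)"])
    then show ?thesis by (auto simp: v(2))
  qed
  define B where "B = {x \<in> space ?n. s x \<le> - (pi/2)}"
  have [measurable]: "s \<in> borel_measurable ?n" using sm by (simp add: measurable_finite_equiv[OF sf])
  have Bm [measurable]: "B \<in> sets ?n" unfolding B_def by measurable
  have "measure ?n B \<le> e" if e: "e > 0" for e
  proof -
    obtain c where c: "c > 0" "\<And>v. v \<in> U \<Longrightarrow> measure ?n {x \<in> space ?n. c \<le> t v x} \<le> e" using level[OF e] by blast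
    \<comment> \<open>By gluing, finitely many \<open>v i\<close> are dominated by one vector of the
      unit ball, so each \<open>C j\<close> has measure at most \<open>e\<close>; \<open>B\<close>
      is covered by their increasing union.\<close>
    define C where "C j = {x \<in> space ?n. \<exists>i\<le>j. c \<le> t (v i) x}" for j :: nat
    have [measurable]: "t (v i) \<in> borel_measurable ?n" for i by (rule tm'[OF vc])
    have Cm [measurable]: "C j \<in> sets ?n" for j unfolding C_def by measurable
    have Cj: "measure ?n (C j) \<le> e" for j
    proof -
      have "\<exists>z\<in>U. \<forall>i\<le>j. AE x in n. t (v i) x \<le> t z x"
      proof (induction j)
        case 0 then show ?case using v(1) by (intro bexI[of _ "v 0"]) auto
      next
        case (Suc j)
        then obtain z where z: "z \<in> U" "\<And>i. i \<le> j \<Longrightarrow> AE x in n. t (v i) x \<le> t z x" by blast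
        obtain z' where z': "z' \<in> U" "AE x in n. t z x \<le> t z' x" "AE x in n. t (v (Suc j)) x \<le> t z' x"
          using glue[OF z(1) v(1)] by blast
        have "AE x in n. t (v i) x \<le> t z' x" if "i \<le> Suc j" for i
        proof (cases "i = Suc j")
          case False
          then have "i \<le> j" using that by simp
          from z(2)[OF this] z'(2) show ?thesis by eventually_elim simp
        qed (use z'(3) in simp)
        then show ?case using z'(1) by blast
      qed
      then obtain z where z: "z \<in> U" "\<And>i. i \<le> j \<Longrightarrow> AE x in n. t (v i) x \<le> t z x" by blast
      have zc: "z \<in> carrier M" using z(1) by (simp add: U_def)
      have [measurable]: "t z \<in> borel_measurable ?n" by (rule tm'[OF zc])
      have "AE x in n. \<forall>i\<in>{..j}. t (v i) x \<le> t z x" using z(2) by (subst AE_ball_countable) auto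
      then have "AE x in ?n. x \<in> C j \<longrightarrow> x \<in> {x \<in> space ?n. c \<le> t z x}"
        unfolding AE_finite_equiv[OF sf]
      proof eventually_elim
        case (elim x)
        show ?case
        proof
          assume "x \<in> C j"
          then obtain i where "i \<le> j" "c \<le> t (v i) x" "x \<in> space ?n" by (auto simp: C_def)
          moreover from this elim have "t (v i) x \<le> t z x" by simp
          ultimately show "x \<in> {x \<in> space ?n. c \<le> t z x}" by simp
        qed
      qed
      then have "measure ?n (C j) \<le> measure ?n {x \<in> space ?n. c \<le> t z x}"
        by (rule fe.finite_measure_mono_AE) measurable
      also have "\<dots> \<le> e" by (rule c(2)[OF z(1)])
      finally show ?thesis .
    qed
    have "(\<lambda>j. measure ?n (C j)) \<longlonglongrightarrow> measure ?n (\<Union>j. C j)"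
      by (rule fe.finite_Lim_measure_incseq) (auto simp: incseq_def C_def intro: order_trans)
    then have "measure ?n (\<Union>j. C j) \<le> e" by (rule LIMSEQ_le_const2) (use Cj in blast)
    moreover have "B \<subseteq> (\<Union>j. C j)"
    proof
      fix x assume x: "x \<in> B"
      have "s x < - arctan c" using x arctan_ubound[of c] by (simp add: B_def)
      from s_less[OF this] obtain k where "arctan c < arctan (t (v k) x)" by blast
      then have "c \<le> t (v k) x" by (simp add: arctan_less_iff)
      then show "x \<in> (\<Union>j. C j)" using x by (auto simp: B_def C_def)
    qed
    then have "measure ?n B \<le> measure ?n (\<Union>j. C j)" by (intro fe.finite_measure_mono) measurable
    ultimately show ?thesis by simp
  qed
  then have "measure ?n B \<le> 0" by (rule field_le_epsilon[of _ 0, simplified])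
  then have "measure ?n B = 0" by (simp add: measure_le_0_iff)
  then have "B \<in> null_sets ?n" using Bm by (auto simp: null_sets_def fe.emeasure_eq_measure)
  then have "AE x in ?n. x \<notin> B" by (rule AE_not_in)
  then have s_gt: "AE x in n. - (pi / 2) < s x"
    unfolding AE_finite_equiv[OF sf] using AE_space by eventually_elim (auto simp: B_def sp)
  have s_le0: "s x \<le> 0" for x using s_le[of x 0] by (simp add: t_def order_trans)
  \<comment> \<open>Undoing arctan, \<open>b\<close> is the essential supremum itself, finite off
    the null set \<open>B\<close>.\<close>
  define b where "b x = (if - (pi / 2) < s x then tan (- s x) else 0)" for x
  have bm: "b \<in> borel_measurable n" unfolding b_def tan_def using sm by measurable
  have b0: "0 \<le> b x" for x
  proof (cases "- (pi / 2) < s x \<and> s x \<noteq> 0")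
    case True then show ?thesis using s_le0[of x] tan_gt_zero[of "- s x"] by (auto simp: b_def)
  qed (auto simp: b_def)
  have ball: "AE x in n. t w x \<le> b x" if w: "w \<in> U" for w
  proof -
    have "AE x in n. s x \<le> - arctan (t w x)" using w by (intro sle) (auto simp: S_def)
    then show ?thesis
      using s_gt
    proof eventually_elim
      case (elim x)
      have "arctan (t w x) \<le> - s x" using elim by simp
      also have "- s x = arctan (tan (- s x))" using elim s_le0[of x] by (intro arctan_tan[symmetric]) auto
      finally show ?case using elim by (simp add: b_def arctan_le_iff)
    qed
  qed
  show thesis
  proof (rule that[OF bm b0])
    fix w assume w: "w \<in> carrier M"
    \<comment> \<open>Scaling by the inverse of the norm brings \<open>w\<close> into the unit ball;
      where the norm is 0 the inverse is 0 by convention, and that region is treated through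
      \<open>k\<close>, for which the scaled vector is zero.\<close>
    define h where "h x = inverse (nm M w x)" for x
    define k where "k x = (if nm M w x = 0 then 1 else 0 :: real)" for x
    have hm: "h \<in> borel_measurable n" "k \<in> borel_measurable n" unfolding h_def k_def using nm_measurable[OF w] by measurable
    note hc = L0_cls_carrier[OF hm(1)] L0_cls_carrier[OF hm(2)]
    have hw: "L0_cls n h \<odot> w \<in> carrier M" "L0_cls n k \<odot> w \<in> carrier M" using hc w by auto
    have "AE x in n. nm M (L0_cls n h \<odot> w) x \<le> 1"
      using nm_smult[OF hc(1) w] L0_rep_cls[OF hm(1)] nm_nonneg[OF w]
    proof eventually_elim
      case (elim x) then show ?case by (cases "nm M w x = 0") (simp_all add: h_def)
    qed
    then have 1: "AE x in n. t (L0_cls n h \<odot> w) x \<le> b x" using hw by (intro ball) (simp add: U_def)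
    have "AE x in n. nm M (L0_cls n k \<odot> w) x = 0"
      using nm_smult[OF hc(2) w] L0_rep_cls[OF hm(2)] by eventually_elim (simp add: k_def)
    then have "L0_cls n k \<odot> w = \<zero>" by (rule nm_eq_0[OF hw(2)])
    then have "T (L0_cls n k \<odot> w) = \<zero>\<^bsub>L0 n\<^esub>"
      using additive_map_zero[OF M.abelian_group_axioms R.abelian_group_axioms linear_props(2)[OF T]] by simp
    then have 2: "AE x in n. L0_rep (T (L0_cls n k \<odot> w)) x = 0" using L0_rep_zero[of n] by simp
    show "AE x in n. \<bar>L0_rep (T w) x\<bar> \<le> b x * nm M w x"
      using 1 2 Tsm[OF hc(1) w] Tsm[OF hc(2) w] L0_rep_cls[OF hm(1)] L0_rep_cls[OF hm(2)] nm_nonneg[OF w]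
    proof eventually_elim
      case (elim x)
      show ?case
      proof (cases "nm M w x = 0")
        case True then show ?thesis using elim by (simp add: k_def)
      next
        case False
        then have "nm M w x > 0" using elim by simp
        then show ?thesis using elim by (simp add: t_def h_def abs_mult field_simps)
      qed
    qed
  qed
qed

end

section \<open>The dual module and its operator norm\<close>

locale L0_normed_dual = L0_normed n M
  for n :: "'z measure" and M :: "('z L0_elt, 'v) normed_module" (structure)
begin

lemma bounded_linear_continuous:
  assumes T: "L0_linear n M (L0 n) T" and b: "b \<in> borel_measurable n"
    "\<And>v. v \<in> carrier M \<Longrightarrow> AE x in n. \<bar>L0_rep (T v) x\<bar> \<le> b x * nm M v x"
  shows "L0_continuous n M (L0 n) T"
proof (rule bounded_additive_continuous[OF L0_normed_group_axioms L0_normed_group_L0[OF sf] linear_props(2)[OF T] b(1)])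
  show "AE x in n. nm (L0 n) (T v) x \<le> b x * nm M v x" if "v \<in> carrier M" for v
    using b(2)[OF that] L0_rep_pnorm[OF linear_props(1)[OF T that]] by eventually_elim simp
qed

text \<open>Continuity is traded for a pointwise bound, by
  \<open>continuous_functional_bounded\<close> one way and \<open>bounded_linear_continuous\<close>
  the other; closure of the dual under its operations then becomes a matter of estimates.\<close>

lemma dual_carrier_iff:
  "L \<in> carrier (L0_dual n M) \<longleftrightarrow> L \<in> extensional (carrier M) \<and> L0_linear n M (L0 n) L \<and>
    (\<exists>b. b \<in> borel_measurable n \<and> (\<forall>x. 0 \<le> b x) \<and> (\<forall>v\<in>carrier M. AE x in n. \<bar>L0_rep (L v) x\<bar> \<le> b x * nm M v x))"
proof
  assume "L \<in> carrier (L0_dual n M)"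
  then have L: "L \<in> extensional (carrier M)" "L0_linear n M (L0 n) L" "L0_continuous n M (L0 n) L"
    by (auto simp: L0_dual_def)
  from continuous_functional_bounded[OF L(2,3)] L(1,2)
  show "L \<in> extensional (carrier M) \<and> L0_linear n M (L0 n) L \<and>
    (\<exists>b. b \<in> borel_measurable n \<and> (\<forall>x. 0 \<le> b x) \<and> (\<forall>v\<in>carrier M. AE x in n. \<bar>L0_rep (L v) x\<bar> \<le> b x * nm M v x))"
    by metis
next
  assume "L \<in> extensional (carrier M) \<and> L0_linear n M (L0 n) L \<and>
    (\<exists>b. b \<in> borel_measurable n \<and> (\<forall>x. 0 \<le> b x) \<and> (\<forall>v\<in>carrier M. AE x in n. \<bar>L0_rep (L v) x\<bar> \<le> b x * nm M v x))"
  then show "L \<in> carrier (L0_dual n M)" unfolding L0_dual_def using bounded_linear_continuous by auto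
qed

lemma dual_linear: "L \<in> carrier (L0_dual n M) \<Longrightarrow> L0_linear n M (L0 n) L"
  by (simp add: dual_carrier_iff)

text \<open>The bound \<open>b\<close> makes the defining family of the essential supremum bounded.
  The inequality for a general \<open>v\<close> comes from normalising it pointwise; where
  \<open>|v|\<close> vanishes, \<open>b\<close> shows that \<open>T v\<close> vanishes too.\<close>

lemma opnorm_props:
  assumes T: "L0_linear n M (L0 n) T" and b: "b \<in> borel_measurable n" "\<And>x. 0 \<le> b x"
    "\<And>v. v \<in> carrier M \<Longrightarrow> AE x in n. \<bar>L0_rep (T v) x\<bar> \<le> b x * nm M v x"
  shows "L0_opnorm n M (L0 n) T \<in> carrier (L0 n)"
    and "AE x in n. 0 \<le> L0_rep (L0_opnorm n M (L0 n) T) x"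
    and "v \<in> carrier M \<Longrightarrow> AE x in n. \<bar>L0_rep (T v) x\<bar> \<le> L0_rep (L0_opnorm n M (L0 n) T) x * nm M v x"
    and "c \<in> borel_measurable n \<Longrightarrow> AE x in n. 0 \<le> c x \<Longrightarrow>
      (\<And>v. v \<in> carrier M \<Longrightarrow> AE x in n. \<bar>L0_rep (T v) x\<bar> \<le> c x * nm M v x) \<Longrightarrow>
      AE x in n. L0_rep (L0_opnorm n M (L0 n) T) x \<le> c x"
proof -
  define S where "S = {pnorm (L0 n) (T v) | v. v \<in> carrier M \<and> L0_le n (pnorm M v) \<one>\<^bsub>L0 n\<^esub>}"
  have le1: "L0_le n (pnorm M v) \<one>\<^bsub>L0 n\<^esub> \<longleftrightarrow> (AE x in n. nm M v x \<le> 1)" for v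
    unfolding L0_le_def using L0_rep_one[of n] by (intro iffI) (erule (1) AE_mp[OF AE_conjI], simp)+
  note Tc = linear_props(1)[OF T]
  have inS: "pnorm (L0 n) (T v) \<in> S" if "v \<in> carrier M" "AE x in n. nm M v x \<le> 1" for v
    using that le1 by (auto simp: S_def)
  have n01: "AE x in n. nm M \<zero> x \<le> 1" using nm_0 by eventually_elim simp
  have ne: "S \<noteq> {}" using inS[OF M.zero_closed n01] by blast
  have Sc: "S \<subseteq> carrier (L0 n)" unfolding S_def using Tc L0_pnorm_carrier by blast
  have up: "AE x in n. L0_rep F x \<le> c x"
    if F: "F \<in> S" and c: "AE x in n. 0 \<le> c x" "\<And>v. v \<in> carrier M \<Longrightarrow> AE x in n. \<bar>L0_rep (T v) x\<bar> \<le> c x * nm M v x" for F c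
  proof -
    obtain v where v: "v \<in> carrier M" "AE x in n. nm M v x \<le> 1" "F = pnorm (L0 n) (T v)" using F le1 by (auto simp: S_def)
    show ?thesis
      using c(2)[OF v(1)] v(2) c(1) L0_rep_pnorm[OF Tc[OF v(1)]] unfolding v(3)
    proof eventually_elim
      case (elim x)
      have "c x * nm M v x \<le> c x * 1" using elim by (intro mult_left_mono) auto
      then show ?case using elim by linarith
    qed
  qed
  define o' where "o' = L0_opnorm n M (L0 n) T"
  have o'_eq: "o' = L0_esssup n S" by (simp add: o'_def L0_opnorm_def S_def)
  have ub: "AE x in n. L0_rep F x \<le> b x" if "F \<in> S" for F by (rule up[OF that _ b(3)]) (simp add: b(2))
  note E = L0_esssup_props[OF sf ne Sc b(1), folded o'_eq]
  show oc: "o' \<in> carrier (L0 n)" by (rule E(1)) (rule ub)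
  have E2: "L0_le n F o'" if "F \<in> S" for F using that by (intro E(2) ub)
  have z: "pnorm (L0 n) (T \<zero>) \<in> S" by (rule inS[OF M.zero_closed n01])
  show o0: "AE x in n. 0 \<le> L0_rep o' x"
    using E2[OF z] L0_rep_pnorm[OF Tc[OF M.zero_closed]] unfolding L0_le_def by eventually_elim simp
  show "AE x in n. L0_rep o' x \<le> c x" if "c \<in> borel_measurable n" "AE x in n. 0 \<le> c x"
    "\<And>v. v \<in> carrier M \<Longrightarrow> AE x in n. \<bar>L0_rep (T v) x\<bar> \<le> c x * nm M v x"
    by (rule E(3)[OF ub _ that(1)]) (assumption | rule up[OF _ that(2,3)])+
  assume v: "v \<in> carrier M"
  define h where "h x = inverse (nm M v x)" for x
  have hm: "h \<in> borel_measurable n" unfolding h_def using nm_measurable[OF v] by measurable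
  note hc = L0_cls_carrier[OF hm]
  define w where "w = L0_cls n h \<odot> v"
  have w: "w \<in> carrier M" unfolding w_def using hc v by auto
  have "AE x in n. nm M w x \<le> 1"
    unfolding w_def using nm_smult[OF hc v] L0_rep_cls[OF hm] nm_nonneg[OF v]
  proof eventually_elim
    case (elim x) then show ?case by (cases "nm M v x = 0") (simp_all add: h_def)
  qed
  from E2[OF inS[OF w this]] have "AE x in n. nm (L0 n) (T w) x \<le> L0_rep o' x" by (simp add: L0_le_def)
  then show "AE x in n. \<bar>L0_rep (T v) x\<bar> \<le> L0_rep o' x * nm M v x"
    using L0_rep_pnorm[OF Tc[OF w]] linear_props(4)[OF T hc v, folded w_def] L0_rep_cls[OF hm] nm_nonneg[OF v] b(3)[OF v]
  proof eventually_elim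
    case (elim x)
    show ?case
    proof (cases "nm M v x = 0")
      case True then show ?thesis using elim by simp
    next
      case False
      then have "nm M v x > 0" using elim by simp
      then show ?thesis using elim by (simp add: h_def abs_mult field_simps)
    qed
  qed
qed

lemma dual_opnorm:
  assumes L: "L \<in> carrier (L0_dual n M)"
  shows "pnorm (L0_dual n M) L \<in> carrier (L0 n)"
    and "AE x in n. 0 \<le> nm (L0_dual n M) L x"
    and "v \<in> carrier M \<Longrightarrow> AE x in n. \<bar>L0_rep (L v) x\<bar> \<le> nm (L0_dual n M) L x * nm M v x"
    and "c \<in> borel_measurable n \<Longrightarrow> AE x in n. 0 \<le> c x \<Longrightarrow>
      (\<And>v. v \<in> carrier M \<Longrightarrow> AE x in n. \<bar>L0_rep (L v) x\<bar> \<le> c x * nm M v x) \<Longrightarrow>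
      AE x in n. nm (L0_dual n M) L x \<le> c x"
proof -
  obtain b where b: "b \<in> borel_measurable n" "\<And>x. 0 \<le> b x"
    "\<And>v. v \<in> carrier M \<Longrightarrow> AE x in n. \<bar>L0_rep (L v) x\<bar> \<le> b x * nm M v x" using L dual_carrier_iff by blast
  have eq: "pnorm (L0_dual n M) L = L0_opnorm n M (L0 n) L" by (simp add: L0_dual_def)
  note P = opnorm_props[OF dual_linear[OF L] b, folded eq]
  show "pnorm (L0_dual n M) L \<in> carrier (L0 n)" by (rule P(1))
  show "AE x in n. 0 \<le> nm (L0_dual n M) L x" by (rule P(2))
  show "v \<in> carrier M \<Longrightarrow> AE x in n. \<bar>L0_rep (L v) x\<bar> \<le> nm (L0_dual n M) L x * nm M v x" by (rule P(3))
  show "c \<in> borel_measurable n \<Longrightarrow> AE x in n. 0 \<le> c x \<Longrightarrow>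
      (\<And>v. v \<in> carrier M \<Longrightarrow> AE x in n. \<bar>L0_rep (L v) x\<bar> \<le> c x * nm M v x) \<Longrightarrow>
      AE x in n. nm (L0_dual n M) L x \<le> c x" by (rule P(4))
qed

lemma dual_eqI:
  assumes "K \<in> carrier (L0_dual n M)" "L \<in> carrier (L0_dual n M)" "\<And>v. v \<in> carrier M \<Longrightarrow> K v = L v"
  shows "K = L"
  using assms by (intro extensionalityI[of K "carrier M" L]) (auto simp: dual_carrier_iff)

lemma dual_apply:
  "v \<in> carrier M \<Longrightarrow> (K \<oplus>\<^bsub>L0_dual n M\<^esub> L) v = K v \<oplus>\<^bsub>L0 n\<^esub> L v"
  "v \<in> carrier M \<Longrightarrow> (h \<odot>\<^bsub>L0_dual n M\<^esub> L) v = h \<otimes>\<^bsub>L0 n\<^esub> L v"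
  "v \<in> carrier M \<Longrightarrow> \<zero>\<^bsub>L0_dual n M\<^esub> v = \<zero>\<^bsub>L0 n\<^esub>"
  by (simp_all add: L0_dual_def)

lemma functional_dualI:
  assumes ext: "L \<in> extensional (carrier M)" and c: "\<And>v. v \<in> carrier M \<Longrightarrow> L v \<in> carrier (L0 n)"
    and add: "\<And>v w. v \<in> carrier M \<Longrightarrow> w \<in> carrier M \<Longrightarrow> AE x in n. L0_rep (L (v \<oplus> w)) x = L0_rep (L v) x + L0_rep (L w) x"
    and sm: "\<And>h v. h \<in> carrier (L0 n) \<Longrightarrow> v \<in> carrier M \<Longrightarrow> AE x in n. L0_rep (L (h \<odot> v)) x = L0_rep h x * L0_rep (L v) x"
    and b: "b \<in> borel_measurable n" "\<And>x. 0 \<le> b x"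
      "\<And>v. v \<in> carrier M \<Longrightarrow> AE x in n. \<bar>L0_rep (L v) x\<bar> \<le> b x * nm M v x"
  shows "L \<in> carrier (L0_dual n M)"
proof -
  have "L (v \<oplus> w) = L v \<oplus>\<^bsub>L0 n\<^esub> L w" if "v \<in> carrier M" "w \<in> carrier M" for v w
    by (rule L0_eqI[of _ n]) (use that c add[OF that] L0_rep_add[OF c c, OF that] in \<open>auto intro: L0_add_carrier\<close>)
  moreover have "L (h \<odot> v) = h \<odot>\<^bsub>L0 n\<^esub> L v" if "h \<in> carrier (L0 n)" "v \<in> carrier M" for h v
    unfolding L0_smult_eq
    by (rule L0_eqI[of _ n]) (use that c sm[OF that] L0_rep_mult[OF that(1) c[OF that(2)]] in \<open>auto intro: L0_mult_carrier\<close>)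
  ultimately have "L0_linear n M (L0 n) L" unfolding L0_linear_def using c by auto
  then show ?thesis unfolding dual_carrier_iff using ext b by blast
qed

lemma dual_smult_closed:
  assumes L: "L \<in> carrier (L0_dual n M)" and a: "a \<in> carrier (L0 n)"
  shows "a \<odot>\<^bsub>L0_dual n M\<^esub> L \<in> carrier (L0_dual n M)"
proof -
  let ?D = "L0_dual n M"
  note l = linear_props[OF dual_linear[OF L]]
  obtain c where c: "c \<in> borel_measurable n" "\<And>x. 0 \<le> c x"
    "\<And>v. v \<in> carrier M \<Longrightarrow> AE x in n. \<bar>L0_rep (L v) x\<bar> \<le> c x * nm M v x" using L dual_carrier_iff by blast
  have rep: "AE x in n. L0_rep ((a \<odot>\<^bsub>?D\<^esub> L) v) x = L0_rep a x * L0_rep (L v) x" if "v \<in> carrier M" for v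
    using L0_rep_mult[OF a l(1)[OF that]] that by (simp add: dual_apply)
  show ?thesis
  proof (rule functional_dualI[where b = "\<lambda>x. \<bar>L0_rep a x\<bar> * c x"])
    show "a \<odot>\<^bsub>?D\<^esub> L \<in> extensional (carrier M)" by (simp add: L0_dual_def)
    show "(a \<odot>\<^bsub>?D\<^esub> L) v \<in> carrier (L0 n)" if "v \<in> carrier M" for v
      using that l(1) a by (simp add: dual_apply L0_mult_carrier)
    show "AE x in n. L0_rep ((a \<odot>\<^bsub>?D\<^esub> L) (v \<oplus> w)) x =
      L0_rep ((a \<odot>\<^bsub>?D\<^esub> L) v) x + L0_rep ((a \<odot>\<^bsub>?D\<^esub> L) w) x"
      if "v \<in> carrier M" "w \<in> carrier M" for v w
      using rep[OF M.a_closed[OF that]] rep[OF that(1)] rep[OF that(2)] l(3)[OF that]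
      by eventually_elim (simp add: algebra_simps)
    show "AE x in n. L0_rep ((a \<odot>\<^bsub>?D\<^esub> L) (h \<odot> v)) x = L0_rep h x * L0_rep ((a \<odot>\<^bsub>?D\<^esub> L) v) x"
      if "h \<in> carrier (L0 n)" "v \<in> carrier M" for h v
      using rep[OF smult_closed[OF that]] rep[OF that(2)] l(4)[OF that] by eventually_elim (simp add: algebra_simps)
    show "AE x in n. \<bar>L0_rep ((a \<odot>\<^bsub>?D\<^esub> L) v) x\<bar> \<le> (\<bar>L0_rep a x\<bar> * c x) * nm M v x" if "v \<in> carrier M" for v
      using rep[OF that] c(3)[OF that]
      by eventually_elim (simp add: abs_mult mult.assoc mult_left_mono)
    show "(\<lambda>x. \<bar>L0_rep a x\<bar> * c x) \<in> borel_measurable n" using c(1) L0_rep_measurable[OF a] by measurable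
  qed (use c in auto)
qed

text \<open>The norm axioms follow from the description of the operator norm as the least
  nonnegative pointwise bound (\<open>dual_opnorm\<close>).\<close>

lemma dual_normed_group: "L0_normed_group n (L0_dual n M)"
proof -
  let ?D = "L0_dual n M"
  have addc: "K \<oplus>\<^bsub>?D\<^esub> L \<in> carrier ?D" if K: "K \<in> carrier ?D" and L: "L \<in> carrier ?D" for K L
  proof -
    note k = linear_props[OF dual_linear[OF K]] and l = linear_props[OF dual_linear[OF L]]
    obtain b where b: "b \<in> borel_measurable n" "\<And>x. 0 \<le> b x"
      "\<And>v. v \<in> carrier M \<Longrightarrow> AE x in n. \<bar>L0_rep (K v) x\<bar> \<le> b x * nm M v x" using K dual_carrier_iff by blast
    obtain c where c: "c \<in> borel_measurable n" "\<And>x. 0 \<le> c x"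
      "\<And>v. v \<in> carrier M \<Longrightarrow> AE x in n. \<bar>L0_rep (L v) x\<bar> \<le> c x * nm M v x" using L dual_carrier_iff by blast
    have rep: "AE x in n. L0_rep ((K \<oplus>\<^bsub>?D\<^esub> L) v) x = L0_rep (K v) x + L0_rep (L v) x" if "v \<in> carrier M" for v
      using L0_rep_add[OF k(1)[OF that] l(1)[OF that]] that by (simp add: dual_apply)
    show ?thesis
    proof (rule functional_dualI[where b = "\<lambda>x. b x + c x"])
      show "K \<oplus>\<^bsub>?D\<^esub> L \<in> extensional (carrier M)" by (simp add: L0_dual_def)
      show "(K \<oplus>\<^bsub>?D\<^esub> L) v \<in> carrier (L0 n)" if "v \<in> carrier M" for v
        using that k(1) l(1) by (simp add: dual_apply L0_add_carrier)
      show "AE x in n. L0_rep ((K \<oplus>\<^bsub>?D\<^esub> L) (v \<oplus> w)) x = L0_rep ((K \<oplus>\<^bsub>?D\<^esub> L) v) x + L0_rep ((K \<oplus>\<^bsub>?D\<^esub> L) w) x"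
        if "v \<in> carrier M" "w \<in> carrier M" for v w
        using rep[OF M.a_closed[OF that]] rep[OF that(1)] rep[OF that(2)] k(3)[OF that] l(3)[OF that]
        by eventually_elim simp
      show "AE x in n. L0_rep ((K \<oplus>\<^bsub>?D\<^esub> L) (h \<odot> v)) x = L0_rep h x * L0_rep ((K \<oplus>\<^bsub>?D\<^esub> L) v) x"
        if "h \<in> carrier (L0 n)" "v \<in> carrier M" for h v
        using rep[OF smult_closed[OF that]] rep[OF that(2)] k(4)[OF that] l(4)[OF that]
        by eventually_elim (simp add: algebra_simps)
      show "AE x in n. \<bar>L0_rep ((K \<oplus>\<^bsub>?D\<^esub> L) v) x\<bar> \<le> (b x + c x) * nm M v x" if "v \<in> carrier M" for v
        using rep[OF that] b(3)[OF that] c(3)[OF that] by eventually_elim (simp add: algebra_simps)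
    qed (use b c in auto)
  qed
  have smc: "cst n a \<odot>\<^bsub>?D\<^esub> L \<in> carrier ?D" if "L \<in> carrier ?D" for L a
    by (rule dual_smult_closed[OF that cst_carrier])
  have zc: "\<zero>\<^bsub>?D\<^esub> \<in> carrier ?D"
  proof (rule functional_dualI[where b = "\<lambda>x. 0"])
    have rep: "AE x in n. L0_rep (\<zero>\<^bsub>?D\<^esub> v) x = 0" if "v \<in> carrier M" for v
      using that L0_rep_zero[of n] by (simp add: dual_apply)
    show "\<zero>\<^bsub>?D\<^esub> \<in> extensional (carrier M)" by (simp add: L0_dual_def)
    show "\<zero>\<^bsub>?D\<^esub> v \<in> carrier (L0 n)" if "v \<in> carrier M" for v using that by (simp add: dual_apply)
    show "AE x in n. L0_rep (\<zero>\<^bsub>?D\<^esub> (v \<oplus> w)) x = L0_rep (\<zero>\<^bsub>?D\<^esub> v) x + L0_rep (\<zero>\<^bsub>?D\<^esub> w) x"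
      if "v \<in> carrier M" "w \<in> carrier M" for v w
      using rep[OF M.a_closed[OF that]] rep[OF that(1)] rep[OF that(2)] by eventually_elim simp
    show "AE x in n. L0_rep (\<zero>\<^bsub>?D\<^esub> (h \<odot> v)) x = L0_rep h x * L0_rep (\<zero>\<^bsub>?D\<^esub> v) x"
      if "h \<in> carrier (L0 n)" "v \<in> carrier M" for h v
      using rep[OF smult_closed[OF that]] rep[OF that(2)] by eventually_elim simp
    show "AE x in n. \<bar>L0_rep (\<zero>\<^bsub>?D\<^esub> v) x\<bar> \<le> 0 * nm M v x" if "v \<in> carrier M" for v
      using rep[OF that] by eventually_elim simp
  qed auto
  have ev: "L v \<in> carrier (L0 n)" if "L \<in> carrier ?D" "v \<in> carrier M" for L v
    by (rule linear_props(1)[OF dual_linear[OF that(1)] that(2)])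
  have grp: "abelian_group ?D"
  proof (rule abelian_groupI)
    fix K L H assume c: "K \<in> carrier ?D" "L \<in> carrier ?D" "H \<in> carrier ?D"
    show "K \<oplus>\<^bsub>?D\<^esub> L \<oplus>\<^bsub>?D\<^esub> H = K \<oplus>\<^bsub>?D\<^esub> (L \<oplus>\<^bsub>?D\<^esub> H)"
      by (rule dual_eqI) (use c in \<open>simp_all add: addc dual_apply ev R.a_assoc\<close>)
  next
    fix K L assume c: "K \<in> carrier ?D" "L \<in> carrier ?D"
    show "K \<oplus>\<^bsub>?D\<^esub> L = L \<oplus>\<^bsub>?D\<^esub> K" by (rule dual_eqI) (use c in \<open>simp_all add: addc dual_apply ev R.a_comm\<close>)
  next
    fix L assume c: "L \<in> carrier ?D"
    show "\<zero>\<^bsub>?D\<^esub> \<oplus>\<^bsub>?D\<^esub> L = L" by (rule dual_eqI) (use c in \<open>simp_all add: addc zc dual_apply ev\<close>)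
    show "\<exists>K\<in>carrier ?D. K \<oplus>\<^bsub>?D\<^esub> L = \<zero>\<^bsub>?D\<^esub>"
    proof
      show "cst n (-1) \<odot>\<^bsub>?D\<^esub> L \<oplus>\<^bsub>?D\<^esub> L = \<zero>\<^bsub>?D\<^esub>"
      proof (rule dual_eqI)
        fix v assume v: "v \<in> carrier M"
        show "(cst n (-1) \<odot>\<^bsub>?D\<^esub> L \<oplus>\<^bsub>?D\<^esub> L) v = \<zero>\<^bsub>?D\<^esub> v"
          unfolding dual_apply[OF v]
        proof (rule L0_eqI[of _ n])
          note lv = ev[OF c v]
          have k: "cst n (-1) \<otimes>\<^bsub>L0 n\<^esub> L v \<in> carrier (L0 n)" by (rule L0_mult_carrier[OF cst_carrier lv])
          show "AE x in n. L0_rep (cst n (-1) \<otimes>\<^bsub>L0 n\<^esub> L v \<oplus>\<^bsub>L0 n\<^esub> L v) x = L0_rep \<zero>\<^bsub>L0 n\<^esub> x"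
            using L0_rep_add[OF k lv] L0_cls_cmult[OF lv, of "-1"] L0_rep_zero[of n] by eventually_elim simp
        qed (use ev[OF c v] in \<open>simp_all add: L0_carriers\<close>)
      qed (use addc smc zc c in auto)
    qed (rule smc[OF c])
  qed (use addc zc in auto)
  interpret D: abelian_group ?D by (rule grp)
  have nm0: "AE x in n. nm ?D L x = 0"
    if L: "L \<in> carrier ?D" and 0: "\<And>v. v \<in> carrier M \<Longrightarrow> AE x in n. L0_rep (L v) x = 0" for L
  proof -
    have "AE x in n. nm ?D L x \<le> 0"
    proof (rule dual_opnorm(4)[OF L])
      show "AE x in n. \<bar>L0_rep (L v) x\<bar> \<le> 0 * nm M v x" if "v \<in> carrier M" for v
        using 0[OF that] by eventually_elim simp
    qed auto
    then show ?thesis using dual_opnorm(2)[OF L] by eventually_elim simp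
  qed
  have nm_le: "AE x in n. nm ?D L x \<le> nm ?D K x"
    if L: "L \<in> carrier ?D" and K: "K \<in> carrier ?D" and LK: "\<And>v. v \<in> carrier M \<Longrightarrow> AE x in n. \<bar>L0_rep (L v) x\<bar> = \<bar>L0_rep (K v) x\<bar>"
    for L K
  proof (rule dual_opnorm(4)[OF L])
    show "nm ?D K \<in> borel_measurable n" by (rule L0_rep_measurable[OF dual_opnorm(1)[OF K]])
    show "AE x in n. 0 \<le> nm ?D K x" by (rule dual_opnorm(2)[OF K])
    show "AE x in n. \<bar>L0_rep (L v) x\<bar> \<le> nm ?D K x * nm M v x" if "v \<in> carrier M" for v
      using LK[OF that] dual_opnorm(3)[OF K that] by eventually_elim simp
  qed
  show ?thesis
  proof (intro L0_normed_group.intro L0_normed_group_axioms.intro grp sf)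
    fix K assume K: "K \<in> carrier ?D"
    show "pnorm ?D K \<in> carrier (L0 n)" by (rule dual_opnorm(1)[OF K])
    show "AE x in n. 0 \<le> nm ?D K x" by (rule dual_opnorm(2)[OF K])
    show "K = \<zero>\<^bsub>?D\<^esub>" if z: "AE x in n. nm ?D K x = 0"
    proof (rule dual_eqI[OF K zc])
      fix v assume v: "v \<in> carrier M"
      have "AE x in n. L0_rep (K v) x = L0_rep \<zero>\<^bsub>L0 n\<^esub> x"
        using dual_opnorm(3)[OF K v] z L0_rep_zero[of n] by eventually_elim simp
      then show "K v = \<zero>\<^bsub>?D\<^esub> v" using v ev[OF K v] by (simp add: dual_apply L0_eqI)
    qed
    show "AE x in n. nm ?D (\<ominus>\<^bsub>?D\<^esub> K) x = nm ?D K x"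
    proof -
      have mK: "\<ominus>\<^bsub>?D\<^esub> K \<in> carrier ?D" using K by simp
      have "AE x in n. \<bar>L0_rep ((\<ominus>\<^bsub>?D\<^esub> K) v) x\<bar> = \<bar>L0_rep (K v) x\<bar>" if v: "v \<in> carrier M" for v
      proof -
        have "(\<ominus>\<^bsub>?D\<^esub> K \<oplus>\<^bsub>?D\<^esub> K) v = \<zero>\<^bsub>?D\<^esub> v" using K by (simp add: D.l_neg)
        then have "(\<ominus>\<^bsub>?D\<^esub> K) v \<oplus>\<^bsub>L0 n\<^esub> K v = \<zero>\<^bsub>L0 n\<^esub>" using v by (simp add: dual_apply)
        with L0_rep_zero[of n] have "AE x in n. L0_rep ((\<ominus>\<^bsub>?D\<^esub> K) v \<oplus>\<^bsub>L0 n\<^esub> K v) x = 0" by simp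
        with L0_rep_add[OF ev[OF mK v] ev[OF K v]] show ?thesis
          by eventually_elim (simp add: eq_neg_iff_add_eq_0[symmetric])
      qed
      note eq = this
      have "AE x in n. nm ?D (\<ominus>\<^bsub>?D\<^esub> K) x \<le> nm ?D K x" by (rule nm_le[OF mK K eq])
      moreover have "AE x in n. nm ?D K x \<le> nm ?D (\<ominus>\<^bsub>?D\<^esub> K) x"
        by (rule nm_le[OF K mK], drule eq, erule eventually_mono) simp
      ultimately show ?thesis by eventually_elim simp
    qed
    fix L assume L: "L \<in> carrier ?D"
    show "AE x in n. nm ?D (K \<oplus>\<^bsub>?D\<^esub> L) x \<le> nm ?D K x + nm ?D L x"
    proof (rule dual_opnorm(4)[OF addc[OF K L]])
      have "nm ?D K \<in> borel_measurable n" "nm ?D L \<in> borel_measurable n"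
        by (rule L0_rep_measurable[OF dual_opnorm(1)[OF K]], rule L0_rep_measurable[OF dual_opnorm(1)[OF L]])
      then show "(\<lambda>x. nm ?D K x + nm ?D L x) \<in> borel_measurable n" by measurable
      show "AE x in n. 0 \<le> nm ?D K x + nm ?D L x"
        using dual_opnorm(2)[OF K] dual_opnorm(2)[OF L] by eventually_elim simp
      show "AE x in n. \<bar>L0_rep ((K \<oplus>\<^bsub>?D\<^esub> L) v) x\<bar> \<le> (nm ?D K x + nm ?D L x) * nm M v x" if v: "v \<in> carrier M" for v
        using dual_opnorm(3)[OF K v] dual_opnorm(3)[OF L v] L0_rep_add[OF ev[OF K v] ev[OF L v]] v
        unfolding dual_apply[OF v] by (elim AE_mp) (auto simp: algebra_simps)
    qed
  next
    show "AE x in n. nm ?D \<zero>\<^bsub>?D\<^esub> x = 0"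
      by (rule nm0[OF zc]) (use L0_rep_zero[of n] in \<open>simp add: dual_apply\<close>)
  qed
qed

text \<open>Homogeneity over the reals is enough: \<open>real_linear_bounded_homogeneous\<close>,
  with the identity as base map, upgrades it to homogeneity over L0.\<close>

lemma real_functional_dualI:
  assumes T: "\<And>v. v \<in> carrier M \<Longrightarrow> T v \<in> carrier (L0 n)"
      "\<And>v w. v \<in> carrier M \<Longrightarrow> w \<in> carrier M \<Longrightarrow> T (v \<oplus> w) = T v \<oplus>\<^bsub>L0 n\<^esub> T w"
      "\<And>c v. v \<in> carrier M \<Longrightarrow> T (cst n c \<odot> v) = cst n c \<otimes>\<^bsub>L0 n\<^esub> T v"
    and b: "b \<in> borel_measurable n" "\<And>x. 0 \<le> b x"
      "\<And>v. v \<in> carrier M \<Longrightarrow> AE x in n. \<bar>L0_rep (T v) x\<bar> \<le> b x * nm M v x"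
  shows "restrict T (carrier M) \<in> carrier (L0_dual n M)"
proof -
  have lin: "L0_linear n M (L0 n) T"
    unfolding L0_linear_def
  proof (intro conjI ballI)
    fix h v assume h: "h \<in> carrier (L0 n)" and v: "v \<in> carrier M"
    show "T (h \<odot> v) = h \<odot>\<^bsub>L0 n\<^esub> T v"
    proof (rule real_linear_bounded_homogeneous[OF L0_normed_axioms L0_normed_L0[OF sf], where u = "\<lambda>x. x" and b = b])
      show "AE x in n. nm (L0 n) (T v) x \<le> b x * nm M v x" if "v \<in> carrier M" for v
        using b(3)[OF that] L0_rep_pnorm[OF T(1)[OF that]] by eventually_elim simp
    qed (use T h v in \<open>auto simp: additive_map_def L0_smult_eq\<close>)
  qed (use T in auto)
  note p = linear_props[OF lin]
  show ?thesis
    by (rule functional_dualI[OF _ _ _ _ b(1,2)])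
      (use p(1,3,4) b(3) a_closed smult_closed in \<open>simp_all\<close>)
qed

lemma cst_uminus: "v \<in> carrier M \<Longrightarrow> cst n (-1) \<odot> v = \<ominus> v"
proof -
  assume v: "v \<in> carrier M"
  have "cst n (-1) \<odot> v \<oplus> cst n 1 \<odot> v = cst n 0 \<odot> v"
    using v by (subst smult_l_distr[symmetric]) (simp_all add: cst_add)
  then have "cst n (-1) \<odot> v \<oplus> v = \<zero>" using v by (simp add: cst_1 cst_0)
  then show ?thesis using v by (intro M.minus_equality[symmetric]) simp_all
qed

subsection \<open>Functionals norming a given element\<close>

text \<open>The graph of a partially defined real-linear functional below the pointwise norm. As a
  relation it is stable under unions of chains; that it is single-valued follows from domination,
  applied to the difference of two values in both signs.\<close>

definition dominated_relation :: "('v \<times> 'z L0_elt) set \<Rightarrow> bool" where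
  "dominated_relation \<Gamma> \<longleftrightarrow> \<Gamma> \<subseteq> carrier M \<times> carrier (L0 n) \<and>
     (\<forall>v r w s. (v, r) \<in> \<Gamma> \<longrightarrow> (w, s) \<in> \<Gamma> \<longrightarrow> (v \<oplus> w, r \<oplus>\<^bsub>L0 n\<^esub> s) \<in> \<Gamma>) \<and>
     (\<forall>c v r. (v, r) \<in> \<Gamma> \<longrightarrow> (cst n c \<odot> v, cst n c \<otimes>\<^bsub>L0 n\<^esub> r) \<in> \<Gamma>) \<and>
     (\<forall>v r. (v, r) \<in> \<Gamma> \<longrightarrow> (AE x in n. L0_rep r x \<le> nm M v x))"

lemma dominated_relationD:
  assumes "dominated_relation \<Gamma>" "(v, r) \<in> \<Gamma>"
  shows "v \<in> carrier M" "r \<in> carrier (L0 n)" "AE x in n. L0_rep r x \<le> nm M v x"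
    "(w, s) \<in> \<Gamma> \<Longrightarrow> (v \<oplus> w, r \<oplus>\<^bsub>L0 n\<^esub> s) \<in> \<Gamma>" "(cst n c \<odot> v, cst n c \<otimes>\<^bsub>L0 n\<^esub> r) \<in> \<Gamma>"
  using assms unfolding dominated_relation_def by auto

text \<open>The one-step extension of Hahn-Banach. The value at \<open>\<eta>\<close> must lie above
  all \<open>r - |z - \<eta>|\<close> and below all \<open>|z + \<eta>| - r\<close>; the triangle
  inequality orders these families, and the essential infimum of the upper one lies between
  them.\<close>

lemma dominated_relation_extend:
  assumes \<Gamma>: "dominated_relation \<Gamma>" "\<Gamma> \<noteq> {}" and e: "\<eta> \<in> carrier M"
  obtains \<Gamma>' where "dominated_relation \<Gamma>'" "\<Gamma> \<subseteq> \<Gamma>'" "\<eta> \<in> fst ` \<Gamma>'"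
proof -
  note D = dominated_relationD[OF \<Gamma>(1)]
  obtain z0 r0 where z0: "(z0, r0) \<in> \<Gamma>" using \<Gamma>(2) by auto
  define F where "F z r x = nm M (z \<oplus> \<eta>) x - L0_rep r x" for z r x
  define G where "G z r x = L0_rep r x - nm M (z \<ominus> \<eta>) x" for z r x
  have Fm: "F z r \<in> borel_measurable n" "G z r \<in> borel_measurable n" if "(z, r) \<in> \<Gamma>" for z r
    using L0_rep_measurable[OF D(2)[OF that]] nm_measurable[of "z \<oplus> \<eta>"] nm_measurable[of "z \<ominus> \<eta>"] D(1)[OF that] e
    unfolding F_def G_def by simp_all
  have GF: "AE x in n. G z r x \<le> F w s x" if zr: "(z, r) \<in> \<Gamma>" and ws: "(w, s) \<in> \<Gamma>" for z r w s
  proof -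
    note c = D(1)[OF zr] D(1)[OF ws]
    have "(z \<ominus> \<eta>) \<oplus> (w \<oplus> \<eta>) = z \<oplus> w"
    proof -
      have "w \<oplus> \<eta> = \<eta> \<oplus> w" using c e by (simp add: M.a_comm)
      then show ?thesis using c e by (simp add: M.minus_eq M.a_assoc M.r_neg1)
    qed
    then have "AE x in n. nm M (z \<oplus> w) x \<le> nm M (z \<ominus> \<eta>) x + nm M (w \<oplus> \<eta>) x"
      using nm_triangle[of "z \<ominus> \<eta>" "w \<oplus> \<eta>"] c e by simp
    then show ?thesis
      using D(3)[OF D(4)[OF zr ws]] L0_rep_add[OF D(2)[OF zr] D(2)[OF ws]] unfolding F_def G_def by eventually_elim linarith
  qed
  have "\<exists>s\<in>borel_measurable n. (\<forall>g\<in>{F z r | z r. (z, r) \<in> \<Gamma>}. AE x in n. s x \<le> g x) \<and>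
    (\<forall>t. (\<forall>g\<in>{F z r | z r. (z, r) \<in> \<Gamma>}. AE x in n. t x \<le> g x) \<longrightarrow> (AE x in n. t x \<le> s x))"
  proof (rule essential_infimum_ex[OF sf])
    show "{F z r | z r. (z, r) \<in> \<Gamma>} \<noteq> {}" using z0 by auto
    show "{F z r | z r. (z, r) \<in> \<Gamma>} \<subseteq> borel_measurable n" using Fm by auto
    show "G z0 r0 \<in> borel_measurable n" by (rule Fm(2)[OF z0])
    show "AE x in n. G z0 r0 x \<le> f x" if "f \<in> {F z r | z r. (z, r) \<in> \<Gamma>}" for f using that GF[OF z0] by auto
  qed
  then obtain s where s: "s \<in> borel_measurable n" "\<And>g. g \<in> {F z r | z r. (z, r) \<in> \<Gamma>} \<Longrightarrow> AE x in n. s x \<le> g x"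
    "\<And>t. \<forall>g\<in>{F z r | z r. (z, r) \<in> \<Gamma>}. AE x in n. t x \<le> g x \<Longrightarrow> AE x in n. t x \<le> s x" by blast
  have up: "AE x in n. s x \<le> F z r x" if "(z, r) \<in> \<Gamma>" for z r using s(2) that by blast
  have lo: "AE x in n. G z r x \<le> s x" if "(z, r) \<in> \<Gamma>" for z r by (rule s(3)) (use GF that in blast)
  define a where "a = L0_cls n s"
  have a: "a \<in> carrier (L0 n)" "AE x in n. L0_rep a x = s x"
    unfolding a_def using s(1) L0_rep_cls by auto
  define Q where "Q = {(z \<oplus> cst n c \<odot> \<eta>, r \<oplus>\<^bsub>L0 n\<^esub> cst n c \<otimes>\<^bsub>L0 n\<^esub> a) | z r c. (z, r) \<in> \<Gamma>}"
  have ce: "cst n c \<odot> \<eta> \<in> carrier M" "cst n c \<otimes>\<^bsub>L0 n\<^esub> a \<in> carrier (L0 n)" for c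
    using e a(1) by (simp_all add: L0_mult_carrier)
  have bound: "AE x in n. L0_rep (r \<oplus>\<^bsub>L0 n\<^esub> cst n c \<otimes>\<^bsub>L0 n\<^esub> a) x \<le> nm M (z \<oplus> cst n c \<odot> \<eta>) x"
    if zr: "(z, r) \<in> \<Gamma>" for z r c
  proof -
    note cc = D(1)[OF zr] D(2)[OF zr]
    have rep: "AE x in n. L0_rep (r \<oplus>\<^bsub>L0 n\<^esub> cst n c \<otimes>\<^bsub>L0 n\<^esub> a) x = L0_rep r x + c * s x"
      using L0_rep_add[OF cc(2) ce(2)[of c]] L0_cls_cmult[OF a(1), of c] a(2) by eventually_elim simp
    show ?thesis
    proof (cases "c = 0")
      case True
      have "z \<oplus> cst n c \<odot> \<eta> = z" using True cc e by (simp add: cst_0)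
      then have "AE x in n. nm M (z \<oplus> cst n c \<odot> \<eta>) x = nm M z x" by simp
      then show ?thesis using rep D(3)[OF zr] by eventually_elim (simp add: True)
    next
      case False
      \<comment> \<open>Division by \<open>|c|\<close> reduces to the coefficients 1 and -1, where
        the upper and the lower bound on the new value apply respectively.\<close>
      define z' where "z' = cst n (1 / \<bar>c\<bar>) \<odot> z"
      define r' where "r' = cst n (1 / \<bar>c\<bar>) \<otimes>\<^bsub>L0 n\<^esub> r"
      have zr': "(z', r') \<in> \<Gamma>" unfolding z'_def r'_def by (rule D(5)[OF zr])
      have r': "AE x in n. \<bar>c\<bar> * L0_rep r' x = L0_rep r x"
        unfolding r'_def using L0_cls_cmult[OF cc(2), of "1 / \<bar>c\<bar>"] by eventually_elim (use False in simp)
      have zz: "cst n \<bar>c\<bar> \<odot> z' = z"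
        unfolding z'_def using cc(1) False by (simp add: smult_assoc1[symmetric] cst_mult cst_1)
      have dist: "cst n \<bar>c\<bar> \<odot> (z' \<oplus> cst n d \<odot> \<eta>) = z \<oplus> cst n (\<bar>c\<bar> * d) \<odot> \<eta>" for d
        using D(1)[OF zr'] ce e by (simp add: smult_r_distr zz smult_assoc1[symmetric] cst_mult)
      show ?thesis
      proof (cases "c > 0")
        case True
        then have "z \<oplus> cst n c \<odot> \<eta> = cst n \<bar>c\<bar> \<odot> (z' \<oplus> \<eta>)" using dist[of 1] e by (simp add: cst_1)
        then have "AE x in n. nm M (z \<oplus> cst n c \<odot> \<eta>) x = \<bar>c\<bar> * nm M (z' \<oplus> \<eta>) x"
          using nm_cst[of "z' \<oplus> \<eta>" "\<bar>c\<bar>"] D(1)[OF zr'] e by simp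
        then show ?thesis
          using rep r' up[OF zr'] unfolding F_def
        proof eventually_elim
          case (elim x)
          have "c * s x \<le> c * (nm M (z' \<oplus> \<eta>) x - L0_rep r' x)" using elim True by (intro mult_left_mono) auto
          then show ?case using elim True by (simp add: algebra_simps)
        qed
      next
        case False
        with \<open>c \<noteq> 0\<close> have neg: "c < 0" by simp
        then have "z \<oplus> cst n c \<odot> \<eta> = cst n \<bar>c\<bar> \<odot> (z' \<ominus> \<eta>)" using dist[of "-1"] e by (simp add: cst_uminus M.minus_eq)
        then have "AE x in n. nm M (z \<oplus> cst n c \<odot> \<eta>) x = \<bar>c\<bar> * nm M (z' \<ominus> \<eta>) x"
          using nm_cst[of "z' \<ominus> \<eta>" "\<bar>c\<bar>"] D(1)[OF zr'] e by simp
        then show ?thesis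
          using rep r' lo[OF zr'] unfolding G_def
        proof eventually_elim
          case (elim x)
          have "- c * (L0_rep r' x - nm M (z' \<ominus> \<eta>) x) \<le> - c * s x" using elim neg by (intro mult_left_mono) auto
          then show ?case using elim neg by (simp add: algebra_simps)
        qed
      qed
    qed
  qed
  show thesis
  proof (rule that)
    show "\<Gamma> \<subseteq> Q"
    proof
      fix p assume p: "p \<in> \<Gamma>"
      obtain z r where zr: "p = (z, r)" by (cases p)
      have "p = (z \<oplus> cst n 0 \<odot> \<eta>, r \<oplus>\<^bsub>L0 n\<^esub> cst n 0 \<otimes>\<^bsub>L0 n\<^esub> a)"
        using D(1,2)[of z r] p e a(1) by (simp add: zr cst_0)
      then show "p \<in> Q" unfolding Q_def mem_Collect_eq
        by (intro exI[of _ z] exI[of _ r] exI[of _ 0] conjI) (use p in \<open>simp_all add: zr\<close>)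
    qed
    have "(\<zero>, \<zero>\<^bsub>L0 n\<^esub>) \<in> \<Gamma>" using D(5)[OF z0, of 0] D(1,2)[OF z0] by (simp add: cst_0)
    then have "(\<zero> \<oplus> cst n 1 \<odot> \<eta>, \<zero>\<^bsub>L0 n\<^esub> \<oplus>\<^bsub>L0 n\<^esub> cst n 1 \<otimes>\<^bsub>L0 n\<^esub> a) \<in> Q" unfolding Q_def by blast
    then show "\<eta> \<in> fst ` Q" using e by (simp add: cst_1) force
    show "dominated_relation Q"
      unfolding dominated_relation_def
    proof (intro conjI allI impI)
      show "Q \<subseteq> carrier M \<times> carrier (L0 n)" unfolding Q_def using D(1,2) ce by (auto simp: L0_add_carrier)
      show "AE x in n. L0_rep r x \<le> nm M v x" if vr: "(v, r) \<in> Q" for v r using vr bound by (auto simp: Q_def)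
      show "(cst n d \<odot> v, cst n d \<otimes>\<^bsub>L0 n\<^esub> r) \<in> Q" if vr: "(v, r) \<in> Q" for d v r
      proof -
        obtain z t c where q: "(z, t) \<in> \<Gamma>" "v = z \<oplus> cst n c \<odot> \<eta>" "r = t \<oplus>\<^bsub>L0 n\<^esub> cst n c \<otimes>\<^bsub>L0 n\<^esub> a"
          using vr by (auto simp: Q_def)
        have "cst n d \<odot> v = cst n d \<odot> z \<oplus> cst n (d * c) \<odot> \<eta>"
          unfolding q using D(1)[OF q(1)] ce e by (simp add: smult_r_distr smult_assoc1[symmetric] cst_mult)
        moreover have "cst n d \<otimes>\<^bsub>L0 n\<^esub> r = cst n d \<otimes>\<^bsub>L0 n\<^esub> t \<oplus>\<^bsub>L0 n\<^esub> cst n (d * c) \<otimes>\<^bsub>L0 n\<^esub> a"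
          unfolding q using D(2)[OF q(1)] ce a(1) by (simp add: R.r_distr R.m_assoc[symmetric] cst_mult)
        ultimately show ?thesis unfolding Q_def using D(5)[OF q(1), of d] by blast
      qed
      show "(v \<oplus> v', r \<oplus>\<^bsub>L0 n\<^esub> r') \<in> Q" if vr: "(v, r) \<in> Q" and vr': "(v', r') \<in> Q" for v r v' r'
      proof -
        obtain z t c where q: "(z, t) \<in> \<Gamma>" "v = z \<oplus> cst n c \<odot> \<eta>" "r = t \<oplus>\<^bsub>L0 n\<^esub> cst n c \<otimes>\<^bsub>L0 n\<^esub> a"
          using vr by (auto simp: Q_def)
        obtain z' t' c' where q': "(z', t') \<in> \<Gamma>" "v' = z' \<oplus> cst n c' \<odot> \<eta>" "r' = t' \<oplus>\<^bsub>L0 n\<^esub> cst n c' \<otimes>\<^bsub>L0 n\<^esub> a"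
          using vr' by (auto simp: Q_def)
        have "v \<oplus> v' = (z \<oplus> z') \<oplus> (cst n c \<odot> \<eta> \<oplus> cst n c' \<odot> \<eta>)"
          unfolding q q' using D(1)[OF q(1)] D(1)[OF q'(1)] ce by (simp add: M.a_ac)
        also have "cst n c \<odot> \<eta> \<oplus> cst n c' \<odot> \<eta> = cst n (c + c') \<odot> \<eta>"
          using e by (simp add: smult_l_distr[symmetric] cst_add)
        finally have 1: "v \<oplus> v' = (z \<oplus> z') \<oplus> cst n (c + c') \<odot> \<eta>" .
        have "r \<oplus>\<^bsub>L0 n\<^esub> r' = (t \<oplus>\<^bsub>L0 n\<^esub> t') \<oplus>\<^bsub>L0 n\<^esub> (cst n c \<otimes>\<^bsub>L0 n\<^esub> a \<oplus>\<^bsub>L0 n\<^esub> cst n c' \<otimes>\<^bsub>L0 n\<^esub> a)"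
          unfolding q q' using D(2)[OF q(1)] D(2)[OF q'(1)] ce by (simp add: R.a_ac)
        also have "cst n c \<otimes>\<^bsub>L0 n\<^esub> a \<oplus>\<^bsub>L0 n\<^esub> cst n c' \<otimes>\<^bsub>L0 n\<^esub> a = cst n (c + c') \<otimes>\<^bsub>L0 n\<^esub> a"
          using a(1) by (simp add: R.l_distr[symmetric] cst_add)
        finally have 2: "r \<oplus>\<^bsub>L0 n\<^esub> r' = (t \<oplus>\<^bsub>L0 n\<^esub> t') \<oplus>\<^bsub>L0 n\<^esub> cst n (c + c') \<otimes>\<^bsub>L0 n\<^esub> a" .
        show ?thesis unfolding Q_def 1 2 using D(4)[OF q(1) q'(1)] by blast
      qed
    qed
  qed
qed

text \<open>Hahn-Banach with L0-valued functionals: start from the real line through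
  \<open>\<xi>\<close> with value \<open>c |\<xi>|\<close> at \<open>c \<xi>\<close>, and take a
  maximal dominated relation; by one-step extension its domain is everything. The pointwise bound
  makes the resulting real-linear map L0-linear.\<close>

lemma norming_functional_exists:
  assumes xi: "\<xi> \<in> carrier M"
  obtains L where "L \<in> carrier (L0_dual n M)" "L \<xi> = pnorm M \<xi>"
    "\<And>v. v \<in> carrier M \<Longrightarrow> AE x in n. \<bar>L0_rep (L v) x\<bar> \<le> nm M v x"
proof -
  define Q0 where "Q0 = {(cst n c \<odot> \<xi>, cst n c \<otimes>\<^bsub>L0 n\<^esub> pnorm M \<xi>) | c. True}"
  note px = pn_carrier[OF xi]
  have Q0: "dominated_relation Q0"
    unfolding dominated_relation_def
  proof (intro conjI allI impI)
    show "Q0 \<subseteq> carrier M \<times> carrier (L0 n)" unfolding Q0_def using xi px by (auto simp: L0_mult_carrier)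
    show "AE x in n. L0_rep r x \<le> nm M v x" if vr: "(v, r) \<in> Q0" for v r
    proof -
      obtain c where c: "v = cst n c \<odot> \<xi>" "r = cst n c \<otimes>\<^bsub>L0 n\<^esub> pnorm M \<xi>" using vr by (auto simp: Q0_def)
      show ?thesis
        using nm_cst[OF xi, of c] L0_cls_cmult[OF px, of c] nm_nonneg[OF xi] unfolding c
        by eventually_elim (simp add: mult_right_mono)
    qed
    show "(cst n d \<odot> v, cst n d \<otimes>\<^bsub>L0 n\<^esub> r) \<in> Q0" if vr: "(v, r) \<in> Q0" for d v r
    proof -
      obtain c where c: "v = cst n c \<odot> \<xi>" "r = cst n c \<otimes>\<^bsub>L0 n\<^esub> pnorm M \<xi>" using vr by (auto simp: Q0_def)
      have "cst n d \<odot> v = cst n (d * c) \<odot> \<xi>" "cst n d \<otimes>\<^bsub>L0 n\<^esub> r = cst n (d * c) \<otimes>\<^bsub>L0 n\<^esub> pnorm M \<xi>"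
        unfolding c using xi px by (simp_all add: smult_assoc1[symmetric] R.m_assoc[symmetric] cst_mult)
      then show ?thesis unfolding Q0_def by blast
    qed
    show "(v \<oplus> w, r \<oplus>\<^bsub>L0 n\<^esub> s) \<in> Q0" if vr: "(v, r) \<in> Q0" and vr': "(w, s) \<in> Q0" for v r w s
    proof -
      obtain c where c: "v = cst n c \<odot> \<xi>" "r = cst n c \<otimes>\<^bsub>L0 n\<^esub> pnorm M \<xi>" using vr by (auto simp: Q0_def)
      obtain d where d: "w = cst n d \<odot> \<xi>" "s = cst n d \<otimes>\<^bsub>L0 n\<^esub> pnorm M \<xi>" using vr' by (auto simp: Q0_def)
      have "v \<oplus> w = cst n (c + d) \<odot> \<xi>" "r \<oplus>\<^bsub>L0 n\<^esub> s = cst n (c + d) \<otimes>\<^bsub>L0 n\<^esub> pnorm M \<xi>"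
        unfolding c d using xi px by (simp_all add: smult_l_distr[symmetric] R.l_distr[symmetric] cst_add)
      then show ?thesis unfolding Q0_def by blast
    qed
  qed
  have xi0: "(\<xi>, pnorm M \<xi>) \<in> Q0" unfolding Q0_def using xi px
    by (auto intro!: exI[of _ 1] simp: cst_1)
  define A where "A = {Q. dominated_relation Q \<and> Q0 \<subseteq> Q}"
  have "\<exists>Q\<in>A. \<forall>X\<in>A. Q \<subseteq> X \<longrightarrow> X = Q"
  proof (rule subset_Zorn_nonempty)
    show "A \<noteq> {}" using Q0 by (auto simp: A_def)
    fix C assume C: "C \<noteq> {}" "subset.chain A C"
    then have CA: "Q \<in> C \<Longrightarrow> dominated_relation Q" "Q \<in> C \<Longrightarrow> Q0 \<subseteq> Q" for Q by (auto simp: subset_chain_def A_def)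
    have "dominated_relation (\<Union>C)"
      unfolding dominated_relation_def
    proof (intro conjI allI impI)
      show "\<Union>C \<subseteq> carrier M \<times> carrier (L0 n)" using dominated_relationD(1,2)[OF CA(1)] by auto
      show "AE x in n. L0_rep r x \<le> nm M v x" if "(v, r) \<in> \<Union>C" for v r
        using that dominated_relationD(3)[OF CA(1)] by blast
      show "(cst n c \<odot> v, cst n c \<otimes>\<^bsub>L0 n\<^esub> r) \<in> \<Union>C" if "(v, r) \<in> \<Union>C" for c v r
        using that dominated_relationD(5)[OF CA(1)] by blast
      show "(v \<oplus> w, r \<oplus>\<^bsub>L0 n\<^esub> s) \<in> \<Union>C" if vr: "(v, r) \<in> \<Union>C" and ws: "(w, s) \<in> \<Union>C" for v r w s
      proof -
        obtain Q1 Q2 where Q: "Q1 \<in> C" "(v, r) \<in> Q1" "Q2 \<in> C" "(w, s) \<in> Q2" using vr ws by blast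
        have "Q1 \<subseteq> Q2 \<or> Q2 \<subseteq> Q1" using C(2) Q by (auto simp: subset_chain_def)
        then obtain Q3 where "Q3 \<in> C" "(v, r) \<in> Q3" "(w, s) \<in> Q3" using Q by blast
        then show ?thesis using dominated_relationD(4)[OF CA(1)] by blast
      qed
    qed
    then show "\<Union>C \<in> A" using CA(2) C(1) by (auto simp: A_def)
  qed
  then obtain Q where "Q \<in> A" and QA: "\<And>X. X \<in> A \<Longrightarrow> Q \<subseteq> X \<Longrightarrow> X = Q" by metis
  then have Q: "dominated_relation Q" "Q0 \<subseteq> Q" by (simp_all add: A_def)
  have max: "X = Q" if "dominated_relation X" "Q \<subseteq> X" for X
    by (rule QA) (use that Q in \<open>auto simp: A_def\<close>)
  note D = dominated_relationD[OF Q(1)]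
  have ex: "\<exists>r. (v, r) \<in> Q" if v: "v \<in> carrier M" for v
  proof (rule dominated_relation_extend[OF Q(1) _ v])
    show "Q \<noteq> {}" using xi0 Q(2) by blast
    fix X assume X: "dominated_relation X" "Q \<subseteq> X" "v \<in> fst ` X"
    then show ?thesis unfolding max[OF X(1,2)] by auto
  qed
  have abs: "AE x in n. \<bar>L0_rep r x\<bar> \<le> nm M v x" if vr: "(v, r) \<in> Q" for v r
    using D(3)[OF vr] D(3)[OF D(5)[OF vr, of "-1"]] nm_cst[OF D(1)[OF vr], of "-1"] L0_cls_cmult[OF D(2)[OF vr], of "-1"]
    by eventually_elim (simp add: abs_le_iff)
  have uniq: "r = s" if r: "(v, r) \<in> Q" and s: "(v, s) \<in> Q" for v r s
  proof (rule L0_eqI[OF D(2)[OF r] D(2)[OF s]])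
    note v = D(1)[OF r]
    have "(v \<oplus> cst n (-1) \<odot> v, r \<oplus>\<^bsub>L0 n\<^esub> cst n (-1) \<otimes>\<^bsub>L0 n\<^esub> s) \<in> Q" by (rule D(4)[OF r D(5)[OF s]])
    then have "(\<zero>, r \<oplus>\<^bsub>L0 n\<^esub> cst n (-1) \<otimes>\<^bsub>L0 n\<^esub> s) \<in> Q" using v by (simp add: cst_uminus M.r_neg)
    from abs[OF this] nm_0 L0_rep_add[OF D(2)[OF r] L0_mult_carrier[OF cst_carrier[of n "-1"] D(2)[OF s]]] L0_cls_cmult[OF D(2)[OF s], of "-1"]
    show "AE x in n. L0_rep r x = L0_rep s x" by eventually_elim simp
  qed
  define T where "T v = (THE r. (v, r) \<in> Q)" for v
  have T_eq: "T v = r" if vr: "(v, r) \<in> Q" for v r unfolding T_def by (rule the_equality, rule that, rule uniq[OF _ that])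
  have TQ: "(v, T v) \<in> Q" if "v \<in> carrier M" for v using ex[OF that] by (auto simp: T_eq)
  show thesis
  proof (rule that)
    show "restrict T (carrier M) \<in> carrier (L0_dual n M)"
    proof (rule real_functional_dualI[where b = "\<lambda>x. 1"])
      show "T v \<in> carrier (L0 n)" if "v \<in> carrier M" for v by (rule D(2)[OF TQ[OF that]])
      show "T (v \<oplus> w) = T v \<oplus>\<^bsub>L0 n\<^esub> T w" if "v \<in> carrier M" "w \<in> carrier M" for v w
        by (rule T_eq[OF D(4)[OF TQ[OF that(1)] TQ[OF that(2)]]])
      show "T (cst n c \<odot> v) = cst n c \<otimes>\<^bsub>L0 n\<^esub> T v" if "v \<in> carrier M" for c v by (rule T_eq[OF D(5)[OF TQ[OF that]]])
      show "AE x in n. \<bar>L0_rep (T v) x\<bar> \<le> 1 * nm M v x" if "v \<in> carrier M" for v using abs[OF TQ[OF that]] by simp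
    qed simp_all
    show "restrict T (carrier M) \<xi> = pnorm M \<xi>" using xi T_eq[of \<xi> "pnorm M \<xi>"] xi0 Q(2) by auto
    show "AE x in n. \<bar>L0_rep (restrict T (carrier M) v) x\<bar> \<le> nm M v x" if "v \<in> carrier M" for v
      using abs[OF TQ[OF that]] that by simp
  qed
qed

end

section \<open>Extension of functionals from generating sets\<close>

context L0_normed
begin

text \<open>The essential infimum of \<open>|p - s|\<close> over \<open>s\<close> in
  \<open>S\<close> is 0. This local form of closure permits different \<open>s\<close> on different
  parts of the space, so a merely real subspace already approximates its L0-linear
  combinations.\<close>

definition approximable :: "'v set \<Rightarrow> 'v \<Rightarrow> bool" where
  "approximable S p \<longleftrightarrow> p \<in> carrier M \<and>
     (\<forall>t\<in>borel_measurable n. (\<forall>s\<in>S. AE x in n. t x \<le> nm M (p \<ominus> s) x) \<longrightarrow> (AE x in n. t x \<le> 0))"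

lemma approximable_le:
  assumes p: "approximable S p" and t: "t \<in> borel_measurable n"
    and le: "\<And>s. s \<in> S \<Longrightarrow> AE x in n. t x \<le> nm M (p \<ominus> s) x"
  shows "AE x in n. t x \<le> 0"
proof -
  have "(\<forall>s\<in>S. AE x in n. t x \<le> nm M (p \<ominus> s) x) \<longrightarrow> (AE x in n. t x \<le> 0)"
    using p t unfolding approximable_def by simp
  then show ?thesis by (rule mp) (intro ballI le)
qed

text \<open>The form used in estimates: a weight \<open>b\<close> is absorbed by dividing by
  \<open>b + 1\<close>.\<close>

lemma approximableD:
  assumes p: "approximable S p" and "t \<in> borel_measurable n" "b \<in> borel_measurable n" "AE x in n. 0 \<le> b x"
    and le: "\<And>s. s \<in> S \<Longrightarrow> AE x in n. t x \<le> b x * nm M (p \<ominus> s) x" and S: "S \<subseteq> carrier M"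
  shows "AE x in n. t x \<le> 0"
proof -
  have pc: "p \<in> carrier M" using p by (simp add: approximable_def)
  have m: "(\<lambda>x. t x / (b x + 1)) \<in> borel_measurable n" using assms(2,3) by measurable
  have "AE x in n. t x / (b x + 1) \<le> 0"
  proof -
    have "AE x in n. t x / (b x + 1) \<le> nm M (p \<ominus> s) x" if s: "s \<in> S" for s
    proof -
      have "p \<ominus> s \<in> carrier M" using pc s S by auto
      from le[OF s] nm_nonneg[OF this] assms(4) show ?thesis
      proof eventually_elim
        case (elim x)
        have "t x \<le> (b x + 1) * nm M (p \<ominus> s) x" using elim by (simp add: algebra_simps)
        then show ?case using elim(3) by (simp add: divide_le_eq mult.commute)
      qed
    qed
    then show ?thesis by (rule approximable_le[OF p m])
  qed
  then show ?thesis using assms(4) by eventually_elim (simp add: divide_le_0_iff)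
qed

lemma nm_diff_self: "p \<in> carrier M \<Longrightarrow> AE x in n. nm M (p \<ominus> p) x = 0"
  using nm_0 by (simp add: M.minus_eq M.r_neg)

lemma approximable_mem: "s \<in> S \<Longrightarrow> S \<subseteq> carrier M \<Longrightarrow> approximable S s"
  unfolding approximable_def
proof (intro conjI ballI impI)
  fix t assume s: "s \<in> S" "S \<subseteq> carrier M" and "\<forall>q\<in>S. AE x in n. t x \<le> nm M (s \<ominus> q) x"
  then have "AE x in n. t x \<le> nm M (s \<ominus> s) x" by blast
  moreover have "s \<in> carrier M" using s by auto
  note nm_diff_self[OF this]
  ultimately show "AE x in n. t x \<le> 0" by eventually_elim simp
qed auto

lemma minus_add_add:
  assumes "p \<in> carrier M" "q \<in> carrier M" "s \<in> carrier M" "r \<in> carrier M"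
  shows "(p \<oplus> q) \<ominus> (s \<oplus> r) = (p \<ominus> s) \<oplus> (q \<ominus> r)"
  using assms by (simp add: M.minus_eq M.minus_add M.a_ac)

lemma nm_minus_add_add:
  assumes "p \<in> carrier M" "q \<in> carrier M" "s \<in> carrier M" "r \<in> carrier M"
  shows "AE x in n. nm M ((p \<oplus> q) \<ominus> (s \<oplus> r)) x \<le> nm M (p \<ominus> s) x + nm M (q \<ominus> r) x"
  unfolding minus_add_add[OF assms] using assms by (intro nm_triangle) simp_all

text \<open>Two independent approximations, removed one after the other: for fixed \<open>r\<close>
  the test for \<open>p\<close> is applied, and what remains is a test for \<open>q\<close>.\<close>

lemma approximable_pair:
  assumes p: "approximable S p" and q: "approximable S q" and S: "S \<subseteq> carrier M"
    and t: "t \<in> borel_measurable n" and b: "b \<in> borel_measurable n" "AE x in n. 0 \<le> b x"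
    and le: "\<And>s r. s \<in> S \<Longrightarrow> r \<in> S \<Longrightarrow> AE x in n. t x \<le> b x * (nm M (p \<ominus> s) x + nm M (q \<ominus> r) x)"
  shows "AE x in n. t x \<le> 0"
proof (rule approximableD[OF q t b _ S])
  fix r assume r: "r \<in> S"
  have "q \<ominus> r \<in> carrier M" using r S q by (auto simp: approximable_def)
  note m = nm_measurable[OF this]
  have m2: "(\<lambda>x. t x - b x * nm M (q \<ominus> r) x) \<in> borel_measurable n" using t b(1) m by measurable
  have "AE x in n. t x - b x * nm M (q \<ominus> r) x \<le> 0"
  proof (rule approximableD[OF p m2 b _ S])
    fix s assume "s \<in> S"
    from le[OF this r] show "AE x in n. t x - b x * nm M (q \<ominus> r) x \<le> b x * nm M (p \<ominus> s) x"
      by eventually_elim (simp add: algebra_simps)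
  qed
  then show "AE x in n. t x \<le> b x * nm M (q \<ominus> r) x" by eventually_elim simp
qed

definition real_subspace :: "'v set \<Rightarrow> bool" where
  "real_subspace S \<longleftrightarrow> S \<noteq> {} \<and> S \<subseteq> carrier M \<and> (\<forall>s\<in>S. \<forall>r\<in>S. s \<oplus> r \<in> S) \<and>
     (\<forall>c. \<forall>s\<in>S. cst n c \<odot> s \<in> S)"

lemma real_subspaceD:
  assumes "real_subspace S"
  shows "S \<subseteq> carrier M" "s \<in> S \<Longrightarrow> r \<in> S \<Longrightarrow> s \<oplus> r \<in> S" "s \<in> S \<Longrightarrow> cst n c \<odot> s \<in> S" "\<zero> \<in> S"
proof -
  show 1: "S \<subseteq> carrier M" "s \<in> S \<Longrightarrow> r \<in> S \<Longrightarrow> s \<oplus> r \<in> S" "s \<in> S \<Longrightarrow> cst n c \<odot> s \<in> S" for s r c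
    using assms by (auto simp: real_subspace_def)
  obtain s where s: "s \<in> S" using assms by (auto simp: real_subspace_def)
  then show "\<zero> \<in> S" using 1(3)[OF s, of 0] 1(1) by (auto simp: cst_0)
qed

lemma approximable_add:
  assumes S: "real_subspace S" and p: "approximable S p" and q: "approximable S q"
  shows "approximable S (p \<oplus> q)"
  unfolding approximable_def
proof (intro conjI ballI impI)
  have pq: "p \<in> carrier M" "q \<in> carrier M" using p q by (auto simp: approximable_def)
  then show "p \<oplus> q \<in> carrier M" by simp
  note Sc = real_subspaceD(1)[OF S]
  fix t assume t: "t \<in> borel_measurable n" and le: "\<forall>s\<in>S. AE x in n. t x \<le> nm M (p \<oplus> q \<ominus> s) x"
  show "AE x in n. t x \<le> 0"
  proof (rule approximable_pair[OF p q Sc t])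
    fix s r assume sr: "s \<in> S" "r \<in> S"
    then have c: "s \<in> carrier M" "r \<in> carrier M" using Sc by auto
    show "AE x in n. t x \<le> 1 * (nm M (p \<ominus> s) x + nm M (q \<ominus> r) x)"
      using le[rule_format, OF real_subspaceD(2)[OF S sr]] nm_minus_add_add[OF pq c] by eventually_elim simp
  qed auto
qed

text \<open>For a constant \<open>c\<close> the multiples \<open>c s\<close> stay in
  \<open>S\<close>, which bounds any test function by \<open>|h - c| |p|\<close>. At each point
  \<open>c\<close> may then be chosen as a rational close to the value of \<open>h\<close>.\<close>

lemma approximable_smult:
  assumes S: "real_subspace S" and p: "approximable S p" and h: "h \<in> carrier (L0 n)"
  shows "approximable S (h \<odot> p)"
  unfolding approximable_def
proof (intro conjI ballI impI)
  have pc: "p \<in> carrier M" using p by (auto simp: approximable_def)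
  then show hp: "h \<odot> p \<in> carrier M" using h by simp
  note Sc = real_subspaceD(1)[OF S]
  note hm = L0_rep_measurable[OF h] and pm = nm_measurable[OF pc]
  fix t assume t: "t \<in> borel_measurable n" and le: "\<forall>s\<in>S. AE x in n. t x \<le> nm M (h \<odot> p \<ominus> s) x"
  have "AE x in n. t x \<le> \<bar>L0_rep h x - c\<bar> * nm M p x" for c
  proof -
    have m: "(\<lambda>x. t x - \<bar>L0_rep h x - c\<bar> * nm M p x) \<in> borel_measurable n" using t hm pm by measurable
    have "AE x in n. t x - \<bar>L0_rep h x - c\<bar> * nm M p x \<le> 0"
    proof (rule approximableD[OF p m _ _ _ Sc, where b = "\<lambda>_. \<bar>c\<bar>"])
      fix s assume s: "s \<in> S"
      have sc: "s \<in> carrier M" using s Sc by auto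
      have cc: "cst n c \<odot> p \<in> carrier M" "cst n c \<odot> s \<in> carrier M" using pc sc by simp_all
      have "cst n c \<odot> p \<ominus> cst n c \<odot> s = cst n c \<odot> (p \<ominus> s)"
        using pc sc by (simp add: M.minus_eq smult_r_distr smult_r_minus)
      then have 1: "AE x in n. nm M (cst n c \<odot> p \<ominus> cst n c \<odot> s) x = \<bar>c\<bar> * nm M (p \<ominus> s) x"
        using nm_cst[of "p \<ominus> s" c] pc sc by simp
      show "AE x in n. t x - \<bar>L0_rep h x - c\<bar> * nm M p x \<le> \<bar>c\<bar> * nm M (p \<ominus> s) x"
        using le[rule_format, OF real_subspaceD(3)[OF S s, of c]] nm_minus_triangle[OF hp cc] 1
          nm_diff_smult[OF h cst_carrier[of n c] pc] rep_cst[of n c]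
        by eventually_elim simp
    qed auto
    then show ?thesis by eventually_elim simp
  qed
  then have "AE x in n. \<forall>c\<in>\<rat>. t x \<le> \<bar>L0_rep h x - c\<bar> * nm M p x" by (subst AE_ball_countable) (auto simp: countable_rat)
  then show "AE x in n. t x \<le> 0" by eventually_elim (rule rational_approx_nonpos, blast)
qed

text \<open>The error \<open>|p - a|\<close> is subtracted before testing \<open>a\<close> and
  removed by \<open>AE_le_0_closure\<close>.\<close>

lemma approximable_closure:
  assumes p: "p \<in> L0_topology n M closure_of A" "p \<in> carrier M" and A: "\<And>a. a \<in> A \<Longrightarrow> approximable S a" and S: "S \<subseteq> carrier M"
  shows "approximable S p"
  unfolding approximable_def
proof (intro conjI ballI impI p(2))
  fix t assume t: "t \<in> borel_measurable n" and le: "\<forall>s\<in>S. AE x in n. t x \<le> nm M (p \<ominus> s) x"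
  show "AE x in n. t x \<le> 0"
  proof (rule AE_le_0_closure[OF p(1) t])
    fix a assume a: "a \<in> A" "a \<in> carrier M"
    have pa: "p \<ominus> a \<in> carrier M" using p(2) a(2) by simp
    have m: "(\<lambda>x. t x - nm M (p \<ominus> a) x) \<in> borel_measurable n" using t nm_measurable[OF pa] by measurable
    have "AE x in n. t x - nm M (p \<ominus> a) x \<le> 0"
    proof (rule approximableD[OF A[OF a(1)] m _ _ _ S, where b = "\<lambda>_. 1"])
      fix s assume s: "s \<in> S"
      then have sc: "s \<in> carrier M" using S by auto
      show "AE x in n. t x - nm M (p \<ominus> a) x \<le> 1 * nm M (a \<ominus> s) x"
        using le[rule_format, OF s] nm_minus_triangle[OF p(2) a(2) sc] by eventually_elim simp
    qed auto
    then show "AE x in n. t x \<le> nm M (p \<ominus> a) x" by eventually_elim simp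
  qed
qed

lemma span_induct:
  assumes p: "p \<in> L0_span n M A" and A: "A \<subseteq> carrier M"
    and Q: "Q \<zero>" "\<And>v w. v \<in> carrier M \<Longrightarrow> w \<in> carrier M \<Longrightarrow> Q v \<Longrightarrow> Q w \<Longrightarrow> Q (v \<oplus> w)"
      "\<And>h v. h \<in> carrier (L0 n) \<Longrightarrow> v \<in> A \<Longrightarrow> Q (h \<odot> v)"
  shows "Q p" "p \<in> carrier M"
proof -
  obtain a B where aB: "p = (\<Oplus>v\<in>B. a v \<odot> v)" "finite B" "B \<subseteq> A" "a \<in> B \<rightarrow> carrier (L0 n)"
    using p by (auto simp: L0_span_def)
  have "Q (\<Oplus>v\<in>B. a v \<odot> v) \<and> (\<Oplus>v\<in>B. a v \<odot> v) \<in> carrier M"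
    using aB(2-4)
  proof (induction B rule: finite_induct)
    case (insert v B)
    have v: "a v \<in> carrier (L0 n)" "v \<in> A" "v \<in> carrier M" using insert.prems A by auto
    have f: "(\<lambda>v. a v \<odot> v) \<in> B \<rightarrow> carrier M" using insert.prems A by auto
    have "(\<Oplus>v\<in>insert v B. a v \<odot> v) = a v \<odot> v \<oplus> (\<Oplus>v\<in>B. a v \<odot> v)"
      using insert.hyps f v by (intro M.finsum_insert) simp_all
    then show ?case using insert v Q(2,3) by auto
  qed (use Q(1) in simp)
  then show "Q p" "p \<in> carrier M" using aB(1) by auto
qed

end

context L0_normed_dual
begin

text \<open>As the functionals agree at \<open>s\<close>, their difference at \<open>p\<close> is at
  most \<open>(|K| + |L|) |p - s|\<close> for every \<open>s\<close> in \<open>S\<close>.\<close>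

lemma dual_eq_on_approximable:
  assumes K: "K \<in> carrier (L0_dual n M)" and L: "L \<in> carrier (L0_dual n M)" and S: "S \<subseteq> carrier M"
    and eq: "\<And>s. s \<in> S \<Longrightarrow> AE x in n. L0_rep (K s) x = L0_rep (L s) x"
    and ap: "\<And>p. p \<in> carrier M \<Longrightarrow> approximable S p"
  shows "K = L"
proof (rule dual_eqI[OF K L])
  fix p assume p: "p \<in> carrier M"
  note k = linear_props[OF dual_linear[OF K]] and l = linear_props[OF dual_linear[OF L]]
  note kp = k(1)[OF p] and lp = l(1)[OF p]
  note [measurable] = L0_rep_measurable[OF kp] L0_rep_measurable[OF lp]
    L0_rep_measurable[OF dual_opnorm(1)[OF K]] L0_rep_measurable[OF dual_opnorm(1)[OF L]]
  have "AE x in n. \<bar>L0_rep (K p) x - L0_rep (L p) x\<bar> \<le> 0"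
  proof (rule approximableD[OF ap[OF p] _ _ _ _ S, where b = "\<lambda>x. nm (L0_dual n M) K x + nm (L0_dual n M) L x"])
    show "AE x in n. 0 \<le> nm (L0_dual n M) K x + nm (L0_dual n M) L x"
      using dual_opnorm(2)[OF K] dual_opnorm(2)[OF L] by eventually_elim simp
    fix s assume s: "s \<in> S"
    then have sc: "s \<in> carrier M" using S by auto
    have ps: "p \<ominus> s \<in> carrier M" using p sc by simp
    show "AE x in n. \<bar>L0_rep (K p) x - L0_rep (L p) x\<bar> \<le> (nm (L0_dual n M) K x + nm (L0_dual n M) L x) * nm M (p \<ominus> s) x"
      using linear_minus[OF dual_linear[OF K] p sc] linear_minus[OF dual_linear[OF L] p sc] eq[OF s]
        dual_opnorm(3)[OF K ps] dual_opnorm(3)[OF L ps]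
      by eventually_elim (simp add: distrib_right)
  qed measurable
  then have "AE x in n. L0_rep (K p) x = L0_rep (L p) x" by eventually_elim simp
  then show "K p = L p" by (rule L0_eqI[OF kp lp])
qed

text \<open>A McShane-type extension with L0 values: a value at \<open>p\<close> is found between
  all \<open>r - b |p - q|\<close> and all \<open>r + b |p - q|\<close> by an essential infimum.
  Approximability pins it down, and additivity and homogeneity follow from this. Two values of the
  relation at one vector agree by the bound.\<close>

lemma bounded_relation_extends:
  assumes G: "\<Gamma> \<subseteq> carrier M \<times> carrier (L0 n)" "\<Gamma> \<noteq> {}"
      "\<And>v r w s. (v, r) \<in> \<Gamma> \<Longrightarrow> (w, s) \<in> \<Gamma> \<Longrightarrow> (v \<oplus> w, r \<oplus>\<^bsub>L0 n\<^esub> s) \<in> \<Gamma>"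
      "\<And>c v r. (v, r) \<in> \<Gamma> \<Longrightarrow> (cst n c \<odot> v, cst n c \<otimes>\<^bsub>L0 n\<^esub> r) \<in> \<Gamma>"
    and b: "b \<in> borel_measurable n" "\<And>x. 0 \<le> b x"
      "\<And>v r. (v, r) \<in> \<Gamma> \<Longrightarrow> AE x in n. \<bar>L0_rep r x\<bar> \<le> b x * nm M v x"
    and ap: "\<And>p. p \<in> carrier M \<Longrightarrow> approximable (fst ` \<Gamma>) p"
  obtains L where "L \<in> carrier (L0_dual n M)" "\<And>v r. (v, r) \<in> \<Gamma> \<Longrightarrow> AE x in n. L0_rep (L v) x = L0_rep r x"
    "\<And>v. v \<in> carrier M \<Longrightarrow> AE x in n. \<bar>L0_rep (L v) x\<bar> \<le> b x * nm M v x"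
proof -
  have Gc: "v \<in> carrier M" "r \<in> carrier (L0 n)" if "(v, r) \<in> \<Gamma>" for v r using that G(1) by auto
  have fG: "fst ` \<Gamma> \<subseteq> carrier M" using G(1) by auto
  have diff: "AE x in n. \<bar>L0_rep r x - L0_rep s x\<bar> \<le> b x * nm M (v \<ominus> w) x"
    if vr: "(v, r) \<in> \<Gamma>" and ws: "(w, s) \<in> \<Gamma>" for v r w s
  proof -
    note c = Gc[OF vr] Gc[OF ws]
    have "v \<ominus> w = v \<oplus> cst n (-1) \<odot> w" using c by (simp add: cst_uminus M.minus_eq)
    note eq = this
    show ?thesis
      unfolding eq
      using b(3)[OF G(3)[OF vr G(4)[OF ws, of "-1"]]]
        L0_rep_add[OF c(2) L0_mult_carrier[OF cst_carrier[of n "-1"] c(4)]] L0_cls_cmult[OF c(4), of "-1"]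
      by eventually_elim simp
  qed
  have near: "\<exists>l\<in>carrier (L0 n). \<forall>q r. (q, r) \<in> \<Gamma> \<longrightarrow> (AE x in n. \<bar>L0_rep l x - L0_rep r x\<bar> \<le> b x * nm M (p \<ominus> q) x)"
    if p: "p \<in> carrier M" for p
  proof -
    define F where "F q r x = L0_rep r x + b x * nm M (p \<ominus> q) x" for q r x
    define E where "E q r x = L0_rep r x - b x * nm M (p \<ominus> q) x" for q r x
    define S where "S = (\<lambda>(q, r). F q r) ` \<Gamma>"
    have mF: "F q r \<in> borel_measurable n" "E q r \<in> borel_measurable n" if qr: "(q, r) \<in> \<Gamma>" for q r
    proof -
      have "p \<ominus> q \<in> carrier M" using p Gc[OF qr] by simp
      note [measurable] = L0_rep_measurable[OF Gc(2)[OF qr]] nm_measurable[OF this] b(1)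
      show "F q r \<in> borel_measurable n" "E q r \<in> borel_measurable n" unfolding F_def E_def by measurable
    qed
    have EF: "AE x in n. E w s x \<le> F q r x" if qr: "(q, r) \<in> \<Gamma>" and ws: "(w, s) \<in> \<Gamma>" for q r w s
      using diff[OF ws qr] nm_minus_triangle[OF Gc(1)[OF ws] p Gc(1)[OF qr]] nm_minus_commute[OF Gc(1)[OF ws] p]
    proof eventually_elim
      case (elim x)
      have "L0_rep s x - L0_rep r x \<le> b x * (nm M (p \<ominus> w) x + nm M (p \<ominus> q) x)"
        using elim mult_left_mono[OF elim(2) b(2)[of x]] by simp
      then show ?case by (simp add: E_def F_def algebra_simps)
    qed
    obtain q0 r0 where 0: "(q0, r0) \<in> \<Gamma>" using G(2) by auto
    have "\<exists>s\<in>borel_measurable n. (\<forall>g\<in>S. AE x in n. s x \<le> g x) \<and>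
      (\<forall>t. (\<forall>g\<in>S. AE x in n. t x \<le> g x) \<longrightarrow> (AE x in n. t x \<le> s x))"
    proof (rule essential_infimum_ex[OF sf])
      show "S \<noteq> {}" using 0 by (auto simp: S_def)
      show "S \<subseteq> borel_measurable n" using mF by (auto simp: S_def)
      show "E q0 r0 \<in> borel_measurable n" by (rule mF(2)[OF 0])
      show "AE x in n. E q0 r0 x \<le> f x" if "f \<in> S" for f using that EF[OF _ 0] by (auto simp: S_def)
    qed
    then obtain s where s: "s \<in> borel_measurable n" "\<And>g. g \<in> S \<Longrightarrow> AE x in n. s x \<le> g x"
      "\<And>t. \<forall>g\<in>S. AE x in n. t x \<le> g x \<Longrightarrow> AE x in n. t x \<le> s x" by blast
    show ?thesis
    proof (intro bexI[of _ "L0_cls n s"] allI impI)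
      fix q r assume qr: "(q, r) \<in> \<Gamma>"
      have "AE x in n. s x \<le> F q r x" by (rule s(2)) (use qr in \<open>auto simp: S_def\<close>)
      moreover have "AE x in n. E q r x \<le> s x" by (rule s(3)) (use EF[OF _ qr] in \<open>auto simp: S_def\<close>)
      ultimately show "AE x in n. \<bar>L0_rep (L0_cls n s) x - L0_rep r x\<bar> \<le> b x * nm M (p \<ominus> q) x"
        using L0_rep_cls[OF s(1)] by eventually_elim (simp add: E_def F_def abs_le_iff)
    qed (use s(1) in simp)
  qed
  \<comment> \<open>Any choice will do: every property of \<open>T\<close> is derived from the
    estimate against the relation.\<close>
  define T where "T p = (SOME l. l \<in> carrier (L0 n) \<and>
    (\<forall>q r. (q, r) \<in> \<Gamma> \<longrightarrow> (AE x in n. \<bar>L0_rep l x - L0_rep r x\<bar> \<le> b x * nm M (p \<ominus> q) x)))" for p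
  have T: "T p \<in> carrier (L0 n) \<and>
    (\<forall>q r. (q, r) \<in> \<Gamma> \<longrightarrow> (AE x in n. \<bar>L0_rep (T p) x - L0_rep r x\<bar> \<le> b x * nm M (p \<ominus> q) x))" if "p \<in> carrier M" for p
    unfolding T_def by (rule someI_ex) (use near[OF that] in blast)
  have Tc: "T p \<in> carrier (L0 n)" if "p \<in> carrier M" for p using T[OF that] by simp
  have Tn: "AE x in n. \<bar>L0_rep (T p) x - L0_rep r x\<bar> \<le> b x * nm M (p \<ominus> q) x" if "p \<in> carrier M" "(q, r) \<in> \<Gamma>" for p q r
    using T[OF that(1)] that(2) by blast
  have Tm: "L0_rep (T p) \<in> borel_measurable n" if "p \<in> carrier M" for p by (rule L0_rep_measurable[OF Tc[OF that]])
  have Teq: "AE x in n. L0_rep (T v) x = L0_rep r x" if "(v, r) \<in> \<Gamma>" for v r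
    using Tn[OF Gc(1)[OF that] that] nm_diff_self[OF Gc(1)[OF that]] by eventually_elim simp
  obtain q0 r0 where 0: "(q0, r0) \<in> \<Gamma>" using G(2) by auto
  have z: "(\<zero>, \<zero>\<^bsub>L0 n\<^esub>) \<in> \<Gamma>" using G(4)[OF 0, of 0] Gc[OF 0] by (simp add: cst_0)
  have Tb: "AE x in n. \<bar>L0_rep (T p) x\<bar> \<le> b x * nm M p x" if p: "p \<in> carrier M" for p
  proof -
    have "p \<ominus> \<zero> = p" using p by (simp add: M.minus_eq)
    then have "AE x in n. \<bar>L0_rep (T p) x - L0_rep \<zero>\<^bsub>L0 n\<^esub> x\<bar> \<le> b x * nm M p x" using Tn[OF p z] by simp
    then show ?thesis using L0_rep_zero[of n] by eventually_elim simp
  qed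
  have Tadd: "T (p \<oplus> q) = T p \<oplus>\<^bsub>L0 n\<^esub> T q" if p: "p \<in> carrier M" and q: "q \<in> carrier M" for p q
  proof (rule L0_eqI[of _ n])
    have pq: "p \<oplus> q \<in> carrier M" using p q by simp
    show "T (p \<oplus> q) \<in> carrier (L0 n)" "T p \<oplus>\<^bsub>L0 n\<^esub> T q \<in> carrier (L0 n)"
      using Tc[OF pq] Tc[OF p] Tc[OF q] by (auto intro: L0_add_carrier)
    note [measurable] = Tm[OF pq] Tm[OF p] Tm[OF q]
    \<comment> \<open>Additivity is exact on the relation, so the defect at \<open>p\<close> and
      \<open>q\<close> is bounded by their distances to its domain, which have essential infimum
      0.\<close>
    have "AE x in n. \<bar>L0_rep (T (p \<oplus> q)) x - (L0_rep (T p) x + L0_rep (T q) x)\<bar> \<le> 0"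
    proof (rule approximable_pair[OF ap[OF p] ap[OF q] fG, where b = "\<lambda>x. 2 * b x"])
      fix v w assume "v \<in> fst ` \<Gamma>" "w \<in> fst ` \<Gamma>"
      then obtain r s where vr: "(v, r) \<in> \<Gamma>" and ws: "(w, s) \<in> \<Gamma>" by auto
      note c = Gc[OF vr] Gc[OF ws]
      show "AE x in n. \<bar>L0_rep (T (p \<oplus> q)) x - (L0_rep (T p) x + L0_rep (T q) x)\<bar>
        \<le> 2 * b x * (nm M (p \<ominus> v) x + nm M (q \<ominus> w) x)"
        using Tn[OF pq G(3)[OF vr ws]] Tn[OF p vr] Tn[OF q ws] L0_rep_add[OF c(2,4)] nm_minus_add_add[OF p q c(1,3)]
      proof eventually_elim
        case (elim x)
        have "b x * nm M (p \<oplus> q \<ominus> (v \<oplus> w)) x \<le> b x * (nm M (p \<ominus> v) x + nm M (q \<ominus> w) x)"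
          using elim(5) b(2) by (rule mult_left_mono)
        then show ?case using elim(1-4) by (simp add: algebra_simps abs_le_iff)
      qed
    qed (use b in \<open>auto\<close>)
    then show "AE x in n. L0_rep (T (p \<oplus> q)) x = L0_rep (T p \<oplus>\<^bsub>L0 n\<^esub> T q) x"
      using L0_rep_add[OF Tc[OF p] Tc[OF q]] by eventually_elim simp
  qed
  have Tcst: "T (cst n c \<odot> p) = cst n c \<otimes>\<^bsub>L0 n\<^esub> T p" if p: "p \<in> carrier M" for c p
  proof (rule L0_eqI[of _ n])
    have cp: "cst n c \<odot> p \<in> carrier M" using p by simp
    show "T (cst n c \<odot> p) \<in> carrier (L0 n)" "cst n c \<otimes>\<^bsub>L0 n\<^esub> T p \<in> carrier (L0 n)"
      using Tc[OF cp] Tc[OF p] by (auto intro: L0_mult_carrier)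
    note [measurable] = Tm[OF cp] Tm[OF p]
    have "AE x in n. \<bar>L0_rep (T (cst n c \<odot> p)) x - c * L0_rep (T p) x\<bar> \<le> 0"
    proof (rule approximableD[OF ap[OF p] _ _ _ _ fG, where b = "\<lambda>x. 2 * \<bar>c\<bar> * b x"])
      fix v assume "v \<in> fst ` \<Gamma>"
      then obtain r where vr: "(v, r) \<in> \<Gamma>" by auto
      note cc = Gc[OF vr]
      have "cst n c \<odot> p \<ominus> cst n c \<odot> v = cst n c \<odot> (p \<ominus> v)"
        using p cc by (simp add: M.minus_eq smult_r_distr smult_r_minus)
      then have 1: "AE x in n. nm M (cst n c \<odot> p \<ominus> cst n c \<odot> v) x = \<bar>c\<bar> * nm M (p \<ominus> v) x"
        using nm_cst[of "p \<ominus> v" c] p cc by simp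
      show "AE x in n. \<bar>L0_rep (T (cst n c \<odot> p)) x - c * L0_rep (T p) x\<bar> \<le> 2 * \<bar>c\<bar> * b x * nm M (p \<ominus> v) x"
        using Tn[OF cp G(4)[OF vr, of c]] Tn[OF p vr] L0_cls_cmult[OF cc(2), of c] 1
      proof eventually_elim
        case (elim x)
        have "\<bar>c * L0_rep (T p) x - c * L0_rep r x\<bar> = \<bar>c\<bar> * \<bar>L0_rep (T p) x - L0_rep r x\<bar>"
          by (simp add: abs_mult[symmetric] right_diff_distrib)
        also have "\<dots> \<le> \<bar>c\<bar> * (b x * nm M (p \<ominus> v) x)" using elim by (intro mult_left_mono) auto
        finally have "\<bar>c * L0_rep (T p) x - c * L0_rep r x\<bar> \<le> \<bar>c\<bar> * (b x * nm M (p \<ominus> v) x)" .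
        moreover have "\<bar>L0_rep (T (cst n c \<odot> p)) x - c * L0_rep r x\<bar> \<le> \<bar>c\<bar> * (b x * nm M (p \<ominus> v) x)"
          using elim by (simp add: ac_simps)
        ultimately have "\<bar>L0_rep (T (cst n c \<odot> p)) x - c * L0_rep (T p) x\<bar> \<le> 2 * (\<bar>c\<bar> * (b x * nm M (p \<ominus> v) x))"
          using abs_triangle_ineq4[of "L0_rep (T (cst n c \<odot> p)) x - c * L0_rep r x" "c * L0_rep (T p) x - c * L0_rep r x"]
          by simp
        then show ?case by (simp add: mult.assoc)
      qed
    qed (use b in \<open>auto\<close>)
    then show "AE x in n. L0_rep (T (cst n c \<odot> p)) x = L0_rep (cst n c \<otimes>\<^bsub>L0 n\<^esub> T p) x"
      using L0_cls_cmult[OF Tc[OF p], of c] by eventually_elim simp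
  qed
  show thesis
  proof (rule that)
    show "restrict T (carrier M) \<in> carrier (L0_dual n M)" by (rule real_functional_dualI[OF Tc Tadd Tcst b(1,2) Tb])
    show "AE x in n. L0_rep (restrict T (carrier M) v) x = L0_rep r x" if "(v, r) \<in> \<Gamma>" for v r
      using Teq[OF that] Gc(1)[OF that] by simp
    show "AE x in n. \<bar>L0_rep (restrict T (carrier M) v) x\<bar> \<le> b x * nm M v x" if "v \<in> carrier M" for v
      using Tb[OF that] that by simp
  qed
qed

end

section \<open>Extension by zero\<close>

lemma AE_restr_meas: "E \<in> sets n \<Longrightarrow> (AE x in restr_meas n E. Q x) \<longleftrightarrow> (AE x in n. x \<in> E \<longrightarrow> Q x)"
  unfolding restr_meas_def by (subst AE_density) (auto simp: indicator_def)

lemma measurable_restr_meas: "borel_measurable (restr_meas n E) = borel_measurable n"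
  by (rule measurable_cong_sets) (simp_all add: restr_meas_def)

lemma L0_rep_ext:
  assumes "F \<in> carrier (L0 (restr_meas n E))" and E: "E \<in> sets n"
  shows "L0_ext n E F \<in> carrier (L0 n)" "AE x in n. L0_rep (L0_ext n E F) x = indicator E x * L0_rep F x"
proof -
  have "L0_rep F \<in> borel_measurable n" using L0_rep_measurable[OF assms(1)] by (simp add: measurable_restr_meas)
  then have m: "(\<lambda>x. indicator E x * L0_rep F x) \<in> borel_measurable n" using E by measurable
  show "L0_ext n E F \<in> carrier (L0 n)" "AE x in n. L0_rep (L0_ext n E F) x = indicator E x * L0_rep F x"
    unfolding L0_ext_def using m L0_rep_cls[OF m] by auto
qed

text \<open>The extension keeps the additive group and changes only the scalars and the norm; a norm
  vanishing on \<open>E\<close> still means zero because \<open>N\<close> sees only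
  \<open>E\<close>.\<close>

lemma L0_normed_group_Ext:
  assumes sf: "sigma_finite_measure n" and E: "E \<in> sets n" and N: "L0_normed_group (restr_meas n E) N"
  shows "L0_normed_group n (Ext n E N)"
proof -
  interpret N: L0_normed_group "restr_meas n E" N by (rule N)
  have am: "add_monoid (Ext n E N) = add_monoid N" by (simp add: Ext_def)
  have eq: "carrier (Ext n E N) = carrier N" "\<zero>\<^bsub>Ext n E N\<^esub> = \<zero>\<^bsub>N\<^esub>" "add (Ext n E N) = add N"
    "a_inv (Ext n E N) = a_inv N"
    by (simp_all add: Ext_def a_inv_def)
  have ag: "abelian_group (Ext n E N)"
    using N.abelian_group_axioms unfolding abelian_group_def abelian_monoid_def abelian_group_axioms_def am .
  have rep: "pnorm (Ext n E N) v \<in> carrier (L0 n)" "AE x in n. nm (Ext n E N) v x = indicator E x * nm N v x"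
    if "v \<in> carrier N" for v
    using L0_rep_ext[OF N.pn_carrier[OF that] E] by (simp_all add: Ext_def)
  note AE = AE_restr_meas[OF E]
  show ?thesis
  proof (intro L0_normed_group.intro L0_normed_group_axioms.intro ag sf; unfold eq)
    show "pnorm (Ext n E N) v \<in> carrier (L0 n)" if "v \<in> carrier N" for v by (rule rep(1)[OF that])
    show "AE x in n. 0 \<le> nm (Ext n E N) v x" if "v \<in> carrier N" for v
      using rep(2)[OF that] N.nm_nonneg[OF that, unfolded AE] by eventually_elim (auto simp: indicator_def)
    show "AE x in n. nm (Ext n E N) \<zero>\<^bsub>N\<^esub> x = 0"
      using rep(2)[OF N.zero_closed] N.nm_0[unfolded AE] by eventually_elim (auto simp: indicator_def)
    show "v = \<zero>\<^bsub>N\<^esub>" if "v \<in> carrier N" and 0: "AE x in n. nm (Ext n E N) v x = 0" for v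
    proof (rule N.nm_eq_0[OF that(1)])
      show "AE x in restr_meas n E. nm N v x = 0"
        unfolding AE using 0 rep(2)[OF that(1)] by eventually_elim (auto simp: indicator_def)
    qed
    show "AE x in n. nm (Ext n E N) (v \<oplus>\<^bsub>N\<^esub> w) x \<le> nm (Ext n E N) v x + nm (Ext n E N) w x"
      if "v \<in> carrier N" "w \<in> carrier N" for v w
      using rep(2)[OF that(1)] rep(2)[OF that(2)] rep(2)[OF N.a_closed[OF that]] N.nm_triangle[OF that, unfolded AE]
      by eventually_elim (auto simp: indicator_def)
    show "AE x in n. nm (Ext n E N) (\<ominus>\<^bsub>N\<^esub> v) x = nm (Ext n E N) v x" if "v \<in> carrier N" for v
      using rep(2)[OF that] rep(2)[OF N.a_inv_closed[OF that]] N.nm_uminus[OF that, unfolded AE]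
      by eventually_elim (auto simp: indicator_def)
  qed
qed

section \<open>The differential\<close>

locale differential_setting = sobolev_map m u
  for m :: "'x::metric_space measure" and u :: "'x \<Rightarrow> 'y::metric_space" +
  fixes TX :: "('x L0_elt, 'a) normed_module" and dX :: "'x L0_elt \<Rightarrow> 'a"
    and TY :: "('y L0_elt, 'b) normed_module" and dY :: "'y L0_elt \<Rightarrow> 'b"
    and P :: "('x L0_elt, 'c) normed_module" and pb :: "'b \<Rightarrow> 'c"
  assumes cot_X: "cotangent_module m TX dX"
    and cot_Y: "cotangent_module (map_meas m u) TY dY"
    and pull: "pullback_module u (restr_meas m (pos_slope_set m u)) (map_meas m u) TY P pb"
begin

abbreviation E where "E \<equiv> pos_slope_set m u"
abbreviation \<nu> where "\<nu> \<equiv> restr_meas m E"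
abbreviation assoc where "assoc \<equiv> associated m u TX dX TY dY"
abbreviation diff_at where "diff_at \<equiv> is_differential_at m u TX dX TY dY P pb"
abbreviation tangent where "tangent \<equiv> tangent_module m TX"
abbreviation target where "target \<equiv> target_module m u P"

lemma E_iff: "x \<in> E \<longleftrightarrow> 0 < Du x"
  by (simp add: pos_slope_set_def Du_def)

lemma E_sets: "E \<in> sets m"
proof -
  have "{x \<in> space m. 0 < Du x} \<in> sets m" by measurable
  then show ?thesis by (simp add: space_n pos_slope_set_def Du_def)
qed

lemmas AE_nu = AE_restr_meas[OF E_sets, unfolded E_iff]

lemma AE_pull: "AE y in \<mu>. Q y \<Longrightarrow> AE x in \<nu>. Q (u x)"
  unfolding AE_nu by (drule AE_map_measD) (auto elim: AE_mp)

lemma sf_nu: "sigma_finite_measure \<nu>"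
proof -
  interpret N: bounded_finite \<nu>
  proof
    show "sets \<nu> = sets borel" by (simp add: restr_meas_def sets_n)
    fix B :: "'x set" assume B: "B \<in> sets borel" "bounded B"
    have "emeasure \<nu> B = (\<integral>\<^sup>+x. indicator E x * indicator B x \<partial>m)"
      unfolding restr_meas_def
    proof (rule emeasure_density)
      show "indicator E \<in> borel_measurable m" using E_sets by simp
      show "B \<in> sets m" using B(1) by (simp add: sets_n)
    qed
    also have "\<dots> \<le> (\<integral>\<^sup>+x. indicator B x \<partial>m)" by (intro nn_integral_mono) (simp add: indicator_def)
    also have "\<dots> = emeasure m B" using B(1) by (simp add: sets_n)
    also have "\<dots> < \<infinity>" by (rule bounded_fin[OF B])
    finally show "emeasure \<nu> B < \<infinity>" .
  qed
  show ?thesis by (rule N.sigma_finite)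
qed

sublocale TX: L0_normed_dual m TX
  using cot_X by (simp add: cotangent_module_def L0_normed_dual_def L0_normedI[OF sigma_finite])

sublocale TY: L0_normed "map_meas m u" TY
  using cot_Y by (simp add: cotangent_module_def L0_normedI[OF Y.sigma_finite])

sublocale P: L0_normed_dual \<nu> P
  using pull by (simp add: pullback_module_def L0_normed_dual_def L0_normedI[OF sf_nu])

section \<open>Differentials of functions and the pullback map\<close>

lemma dX_carrier: "G \<in> S2 m \<Longrightarrow> dX G \<in> carrier TX"
  and dX_add: "G \<in> S2 m \<Longrightarrow> H \<in> S2 m \<Longrightarrow> dX (G \<oplus>\<^bsub>L0 m\<^esub> H) = dX G \<oplus>\<^bsub>TX\<^esub> dX H"
  and dX_cst: "G \<in> S2 m \<Longrightarrow> dX (cst m c \<otimes>\<^bsub>L0 m\<^esub> G) = cst m c \<odot>\<^bsub>TX\<^esub> dX G"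
  and pnorm_dX: "G \<in> S2 m \<Longrightarrow> pnorm TX (dX G) = min_slope m G"
  using cot_X by (auto simp: cotangent_module_def real_linear_map_def L0_smult_eq)

lemma dY_carrier: "F \<in> S2 \<mu> \<Longrightarrow> dY F \<in> carrier TY"
  and dY_add: "F \<in> S2 \<mu> \<Longrightarrow> H \<in> S2 \<mu> \<Longrightarrow> dY (F \<oplus>\<^bsub>L0 \<mu>\<^esub> H) = dY F \<oplus>\<^bsub>TY\<^esub> dY H"
  and dY_cst: "F \<in> S2 \<mu> \<Longrightarrow> dY (cst \<mu> c \<otimes>\<^bsub>L0 \<mu>\<^esub> F) = cst \<mu> c \<odot>\<^bsub>TY\<^esub> dY F"
  and pnorm_dY: "F \<in> S2 \<mu> \<Longrightarrow> pnorm TY (dY F) = min_slope \<mu> F"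
  and dY_generates: "L0_generates \<mu> TY (dY ` S2 \<mu>)"
  using cot_Y by (auto simp: cotangent_module_def real_linear_map_def L0_smult_eq)

lemma pb_carrier: "v \<in> carrier TY \<Longrightarrow> pb v \<in> carrier P"
  and pb_add: "v \<in> carrier TY \<Longrightarrow> w \<in> carrier TY \<Longrightarrow> pb (v \<oplus>\<^bsub>TY\<^esub> w) = pb v \<oplus>\<^bsub>P\<^esub> pb w"
  and pb_cst: "v \<in> carrier TY \<Longrightarrow> pb (cst \<mu> c \<odot>\<^bsub>TY\<^esub> v) = cst \<nu> c \<odot>\<^bsub>P\<^esub> pb v"
  and pb_continuous: "continuous_map (L0_topology \<mu> TY) (L0_topology \<nu> P) pb"
  and pb_generates: "L0_generates \<nu> P (pb ` carrier TY)"
  using pull by (auto simp: pullback_module_def real_linear_map_def)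

lemma comp_u_nu: "f \<in> borel_measurable \<mu> \<Longrightarrow> (\<lambda>x. f (u x)) \<in> borel_measurable \<nu>" for f :: "'y \<Rightarrow> real"
  unfolding measurable_restr_meas measurable_map_meas by (rule comp_u_measurable)

lemma nm_pb: "v \<in> carrier TY \<Longrightarrow> AE x in \<nu>. nm P (pb v) x = nm TY v (u x)"
proof -
  assume v: "v \<in> carrier TY"
  then have "pnorm P (pb v) = L0_cls \<nu> (\<lambda>x. nm TY v (u x))"
    using pull by (auto simp: pullback_module_def comp_def)
  then show ?thesis using L0_rep_cls[OF comp_u_nu[OF TY.nm_measurable[OF v]]] by simp
qed

text \<open>The pullback map is assumed real-linear; its norm identity is a bound with weight 1
  along \<open>u\<close>, which yields homogeneity with \<open>h\<close> replaced by
  \<open>h \<circ> u\<close>.\<close>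

lemma pb_smult:
  assumes h: "h \<in> carrier (L0 \<mu>)" and v: "v \<in> carrier TY"
  shows "pb (h \<odot>\<^bsub>TY\<^esub> v) = L0_cls \<nu> (\<lambda>x. L0_rep h (u x)) \<odot>\<^bsub>P\<^esub> pb v"
proof (rule real_linear_bounded_homogeneous[OF TY.L0_normed_axioms P.L0_normed_axioms, where u = u and b = "\<lambda>_. 1"])
  have m: "(\<lambda>x. L0_rep h (u x)) \<in> borel_measurable \<nu>" by (rule comp_u_nu[OF L0_rep_measurable[OF h]])
  show "L0_cls \<nu> (\<lambda>x. L0_rep h (u x)) \<in> carrier (L0 \<nu>)" using m by simp
  show "AE x in \<nu>. L0_rep (L0_cls \<nu> (\<lambda>x. L0_rep h (u x))) x = L0_rep h (u x)" by (rule L0_rep_cls[OF m])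
  show "additive_map TY P pb" using pb_carrier pb_add by (auto simp: additive_map_def)
  show "AE x in \<nu>. nm P (pb v) x \<le> 1 * nm TY v (u x)" if "v \<in> carrier TY" for v
    using nm_pb[OF that] by eventually_elim simp
qed (use AE_pull pb_cst h v in auto)

lemma zero_S2: "L0_cls \<mu> (\<lambda>_. 0) \<in> S2 \<mu>"
proof (rule Y.S2_clsI(1)[OF Y.upper_slope_LIP_bd[OF LIP_bd_const sqi_zero]])
  show "AE y in \<mu>. lip_a (\<lambda>_::'y. 0) y \<le> 0"
    by (intro AE_I2 lip_a_le_lipschitz lipschitz_on_constant)
qed

text \<open>Two generation statements are chained: differentials generate the cotangent module of Y,
  whose image generates the pullback. Approximability passes through both spans and both closures,
  the first closure being carried over by continuity of \<open>pb\<close>.\<close>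

lemma pb_approximable:
  assumes p: "p \<in> carrier P" shows "P.approximable ((\<lambda>F. pb (dY F)) ` S2 \<mu>) p"
proof -
  define S where "S = (\<lambda>F. pb (dY F)) ` S2 \<mu>"
  have dYc: "dY ` S2 \<mu> \<subseteq> carrier TY" using dY_carrier by blast
  have S: "P.real_subspace S"
    unfolding P.real_subspace_def
  proof (intro conjI ballI allI)
    show "S \<noteq> {}" using zero_S2 by (auto simp: S_def)
    show "S \<subseteq> carrier P" using pb_carrier dY_carrier by (auto simp: S_def)
    show "s \<oplus>\<^bsub>P\<^esub> r \<in> S" if sr: "s \<in> S" "r \<in> S" for s r
    proof -
      from sr obtain F H where FH: "F \<in> S2 \<mu>" "s = pb (dY F)" "H \<in> S2 \<mu>" "r = pb (dY H)" by (auto simp: S_def)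
      have "s \<oplus>\<^bsub>P\<^esub> r = pb (dY (F \<oplus>\<^bsub>L0 \<mu>\<^esub> H))" using FH by (simp add: dY_add pb_add dY_carrier)
      then show ?thesis using Y.S2_add[OF FH(1,3)] by (auto simp: S_def)
    qed
    show "cst \<nu> c \<odot>\<^bsub>P\<^esub> s \<in> S" if s: "s \<in> S" for c s
    proof -
      from s obtain F where F: "F \<in> S2 \<mu>" "s = pb (dY F)" by (auto simp: S_def)
      have "cst \<nu> c \<odot>\<^bsub>P\<^esub> s = pb (dY (cst \<mu> c \<otimes>\<^bsub>L0 \<mu>\<^esub> F))" using F by (simp add: dY_cst pb_cst dY_carrier)
      then show ?thesis using Y.S2_cmult[OF F(1), of c] by (auto simp: S_def)
    qed
  qed
  note Sc = P.real_subspaceD(1)[OF S]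
  have zero: "P.approximable S \<zero>\<^bsub>P\<^esub>" by (rule P.approximable_mem[OF P.real_subspaceD(4)[OF S] Sc])
  have pb0: "pb \<zero>\<^bsub>TY\<^esub> = \<zero>\<^bsub>P\<^esub>"
    by (rule additive_map_zero[OF TY.M.abelian_group_axioms P.M.abelian_group_axioms])
      (use pb_carrier pb_add in \<open>auto simp: additive_map_def\<close>)
  have span: "P.approximable S (pb w)" if "w \<in> L0_span \<mu> TY (dY ` S2 \<mu>)" for w
  proof (rule TY.span_induct(1)[OF that dYc, where Q = "\<lambda>w. P.approximable S (pb w)"])
    show "P.approximable S (pb \<zero>\<^bsub>TY\<^esub>)" using zero by (simp add: pb0)
    show "P.approximable S (pb (v \<oplus>\<^bsub>TY\<^esub> w))"
      if "v \<in> carrier TY" "w \<in> carrier TY" "P.approximable S (pb v)" "P.approximable S (pb w)" for v w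
      using P.approximable_add[OF S that(3,4)] that(1,2) by (simp add: pb_add)
    show "P.approximable S (pb (h \<odot>\<^bsub>TY\<^esub> v))" if h: "h \<in> carrier (L0 \<mu>)" and v: "v \<in> dY ` S2 \<mu>" for h v
    proof -
      have vc: "v \<in> carrier TY" using v dYc by blast
      have "L0_cls \<nu> (\<lambda>x. L0_rep h (u x)) \<in> carrier (L0 \<nu>)" using comp_u_nu[OF L0_rep_measurable[OF h]] by simp
      moreover have "P.approximable S (pb v)" by (rule P.approximable_mem[OF _ Sc]) (use v in \<open>auto simp: S_def\<close>)
      ultimately show ?thesis unfolding pb_smult[OF h vc] by (intro P.approximable_smult[OF S])
    qed
  qed
  have pbv: "P.approximable S (pb v)" if v: "v \<in> carrier TY" for v
  proof (rule P.approximable_closure[OF _ pb_carrier[OF v] _ Sc])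
    have "v \<in> L0_topology \<mu> TY closure_of L0_span \<mu> TY (dY ` S2 \<mu>)"
      using dY_generates v by (simp add: L0_generates_def)
    then show "pb v \<in> L0_topology \<nu> P closure_of (pb ` L0_span \<mu> TY (dY ` S2 \<mu>))"
      using continuous_map_image_closure_subset[OF pb_continuous] by blast
  qed (use span in blast)
  have span2: "P.approximable S w" if "w \<in> L0_span \<nu> P (pb ` carrier TY)" for w
  proof (rule P.span_induct(1)[OF that, where Q = "P.approximable S"])
    show "pb ` carrier TY \<subseteq> carrier P" using pb_carrier by blast
    show "P.approximable S (h \<odot>\<^bsub>P\<^esub> v)" if "h \<in> carrier (L0 \<nu>)" "v \<in> pb ` carrier TY" for h v
      by (rule P.approximable_smult[OF S _ that(1)]) (use that(2) pbv in blast)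
  qed (use zero P.approximable_add[OF S] in auto)
  show ?thesis
    unfolding S_def[symmetric]
  proof (rule P.approximable_closure[OF _ p _ Sc])
    show "p \<in> L0_topology \<nu> P closure_of L0_span \<nu> P (pb ` carrier TY)"
      using pb_generates p by (simp add: L0_generates_def)
  qed (rule span2)
qed

section \<open>Associated functions\<close>

lemma assoc_iff:
  "assoc F G \<longleftrightarrow> F \<in> S2 \<mu> \<and> G \<in> S2 m \<and> (AE x in m. 0 < Du x \<longrightarrow> L0_rep G x = L0_rep F (u x)) \<and>
    (AE x in m. nm TX (dX G) x \<le> nm TY (dY F) (u x) * Du x)"
proof -
  have "L0_le m (pnorm TX (dX G)) (comp_mult_slope m u (pnorm TY (dY F))) \<longleftrightarrow>
    (AE x in m. nm TX (dX G) x \<le> nm TY (dY F) (u x) * Du x)" if F: "F \<in> S2 \<mu>"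
  proof -
    have "(\<lambda>x. nm TY (dY F) (u x)) \<in> borel_measurable m"
      using comp_u_nu[OF TY.nm_measurable[OF dY_carrier[OF F]]] by (simp add: measurable_restr_meas)
    then have "(\<lambda>x. nm TY (dY F) (u x) * Du x) \<in> borel_measurable m" by measurable
    note r = L0_rep_cls[OF this]
    show ?thesis unfolding L0_le_def comp_mult_slope_def Du_def[symmetric]
      using r by (intro iffI) (erule (1) AE_mp[OF AE_conjI], simp)+
  qed
  then show ?thesis unfolding associated_def E_iff by blast
qed

lemma assocD:
  assumes "assoc F G"
  shows "F \<in> S2 \<mu>" "G \<in> S2 m" "AE x in m. 0 < Du x \<longrightarrow> L0_rep G x = L0_rep F (u x)"
    "AE x in m. nm TX (dX G) x \<le> nm TY (dY F) (u x) * Du x"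
  using assms by (auto simp: assoc_iff)

lemma assoc_exists: assumes F: "F \<in> S2 \<mu>" shows "\<exists>G. assoc F G"
proof -
  obtain g where g: "upper_slope m g (\<lambda>x. L0_rep (min_slope \<mu> F) (u x) * Du x)" "AE x in m. Du x > 0 \<longrightarrow> g x = L0_rep F (u x)"
    by (rule associated_function_exists[OF Y.upper_slope_min_slope[OF F]])
  note G = S2_clsI[OF g(1)]
  have "assoc F (L0_cls m g)"
    unfolding assoc_iff pnorm_dX[OF G(1)] pnorm_dY[OF F]
  proof (intro conjI F G)
    show "AE x in m. 0 < Du x \<longrightarrow> L0_rep (L0_cls m g) x = L0_rep F (u x)"
      using g(2) L0_rep_cls[OF upper_slope_D(1)[OF g(1)]] by eventually_elim simp
  qed
  then show ?thesis ..
qed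

text \<open>By locality of the minimal slope, agreement on \<open>{|Du| > 0}\<close> with some associated function
  transfers the bound there.\<close>

lemma assocI:
  assumes F: "F \<in> S2 \<mu>" and G: "G \<in> S2 m" and eq: "AE x in m. 0 < Du x \<longrightarrow> L0_rep G x = L0_rep F (u x)"
    and off: "AE x in m. \<not> 0 < Du x \<longrightarrow> nm TX (dX G) x \<le> 0"
  shows "assoc F G"
proof -
  obtain H where H: "assoc F H" using assoc_exists[OF F] by blast
  note h = assocD[OF H]
  have "AE x in m. nm TX (dX G) x \<le> nm TY (dY F) (u x) * Du x"
    using eq h(3,4) off min_slope_local[OF G h(2), folded pnorm_dX[OF G] pnorm_dX[OF h(2)]] Du_nonneg
  proof eventually_elim
    case (elim x)
    show ?case
    proof (cases "0 < Du x")
      case True then show ?thesis using elim by simp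
    next
      case False
      then have "Du x = 0" using elim(6) by simp
      then show ?thesis using elim(4) by simp
    qed
  qed
  then show ?thesis unfolding assoc_iff using F G eq by blast
qed

text \<open>Explains why evaluating at \<open>dX G\<close> is compatible with extension by zero off
  {|Du| > 0}.\<close>

lemma assoc_off:
  assumes "assoc F G" shows "AE x in m. \<not> 0 < Du x \<longrightarrow> nm TX (dX G) x \<le> 0"
  using assocD(4)[OF assms] Du_nonneg
proof eventually_elim
  case (elim x)
  show ?case
  proof
    assume "\<not> 0 < Du x"
    then have "Du x = 0" using elim by simp
    then show "nm TX (dX G) x \<le> 0" using elim by simp
  qed
qed

lemma AE_Du: "AE y in \<mu>. Q y \<Longrightarrow> AE x in m. 0 < Du x \<longrightarrow> Q (u x)"
  by (drule AE_map_measD) (auto elim: AE_mp)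

text \<open>The triangle inequality alone is too weak, since the slope of \<open>F + F'\<close> can
  be smaller than the sum of slopes. \<open>assocI\<close> obtains the right bound on {|Du| > 0} by
  locality, so only the complement is estimated.\<close>

lemma assoc_add:
  assumes a: "assoc F G" and a': "assoc F' G'" shows "assoc (F \<oplus>\<^bsub>L0 \<mu>\<^esub> F') (G \<oplus>\<^bsub>L0 m\<^esub> G')"
proof -
  note d = assocD[OF a] and d' = assocD[OF a']
  show ?thesis
  proof (rule assocI[OF Y.S2_add[OF d(1) d'(1)] S2_add[OF d(2) d'(2)]])
    show "AE x in m. 0 < Du x \<longrightarrow> L0_rep (G \<oplus>\<^bsub>L0 m\<^esub> G') x = L0_rep (F \<oplus>\<^bsub>L0 \<mu>\<^esub> F') (u x)"
      using d(3) d'(3) L0_rep_add[OF S2_carrier[OF d(2)] S2_carrier[OF d'(2)]]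
        AE_Du[OF L0_rep_add[OF Y.S2_carrier[OF d(1)] Y.S2_carrier[OF d'(1)]]]
      by eventually_elim simp
    show "AE x in m. \<not> 0 < Du x \<longrightarrow> nm TX (dX (G \<oplus>\<^bsub>L0 m\<^esub> G')) x \<le> 0"
      unfolding dX_add[OF d(2) d'(2)]
      using assoc_off[OF a] assoc_off[OF a'] TX.nm_triangle[OF dX_carrier[OF d(2)] dX_carrier[OF d'(2)]]
      by eventually_elim auto
  qed
qed

lemma assoc_cst:
  assumes a: "assoc F G" shows "assoc (cst \<mu> c \<otimes>\<^bsub>L0 \<mu>\<^esub> F) (cst m c \<otimes>\<^bsub>L0 m\<^esub> G)"
proof -
  note d = assocD[OF a]
  show ?thesis
  proof (rule assocI[OF Y.S2_cmult[OF d(1)] S2_cmult[OF d(2)]])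
    show "AE x in m. 0 < Du x \<longrightarrow> L0_rep (cst m c \<otimes>\<^bsub>L0 m\<^esub> G) x = L0_rep (cst \<mu> c \<otimes>\<^bsub>L0 \<mu>\<^esub> F) (u x)"
      using d(3) L0_cls_cmult[OF S2_carrier[OF d(2)], of c] AE_Du[OF L0_cls_cmult[OF Y.S2_carrier[OF d(1)], of c]]
      by eventually_elim simp
    show "AE x in m. \<not> 0 < Du x \<longrightarrow> nm TX (dX (cst m c \<otimes>\<^bsub>L0 m\<^esub> G)) x \<le> 0"
      unfolding dX_cst[OF d(2)]
      using assoc_off[OF a] TX.nm_cst[OF dX_carrier[OF d(2)], of c] by eventually_elim (auto simp: mult_le_0_iff)
  qed
qed

section \<open>Existence and uniqueness of the differential at a vector field\<close>

lemma tangent_eq: "tangent = L0_dual m TX" by (simp add: tangent_module_def)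

lemma target_eq:
  "carrier target = carrier (L0_dual \<nu> P)" "add target = add (L0_dual \<nu> P)"
  "h \<odot>\<^bsub>target\<^esub> w = L0_cls \<nu> (L0_rep h) \<odot>\<^bsub>L0_dual \<nu> P\<^esub> w"
  by (simp_all add: target_module_def Ext_def)

text \<open>Off {|Du| > 0} both sides of the defining identity vanish, the left one by extension by
  zero and the right one by \<open>assoc_off\<close>; so only the identity on {|Du| > 0}
  remains.\<close>

lemma diff_at_iff:
  assumes v: "v \<in> carrier tangent"
  shows "diff_at v w \<longleftrightarrow> w \<in> carrier (L0_dual \<nu> P) \<and>
    (\<forall>F G. assoc F G \<longrightarrow> (AE x in \<nu>. L0_rep (w (pb (dY F))) x = L0_rep (v (dX G)) x))"
proof -
  have vd: "v \<in> carrier (L0_dual m TX)" using v by (simp add: tangent_eq)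
  have "ext_pairing m E (pb (dY F)) w = v (dX G) \<longleftrightarrow> (AE x in \<nu>. L0_rep (w (pb (dY F))) x = L0_rep (v (dX G)) x)"
    if w: "w \<in> carrier (L0_dual \<nu> P)" and a: "assoc F G" for F G
  proof -
    note d = assocD[OF a]
    have wc: "w (pb (dY F)) \<in> carrier (L0 \<nu>)"
      by (rule P.linear_props(1)[OF P.dual_linear[OF w] pb_carrier[OF dY_carrier[OF d(1)]]])
    have vc: "v (dX G) \<in> carrier (L0 m)" by (rule TX.linear_props(1)[OF TX.dual_linear[OF vd] dX_carrier[OF d(2)]])
    note ext = L0_rep_ext[OF wc E_sets]
    have off: "AE x in m. \<not> 0 < Du x \<longrightarrow> L0_rep (v (dX G)) x = 0"
      using assoc_off[OF a] TX.nm_nonneg[OF dX_carrier[OF d(2)]] TX.dual_opnorm(3)[OF vd dX_carrier[OF d(2)]]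
      by eventually_elim auto
    show ?thesis
    proof
      assume "ext_pairing m E (pb (dY F)) w = v (dX G)"
      then have "AE x in m. L0_rep (v (dX G)) x = indicator E x * L0_rep (w (pb (dY F))) x"
        using ext(2) by (simp only: ext_pairing_def)
      then show "AE x in \<nu>. L0_rep (w (pb (dY F))) x = L0_rep (v (dX G)) x"
        unfolding AE_nu by eventually_elim (simp add: E_iff indicator_def)
    next
      assume "AE x in \<nu>. L0_rep (w (pb (dY F))) x = L0_rep (v (dX G)) x"
      then have "AE x in m. L0_rep (L0_ext m E (w (pb (dY F)))) x = L0_rep (v (dX G)) x"
        using ext(2) off unfolding AE_nu by eventually_elim (auto simp: E_iff indicator_def)
      then show "ext_pairing m E (pb (dY F)) w = v (dX G)" unfolding ext_pairing_def by (rule L0_eqI[OF ext(1) vc])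
    qed
  qed
  then show ?thesis unfolding is_differential_at_def target_eq using assocD(1,2) by blast
qed

text \<open>The relation pairs \<open>pb (dY F)\<close> with \<open>v (dX G)\<close> over all
  associated pairs. Its bound \<open>|v| |Du|\<close> comes from the slope inequality in
  \<open>assoc\<close> and from \<open>|pb (dY F)| = |dY F| \<circ> u\<close>; dependence on the
  choice of \<open>F\<close> or \<open>G\<close> is excluded by this bound together with
  additivity.\<close>

lemma differential_exists:
  assumes v: "v \<in> carrier tangent"
  obtains w where "diff_at v w"
    "\<And>p. p \<in> carrier P \<Longrightarrow> AE x in \<nu>. \<bar>L0_rep (w p) x\<bar> \<le> max 0 (nm tangent v x * Du x) * nm P p x"
proof -
  have vd: "v \<in> carrier (L0_dual m TX)" using v by (simp add: tangent_eq)
  note vl = TX.linear_props[OF TX.dual_linear[OF vd]]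
  define r where "r G = L0_cls \<nu> (L0_rep (v (dX G)))" for G
  have vm: "L0_rep (v (dX G)) \<in> borel_measurable \<nu>" if "G \<in> S2 m" for G
    unfolding measurable_restr_meas by (rule L0_rep_measurable[OF vl(1)[OF dX_carrier[OF that]]])
  have rc: "r G \<in> carrier (L0 \<nu>)" "AE x in \<nu>. L0_rep (r G) x = L0_rep (v (dX G)) x" if "G \<in> S2 m" for G
    unfolding r_def using vm[OF that] L0_rep_cls[OF vm[OF that]] by auto
  define Q where "Q = {(pb (dY F), r G) | F G. assoc F G}"
  \<comment> \<open>The maximum with 0 makes the weight nonnegative at every point, as the extension
    result demands; a.e. it changes nothing.\<close>
  define b where "b x = max 0 (nm tangent v x * Du x)" for x
  have bm: "b \<in> borel_measurable m"
    unfolding b_def tangent_eq using L0_rep_measurable[OF TX.dual_opnorm(1)[OF vd]] by measurable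
  obtain w where w: "w \<in> carrier (L0_dual \<nu> P)" "\<And>q s. (q, s) \<in> Q \<Longrightarrow> AE x in \<nu>. L0_rep (w q) x = L0_rep s x"
    "\<And>p. p \<in> carrier P \<Longrightarrow> AE x in \<nu>. \<bar>L0_rep (w p) x\<bar> \<le> b x * nm P p x"
  proof (rule P.bounded_relation_extends[of Q b])
    show "Q \<subseteq> carrier P \<times> carrier (L0 \<nu>)"
      unfolding Q_def using pb_carrier[OF dY_carrier[OF assocD(1)]] rc(1)[OF assocD(2)] by auto
    have fst_eq: "fst ` Q = (\<lambda>F. pb (dY F)) ` S2 \<mu>"
    proof
      show "fst ` Q \<subseteq> (\<lambda>F. pb (dY F)) ` S2 \<mu>" using assocD(1) by (auto simp: Q_def)
      show "(\<lambda>F. pb (dY F)) ` S2 \<mu> \<subseteq> fst ` Q" using assoc_exists by (force simp: Q_def)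
    qed
    show "P.approximable (fst ` Q) p" if "p \<in> carrier P" for p
      unfolding fst_eq by (rule pb_approximable[OF that])
    show "Q \<noteq> {}"
    proof
      assume "Q = {}"
      then have "S2 \<mu> = {}" using fst_eq by simp
      then show False using zero_S2 by blast
    qed
    show "(q \<oplus>\<^bsub>P\<^esub> q', s \<oplus>\<^bsub>L0 \<nu>\<^esub> s') \<in> Q" if qs: "(q, s) \<in> Q" and qs': "(q', s') \<in> Q" for q s q' s'
    proof -
      obtain F G where a: "assoc F G" "q = pb (dY F)" "s = r G" using qs by (auto simp: Q_def)
      obtain F' G' where a': "assoc F' G'" "q' = pb (dY F')" "s' = r G'" using qs' by (auto simp: Q_def)
      note d = assocD[OF a(1)] and d' = assocD[OF a'(1)]
      have 1: "q \<oplus>\<^bsub>P\<^esub> q' = pb (dY (F \<oplus>\<^bsub>L0 \<mu>\<^esub> F'))"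
        unfolding a a' using d(1) d'(1) by (simp add: dY_add pb_add dY_carrier)
      note c = rc[OF d(2)] rc[OF d'(2)]
      have 2: "s \<oplus>\<^bsub>L0 \<nu>\<^esub> s' = r (G \<oplus>\<^bsub>L0 m\<^esub> G')"
      proof (rule L0_eqI[of _ \<nu>])
        have "AE x in \<nu>. L0_rep (v (dX (G \<oplus>\<^bsub>L0 m\<^esub> G'))) x = L0_rep (v (dX G)) x + L0_rep (v (dX G')) x"
          unfolding AE_nu dX_add[OF d(2) d'(2)] using vl(3)[OF dX_carrier[OF d(2)] dX_carrier[OF d'(2)]] by eventually_elim simp
        with L0_rep_add[OF c(1,3)] c(2,4) rc(2)[OF S2_add[OF d(2) d'(2)]]
        show "AE x in \<nu>. L0_rep (s \<oplus>\<^bsub>L0 \<nu>\<^esub> s') x = L0_rep (r (G \<oplus>\<^bsub>L0 m\<^esub> G')) x"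
          unfolding a a' by eventually_elim simp
      qed (use c rc(1)[OF S2_add[OF d(2) d'(2)]] in \<open>simp_all add: a a' L0_add_carrier\<close>)
      show ?thesis unfolding 1 2 Q_def using assoc_add[OF a(1) a'(1)] by blast
    qed
    show "(cst \<nu> c \<odot>\<^bsub>P\<^esub> q, cst \<nu> c \<otimes>\<^bsub>L0 \<nu>\<^esub> s) \<in> Q" if qs: "(q, s) \<in> Q" for c q s
    proof -
      obtain F G where a: "assoc F G" "q = pb (dY F)" "s = r G" using qs by (auto simp: Q_def)
      note d = assocD[OF a(1)]
      have 1: "cst \<nu> c \<odot>\<^bsub>P\<^esub> q = pb (dY (cst \<mu> c \<otimes>\<^bsub>L0 \<mu>\<^esub> F))"
        unfolding a using d(1) by (simp add: dY_cst pb_cst dY_carrier)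
      note k = rc[OF d(2)]
      have 2: "cst \<nu> c \<otimes>\<^bsub>L0 \<nu>\<^esub> s = r (cst m c \<otimes>\<^bsub>L0 m\<^esub> G)"
      proof (rule L0_eqI[of _ \<nu>])
        have "AE x in \<nu>. L0_rep (v (dX (cst m c \<otimes>\<^bsub>L0 m\<^esub> G))) x = c * L0_rep (v (dX G)) x"
          unfolding AE_nu dX_cst[OF d(2)] using vl(4)[OF cst_carrier[of m c] dX_carrier[OF d(2)]] rep_cst[of m c] by eventually_elim simp
        with L0_cls_cmult[OF k(1), of c] k(2) rc(2)[OF S2_cmult[OF d(2), of c]]
        show "AE x in \<nu>. L0_rep (cst \<nu> c \<otimes>\<^bsub>L0 \<nu>\<^esub> s) x = L0_rep (r (cst m c \<otimes>\<^bsub>L0 m\<^esub> G)) x"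
          unfolding a by eventually_elim simp
      qed (use k rc(1)[OF S2_cmult[OF d(2), of c]] in \<open>simp_all add: a L0_mult_carrier\<close>)
      show ?thesis unfolding 1 2 Q_def using assoc_cst[OF a(1), of c] by blast
    qed
    show "b \<in> borel_measurable \<nu>" using bm by (simp add: measurable_restr_meas)
    show "0 \<le> b x" for x by (simp add: b_def)
    show "AE x in \<nu>. \<bar>L0_rep s x\<bar> \<le> b x * nm P q x" if qs: "(q, s) \<in> Q" for q s
    proof -
      obtain F G where a: "assoc F G" "q = pb (dY F)" "s = r G" using qs by (auto simp: Q_def)
      note d = assocD[OF a(1)]
      have "AE x in \<nu>. \<bar>L0_rep (v (dX G)) x\<bar> \<le> nm tangent v x * nm TX (dX G) x \<and>
          nm TX (dX G) x \<le> nm TY (dY F) (u x) * Du x \<and> 0 \<le> nm tangent v x \<and> 0 < Du x"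
        unfolding AE_nu tangent_eq using TX.dual_opnorm(3)[OF vd dX_carrier[OF d(2)]] d(4) TX.dual_opnorm(2)[OF vd]
        by eventually_elim simp
      with rc(2)[OF d(2)] nm_pb[OF dY_carrier[OF d(1)]] show ?thesis unfolding a
      proof eventually_elim
        case (elim x)
        have "\<bar>L0_rep (r G) x\<bar> \<le> nm tangent v x * nm TX (dX G) x" using elim by simp
        also have "\<dots> \<le> nm tangent v x * (nm TY (dY F) (u x) * Du x)" using elim by (intro mult_left_mono) auto
        also have "\<dots> = b x * nm P (pb (dY F)) x" using elim by (simp add: b_def max_def)
        finally show ?case .
      qed
    qed
  qed (rule that)
  show thesis
  proof (rule that)
    show "diff_at v w"
      unfolding diff_at_iff[OF v]
    proof (intro conjI allI impI w(1))
      fix F G assume a: "assoc F G"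
      then have "(pb (dY F), r G) \<in> Q" by (auto simp: Q_def)
      from w(2)[OF this] rc(2)[OF assocD(2)[OF a]]
      show "AE x in \<nu>. L0_rep (w (pb (dY F))) x = L0_rep (v (dX G)) x" by eventually_elim simp
    qed
    show "AE x in \<nu>. \<bar>L0_rep (w p) x\<bar> \<le> max 0 (nm tangent v x * Du x) * nm P p x" if "p \<in> carrier P" for p
      using w(3)[OF that] by (simp add: b_def)
  qed
qed

text \<open>Every \<open>F\<close> has an associated function, so the values on all
  \<open>pb (dY F)\<close> are prescribed, and these approximate the whole pullback.\<close>

lemma differential_unique:
  assumes v: "v \<in> carrier tangent" and w: "diff_at v w" and w': "diff_at v w'" shows "w = w'"
proof -
  note 1 = w[unfolded diff_at_iff[OF v]] and 2 = w'[unfolded diff_at_iff[OF v]]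
  show ?thesis
  proof (rule P.dual_eq_on_approximable[OF _ _ _ _ pb_approximable])
    show "(\<lambda>F. pb (dY F)) ` S2 \<mu> \<subseteq> carrier P" using pb_carrier[OF dY_carrier] by blast
    fix s assume "s \<in> (\<lambda>F. pb (dY F)) ` S2 \<mu>"
    then obtain F where F: "F \<in> S2 \<mu>" "s = pb (dY F)" by blast
    obtain G where "assoc F G" using assoc_exists[OF F(1)] by blast
    then have "AE x in \<nu>. L0_rep (w s) x = L0_rep (v (dX G)) x" "AE x in \<nu>. L0_rep (w' s) x = L0_rep (v (dX G)) x"
      using 1 2 F(2) by auto
    then show "AE x in \<nu>. L0_rep (w s) x = L0_rep (w' s) x" by eventually_elim simp
  qed (use 1 2 in auto)
qed

section \<open>Linearity, continuity and operator norm of the differential\<close>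

abbreviation du where "du \<equiv> differential m u TX dX TY dY P pb"

lemma du_eqI: "v \<in> carrier tangent \<Longrightarrow> diff_at v w \<Longrightarrow> du v = w"
  unfolding differential_def by (rule the_equality) (auto intro: differential_unique)

lemma diff_at_ex1: "v \<in> carrier tangent \<Longrightarrow> \<exists>!w. diff_at v w"
  by (metis differential_exists differential_unique)

lemma diff_at_du: "v \<in> carrier tangent \<Longrightarrow> diff_at v (du v)"
  by (metis differential_exists du_eqI)

lemma du_carrier: "v \<in> carrier tangent \<Longrightarrow> du v \<in> carrier (L0_dual \<nu> P)"
  using diff_at_du diff_at_iff by blast

lemma du_pb:
  assumes "v \<in> carrier tangent" "assoc F G"
  shows "AE x in \<nu>. L0_rep (du v (pb (dY F))) x = L0_rep (v (dX G)) x"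
  using diff_at_du[OF assms(1)] assms(2) unfolding diff_at_iff[OF assms(1)] by blast

lemma target_group: "L0_normed_group m target"
  unfolding target_module_def by (rule L0_normed_group_Ext[OF sigma_finite E_sets P.dual_normed_group])

lemma nm_target:
  "w \<in> carrier (L0_dual \<nu> P) \<Longrightarrow> AE x in m. nm target w x = indicator E x * nm (L0_dual \<nu> P) w x"
  using L0_rep_ext(2)[OF P.dual_opnorm(1) E_sets] by (simp add: target_module_def Ext_def)

lemma nm_du_le:
  assumes v: "v \<in> carrier tangent" shows "AE x in m. nm target (du v) x \<le> Du x * nm tangent v x"
proof -
  have vd: "v \<in> carrier (L0_dual m TX)" using v by (simp add: tangent_eq)
  obtain w where w: "diff_at v w"
    "\<And>p. p \<in> carrier P \<Longrightarrow> AE x in \<nu>. \<bar>L0_rep (w p) x\<bar> \<le> max 0 (nm tangent v x * Du x) * nm P p x"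
    by (rule differential_exists[OF v], rule that)
  have [simp]: "w = du v" using du_eqI[OF v w(1)] by simp
  have "AE x in \<nu>. nm (L0_dual \<nu> P) (du v) x \<le> max 0 (nm tangent v x * Du x)"
  proof (rule P.dual_opnorm(4)[OF du_carrier[OF v]])
    show "(\<lambda>x. max 0 (nm tangent v x * Du x)) \<in> borel_measurable \<nu>"
      unfolding tangent_eq measurable_restr_meas using L0_rep_measurable[OF TX.dual_opnorm(1)[OF vd]] by measurable
  qed (use w(2) in auto)
  then show ?thesis
    using nm_target[OF du_carrier[OF v]] TX.dual_opnorm(2)[OF vd] Du_nonneg unfolding AE_nu tangent_eq
    by eventually_elim (auto simp: E_iff indicator_def mult.commute)
qed

text \<open>Read off from uniqueness: the sum of the differentials satisfies the identity that
  defines the differential of the sum.\<close>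

lemma du_add:
  assumes v: "v \<in> carrier tangent" and w: "w \<in> carrier tangent"
  shows "du (v \<oplus>\<^bsub>tangent\<^esub> w) = du v \<oplus>\<^bsub>target\<^esub> du w"
proof (rule du_eqI)
  interpret D: abelian_group "L0_dual m TX" using TX.dual_normed_group by (rule L0_normed_group.axioms)
  interpret DP: abelian_group "L0_dual \<nu> P" using P.dual_normed_group by (rule L0_normed_group.axioms)
  note vd = v[unfolded tangent_eq] and wd = w[unfolded tangent_eq]
  show vw: "v \<oplus>\<^bsub>tangent\<^esub> w \<in> carrier tangent" using vd wd by (simp add: tangent_eq)
  note dc = du_carrier[OF v] du_carrier[OF w]
  show "diff_at (v \<oplus>\<^bsub>tangent\<^esub> w) (du v \<oplus>\<^bsub>target\<^esub> du w)"
    unfolding diff_at_iff[OF vw] target_eq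
  proof (intro conjI allI impI)
    show "du v \<oplus>\<^bsub>L0_dual \<nu> P\<^esub> du w \<in> carrier (L0_dual \<nu> P)" using dc by simp
    fix F G assume a: "assoc F G"
    note d = assocD[OF a]
    note pc = pb_carrier[OF dY_carrier[OF d(1)]] and xc = dX_carrier[OF d(2)]
    note c = P.linear_props(1)[OF P.dual_linear[OF dc(1)] pc] P.linear_props(1)[OF P.dual_linear[OF dc(2)] pc]
    note k = TX.linear_props(1)[OF TX.dual_linear[OF vd] xc] TX.linear_props(1)[OF TX.dual_linear[OF wd] xc]
    have "AE x in \<nu>. L0_rep (v (dX G) \<oplus>\<^bsub>L0 m\<^esub> w (dX G)) x = L0_rep (v (dX G)) x + L0_rep (w (dX G)) x"
      unfolding AE_nu using L0_rep_add[OF k] by eventually_elim simp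
    then show "AE x in \<nu>. L0_rep ((du v \<oplus>\<^bsub>L0_dual \<nu> P\<^esub> du w) (pb (dY F))) x = L0_rep ((v \<oplus>\<^bsub>tangent\<^esub> w) (dX G)) x"
      unfolding tangent_eq P.dual_apply(1)[OF pc] TX.dual_apply(1)[OF xc]
      using L0_rep_add[OF c] du_pb[OF v a] du_pb[OF w a] by eventually_elim simp
  qed
qed

lemma tangent_smult_closed:
  "h \<in> carrier (L0 m) \<Longrightarrow> v \<in> carrier tangent \<Longrightarrow> h \<odot>\<^bsub>tangent\<^esub> v \<in> carrier tangent"
  unfolding tangent_eq by (rule TX.dual_smult_closed)

lemma du_smult:
  assumes h: "h \<in> carrier (L0 m)" and v: "v \<in> carrier tangent"
  shows "du (h \<odot>\<^bsub>tangent\<^esub> v) = h \<odot>\<^bsub>target\<^esub> du v"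
proof (rule du_eqI)
  note vd = v[unfolded tangent_eq]
  show hv: "h \<odot>\<^bsub>tangent\<^esub> v \<in> carrier tangent" by (rule tangent_smult_closed[OF h v])
  have hm: "L0_rep h \<in> borel_measurable \<nu>" using L0_rep_measurable[OF h] by (simp add: measurable_restr_meas)
  note hc = L0_cls_carrier[OF hm]
  note dc = du_carrier[OF v]
  show "diff_at (h \<odot>\<^bsub>tangent\<^esub> v) (h \<odot>\<^bsub>target\<^esub> du v)"
    unfolding diff_at_iff[OF hv] target_eq
  proof (intro conjI allI impI)
    show "L0_cls \<nu> (L0_rep h) \<odot>\<^bsub>L0_dual \<nu> P\<^esub> du v \<in> carrier (L0_dual \<nu> P)" by (rule P.dual_smult_closed[OF dc hc])
    fix F G assume a: "assoc F G"
    note d = assocD[OF a]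
    note pc = pb_carrier[OF dY_carrier[OF d(1)]] and xc = dX_carrier[OF d(2)]
    note c = P.linear_props(1)[OF P.dual_linear[OF dc] pc]
    note k = TX.linear_props(1)[OF TX.dual_linear[OF vd] xc]
    have "AE x in \<nu>. L0_rep (h \<otimes>\<^bsub>L0 m\<^esub> v (dX G)) x = L0_rep h x * L0_rep (v (dX G)) x"
      unfolding AE_nu using L0_rep_mult[OF h k] by eventually_elim simp
    then show "AE x in \<nu>. L0_rep ((L0_cls \<nu> (L0_rep h) \<odot>\<^bsub>L0_dual \<nu> P\<^esub> du v) (pb (dY F))) x = L0_rep ((h \<odot>\<^bsub>tangent\<^esub> v) (dX G)) x"
      unfolding tangent_eq P.dual_apply(2)[OF pc] TX.dual_apply(2)[OF xc]
      using L0_rep_mult[OF hc c] L0_rep_cls[OF hm] du_pb[OF v a] by eventually_elim simp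
  qed
qed

lemma du_linear: "L0_linear m tangent target du"
  unfolding L0_linear_def using du_carrier du_add du_smult by (auto simp: target_eq(1))

lemma du_continuous: "L0_continuous m tangent target du"
proof (rule bounded_additive_continuous[OF _ target_group])
  show "L0_normed_group m tangent" unfolding tangent_eq by (rule TX.dual_normed_group)
  show "additive_map tangent target du" using du_carrier du_add by (auto simp: additive_map_def target_eq(1))
  show "Du \<in> borel_measurable m" by measurable
qed (rule nm_du_le)

lemma opnorm_du: "L0_opnorm m tangent target du = map_slope m u"
proof -
  interpret D: L0_normed_group m "L0_dual m TX" by (rule TX.dual_normed_group)
  interpret T: L0_normed_group m target by (rule target_group)
  define S where "S = {pnorm target (du v) | v. v \<in> carrier tangent \<and> L0_le m (pnorm tangent v) \<one>\<^bsub>L0 m\<^esub>}"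
  have le1: "L0_le m F \<one>\<^bsub>L0 m\<^esub> \<longleftrightarrow> (AE x in m. L0_rep F x \<le> 1)" for F
    unfolding L0_le_def using L0_rep_one[of m] by (intro iffI) (erule (1) AE_mp[OF AE_conjI], simp)+
  have duc: "du v \<in> carrier target" if "v \<in> carrier tangent" for v using du_carrier[OF that] by (simp add: target_eq)
  have inS: "pnorm target (du v) \<in> S" if "v \<in> carrier tangent" "AE x in m. nm tangent v x \<le> 1" for v
    using that le1 by (auto simp: S_def)
  have z: "\<zero>\<^bsub>L0_dual m TX\<^esub> \<in> carrier tangent" by (simp add: tangent_eq)
  have z1: "AE x in m. nm tangent \<zero>\<^bsub>L0_dual m TX\<^esub> x \<le> 1" unfolding tangent_eq using D.nm_0 by eventually_elim simp
  have ub: "AE x in m. L0_rep F x \<le> Du x" if F: "F \<in> S" for F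
  proof -
    obtain v where v: "v \<in> carrier tangent" "AE x in m. nm tangent v x \<le> 1" "F = pnorm target (du v)"
      using F le1 by (auto simp: S_def)
    show ?thesis unfolding v(3) using nm_du_le[OF v(1)] v(2) Du_nonneg
    proof eventually_elim
      case (elim x)
      then show ?case using mult_left_mono[OF elim(2,3)] by simp
    qed
  qed
  have ne: "S \<noteq> {}" using inS[OF z z1] by blast
  have Sc: "S \<subseteq> carrier (L0 m)" unfolding S_def using T.pn_carrier[OF duc] by blast
  define H where "H = L0_opnorm m tangent target du"
  have H_eq: "H = L0_esssup m S" by (simp add: H_def L0_opnorm_def S_def)
  note E' = L0_esssup_props[OF sigma_finite ne Sc Du_measurable, folded H_eq]
  have Hc: "H \<in> carrier (L0 m)" by (rule E'(1)) (rule ub)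
  have HS: "AE x in m. L0_rep F x \<le> L0_rep H x" if "F \<in> S" for F
    using that ub by (intro E'(2)[unfolded L0_le_def]) auto
  have HDu: "AE x in m. L0_rep H x \<le> Du x" by (rule E'(3)) (use ub Du_measurable in auto)
  have H0: "AE x in m. 0 \<le> L0_rep H x" using HS[OF inS[OF z z1]] T.nm_nonneg[OF duc[OF z]] by eventually_elim simp
  \<comment> \<open>The operator norm \<open>H\<close> is shown to be admissible in the definition
    of the slope of \<open>u\<close>, so that minimality bounds \<open>|Du|\<close> by
    \<open>H\<close>.\<close>
  have Hslope: "H \<in> map_slopes m u"
    unfolding map_slopes_iff
  proof (intro conjI ballI Hc H0)
    show "sqi m (L0_rep H)"
      by (rule sqi_bound[OF sqi_Du L0_rep_measurable[OF Hc]]) (use HDu H0 in \<open>eventually_elim, simp\<close>)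
    fix f :: "'y \<Rightarrow> real" assume f: "f \<in> LIP"
    note fL = Lip_lipschitz[OF f]
    note f0 = lipschitz_on_nonneg[OF fL]
    define F where "F = L0_cls \<mu> f"
    define G where "G = L0_cls m (f \<circ> u)"
    \<comment> \<open>Constants are square integrable for the finite image measure, so
      \<open>f\<close> itself is Sobolev on Y with slope at most \<open>Lip f\<close>.\<close>
    have upF: "upper_slope \<mu> f (\<lambda>_. Lip f)"
    proof (rule Y.upper_slope_LIP_bd[OF lipschitz_LIP_bd[OF fL]])
      show "sqi \<mu> (\<lambda>_. Lip f)"
        using map_meas_integral(1)[of "\<lambda>_. Lip f"] sqi_cmult[OF sqi_Du, of "Lip f"] by simp
      show "AE y in \<mu>. lip_a f y \<le> Lip f" by (intro AE_I2 lip_a_le_lipschitz[OF fL])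
    qed
    have F: "F \<in> S2 \<mu>" "AE y in \<mu>. L0_rep (min_slope \<mu> F) y \<le> Lip f"
      unfolding F_def by (rule Y.S2_clsI[OF upF])+
    show G: "L0_cls m (f \<circ> u) \<in> S2 m" by (rule LIP_comp_S2[OF f])
    have G2: "G \<in> S2 m" using G by (simp add: G_def)
    have fm: "(\<lambda>x. f (u x)) \<in> borel_measurable m" by (rule LIP_comp_measurable[OF lipschitz_LIP_bd[OF fL]])
    have fm': "f \<in> borel_measurable \<mu>" using Y.upper_slope_D(1)[OF upF] .
    have a: "assoc F G"
    proof (rule assocI[OF F(1) G2])
      show "AE x in m. 0 < Du x \<longrightarrow> L0_rep G x = L0_rep F (u x)"
        using L0_rep_cls[OF fm] AE_Du[OF L0_rep_cls[OF fm']] unfolding F_def G_def comp_def by eventually_elim simp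
      have "AE x in m. L0_rep (min_slope m G) x \<le> Lip f * Du x"
        using map_slope_in f by (simp add: map_slopes_iff G_def Du_def)
      then show "AE x in m. \<not> 0 < Du x \<longrightarrow> nm TX (dX G) x \<le> 0"
        unfolding pnorm_dX[OF G2] using Du_nonneg
      proof eventually_elim
        case (elim x)
        show ?case
        proof
          assume "\<not> 0 < Du x"
          then have "Du x = 0" using elim(2) by simp
          then show "L0_rep (min_slope m G) x \<le> 0" using elim(1) by simp
        qed
      qed
    qed
    \<comment> \<open>A test vector of norm at most 1 that detects the full slope of
      \<open>f \<circ> u\<close>; the norm of its image under \<open>du\<close> is bounded by
      \<open>H\<close>.\<close>
    obtain v where v: "v \<in> carrier (L0_dual m TX)" "v (dX G) = pnorm TX (dX G)"
      "\<And>w. w \<in> carrier TX \<Longrightarrow> AE x in m. \<bar>L0_rep (v w) x\<bar> \<le> nm TX w x"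
      by (rule TX.norming_functional_exists[OF dX_carrier[OF G2]], rule that)
    have vt: "v \<in> carrier tangent" using v(1) by (simp add: tangent_eq)
    have v1: "AE x in m. nm tangent v x \<le> 1"
      unfolding tangent_eq by (rule TX.dual_opnorm(4)[OF v(1)]) (use v(3) in auto)
    note pc = pb_carrier[OF dY_carrier[OF F(1)]]
    have "AE x in m. 0 < Du x \<longrightarrow> L0_rep (du v (pb (dY F))) x = L0_rep (v (dX G)) x"
      using du_pb[OF vt a] unfolding AE_nu .
    moreover have "AE x in m. 0 < Du x \<longrightarrow> \<bar>L0_rep (du v (pb (dY F))) x\<bar> \<le> nm (L0_dual \<nu> P) (du v) x * nm P (pb (dY F)) x"
      using P.dual_opnorm(3)[OF du_carrier[OF vt] pc] unfolding AE_nu .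
    moreover have "AE x in m. 0 < Du x \<longrightarrow> nm P (pb (dY F)) x = L0_rep (min_slope \<mu> F) (u x)"
      using nm_pb[OF dY_carrier[OF F(1)]] unfolding AE_nu pnorm_dY[OF F(1)] .
    moreover have "AE x in m. 0 < Du x \<longrightarrow> 0 \<le> nm (L0_dual \<nu> P) (du v) x"
      using P.dual_opnorm(2)[OF du_carrier[OF vt]] unfolding AE_nu .
    ultimately have "AE x in m. L0_rep (min_slope m G) x \<le> Lip f * L0_rep H x"
      using HS[OF inS[OF vt v1]] nm_target[OF du_carrier[OF vt]] AE_Du[OF F(2)] H0
        assoc_off[OF a, unfolded pnorm_dX[OF G2]]
    proof eventually_elim
      case (elim x)
      show ?case
      proof (cases "0 < Du x")
        case True
        have "L0_rep (min_slope m G) x \<le> \<bar>L0_rep (du v (pb (dY F))) x\<bar>"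
          using elim(1) True by (simp add: v(2) pnorm_dX[OF G2])
        also have "\<dots> \<le> nm (L0_dual \<nu> P) (du v) x * nm P (pb (dY F)) x" using elim(2) True by simp
        also have "\<dots> \<le> nm (L0_dual \<nu> P) (du v) x * Lip f"
          using elim(3,4,7) True by (intro mult_left_mono) auto
        also have "\<dots> \<le> L0_rep H x * Lip f"
          using elim(5,6) True f0 by (intro mult_right_mono) (auto simp: E_iff)
        finally show ?thesis by (simp add: mult.commute)
      next
        case False
        then have "L0_rep (min_slope m G) x \<le> 0" using elim by simp
        also have "0 \<le> Lip f * L0_rep H x" using elim f0 by simp
        finally show ?thesis .
      qed
    qed
    then show "AE x in m. L0_rep (min_slope m (L0_cls m (f \<circ> u))) x \<le> Lip f * L0_rep H x" by (simp add: G_def)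
  qed
  have "AE x in m. L0_rep (map_slope m u) x \<le> L0_rep H x"
    using map_slope_least[OF Hslope] by (simp add: L0_le_def)
  then have "AE x in m. L0_rep H x = L0_rep (map_slope m u) x"
    using HDu unfolding Du_def by eventually_elim simp
  then show ?thesis unfolding H_def[symmetric] by (rule L0_eqI[OF Hc map_slope_carrier])
qed

end

theorem proposition3p5:
  fixes m :: "'x::polish_space measure"
    and u :: "'x \<Rightarrow> 'y::complete_space"
    and TX :: "('x L0_elt, 'a) normed_module" and dX :: "'x L0_elt \<Rightarrow> 'a"
    and TY :: "('y L0_elt, 'b) normed_module" and dY :: "'y L0_elt \<Rightarrow> 'b"
    and P :: "('x L0_elt, 'c) normed_module" and pb :: "'b \<Rightarrow> 'c"
  defines "\<mu> \<equiv> map_meas m u"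
    and "\<nu> \<equiv> restr_meas m (pos_slope_set m u)"
    and "du \<equiv> differential m u TX dX TY dY P pb"
  assumes "radon_measure m"
    and "\<And>B. B \<in> sets borel \<Longrightarrow> bounded B \<Longrightarrow> emeasure m B < \<infinity>"
    and "emeasure m UNIV \<noteq> 0"
    and "u \<in> S2_map m"
    and "cotangent_module m TX dX"
    and "cotangent_module \<mu> TY dY"
    and "pullback_module u \<nu> \<mu> TY P pb"
  shows "(\<forall>v\<in>carrier (tangent_module m TX). \<exists>!w. is_differential_at m u TX dX TY dY P pb v w) \<and>
    L0_linear m (tangent_module m TX) (target_module m u P) du \<and>
    L0_continuous m (tangent_module m TX) (target_module m u P) du \<and>
    L0_opnorm m (tangent_module m TX) (target_module m u P) du = map_slope m u"
proof -
  interpret differential_setting m u TX dX TY dY P pb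
    by unfold_locales (use assms in \<open>auto simp: radon_measure_def\<close>)
  show ?thesis
    unfolding du_def using diff_at_ex1 du_linear du_continuous opnorm_du by blast
qed

end
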